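(* Let $\Gamma\subset SL(2,\mathbb{R})$ be such that $M=\Gamma\backslash\mathbb{H}$ is a compact hyperbolic surface, and let $X=\Gamma\backslash SL(2,\mathbb{R})=S^*M$. Fix constants $C>0$ and $c>0$, and let $r_j\to\infty$ be a sequence of positive real numbers. For each $j$, let $\mathcal{S}_j\subset S_C(r_j)$ be a linear subspace of dimension $c\,r_j$. Then there exists a sequence of quasimodes $\psi_j\in\mathcal{S}_j$, $\|\psi_j\|_{L^2(M)}=1$, such that any weak-* limit point of the sequence of measures $|\Psi_j|^2\,dVol$ on $X$ (the microlocal lifts of $|\psi_j|^2dz$, defined for all sufficiently large $j$) gives positive measure to a subset of $X$ of codimension $1$.
   Context: Let $\Delta$ be the hyperbolic Laplacian (curvature $-1$). The measures $dz$ on $M$ and $dx=dVol$ on $X$ are the uniform measures (hyperbolic area, resp. the $SL(2,\mathbb{R})$-invariant measure), normalized to have total mass $1$. A Laplace eigenfunction $\phi$ has spectral parameter $r$ if $\Delta\phi=-(\tfrac14+r^2)\phi$. For $C>0$ and $r>C$, $S_C(r)\subset C^\infty(M)$ is the space spanned by the Laplace eigenfunctions with spectral parameter in $[r-C,r+C]$. Functions on $M$ are regarded as right $K$-invariant functions on $X$, where $K=SO(2)$. Let $E^{\pm}$ be the left-invariant first-order differential operators on $X$ (acting by differentiating right translation, extended complex-linearly) corresponding to $\tfrac12\begin{pmatrix}1&\pm i\\ \pm i&-1\end{pmatrix}$ in the complexified Lie algebra. For an eigenfunction $\phi$ with real spectral parameter $s>0$, put $\phi_0=\phi$ and define $\phi_{2n}$,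 $n\in\mathbb{Z}$, recursively by $$(is+\tfrac12+n)\,\phi_{2n+2}=E^+\phi_{2n},\qquad (is+\tfrac12-n)\,\phi_{2n-2}=E^-\phi_{2n}.$$ Then $\phi_{2n}$ has weight $2n$, i.e. $\phi_{2n}(xk_\theta)=e^{2in\theta}\phi_{2n}(x)$ with $k_\theta=\begin{pmatrix}\cos\theta&\sin\theta\\-\sin\theta&\cos\theta\end{pmatrix}$, and $\|\phi_{2n}\|_{L^2(X)}=\|\phi\|_{L^2(M)}$. Extend $\phi\mapsto\phi_{2n}$ linearly to $\psi\mapsto\psi_{2n}$ for $\psi\in S_C(r)$. For a unit vector $\psi\in S_C(r)$ and $L=\lfloor\sqrt r\rfloor\ge1$, set $$\Psi=\sqrt{\frac{3L}{2L^2+1}}\sum_{|n|\le L}\frac{L-|n|}{L}\,\psi_{2n}.$$ The measure $|\Psi|^2dVol$ on $X$ is called the microlocal lift of $|\psi|^2dz$; $\Psi_j$ denotes the function $\Psi$ associated to $\psi=\psi_j$, $r=r_j$. $X$ is a $3$-dimensional manifold; a subset of codimension $1$ means a subset contained in a $2$-dimensional compact embedded smooth submanifold (possibly with boundary) of $X$. *)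

theory Defs
  imports
    "HOL-Analysis.Analysis"
    "HOL-Library.Function_Algebras"
begin

section \<open>Topology, measure and smoothness\<close>

definition quotient_topology :: "'a topology \<Rightarrow> ('a \<Rightarrow> 'b) \<Rightarrow> 'b topology" where
  "quotient_topology T p =
     topology (\<lambda>U. U \<subseteq> p ` topspace T \<and> openin T {x \<in> topspace T. p x \<in> U})"

definition borel_of :: "'a topology \<Rightarrow> 'a measure" where
  "borel_of T = sigma (topspace T) {U. openin T U}"

text \<open>
  A strict measurable fundamental domain for the fibres of \<open>p\<close>. For an invariant measure on a space
  with a countable group action and orbit map \<open>p\<close>, the measure on the quotient obtained by pushing
  forward the restriction to such a set does not depend on the choice of the set.
\<close>

definition fundamental_set :: "'a measure \<Rightarrow> ('a \<Rightarrow> 'b) \<Rightarrow> 'a set \<Rightarrow> bool" where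
  "fundamental_set \<nu> p F \<longleftrightarrow> F \<in> sets \<nu> \<and> bij_betw p F (p ` space \<nu>)"

definition quotient_measure :: "'a measure \<Rightarrow> 'b topology \<Rightarrow> ('a \<Rightarrow> 'b) \<Rightarrow> 'b measure" where
  "quotient_measure \<nu> T p =
     distr (restrict_space \<nu> (SOME F. fundamental_set \<nu> p F)) (borel_of T) p"

definition normalized :: "'a measure \<Rightarrow> 'a measure" where
  "normalized \<nu> = uniform_measure \<nu> (space \<nu>)"

text \<open>Only used for open \<open>S\<close>.\<close>

primrec Ck_on :: "nat \<Rightarrow> 'a::real_normed_vector set \<Rightarrow> ('a \<Rightarrow> 'b::real_normed_vector) \<Rightarrow> bool" where
  "Ck_on 0 S f \<longleftrightarrow> continuous_on S f"
| "Ck_on (Suc k) S f \<longleftrightarrow>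
     (\<forall>x\<in>S. f differentiable (at x)) \<and> (\<forall>v. Ck_on k S (\<lambda>x. frechet_derivative f (at x) v))"

definition smooth_on :: "'a::real_normed_vector set \<Rightarrow> ('a \<Rightarrow> 'b::real_normed_vector) \<Rightarrow> bool" where
  "smooth_on S f \<longleftrightarrow> (\<forall>k. Ck_on k S f)"

text \<open>Complex-valued functions as a complex vector space.\<close>

definition cscale :: "complex \<Rightarrow> ('a \<Rightarrow> complex) \<Rightarrow> 'a \<Rightarrow> complex" where
  "cscale a f = (\<lambda>x. a * f x)"

interpretation cfun: vector_space "cscale :: complex \<Rightarrow> ('a \<Rightarrow> complex) \<Rightarrow> 'a \<Rightarrow> complex"
  by unfold_locales (auto simp: cscale_def fun_eq_iff algebra_simps)

section \<open>The surface $M$ and the space $X$\<close>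

definition mat2 :: "real \<Rightarrow> real \<Rightarrow> real \<Rightarrow> real \<Rightarrow> real^2^2" where
  "mat2 a b c d = vector [vector [a, b], vector [c, d]]"

definition SL2 :: "(real^2^2) set" where
  "SL2 = {g. det g = 1}"

definition uhp :: "complex set" where
  "uhp = {z. Im z > 0}"

definition act :: "real^2^2 \<Rightarrow> complex \<Rightarrow> complex" where
  "act g = moebius (of_real (g$1$1)) (of_real (g$1$2)) (of_real (g$2$1)) (of_real (g$2$2))"

definition orbit :: "(real^2^2) set \<Rightarrow> complex \<Rightarrow> complex set" where
  "orbit \<Gamma> z = (\<lambda>\<gamma>. act \<gamma> z) ` \<Gamma>"

definition coset :: "(real^2^2) set \<Rightarrow> real^2^2 \<Rightarrow> (real^2^2) set" where
  "coset \<Gamma> g = (\<lambda>\<gamma>. \<gamma> ** g) ` \<Gamma>"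

definition M_top :: "(real^2^2) set \<Rightarrow> complex set topology" where
  "M_top \<Gamma> = quotient_topology (top_of_set uhp) (orbit \<Gamma>)"

definition X_top :: "(real^2^2) set \<Rightarrow> (real^2^2) set topology" where
  "X_top \<Gamma> = quotient_topology (top_of_set SL2) (coset \<Gamma>)"

text \<open>
  The freeness condition (up to the centre) says that the quotient of the upper half-plane is a
  surface and not just an orbifold. The group may or may not contain \<open>- mat 1\<close>.
\<close>

definition compact_hyperbolic_surface_group :: "(real^2^2) set \<Rightarrow> bool" where
  "compact_hyperbolic_surface_group \<Gamma> \<longleftrightarrow>
     \<Gamma> \<subseteq> SL2 \<and> mat 1 \<in> \<Gamma> \<and> (\<forall>g\<in>\<Gamma>. \<forall>h\<in>\<Gamma>. g ** h \<in> \<Gamma>) \<and> (\<forall>g\<in>\<Gamma>. matrix_inv g \<in> \<Gamma>) \<and>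
     discrete \<Gamma> \<and>
     (\<forall>g\<in>\<Gamma>. \<forall>z\<in>uhp. act g z = z \<longrightarrow> g = mat 1 \<or> g = - mat 1) \<and>
     compact_space (M_top \<Gamma>)"

definition hyperbolic_area :: "complex measure" where
  "hyperbolic_area = density (restrict_space lborel uhp) (\<lambda>z. ennreal (1 / (Im z)\<^sup>2))"

text \<open>
  Haar measure: the measure of a Borel set \<open>A \<subseteq> SL2\<close> is the Lebesgue measure of the cone
  \<open>{t A | 0 < t \<le> 1}\<close> in the space of matrices. Multiplication by an element of \<open>SL2\<close>, from the left or
  from the right, is a linear map of determinant 1 on that space and commutes with scaling.
\<close>

definition to_SL2 :: "real^2^2 \<Rightarrow> real^2^2" where
  "to_SL2 m = m /\<^sub>R sqrt (det m)"

definition haar_SL2 :: "(real^2^2) measure" where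
  "haar_SL2 =
     distr (restrict_space lborel {m. 0 < det m \<and> det m \<le> 1}) (restrict_space borel SL2) to_SL2"

definition vol_M :: "(real^2^2) set \<Rightarrow> complex set measure" where
  "vol_M \<Gamma> = normalized (quotient_measure hyperbolic_area (M_top \<Gamma>) (orbit \<Gamma>))"

definition vol_X :: "(real^2^2) set \<Rightarrow> (real^2^2) set measure" where
  "vol_X \<Gamma> = normalized (quotient_measure haar_SL2 (X_top \<Gamma>) (coset \<Gamma>))"

section \<open>Eigenfunctions and quasimodes\<close>

definition partial_deriv :: "complex \<Rightarrow> (complex \<Rightarrow> complex) \<Rightarrow> complex \<Rightarrow> complex" where
  "partial_deriv v f z = vector_derivative (\<lambda>t::real. f (z + of_real t * v)) (at 0)"

definition hyperbolic_laplacian :: "(complex \<Rightarrow> complex) \<Rightarrow> complex \<Rightarrow> complex" where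
  "hyperbolic_laplacian f z =
     of_real ((Im z)\<^sup>2) *
       (partial_deriv 1 (partial_deriv 1 f) z + partial_deriv \<i> (partial_deriv \<i> f) z)"

text \<open>
  Functions on \<open>M\<close> are functions of orbits. They are set to 0 off \<open>M\<close>, so that equality, linear
  independence and dimension refer to their values on \<open>M\<close> only.
\<close>

definition smooth_functions_M :: "(real^2^2) set \<Rightarrow> (complex set \<Rightarrow> complex) set" where
  "smooth_functions_M \<Gamma> =
     {\<phi>. smooth_on uhp (\<lambda>z. \<phi> (orbit \<Gamma> z)) \<and> (\<forall>p. p \<notin> orbit \<Gamma> ` uhp \<longrightarrow> \<phi> p = 0)}"

definition L2_norm_M :: "(real^2^2) set \<Rightarrow> (complex set \<Rightarrow> complex) \<Rightarrow> real" where
  "L2_norm_M \<Gamma> \<phi> = sqrt (\<integral>p. (cmod (\<phi> p))\<^sup>2 \<partial>vol_M \<Gamma>)"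

definition eigenspace :: "(real^2^2) set \<Rightarrow> real \<Rightarrow> (complex set \<Rightarrow> complex) set" where
  "eigenspace \<Gamma> s =
     {\<phi> \<in> smooth_functions_M \<Gamma>.
        \<forall>z\<in>uhp. hyperbolic_laplacian (\<lambda>w. \<phi> (orbit \<Gamma> w)) z
                = - of_real (1/4 + s\<^sup>2) * \<phi> (orbit \<Gamma> z)}"

definition quasimode_space :: "(real^2^2) set \<Rightarrow> real \<Rightarrow> real \<Rightarrow> (complex set \<Rightarrow> complex) set" where
  "quasimode_space \<Gamma> C r = cfun.span (\<Union>s\<in>{r - C..r + C}. eigenspace \<Gamma> s)"

section \<open>The microlocal lift\<close>

definition mexp :: "real^2^2 \<Rightarrow> real^2^2" where
  "mexp A = (\<Sum>n. (1 / fact n) *\<^sub>R (((**) A) ^^ n) (mat 1))"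

text \<open>Right translation on \<open>X\<close>: it sends the coset of \<open>g\<close> to the coset of \<open>g ** h\<close>.\<close>

definition translate :: "(real^2^2) set \<Rightarrow> real^2^2 \<Rightarrow> (real^2^2) set" where
  "translate x h = (\<lambda>g. g ** h) ` x"

definition lie_deriv ::
    "real^2^2 \<Rightarrow> ((real^2^2) set \<Rightarrow> complex) \<Rightarrow> (real^2^2) set \<Rightarrow> complex" where
  "lie_deriv A F x = vector_derivative (\<lambda>t::real. F (translate x (mexp (t *\<^sub>R A)))) (at 0)"

definition E_plus :: "((real^2^2) set \<Rightarrow> complex) \<Rightarrow> (real^2^2) set \<Rightarrow> complex" where
  "E_plus F x =
     lie_deriv (mat2 (1/2) 0 0 (-1/2)) F x + \<i> * lie_deriv (mat2 0 (1/2) (1/2) 0) F x"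

definition E_minus :: "((real^2^2) set \<Rightarrow> complex) \<Rightarrow> (real^2^2) set \<Rightarrow> complex" where
  "E_minus F x =
     lie_deriv (mat2 (1/2) 0 0 (-1/2)) F x - \<i> * lie_deriv (mat2 0 (1/2) (1/2) 0) F x"

text \<open>
  The projection from \<open>X\<close> to \<open>M\<close> sends the coset of \<open>g\<close> to the orbit of \<open>act g \<i>\<close>, which is the image
  of that coset under \<open>\<lambda>g. act g \<i>\<close>.
\<close>

definition pullback :: "(complex set \<Rightarrow> complex) \<Rightarrow> (real^2^2) set \<Rightarrow> complex" where
  "pullback \<phi> x = \<phi> ((\<lambda>g. act g \<i>) ` x)"

primrec weight_up :: "real \<Rightarrow> (complex set \<Rightarrow> complex) \<Rightarrow> nat \<Rightarrow> (real^2^2) set \<Rightarrow> complex" where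
  "weight_up s \<phi> 0 = pullback \<phi>"
| "weight_up s \<phi> (Suc n) =
     (\<lambda>x. E_plus (weight_up s \<phi> n) x / (\<i> * of_real s + 1/2 + of_nat n))"

text \<open>\<open>weight_down s \<phi> n\<close> is the vector of weight \<open>- 2 * n\<close>.\<close>

primrec weight_down :: "real \<Rightarrow> (complex set \<Rightarrow> complex) \<Rightarrow> nat \<Rightarrow> (real^2^2) set \<Rightarrow> complex" where
  "weight_down s \<phi> 0 = pullback \<phi>"
| "weight_down s \<phi> (Suc n) =
     (\<lambda>x. E_minus (weight_down s \<phi> n) x / (\<i> * of_real s + 1/2 + of_nat n))"

definition weight_eigen ::
    "real \<Rightarrow> (complex set \<Rightarrow> complex) \<Rightarrow> int \<Rightarrow> (real^2^2) set \<Rightarrow> complex" where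
  "weight_eigen s \<phi> n =
     (if n \<ge> 0 then weight_up s \<phi> (nat n) else weight_down s \<phi> (nat (- n)))"

definition spectral_decomposition ::
    "(real^2^2) set \<Rightarrow> (complex set \<Rightarrow> complex) \<Rightarrow> (real \<Rightarrow> complex set \<Rightarrow> complex) \<Rightarrow> bool" where
  "spectral_decomposition \<Gamma> \<psi> \<phi> \<longleftrightarrow>
     (\<forall>s. \<phi> s \<in> eigenspace \<Gamma> s) \<and> finite {s. \<phi> s \<noteq> 0} \<and> (\<forall>s. \<phi> s \<noteq> 0 \<longrightarrow> s > 0) \<and>
     \<psi> = (\<Sum>s | \<phi> s \<noteq> 0. \<phi> s)"

text \<open>
  The linear extension to finite sums of eigenfunctions with positive spectral parameters. The
  decomposition is unique since eigenspaces for different \<open>s > 0\<close> are linearly independent.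
\<close>

definition weight_component ::
    "(real^2^2) set \<Rightarrow> (complex set \<Rightarrow> complex) \<Rightarrow> int \<Rightarrow> (real^2^2) set \<Rightarrow> complex" where
  "weight_component \<Gamma> \<psi> n =
     (let \<phi> = (THE \<phi>. spectral_decomposition \<Gamma> \<psi> \<phi>)
      in \<Sum>s | \<phi> s \<noteq> 0. weight_eigen s (\<phi> s) n)"

definition lift_function ::
    "(real^2^2) set \<Rightarrow> real \<Rightarrow> (complex set \<Rightarrow> complex) \<Rightarrow> (real^2^2) set \<Rightarrow> complex" where
  "lift_function \<Gamma> r \<psi> x =
     (let L = \<lfloor>sqrt r\<rfloor>
      in of_real (sqrt (3 * of_int L / (2 * (of_int L)\<^sup>2 + 1))) *
         (\<Sum>n\<in>{- L..L}. of_real (of_int (L - \<bar>n\<bar>) / of_int L) * weight_component \<Gamma> \<psi> n x))"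

definition microlocal_lift ::
    "(real^2^2) set \<Rightarrow> real \<Rightarrow> (complex set \<Rightarrow> complex) \<Rightarrow> (real^2^2) set measure" where
  "microlocal_lift \<Gamma> r \<psi> =
     density (vol_X \<Gamma>) (\<lambda>x. ennreal ((cmod (lift_function \<Gamma> r \<psi> x))\<^sup>2))"

section \<open>Weak-* limits and subsets of codimension one\<close>

definition weak_star_limit_point ::
    "'a topology \<Rightarrow> (nat \<Rightarrow> 'a measure) \<Rightarrow> 'a measure \<Rightarrow> bool" where
  "weak_star_limit_point T \<nu> \<mu> \<longleftrightarrow>
     finite_measure \<mu> \<and> sets \<mu> = sets (borel_of T) \<and>
     (\<exists>\<sigma>::nat \<Rightarrow> nat. strict_mono \<sigma> \<and>
        (\<forall>f. continuous_map T euclideanreal f \<longrightarrow>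
             (\<lambda>k. \<integral>x. f x \<partial>\<nu> (\<sigma> k)) \<longlonglongrightarrow> (\<integral>x. f x \<partial>\<mu>)))"

text \<open>
  \<open>coset \<Gamma> \<circ> \<sigma>\<close> is the inverse of a smooth chart of \<open>X\<close>: being an injective immersion between manifolds
  of dimension 3, it is a diffeomorphism of \<open>W\<close> onto an open subset of \<open>X\<close>. Small charts
  of \<open>X\<close> are all of this form, because \<open>SL2\<close> covers \<open>X\<close>.
\<close>

definition local_parametrization ::
    "(real^2^2) set \<Rightarrow> (real^3) set \<Rightarrow> (real^3 \<Rightarrow> real^2^2) \<Rightarrow> bool" where
  "local_parametrization \<Gamma> W \<sigma> \<longleftrightarrow>
     open W \<and> smooth_on W \<sigma> \<and> \<sigma> ` W \<subseteq> SL2 \<and> inj_on (\<lambda>w. coset \<Gamma> (\<sigma> w)) W \<and>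
     (\<forall>w\<in>W. inj (frechet_derivative \<sigma> (at w)))"

text \<open>
  Embedded submanifolds with boundary are described by the local slice condition: near each point,
  the set is a slice or a half-slice of a chart.
\<close>

definition compact_embedded_surface :: "(real^2^2) set \<Rightarrow> (real^2^2) set set \<Rightarrow> bool" where
  "compact_embedded_surface \<Gamma> N \<longleftrightarrow>
     compactin (X_top \<Gamma>) N \<and>
     (\<forall>p\<in>N. \<exists>W \<sigma>. local_parametrization \<Gamma> W \<sigma> \<and> p \<in> (\<lambda>w. coset \<Gamma> (\<sigma> w)) ` W \<and>
        ({w\<in>W. coset \<Gamma> (\<sigma> w) \<in> N} = {w\<in>W. w$3 = 0} \<or>
         {w\<in>W. coset \<Gamma> (\<sigma> w) \<in> N} = {w\<in>W. w$3 = 0 \<and> w$1 \<ge> 0}))"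

definition codimension_one :: "(real^2^2) set \<Rightarrow> (real^2^2) set set \<Rightarrow> bool" where
  "codimension_one \<Gamma> A \<longleftrightarrow> (\<exists>N. compact_embedded_surface \<Gamma> N \<and> A \<subseteq> N)"

end

theory Submission
 imports Defs
begin

text \<open>
  Functions on \<open>X\<close> are treated as left invariant functions on \<open>SL(2,R)\<close>. For a quasimode \<open>\<psi>\<close> with
  parameter near \<open>r\<close>, lift \<open>\<Psi>\<close> and \<open>L = \<lfloor>sqrt r\<rfloor>\<close>, let \<open>B\<close> be the tube of all products
  \<open>n\<^sup>-(q) a(t) n\<^sup>+(p)\<close> with \<open>t\<close> of size at most \<open>\<delta>\<close> and \<open>p\<close>, \<open>q\<close> of size at most \<open>\<delta> / sqrt r\<close>: a thin
  neighbourhood of a segment of the geodesic flow. Three facts make the theorem true.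

  First, up to the phase \<open>e\<^sup>2\<^sup>i\<^sup>r\<^sup>t\<close> the lift does not notice translations by elements of \<open>B\<close>. The weights in \<open>\<Psi>\<close>
  are at most \<open>L\<close>, so unipotent derivatives are of size \<open>L\<close> and a displacement \<open>\<delta> / L\<close> is harmless. Along the
  flow, the coefficients of the derivative minus \<open>2 i r\<close> are second differences of the coefficients
  times \<open>r\<close>. The tent in \<open>\<Psi>\<close> has corners, where this is not bounded; therefore \<open>\<Psi>\<close> is
  tested against the vector with the smooth coefficients \<open>sin\<^sup>2 (\<pi> n / L)\<close>, for which it is
  (\<open>test_tube_estimate\<close>). Translations are unitary, so the correlation of the translated lift with the test
  vector keeps its phase and a positive proportion of its size (\<open>tube_correlation\<close>), and the average
  \<open>T \<psi> x\<close> of \<open>e\<^sup>-\<^sup>2\<^sup>i\<^sup>r\<^sup>t \<Psi> (x h)\<close> over \<open>h \<in> B\<close> has a square norm of at least a constant times \<open>|B|\<^sup>2 \<parallel>\<psi>\<parallel>\<^sup>2\<close>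
  (\<open>nrm2_tube_average_ge\<close>).

  Second, the dimension. Over an orthonormal family of at least \<open>c r\<close> elements the squares of the averages
  add up to a function with mean at least a constant times \<open>c r |B|\<^sup>2\<close>. Hence the
  evaluation \<open>\<psi> \<mapsto> T \<psi> x\<close> is large at some \<open>x\<close>, on the unit vector that represents it. By Cauchy--Schwarz the mass
  of \<open>|\<Psi>|\<^sup>2\<close> on \<open>x B\<close> is at least a constant times \<open>c r |B|\<close>, and \<open>|B|\<close> is at least \<open>\<delta>\<^sup>4 / (1024 r)\<close>:
  a lower bound that does not depend on \<open>r\<close> (\<open>concentrated_quasimode\<close>).

  Third, compactness. The points \<open>x\<close> can be taken in a compact set, so along a subsequence they converge, while the tubes
  shrink to a segment of a geodesic. Each weak-* limit point gives positive mass to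
  such a segment (\<open>weak_limit_concentrates\<close>), and the segment lies in a smooth embedded disc (\<open>disc_surface\<close>).

  The preparations concern the invariance of Haar measure, the unfolding of integrals over the
  quotient, and the orthogonality of weight vectors. The latter follows from integration by parts, which
  makes \<open>- E\<^sup>-\<close> the adjoint of \<open>E\<^sup>+\<close>, and from the relation between the raising and lowering operators
  and the Laplacian.
\<close>

section \<open>Unimodular matrices\<close>

lemma mat2_nth [simp]:
 "mat2 a b c d $ 1 $ 1 = a" "mat2 a b c d $ 1 $ 2 = b"
 "mat2 a b c d $ 2 $ 1 = c" "mat2 a b c d $ 2 $ 2 = d"
 by (simp_all add: mat2_def)

lemma mat2_eq_iff:
 fixes A B :: "'a^2^2"
 shows "A = B \<longleftrightarrow> A$1$1 = B$1$1 \<and> A$1$2 = B$1$2 \<and> A$2$1 = B$2$1 \<and> A$2$2 = B$2$2"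
 by (auto simp: vec_eq_iff forall_2)

lemma mult_nth2:
 fixes A B :: "real^2^2"
 shows "(A ** B) $ i $ j = A$i$1 * B$1$j + A$i$2 * B$2$j"
 by (simp add: matrix_matrix_mult_def sum_2)

lemma mat_1_nth2 [simp]:
 "(mat 1 :: real^2^2) $ 1 $ 1 = 1" "(mat 1 :: real^2^2) $ 1 $ 2 = 0"
 "(mat 1 :: real^2^2) $ 2 $ 1 = 0" "(mat 1 :: real^2^2) $ 2 $ 2 = 1"
 by (simp_all add: mat_def)

lemma mem_SL2: "g \<in> SL2 \<longleftrightarrow> g$1$1 * g$2$2 - g$1$2 * g$2$1 = 1"
 by (simp add: SL2_def det_2)

lemma mat2_in_SL2: "mat2 a b c d \<in> SL2 \<longleftrightarrow> a * d - b * c = 1"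
 by (simp add: mem_SL2)

lemma SL2_mult: "g \<in> SL2 ==> h \<in> SL2 ==> g ** h \<in> SL2"
 by (simp add: SL2_def det_mul)

lemma SL2_one: "mat 1 \<in> SL2"
 by (simp add: SL2_def det_I)

text \<open>The adjugate, which is the inverse on \<^term>\<open>SL2\<close> but is polynomial in the entries everywhere.\<close>

definition adj2 :: "real^2^2 => real^2^2" where
 "adj2 g = mat2 (g$2$2) (- g$1$2) (- g$2$1) (g$1$1)"

lemma adj2_nth [simp]:
 "adj2 g $ 1 $ 1 = g$2$2" "adj2 g $ 1 $ 2 = - g$1$2"
 "adj2 g $ 2 $ 1 = - g$2$1" "adj2 g $ 2 $ 2 = g$1$1"
 by (simp_all add: adj2_def)

lemma adj2_SL2: "g \<in> SL2 ==> adj2 g \<in> SL2"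
 by (simp add: mem_SL2 algebra_simps)

lemma adj2_mult: "g \<in> SL2 ==> adj2 g ** g = mat 1" "g \<in> SL2 ==> g ** adj2 g = mat 1"
 by (auto simp: mem_SL2 mat2_eq_iff mult_nth2 algebra_simps)

lemma matrix_inv_SL2:
 assumes "g \<in> SL2" shows "matrix_inv g = adj2 g"
 unfolding matrix_inv_def
proof (rule some_equality)
 show "g ** adj2 g = mat 1 \<and> adj2 g ** g = mat 1"
  using adj2_mult[OF assms] by blast
next
 fix B assume B: "g ** B = mat 1 \<and> B ** g = mat 1"
 have "B = B ** (g ** adj2 g)" by (simp only: adj2_mult[OF assms] matrix_mul_rid)
 also have "... = adj2 g" using B by (simp only: matrix_mul_assoc matrix_mul_lid)
 finally show "B = adj2 g" .
qed

lemma adj2_cancel: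
 assumes "g \<in> SL2"
 shows "adj2 g ** (g ** h) = h" "g ** (adj2 g ** h) = h" "(h ** g) ** adj2 g = h" "(h ** adj2 g) ** g = h"
proof -
 show "adj2 g ** (g ** h) = h" "g ** (adj2 g ** h) = h"
  by (simp_all only: matrix_mul_assoc adj2_mult[OF assms] matrix_mul_lid)
 show "(h ** g) ** adj2 g = h" "(h ** adj2 g) ** g = h"
  by (simp_all only: matrix_mul_assoc[symmetric] adj2_mult[OF assms] matrix_mul_rid)
qed

lemma adj2_adj2 [simp]: "adj2 (adj2 g) = g"
 by (simp add: mat2_eq_iff)

lemma adj2_mul: "adj2 (g ** h) = adj2 h ** adj2 g"
 by (simp add: mat2_eq_iff mult_nth2 algebra_simps)

lemma det_adj2 [simp]: "det (adj2 g) = det (g :: real^2^2)"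
 by (simp add: det_2)

subsection \<open>Norms of matrices\<close>

lemma norm_mat2_sq: "(norm A)\<^sup>2 = (A$1$1)\<^sup>2 + (A$1$2)\<^sup>2 + (A$2$1)\<^sup>2 + (A$2$2)\<^sup>2" for A :: "real^2^2"
 by (simp add: norm_vec_def L2_set_def sum_2)

lemma norm_mult2_le: "norm (A ** B) <= norm A * norm B" for A B :: "real^2^2"
proof -
 have cs: "(a*x + b*y)\<^sup>2 <= (a\<^sup>2 + b\<^sup>2) * (x\<^sup>2 + y\<^sup>2)" for a b x y :: real
 proof -
  have "(a\<^sup>2 + b\<^sup>2) * (x\<^sup>2 + y\<^sup>2) - (a*x + b*y)\<^sup>2 = (a*y - b*x)\<^sup>2"
   by (simp add: power2_eq_square algebra_simps)
  then show ?thesis by (smt (verit) zero_le_power2)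
 qed
 have "(norm (A ** B))\<^sup>2 <= (norm A * norm B)\<^sup>2"
  unfolding power_mult_distrib norm_mat2_sq mult_nth2
  using cs[of "A$1$1" "B$1$1" "A$1$2" "B$2$1"] cs[of "A$1$1" "B$1$2" "A$1$2" "B$2$2"]
   cs[of "A$2$1" "B$1$1" "A$2$2" "B$2$1"] cs[of "A$2$1" "B$1$2" "A$2$2" "B$2$2"]
  by (simp add: algebra_simps)
 then show ?thesis by (rule power2_le_imp_le) simp
qed

lemma norm_adj2 [simp]: "norm (adj2 g) = norm g"
proof -
 have "(norm (adj2 g))\<^sup>2 = (norm g)\<^sup>2" unfolding norm_mat2_sq by simp
 then show ?thesis by simp
qed

lemma norm_mat2_le: "norm A <= \<bar>A$1$1\<bar> + \<bar>A$1$2\<bar> + \<bar>A$2$1\<bar> + \<bar>A$2$2\<bar>" for A :: "real^2^2"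
proof -
 have "(norm A)\<^sup>2 <= (\<bar>A$1$1\<bar> + \<bar>A$1$2\<bar> + \<bar>A$2$1\<bar> + \<bar>A$2$2\<bar>)\<^sup>2"
  unfolding norm_mat2_sq power2_sum by simp
 then show ?thesis by (rule power2_le_imp_le) simp
qed

lemma mat2_collapse: "mat2 (A$1$1) (A$1$2) (A$2$1) (A$2$2) = A"
 by (simp add: mat2_eq_iff)

lemma continuous_mat2 [continuous_intros]:
 assumes "continuous_on S a" "continuous_on S b" "continuous_on S c" "continuous_on S d"
 shows "continuous_on S (%x. mat2 (a x) (b x) (c x) (d x))"
proof -
 have *: "mat2 p q u v = (\<chi> i j. if i = 1 then (if j = 1 then p else q) else (if j = 1 then u else v))" for p q u v
  by (simp add: mat2_eq_iff)
 have "continuous_on S (%x. if i = 1 then (if j = 1 then a x else b x) else (if j = 1 then c x else d x))" for i j :: 2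
  using assms by (cases "i = 1"; cases "j = 1") simp_all
 then show ?thesis unfolding *
  by (intro continuous_on_vec_lambda)
qed

lemma continuous_mult2 [continuous_intros]:
 fixes f g :: "'a::topological_space => real^2^2"
 assumes "continuous_on S f" "continuous_on S g"
 shows "continuous_on S (%x. f x ** g x)"
proof -
 have "continuous_on S (%x. mat2 ((f x ** g x)$1$1) ((f x ** g x)$1$2) ((f x ** g x)$2$1) ((f x ** g x)$2$2))"
  unfolding mult_nth2 by (intro continuous_intros assms)
 then show ?thesis by (simp only: mat2_collapse)
qed

lemma continuous_adj2 [continuous_intros]:
 "continuous_on S f ==> continuous_on S (%x. adj2 (f x))"
 unfolding adj2_def by (intro continuous_intros)

lemma closed_SL2: "closed SL2"
proof -
 have "SL2 = (%g. g$1$1 * g$2$2 - g$1$2 * g$2$1) -` {1::real}"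
  by (auto simp: mem_SL2)
 moreover have "closed \<dots>"
  by (intro closed_vimage) (simp, intro continuous_intros)
 ultimately show ?thesis by simp
qed

subsection \<open>The action on the upper half-plane\<close>

definition den :: "real^2^2 => complex => complex" where
 "den g z = of_real (g$2$1) * z + of_real (g$2$2)"

definition num :: "real^2^2 => complex => complex" where
 "num g z = of_real (g$1$1) * z + of_real (g$1$2)"

lemma act_num_den: "act g z = num g z / den g z"
 by (simp add: act_def moebius_def num_def den_def)

lemma den_nz:
 assumes "g \<in> SL2" "Im z > 0" shows "den g z \<noteq> 0"
proof
 assume "den g z = 0"
 then have "g$2$1 * Im z = 0" "g$2$1 * Re z + g$2$2 = 0"
  by (auto simp: den_def complex_eq_iff)
 with assms show False by (auto simp: mem_SL2)
qed

lemma Im_act: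
 assumes "g \<in> SL2" "Im z > 0"
 shows "Im (act g z) = Im z / (cmod (den g z))\<^sup>2"
proof -
 have "Im (num g z) * Re (den g z) - Re (num g z) * Im (den g z) = Im z * (g$1$1 * g$2$2 - g$1$2 * g$2$1)"
  by (simp add: num_def den_def algebra_simps)
 with assms(1) show ?thesis
  by (simp add: act_num_den Im_divide cmod_power2 mem_SL2)
qed

lemma act_uhp: "g \<in> SL2 ==> z \<in> uhp ==> act g z \<in> uhp"
 using den_nz[of g z] by (simp add: uhp_def Im_act)

lemma act_mult:
 assumes "h \<in> SL2" "z \<in> uhp"
 shows "act (g ** h) z = act g (act h z)"
proof -
 have "den h z \<noteq> 0" using assms den_nz by (simp add: uhp_def)
 moreover have "num (g ** h) z = of_real (g$1$1) * num h z + of_real (g$1$2) * den h z"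
  "den (g ** h) z = of_real (g$2$1) * num h z + of_real (g$2$2) * den h z"
  by (simp_all add: num_def den_def mult_nth2 algebra_simps)
 ultimately show ?thesis
  unfolding act_num_den num_def[of g] den_def[of g] by (simp add: divide_simps)
qed

lemma act_one [simp]: "act (mat 1) z = z"
 by (simp add: act_def moebius_def)

lemma act_uminus [simp]: "act (- g) z = act g z"
proof -
 have "num (- g) z = - num g z" "den (- g) z = - den g z"
  by (simp_all add: num_def den_def)
 then show ?thesis by (simp add: act_num_den)
qed

lemma act_adj2:
 assumes "g \<in> SL2" "z \<in> uhp"
 shows "act (adj2 g) (act g z) = z" "act g (act (adj2 g) z) = z"
proof -
 show "act (adj2 g) (act g z) = z"
  using act_mult[OF assms, of "adj2 g"] by (simp add: adj2_mult assms)
 show "act g (act (adj2 g) z) = z"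
  using act_mult[OF adj2_SL2[OF assms(1)] assms(2), of g] by (simp add: adj2_mult assms)
qed

lemma i_uhp [simp]: "\<i> \<in> uhp" by (simp add: uhp_def)

lemma open_uhp: "open uhp"
 by (simp add: uhp_def open_halfspace_Im_gt)

definition upper :: "complex => real^2^2" where
 "upper z = mat2 (sqrt (Im z)) (Re z / sqrt (Im z)) 0 (1 / sqrt (Im z))"

lemma upper_SL2: "z \<in> uhp ==> upper z \<in> SL2"
 by (simp add: upper_def mat2_in_SL2 uhp_def)

lemma act_upper: "z \<in> uhp ==> act (upper z) \<i> = z"
 by (simp add: upper_def act_num_den num_def den_def uhp_def complex_eq_iff field_simps)

lemma continuous_upper: "continuous_on uhp upper"
 unfolding upper_def uhp_def
 by (intro continuous_intros) auto

lemma continuous_act: 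
 assumes "continuous_on S f" "continuous_on S h" "\<And>x. x \<in> S ==> f x \<in> SL2" "\<And>x. x \<in> S ==> h x \<in> uhp"
 shows "continuous_on S (%x. act (f x) (h x))"
 unfolding act_num_den num_def den_def
 by (intro continuous_intros assms) (use assms den_nz in \<open>auto simp: den_def uhp_def\<close>)

lemma continuous_act_i: "continuous_on SL2 (%g. act g \<i>)"
 by (intro continuous_act continuous_intros) auto

section \<open>Haar measure on the group of unimodular matrices\<close>

subsection \<open>Lebesgue measure on vectors and matrices\<close>

text \<open>
  Both sides are compared on boxes; the preimage of a box is its image under the inverse matrix, whose
  measure is known.
\<close>

lemma lborel_linear_image2:
 fixes T :: "real^2 => real^2"
 assumes T: "linear T" and d: "det (matrix T) \<noteq> 0"
 shows "lborel = density (distr lborel borel T) (%_. ennreal \<bar>det (matrix T)\<bar>)"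
proof (rule lborel_eqI)
 have "invertible (matrix T)" using d by (simp add: invertible_det_nz)
 then obtain B where B: "matrix T ** B = mat 1" "B ** matrix T = mat 1"
  unfolding invertible_def by blast
 define U where "U = (*v) B"
 have TU: "T (U x) = x" and UT: "U (T x) = x" for x
  proof -
  have "T y = matrix T *v y" for y using T by (simp add: matrix_works)
  then show "T (U x) = x" "U (T x) = x"
   using B by (simp_all add: U_def matrix_vector_mul_assoc)
 qed
 have lin: "linear U" by (simp add: U_def)
 have det: "det (matrix T) * det B = 1"
  by (metis B(1) det_I det_mul)
 have mT: "T \<in> borel_measurable borel"
  by (intro borel_measurable_continuous_onI linear_continuous_on T[unfolded linear_conv_bounded_linear])
 fix l u :: "real^2"
 assume le: "\<And>b. b \<in> Basis ==> l \<bullet> b <= u \<bullet> b"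
 have vim: "T -` box l u = U ` box l u"
  using TU UT by (auto simp: image_iff) (metis UT)
 have "measure lebesgue (U ` box l u) = \<bar>det B\<bar> * measure lebesgue (box l u)"
  using measure_linear_image[OF lin lmeasurable_box] by (simp add: U_def)
 moreover have "U ` box l u \<in> lmeasurable"
  by (rule measurable_linear_image[OF lin lmeasurable_box])
 moreover have "U ` box l u \<in> sets borel"
  unfolding vim[symmetric] using measurable_sets[OF mT, of "box l u"] by simp
 moreover have "emeasure lebesgue (U ` box l u) = ennreal (measure lebesgue (U ` box l u))"
  by (rule emeasure_eq_measure2) fact
 moreover have "emeasure lborel (box l u) < \<infinity>" by (rule emeasure_lborel_box_finite)
 ultimately have em: "emeasure lborel (U ` box l u) = ennreal (\<bar>det B\<bar> * measure lborel (box l u))"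
  by simp
 have "emeasure (density (distr lborel borel T) (%_. ennreal \<bar>det (matrix T)\<bar>)) (box l u)
   = ennreal \<bar>det (matrix T)\<bar> * emeasure lborel (T -` box l u)"
  by (subst emeasure_density) (auto simp: nn_integral_cmult emeasure_distr mT)
 also have "... = ennreal (\<bar>det (matrix T)\<bar> * (\<bar>det B\<bar> * measure lborel (box l u)))"
  by (simp add: vim em ennreal_mult)
 also have "\<bar>det (matrix T)\<bar> * (\<bar>det B\<bar> * measure lborel (box l u)) = measure lborel (box l u)"
  using det by (metis abs_1 abs_mult mult.assoc mult_1)
 also have "ennreal \<dots> = emeasure lborel (box l u)"
  using emeasure_lborel_box_finite[of l u] by (intro emeasure_eq_ennreal_measure[symmetric]) simp
 also have "... = (\<Prod>b\<in>Basis. (u - l) \<bullet> b)"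
  by (rule emeasure_lborel_box[OF le])
 finally show "emeasure (density (distr lborel borel T) (%_. ennreal \<bar>det (matrix T)\<bar>)) (box l u) 
  = (\<Prod>b\<in>Basis. (u - l) \<bullet> b)" .
qed simp

lemma nn_integral_linear2:
 fixes T :: "real^2 => real^2"
 assumes T: "linear T" and d: "det (matrix T) \<noteq> 0" and f: "f \<in> borel_measurable borel"
 shows "(\<integral>\<^sup>+x. f x \<partial>lborel) = ennreal \<bar>det (matrix T)\<bar> * (\<integral>\<^sup>+x. f (T x) \<partial>lborel)"
proof -
 have mT: "T \<in> borel_measurable borel"
  by (intro borel_measurable_continuous_onI linear_continuous_on T[unfolded linear_conv_bounded_linear])
 show ?thesis
  using f mT by (subst lborel_linear_image2[OF T d])
   (simp add: nn_integral_density nn_integral_distr nn_integral_cmult)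
qed

definition rows :: "real^2 => real^2 => real^2^2" where
 "rows u v = (\<chi> i. if i = 1 then u else v)"

lemma rows_nth [simp]: "rows u v $ 1 = u" "rows u v $ 2 = v"
 by (simp_all add: rows_def)

lemma prod_Basis_mat2:
 fixes x :: "real^2^2"
 shows "(\<Prod>b\<in>Basis. x \<bullet> b) = (\<Prod>b\<in>Basis. x$1 \<bullet> b) * (\<Prod>b\<in>Basis. x$2 \<bullet> b)"
proof -
 have B: "(Basis :: (real^2^2) set) = axis 1 ` Basis \<union> axis 2 ` Basis"
  by (auto simp: Basis_vec_def[where 'a="real^2"] UNIV_2)
 have inj: "inj_on (axis i) Basis" for i :: 2
  by (auto simp: inj_on_def axis_eq_axis)
 have "axis (1::2) ` Basis \<inter> axis 2 ` (Basis :: (real^2) set) = {}"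
  by (auto simp: axis_eq_axis)
 then show ?thesis unfolding B
  by (subst prod.union_disjoint) (auto simp: prod.reindex[OF inj] inner_axis)
qed

lemma mem_box_mat2:
 fixes x :: "real^2^2"
 shows "x \<in> box l u \<longleftrightarrow> x$1 \<in> box (l$1) (u$1) \<and> x$2 \<in> box (l$2) (u$2)"
proof -
 have B: "(Basis :: (real^2^2) set) = axis 1 ` Basis \<union> axis 2 ` Basis"
  by (auto simp: Basis_vec_def[where 'a="real^2"] UNIV_2)
 show ?thesis unfolding mem_box B ball_Un ball_simps(9) by (simp add: inner_axis ball_conj_distrib)
qed

lemma measurable_rows [measurable]: "(%(u, v). rows u v) \<in> borel \<Otimes>\<^sub>M borel \<rightarrow>\<^sub>M borel"
proof -
 have "continuous_on UNIV (%p. if i = 1 then fst p else snd p :: real^2)" for i :: 2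
  by (cases "i = 1") (simp_all add: continuous_on_fst continuous_on_snd continuous_on_id)
 then have "continuous_on UNIV (%p. rows (fst p) (snd p))"
  unfolding rows_def by (intro continuous_on_vec_lambda)
 then show ?thesis
  unfolding borel_prod split_beta by (rule borel_measurable_continuous_onI)
qed

text \<open>
  A matrix is a pair of rows, and multiplication from the right acts on each row separately. This
  reduces its Jacobian to the determinant of a map of the plane.
\<close>

lemma lborel_rows: "(lborel :: (real^2^2) measure) = distr (lborel \<Otimes>\<^sub>M lborel) borel (%(u, v). rows u v)"
proof (rule lborel_eqI)
 fix l u :: "real^2^2"
 assume le: "\<And>b. b \<in> Basis ==> l \<bullet> b <= u \<bullet> b"
 have le': "l$i \<bullet> b <= u$i \<bullet> b" if "b \<in> Basis" for i b
  using le[of "axis i b"] that by (simp add: inner_axis axis_in_Basis_iff)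
 have "(%(u, v). rows u v) -` box l u \<inter> space (lborel \<Otimes>\<^sub>M lborel) = box (l$1) (u$1) \<times> box (l$2) (u$2)"
  by (auto simp: mem_box_mat2 space_pair_measure)
 then have "emeasure (distr (lborel \<Otimes>\<^sub>M lborel) borel (%(u, v). rows u v)) (box l u) 
  = emeasure lborel (box (l$1) (u$1)) * emeasure lborel (box (l$2) (u$2))"
  by (simp add: emeasure_distr lborel.emeasure_pair_measure_Times)
 also have "... = (\<Prod>b\<in>Basis. (u - l) \<bullet> b)"
 proof -
  have "0 <= (\<Prod>b\<in>Basis. (u$i - l$i) \<bullet> b)" for i
   using le' by (intro prod_nonneg) (simp add: inner_diff_left)
  then show ?thesis
   using le' by (simp add: prod_Basis_mat2[of "u - l"] ennreal_mult)
 qed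
 finally show "emeasure (distr (lborel \<Otimes>\<^sub>M lborel) borel (%(u, v). rows u v)) (box l u) = (\<Prod>b\<in>Basis. (u - l) \<bullet> b)" .
qed simp

lemma nn_integral_rows:
 assumes f: "f \<in> borel_measurable borel"
 shows "(\<integral>\<^sup>+m. f m \<partial>lborel) = (\<integral>\<^sup>+v. \<integral>\<^sup>+u. f (rows u v) \<partial>lborel \<partial>lborel)"
proof -
 have "(\<integral>\<^sup>+m. f m \<partial>lborel) = (\<integral>\<^sup>+p. f (rows (fst p) (snd p)) \<partial>(lborel \<Otimes>\<^sub>M lborel))"
  by (subst lborel_rows) (simp add: nn_integral_distr f split_beta)
 also have "... = (\<integral>\<^sup>+v. \<integral>\<^sup>+u. f (rows u v) \<partial>lborel \<partial>lborel)"
  using lborel_pair.nn_integral_snd[of "%p. f (rows (fst p) (snd p))"] f 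
  by (simp add: measurable_rows[unfolded split_beta] split_beta)
 finally show ?thesis .
qed

lemma det_right_mult_map: "det (matrix (%u :: real^2. u v* g)) = det (g :: real^2^2)"
proof -
 have "matrix (%u :: real^2. u v* g) = transpose g"
  using matrix_of_matrix_vector_mul[of "transpose g"] by (simp add: )
 then show ?thesis by (simp add: det_transpose)
qed

lemma measurable_mult2 [measurable]:
 fixes g :: "real^2^2"
 shows "(%m. (m :: real^2^2) ** g) \<in> borel_measurable borel" "(%m. g ** (m :: real^2^2)) \<in> borel_measurable borel"
 by (auto intro!: borel_measurable_continuous_onI continuous_intros)

lemma nn_integral_lborel_mult_right:
 fixes f :: "real^2^2 => ennreal"
 assumes g: "g \<in> SL2" and f: "f \<in> borel_measurable borel"
 shows "(\<integral>\<^sup>+m. f (m ** g) \<partial>lborel) = (\<integral>\<^sup>+m. f m \<partial>lborel)"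
proof -
 have r: "rows u v ** g = rows (u v* g) (v v* g)" for u v
  by (simp add: mat2_eq_iff mult_nth2 vector_matrix_mult_def sum_2 rows_def mult.commute)
 have lin: "linear (%u. u v* g)"
  using matrix_vector_mul_linear[of "transpose g"] by simp
 have d: "det (matrix (%u. u v* g)) = 1" using g by (simp add: det_right_mult_map SL2_def)
 have nn: "(\<integral>\<^sup>+u. h (u v* g) \<partial>lborel) = (\<integral>\<^sup>+u. h u \<partial>lborel)" if "h \<in> borel_measurable borel" for h
  using nn_integral_linear2[OF lin _ that] d by simp
 have m: "(%u. f (rows u v)) \<in> borel_measurable borel" for v
  using f by measurable
 have m2: "(%v. \<integral>\<^sup>+u. f (rows u v) \<partial>lborel) \<in> borel_measurable borel"
  using f by measurable
 have "(\<integral>\<^sup>+m. f (m ** g) \<partial>lborel) = (\<integral>\<^sup>+v. \<integral>\<^sup>+u. f (rows (u v* g) (v v* g)) \<partial>lborel \<partial>lborel)"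
  by (subst nn_integral_rows) (use f in \<open>auto simp: r\<close>)
 also have "... = (\<integral>\<^sup>+v. \<integral>\<^sup>+u. f (rows u (v v* g)) \<partial>lborel \<partial>lborel)"
  by (simp add: nn[OF m])
 also have "... = (\<integral>\<^sup>+v. \<integral>\<^sup>+u. f (rows u v) \<partial>lborel \<partial>lborel)"
  by (rule nn[OF m2])
 also have "... = (\<integral>\<^sup>+m. f m \<partial>lborel)" by (rule nn_integral_rows[OF f, symmetric])
 finally show ?thesis .
qed

lemma prod_Basis_mat2_entries:
 "(\<Prod>b\<in>Basis. x \<bullet> b) = x$1$1 * x$1$2 * (x$2$1 * x$2$2)" for x :: "real^2^2"
proof -
 have "(\<Prod>b\<in>Basis. y \<bullet> b) = y$1 * y$2" for y :: "real^2"
 proof -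
  have B: "(Basis :: (real^2) set) = {axis 1 1, axis 2 1}"
   by (auto simp: Basis_vec_def UNIV_2)
  have "axis (1::2) (1::real) \<noteq> axis 2 1" by (simp add: axis_eq_axis)
  then show ?thesis unfolding B by (simp add: inner_axis)
 qed
 then show ?thesis by (simp add: prod_Basis_mat2)
qed

lemma mem_box_mat2_entries:
 "x \<in> box l u \<longleftrightarrow> (\<forall>i j. l$i$j < x$i$j \<and> x$i$j < u$i$j)" for x :: "real^2^2"
 by (auto simp: mem_box_mat2 mem_box_cart forall_2)

text \<open>
  The adjugate permutes the entries up to sign and reverses products, so it turns left into
  right multiplication.
\<close>

lemma lborel_adj2: "(lborel :: (real^2^2) measure) = distr lborel borel adj2"
proof (rule lborel_eqI)
 have [measurable]: "adj2 \<in> borel_measurable borel"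
  by (intro borel_measurable_continuous_onI continuous_intros)
 fix l u :: "real^2^2"
 assume le: "\<And>b. b \<in> Basis ==> l \<bullet> b <= u \<bullet> b"
 have le': "l$i$j <= u$i$j" for i j
  using le[of "axis i (axis j 1)"] by (simp add: inner_axis axis_in_Basis_iff)
 define l' where "l' = mat2 (l$2$2) (- u$1$2) (- u$2$1) (l$1$1)"
 define u' where "u' = mat2 (u$2$2) (- l$1$2) (- l$2$1) (u$1$1)"
 have le2: "l' $ i $ j <= u' $ i $ j" for i j
  using le' exhaust_2[of i] exhaust_2[of j] by (auto simp: l'_def u'_def)
 have le3: "\<And>b. b \<in> Basis ==> l' \<bullet> b <= u' \<bullet> b"
  using le2 by (auto simp: Basis_vec_def inner_axis)
 have vim: "adj2 -` box l u = box l' u'"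
  by (auto simp: mem_box_mat2_entries forall_2 l'_def u'_def)
 show "emeasure (distr lborel borel adj2) (box l u) = (\<Prod>b\<in>Basis. (u - l) \<bullet> b)"
  by (simp add: emeasure_distr vim le3 prod_Basis_mat2_entries[of "u' - l'"] prod_Basis_mat2_entries[of "u - l"])
   (simp add: l'_def u'_def mult.commute mult.left_commute)
qed simp

lemma nn_integral_lborel_mult_left:
 fixes f :: "real^2^2 => ennreal"
 assumes g: "g \<in> SL2" and f: "f \<in> borel_measurable borel"
 shows "(\<integral>\<^sup>+m. f (g ** m) \<partial>lborel) = (\<integral>\<^sup>+m. f m \<partial>lborel)"
proof -
 have [measurable]: "adj2 \<in> borel_measurable borel"
  by (intro borel_measurable_continuous_onI continuous_intros)
 have adj: "(\<integral>\<^sup>+m. h (adj2 m) \<partial>lborel) = (\<integral>\<^sup>+m. h m \<partial>lborel)" if "h \<in> borel_measurable borel" for h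
  using that by (subst (2) lborel_adj2) (simp add: nn_integral_distr)
 have fa: "(%m. f (adj2 m)) \<in> borel_measurable borel" using f by measurable
 have fg: "(%m. f (g ** m)) \<in> borel_measurable borel" using f by measurable
 have "(\<integral>\<^sup>+m. f (g ** m) \<partial>lborel) = (\<integral>\<^sup>+m. f (g ** adj2 m) \<partial>lborel)"
  by (rule adj[OF fg, symmetric])
 also have "... = (\<integral>\<^sup>+m. f (adj2 (m ** adj2 g)) \<partial>lborel)"
  by (simp add: adj2_mul)
 also have "... = (\<integral>\<^sup>+m. f (adj2 m) \<partial>lborel)"
  by (rule nn_integral_lborel_mult_right[OF adj2_SL2[OF g] fa])
 also have "... = (\<integral>\<^sup>+m. f m \<partial>lborel)" by (rule adj[OF f])
 finally show ?thesis .
qed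

subsection \<open>Haar measure\<close>

text \<open>
  The matrices that Haar measure is pushed forward from.
\<close>

definition cone_shell :: "(real^2^2) set" where
 "cone_shell = {m. 0 < det m \<and> det m <= 1}"

abbreviation SL2_borel :: "(real^2^2) measure" where
 "SL2_borel \<equiv> restrict_space borel SL2"

lemma continuous_det2 [continuous_intros]:
 "continuous_on S f ==> continuous_on S (%x. det (f x :: real^2^2))"
 unfolding det_2 by (intro continuous_intros)

lemma cone_shell_borel [measurable]: "cone_shell \<in> sets borel"
proof -
 have [measurable]: "(det :: real^2^2 => real) \<in> borel_measurable borel"
  by (intro borel_measurable_continuous_onI continuous_intros)
 show ?thesis unfolding cone_shell_def by measurable
qed

lemma det_scaleR2: "det (c *\<^sub>R m :: real^2^2) = c\<^sup>2 * det m"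
 by (simp add: det_2 power2_eq_square algebra_simps)

lemma to_SL2_in: "m \<in> cone_shell ==> to_SL2 m \<in> SL2"
 by (simp add: cone_shell_def to_SL2_def SL2_def det_scaleR2 power_inverse)

lemma measurable_to_SL2: "to_SL2 \<in> restrict_space lborel cone_shell \<rightarrow>\<^sub>M SL2_borel"
proof (rule measurable_restrict_space2)
 have "continuous_on cone_shell to_SL2"
  unfolding to_SL2_def by (intro continuous_intros) (auto simp: cone_shell_def)
 then have "to_SL2 \<in> borel_measurable (restrict_space borel cone_shell)"
  by (rule borel_measurable_continuous_on_restrict)
 then show "to_SL2 \<in> borel_measurable (restrict_space lborel cone_shell)"
  by (simp cong: measurable_cong_sets)
qed (auto simp: space_restrict_space to_SL2_in)

lemma space_haar [simp]: "space haar_SL2 = SL2"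
 by (simp add: haar_SL2_def space_restrict_space)

lemma sets_haar [measurable_cong, simp]: "sets haar_SL2 = sets SL2_borel"
 by (simp add: haar_SL2_def)

lemma nn_integral_haar:
 assumes f: "f \<in> borel_measurable SL2_borel"
 shows "(\<integral>\<^sup>+g. f g \<partial>haar_SL2) = (\<integral>\<^sup>+m. indicator cone_shell m * f (to_SL2 m) \<partial>lborel)"
 unfolding haar_SL2_def cone_shell_def[symmetric]
 using f measurable_to_SL2
 by (simp add: nn_integral_distr nn_integral_restrict_space mult.commute)

lemma measurable_cone:
 assumes f: "f \<in> borel_measurable SL2_borel"
 shows "(%m. indicator cone_shell m * f (to_SL2 m) :: ennreal) \<in> borel_measurable borel"
proof -
 have "(%m. f (to_SL2 m)) \<in> borel_measurable (restrict_space lborel cone_shell)"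
  by (rule measurable_compose[OF measurable_to_SL2 f])
 then show ?thesis
  by (subst (asm) borel_measurable_restrict_space_iff_ennreal) (simp_all add: mult.commute)
qed

lemma to_SL2_mult_right: "g \<in> SL2 ==> to_SL2 (m ** g) = to_SL2 m ** g"
 by (simp add: to_SL2_def SL2_def det_mul mat2_eq_iff mult_nth2 algebra_simps)

lemma to_SL2_mult_left: "g \<in> SL2 ==> to_SL2 (g ** m) = g ** to_SL2 m"
 by (simp add: to_SL2_def SL2_def det_mul mat2_eq_iff mult_nth2 algebra_simps)

lemma nn_integral_haar_mult_right:
 assumes g: "g \<in> SL2" and f: "f \<in> borel_measurable SL2_borel"
 shows "(\<integral>\<^sup>+h. f (h ** g) \<partial>haar_SL2) = (\<integral>\<^sup>+h. f h \<partial>haar_SL2)"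
proof -
 have "(%h. h ** g) \<in> SL2_borel \<rightarrow>\<^sub>M SL2_borel"
  by (intro measurable_restrict_space2 measurable_restrict_space1) (auto simp: space_restrict_space SL2_mult g)
 then have fg: "(%h. f (h ** g)) \<in> borel_measurable SL2_borel"
  by (rule measurable_compose) (rule f)
 have "(m ** g \<in> cone_shell) = (m \<in> cone_shell)" for m
  using g by (simp add: cone_shell_def det_mul SL2_def)
 then have "(\<integral>\<^sup>+m. indicator cone_shell m * f (to_SL2 m ** g) \<partial>lborel)
  = (\<integral>\<^sup>+m. indicator cone_shell (m ** g) * f (to_SL2 (m ** g)) \<partial>lborel)"
  by (intro nn_integral_cong) (simp add: to_SL2_mult_right g indicator_def)
 then show ?thesis
  by (simp add: nn_integral_haar fg f nn_integral_lborel_mult_right[OF g measurable_cone[OF f]])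
qed

lemma nn_integral_haar_mult_left:
 assumes g: "g \<in> SL2" and f: "f \<in> borel_measurable SL2_borel"
 shows "(\<integral>\<^sup>+h. f (g ** h) \<partial>haar_SL2) = (\<integral>\<^sup>+h. f h \<partial>haar_SL2)"
proof -
 have "(%h. g ** h) \<in> SL2_borel \<rightarrow>\<^sub>M SL2_borel"
  by (intro measurable_restrict_space2 measurable_restrict_space1) (auto simp: space_restrict_space SL2_mult g)
 then have fg: "(%h. f (g ** h)) \<in> borel_measurable SL2_borel"
  by (rule measurable_compose) (rule f)
 have "(g ** m \<in> cone_shell) = (m \<in> cone_shell)" for m
  using g by (simp add: cone_shell_def det_mul SL2_def)
 then have "(\<integral>\<^sup>+m. indicator cone_shell m * f (g ** to_SL2 m) \<partial>lborel)
  = (\<integral>\<^sup>+m. indicator cone_shell (g ** m) * f (to_SL2 (g ** m)) \<partial>lborel)"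
  by (intro nn_integral_cong) (simp add: to_SL2_mult_left g indicator_def)
 then show ?thesis
  by (simp add: nn_integral_haar fg f nn_integral_lborel_mult_left[OF g measurable_cone[OF f]])
qed

subsection \<open>Size of Haar measure\<close>

lemma emeasure_haar:
 assumes A: "A \<in> sets SL2_borel"
 shows "emeasure haar_SL2 A = emeasure lborel {m \<in> cone_shell. to_SL2 m \<in> A}"
  and "{m \<in> cone_shell. to_SL2 m \<in> A} \<in> sets borel"
proof -
 have mA: "indicator A \<in> borel_measurable SL2_borel" using A by simp
 have eq: "indicator cone_shell m * indicator A (to_SL2 m) 
   = (indicator {m \<in> cone_shell. to_SL2 m \<in> A} m :: ennreal)" for m
  by (simp add: indicator_def)
 have "(%m. indicator {m \<in> cone_shell. to_SL2 m \<in> A} m :: ennreal) \<in> borel_measurable borel"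
  using measurable_cone[OF mA] unfolding eq .
 then show b: "{m \<in> cone_shell. to_SL2 m \<in> A} \<in> sets borel"
  by (subst (asm) borel_measurable_indicator_iff) simp
 have "emeasure haar_SL2 A = (\<integral>\<^sup>+m. indicator A m \<partial>haar_SL2)" using A by simp
 also have "... = (\<integral>\<^sup>+m. indicator {m \<in> cone_shell. to_SL2 m \<in> A} m \<partial>lborel)"
  by (simp only: nn_integral_haar[OF mA] eq)
 finally show "emeasure haar_SL2 A = emeasure lborel {m \<in> cone_shell. to_SL2 m \<in> A}"
  using b by simp
qed

lemma SL2_borel_Int: "A \<in> sets borel ==> A \<inter> SL2 \<in> sets SL2_borel" "A \<in> sets borel ==> SL2 \<inter> A \<in> sets SL2_borel"
 using closed_SL2 by (auto simp: sets_restrict_space)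

lemma SL2_borel_open: "openin (top_of_set SL2) A ==> A \<in> sets SL2_borel"
 by (auto simp: openin_open SL2_borel_Int)

lemma haar_finite_bounded: "emeasure haar_SL2 (SL2 \<inter> cball 0 R) < \<infinity>"
proof -
 have A: "SL2 \<inter> cball 0 R \<in> sets SL2_borel" by (rule SL2_borel_Int) simp
 have "{m \<in> cone_shell. to_SL2 m \<in> SL2 \<inter> cball 0 R} \<subseteq> cball 0 R"
 proof safe
  fix m assume m: "m \<in> cone_shell" "to_SL2 m \<in> cball 0 R"
  then have d: "0 < det m" "det m <= 1" by (auto simp: cone_shell_def)
  have "norm m = sqrt (det m) * norm (to_SL2 m)" using d by (simp add: to_SL2_def)
  also have "... <= 1 * norm (to_SL2 m)" using d by (intro mult_right_mono) auto
  finally show "m \<in> cball 0 R" using m by simp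
 qed
 then have "emeasure haar_SL2 (SL2 \<inter> cball 0 R) <= emeasure lborel (cball (0::real^2^2) R)"
  unfolding emeasure_haar(1)[OF A] by (intro emeasure_mono) simp_all
 also have "... < \<infinity>" by (rule emeasure_lborel_cball_finite)
 finally show ?thesis .
qed

lemma lborel_open_pos:
 fixes U :: "'a::euclidean_space set"
 assumes "open U" "U \<noteq> {}" shows "emeasure lborel U > 0"
proof (rule ccontr)
 assume "\<not> emeasure lborel U > 0"
 then have "U \<in> null_sets lborel" using assms by (intro null_setsI) auto
 then have "negligible U" by (simp add: negligible_iff_null_sets null_sets_completionI)
 then show False using open_not_negligible[OF assms] by simp
qed

lemma haar_open_pos:
 assumes A: "openin (top_of_set SL2) A" and ne: "A \<noteq> {}"
 shows "emeasure haar_SL2 A > 0"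
proof -
 have Am: "A \<in> sets SL2_borel" by (rule SL2_borel_open[OF A])
 obtain U where U: "open U" "A = SL2 \<inter> U" using A by (auto simp: openin_open)
 obtain g where g: "g \<in> SL2" "g \<in> U" using ne U by auto
 define P where "P = {m :: real^2^2. 0 < det m \<and> det m < 1}"
 have oP: "open P" unfolding P_def
  by (intro open_Collect_conj open_Collect_less continuous_intros)
 have "continuous_on P to_SL2"
  unfolding to_SL2_def by (intro continuous_intros) (auto simp: P_def)
 then have oV: "open (P \<inter> to_SL2 -` U)"
  by (rule continuous_open_preimage[OF _ oP U(1)])
 let ?m = "(1/2) *\<^sub>R g"
 have det: "det ?m = 1/4" using g by (simp only: det_scaleR2) (simp add: SL2_def power2_eq_square)
 have "to_SL2 ?m = g" unfolding to_SL2_def det by (simp add: real_sqrt_divide)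
 then have "?m \<in> P \<inter> to_SL2 -` U" using g det by (simp add: P_def)
 then have "emeasure lborel (P \<inter> to_SL2 -` U) > 0"
  using oV by (intro lborel_open_pos) auto
 also have "emeasure lborel (P \<inter> to_SL2 -` U) <= emeasure lborel {m \<in> cone_shell. to_SL2 m \<in> A}"
  using emeasure_haar(2)[OF Am]
  by (intro emeasure_mono) (auto simp: U to_SL2_in cone_shell_def P_def)
 finally show ?thesis by (simp add: emeasure_haar(1)[OF Am])
qed

text \<open>
  For \<open>\<epsilon>\<close> much smaller than \<open>\<delta>\<close> this is a thin neighbourhood of a segment of the diagonal group. Prescribing
  three entries determines the fourth.
\<close>

definition tube :: "real => real => (real^2^2) set" where
 "tube \<delta> \<epsilon> = {h \<in> SL2. \<bar>h$1$1 - 1\<bar> <= \<delta> \<and> \<bar>h$1$2\<bar> <= \<epsilon> \<and> \<bar>h$2$1\<bar> <= \<epsilon>}"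

lemma tube_closed: "closed (tube \<delta> \<epsilon>)"
proof -
 have "tube \<delta> \<epsilon> = SL2 \<inter> ({h. \<bar>h$1$1 - 1\<bar> <= \<delta>} \<inter> ({h. \<bar>h$1$2\<bar> <= \<epsilon>} \<inter> {h. \<bar>h$2$1\<bar> <= \<epsilon>}))"
  by (auto simp: tube_def)
 also have "closed \<dots>"
  by (intro closed_Int closed_SL2 closed_Collect_le continuous_intros)
 finally show ?thesis .
qed

lemma tube_sets: "tube \<delta> \<epsilon> \<in> sets SL2_borel"
 using SL2_borel_Int(2)[of "tube \<delta> \<epsilon>"] tube_closed[of \<delta> \<epsilon>]
 by (metis (no_types, lifting) borel_closed Int_absorb1 mem_Collect_eq subsetI tube_def)

text \<open>
  The cone over the tube contains a box in the space of matrices with two sides of length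
  \<open>\<delta> / 8\<close> and two of length \<open>\<epsilon> / 4\<close>.
\<close>

lemma haar_tube_ge:
 assumes e: "0 < \<epsilon>" "\<epsilon> <= \<delta>" and d: "\<delta> <= 1"
 shows "emeasure haar_SL2 (tube \<delta> \<epsilon>) >= ennreal (\<delta>\<^sup>2 * \<epsilon>\<^sup>2 / 1024)"
proof -
 define l where "l = mat2 (1/2) 0 0 (1/2)"
 define u where "u = mat2 (1/2 + \<delta>/8) (\<epsilon>/4) (\<epsilon>/4) (1/2 + \<delta>/8)"
 have le: "l$i$j <= u$i$j" for i j
  using exhaust_2[of i] exhaust_2[of j] e by (auto simp: l_def u_def)
 have "emeasure lborel (box l u) = ennreal (\<Prod>b\<in>Basis. (u - l) \<bullet> b)"
  using le by (intro emeasure_lborel_box) (auto simp: Basis_vec_def inner_axis)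
 also have "(\<Prod>b\<in>Basis. (u - l) \<bullet> b) = \<delta>\<^sup>2 * \<epsilon>\<^sup>2 / 1024"
  unfolding prod_Basis_mat2_entries by (simp add: l_def u_def power2_eq_square)
 finally have vol: "emeasure lborel (box l u) = ennreal (\<delta>\<^sup>2 * \<epsilon>\<^sup>2 / 1024)" .
 have "box l u \<subseteq> {m \<in> cone_shell. to_SL2 m \<in> tube \<delta> \<epsilon>}"
 proof
  fix m assume "m \<in> box l u"
  then have m: "1/2 < m$1$1" "m$1$1 < 1/2 + \<delta>/8" "0 < m$1$2" "m$1$2 < \<epsilon>/4" "0 < m$2$1" "m$2$1 < \<epsilon>/4"
    "1/2 < m$2$2" "m$2$2 < 1/2 + \<delta>/8"
   by (auto simp: mem_box_mat2_entries forall_2 l_def u_def)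
  define D where "D = det m"
  have D: "D = m$1$1 * m$2$2 - m$1$2 * m$2$1" by (simp add: D_def det_2)
  have bc: "0 < m$1$2 * m$2$1" using m by simp
  have bc2: "m$1$2 * m$2$1 <= (\<epsilon>/4) * (\<epsilon>/4)"
   by (intro mult_mono) (use m e in linarith)+
  have ad: "(1/2) * (1/2) <= m$1$1 * m$2$2"
   by (intro mult_mono) (use m e in linarith)+
  have ad2: "m$1$1 * m$2$2 <= (1/2 + \<delta>/8) * (1/2 + \<delta>/8)"
   by (intro mult_mono) (use m e in linarith)+
  have ee: "\<epsilon> * \<epsilon> <= \<delta> * \<delta>" "\<delta> * \<delta> <= \<delta> * 1" 
   by (intro mult_mono; use e d in linarith)+
  have Dlo: "D >= 1/4 - \<delta> * \<delta> / 16" using D bc bc2 ad ee by simp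
  have Dhi: "D <= (1/2 + \<delta>/8) * (1/2 + \<delta>/8)" using D bc ad2 by simp
  have Dpos: "D > 3/16 - 1/1000" using Dlo ee d by simp
  have D1: "D <= 1" using Dhi ee d by (simp add: algebra_simps)
  have cone: "m \<in> cone_shell" using Dpos D1 by (simp add: cone_shell_def D_def)
  define s where "s = sqrt D"
  have s2: "s * s = D" and s0: "s > 0" using Dpos by (simp_all add: s_def)
  have s14: "s >= 1/4" unfolding s_def using Dpos by (intro real_le_rsqrt) (simp add: power2_eq_square)
  have e1: "to_SL2 m $ i $ j = m$i$j / s" for i j
   by (simp add: to_SL2_def s_def D_def field_simps)
  have up: "m$1$1 <= (1 + \<delta>) * s"
  proof (rule power2_le_imp_le)
   have "(m$1$1)\<^sup>2 <= (1/2 + \<delta>/8)\<^sup>2" using m by (intro power_mono) auto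
   also have "... <= (1 + \<delta>)\<^sup>2 * (1/4 - \<delta> * \<delta> / 16)"
   proof -
    have "\<delta> * (\<delta> * \<delta>) <= \<delta> * (\<delta> * 1)" 
     by (intro mult_left_mono; use e d in linarith)
    moreover have "\<delta> * (\<delta> * (\<delta> * \<delta>)) <= \<delta> * (\<delta> * 1)" 
     by (intro mult_left_mono; use e d mult_left_le[of "\<delta> * \<delta>" \<delta>] in \<open>simp add: mult_le_one\<close>)
    moreover have "0 < \<delta>" using e by simp
    moreover have "(1 + \<delta>)\<^sup>2 * (1/4 - \<delta> * \<delta> / 16) - (1/2 + \<delta>/8)\<^sup>2
     = 3 * \<delta> / 8 + 11 * (\<delta> * (\<delta> * 1)) / 64 - \<delta> * (\<delta> * \<delta>) / 8 - \<delta> * (\<delta> * (\<delta> * \<delta>)) / 16"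
     by (simp add: power2_eq_square field_simps)
    ultimately show ?thesis using ee e d by linarith
   qed
   also have "... <= (1 + \<delta>)\<^sup>2 * D" using Dlo by (intro mult_left_mono) auto
   finally show "(m$1$1)\<^sup>2 <= ((1 + \<delta>) * s)\<^sup>2" using s2 by (simp add: power2_eq_square algebra_simps)
  qed (use e s0 in auto)
  have lo: "(1 - \<delta>) * s <= m$1$1"
  proof -
   have "s <= 1/2 + \<delta>/8" unfolding s_def using Dhi e by (intro real_le_lsqrt) (auto simp: power2_eq_square)
   then have "(1 - \<delta>) * s <= (1 - \<delta>) * (1/2 + \<delta>/8)" using d by (intro mult_left_mono) auto
   also have "(1 - \<delta>) * (1/2 + \<delta>/8) = 1/2 - 3 * \<delta> / 8 - \<delta> * \<delta> / 8" by (simp add: field_simps)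
   also have "... <= 1/2" using e d mult_nonneg_nonneg[of \<delta> \<delta>] by linarith
   finally show ?thesis using m by simp
  qed
  have off: "x / s <= \<epsilon>" if "0 < x" "x < \<epsilon>/4" for x
  proof -
   have "x <= \<epsilon> * (1/4)" using that by simp
   also have "... <= \<epsilon> * s" using s14 e by (intro mult_left_mono) auto
   finally show ?thesis using s0 by (simp add: field_simps)
  qed
  have "m$1$1 / s - 1 <= \<delta>" "- \<delta> <= m$1$1 / s - 1"
   using up lo s0 by (simp_all add: field_simps)
  moreover have "m$1$2 / s > 0" "m$2$1 / s > 0" using m s0 by simp_all
  moreover have "m$1$2 / s <= \<epsilon>" "m$2$1 / s <= \<epsilon>" using off m by blast+
  ultimately have "to_SL2 m \<in> tube \<delta> \<epsilon>"
   using to_SL2_in[OF cone] by (simp add: tube_def e1 abs_le_iff)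
  with cone show "m \<in> {m \<in> cone_shell. to_SL2 m \<in> tube \<delta> \<epsilon>}" by simp
 qed
 then have "emeasure lborel (box l u) <= emeasure haar_SL2 (tube \<delta> \<epsilon>)"
  unfolding emeasure_haar(1)[OF tube_sets]
  by (intro emeasure_mono) (use emeasure_haar(2)[OF tube_sets] in auto)
 then show ?thesis by (simp add: vol)
qed

subsection \<open>The projection to the upper half-plane\<close>

lemma measurable_disc_weight [measurable]:
 "(%v. ennreal ((norm v)\<^sup>2) * indicator (cball 0 1) v) \<in> borel_measurable (borel :: (real^2) measure)"
proof -
 have [measurable]: "cball 0 1 \<in> sets (borel :: (real^2) measure)" by simp
 show ?thesis by measurable
qed

text \<open>
  The ratio between the image of Haar measure in the upper half-plane and the hyperbolic area.
\<close>

definition proj_const :: ennreal where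
 "proj_const = (\<integral>\<^sup>+v. ennreal ((norm v)\<^sup>2) * indicator (cball 0 1) v \<partial>(lborel :: (real^2) measure))"

lemma proj_const_pos: "proj_const > 0"
proof (rule ccontr)
 assume "\<not> proj_const > 0"
 then have "proj_const = 0" by simp
 then have "AE v in (lborel :: (real^2) measure). ennreal ((norm v)\<^sup>2) * indicator (cball 0 1) v = 0"
  unfolding proj_const_def by (subst (asm) nn_integral_0_iff_AE) auto
 then have "AE v in (lborel :: (real^2) measure). v \<notin> ball 0 1 - {0}"
  by eventually_elim (auto simp: indicator_def split: if_splits)
 moreover have o: "open (ball 0 1 - {0 :: real^2})" by auto
 ultimately have "emeasure lborel (ball 0 1 - {0 :: real^2}) = 0"
  by (subst (asm) AE_iff_measurable[of "ball 0 1 - {0}"]) auto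
 then have "ball 0 1 - {0 :: real^2} = {}"
  using lborel_open_pos[OF o] by auto
 moreover have "axis 1 (1/2) \<in> ball 0 1 - {0 :: real^2}"
  by (auto simp: axis_eq_0_iff) (simp add: norm_vec_def L2_set_def sum_2 axis_def)
 ultimately show False by blast
qed

lemma measurable_Complex2 [measurable]: "(%w :: real^2. Complex (w$1) (w$2)) \<in> borel_measurable borel"
proof -
 have "(%w :: real^2. of_real (w$1) + \<i> * of_real (w$2)) \<in> borel_measurable borel"
  by (intro borel_measurable_continuous_onI continuous_intros)
 then show ?thesis by (simp add: Complex_eq)
qed

lemma lborel_complex: "(lborel :: complex measure) = distr (lborel :: (real^2) measure) borel (%w. Complex (w$1) (w$2))"
proof (rule lborel_eqI)
 fix l u :: complex
 assume le: "\<And>b. b \<in> Basis ==> l \<bullet> b <= u \<bullet> b"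
 have le': "Re l <= Re u" "Im l <= Im u" using le[of 1] le[of \<i>] by (auto simp: Basis_complex_def)
 define l' where "l' = (\<chi> i::2. if i = 1 then Re l else Im l)"
 define u' where "u' = (\<chi> i::2. if i = 1 then Re u else Im u)"
 have vim: "(%w :: real^2. Complex (w$1) (w$2)) -` box l u = box l' u'"
  by (auto simp: mem_box_cart mem_box Basis_complex_def forall_2 l'_def u'_def)
 have B: "(Basis :: (real^2) set) = {axis 1 1, axis 2 1}"
  by (auto simp: Basis_vec_def UNIV_2)
 have ne: "axis (1::2) (1::real) \<noteq> axis 2 1" by (simp add: axis_eq_axis)
 have "\<And>b. b \<in> Basis ==> l' \<bullet> b <= u' \<bullet> b"
  using le' by (auto simp: B inner_axis l'_def u'_def)
 then show "emeasure (distr lborel borel (%w :: real^2. Complex (w $ 1) (w $ 2))) (box l u) = (\<Prod>b\<in>Basis. (u - l) \<bullet> b)"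
  using ne by (simp add: emeasure_distr vim)
   (simp add: B Basis_complex_def inner_axis l'_def u'_def)
qed simp

lemma det_scaling2: "det (matrix (%v :: real^2. c *\<^sub>R v)) = c\<^sup>2"
 by (simp add: det_2 matrix_def axis_def power2_eq_square)

lemma nn_integral_disc_scaled:
 assumes y: "y > 0"
 shows "(\<integral>\<^sup>+v. ennreal ((norm v)\<^sup>2) * indicator {v. y * (norm v)\<^sup>2 <= 1} v \<partial>(lborel :: (real^2) measure))
  = ennreal (1 / y\<^sup>2) * proj_const"
proof -
 have lin: "linear (%v :: real^2. sqrt y *\<^sub>R v)" by simp
 have d: "det (matrix (%v :: real^2. sqrt y *\<^sub>R v)) = y" using y by (simp add: det_scaling2)
 have 1: "ennreal ((norm (sqrt y *\<^sub>R v))\<^sup>2) * indicator (cball 0 1) (sqrt y *\<^sub>R v)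
   = ennreal y * (ennreal ((norm v)\<^sup>2) * indicator {v. y * (norm v)\<^sup>2 <= 1} v)" for v :: "real^2"
 proof -
  have n: "(norm (sqrt y *\<^sub>R v))\<^sup>2 = y * (norm v)\<^sup>2" using y by (simp add: power_mult_distrib)
  have "norm (sqrt y *\<^sub>R v) <= 1 \<longleftrightarrow> (norm (sqrt y *\<^sub>R v))\<^sup>2 <= 1"
   by (metis abs_le_square_iff abs_norm_cancel abs_one one_power2)
  then show ?thesis unfolding n using y by (simp add: indicator_def ennreal_mult)
 qed
 have "proj_const = ennreal y * (\<integral>\<^sup>+v. ennreal y * (ennreal ((norm v)\<^sup>2) * indicator {v. y * (norm v)\<^sup>2 <= 1} v) \<partial>(lborel :: (real^2) measure))"
  unfolding proj_const_def
  by (subst nn_integral_linear2[OF lin]) (use y in \<open>simp_all add: d 1 del: norm_scaleR\<close>)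
 also have "... = ennreal (y\<^sup>2) * (\<integral>\<^sup>+v. ennreal ((norm v)\<^sup>2) * indicator {v. y * (norm v)\<^sup>2 <= 1} v \<partial>(lborel :: (real^2) measure))"
  using y by (subst nn_integral_cmult) (simp_all add: power2_eq_square ennreal_mult mult.assoc)
 finally have "ennreal (1 / y\<^sup>2) * proj_const = ennreal (1 / y\<^sup>2) * ennreal (y\<^sup>2) * (\<integral>\<^sup>+v. ennreal ((norm v)\<^sup>2) * indicator {v. y * (norm v)\<^sup>2 <= 1} v \<partial>(lborel :: (real^2) measure))"
  by (simp add: mult.assoc)
 also have "ennreal (1 / y\<^sup>2) * ennreal (y\<^sup>2) = 1" using y by (simp flip: ennreal_mult)
 finally show ?thesis by simp
qed

lemma act_to_SL2: "m \<in> cone_shell ==> act (to_SL2 m) z = act m z"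
proof -
 assume "m \<in> cone_shell"
 then have s: "sqrt (det m) \<noteq> 0" by (simp add: cone_shell_def)
 define c where "c = complex_of_real (inverse (sqrt (det m)))"
 have "num (to_SL2 m) z = c * num m z" "den (to_SL2 m) z = c * den m z"
  by (simp_all add: num_def den_def to_SL2_def c_def algebra_simps)
 moreover have "c \<noteq> 0" using s by (simp add: c_def)
 ultimately show ?thesis by (simp add: act_num_den)
qed

lemma borel_indicator_less [measurable]: "uhp \<in> sets borel"
 using open_uhp by simp

lemma nn_integral_hyperbolic_area:
 assumes f: "f \<in> borel_measurable borel"
 shows "(\<integral>\<^sup>+z. f z \<partial>hyperbolic_area) = (\<integral>\<^sup>+z. indicator uhp z * (ennreal (1 / (Im z)\<^sup>2) * f z) \<partial>lborel)"
proof -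
 have [measurable]: "Im \<in> borel_measurable borel" by (intro borel_measurable_continuous_onI continuous_intros)
 have m: "(%z. ennreal (1 / (Im z)\<^sup>2)) \<in> borel_measurable (restrict_space lborel uhp)"
  by (intro measurable_restrict_space1) measurable
 have "f \<in> borel_measurable (restrict_space lborel uhp)"
  using f by (intro measurable_restrict_space1) simp
 then show ?thesis
  unfolding hyperbolic_area_def using m
  by (simp add: nn_integral_density nn_integral_restrict_space mult.commute)
qed

text \<open>
  In terms of the rows \<open>u\<close> and \<open>v\<close> of a matrix, the image of \<open>\<i>\<close> is a linear function of \<open>u\<close> whose
 determinant has modulus \<open>1 / (norm v)\<^sup>2\<close>, and the condition on the determinant of the matrix is a
 bound on \<open>v\<close> in terms of the imaginary part. After Fubini the integral over \<open>v\<close> gives the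
 hyperbolic density.
\<close>

lemma nn_integral_proj:
 assumes f: "f \<in> borel_measurable borel"
 shows "(\<integral>\<^sup>+g. f (act g \<i>) \<partial>haar_SL2) = proj_const * (\<integral>\<^sup>+z. f z \<partial>hyperbolic_area)"
proof -
 have [measurable]: "Im \<in> borel_measurable borel" by (intro borel_measurable_continuous_onI continuous_intros)
 have mact: "(%g. act g \<i>) \<in> borel_measurable SL2_borel"
  using continuous_act_i by (rule borel_measurable_continuous_on_restrict)
 have fact: "(%g. f (act g \<i>)) \<in> borel_measurable SL2_borel"
  using mact f by (rule measurable_compose)
 have [measurable]: "(%w :: real^2. w$2) \<in> borel_measurable borel" by (intro borel_measurable_continuous_onI continuous_intros)
 define F where "F = (%w :: real^2. f (Complex (w$1) (w$2)))"
 have [measurable]: "F \<in> borel_measurable borel" unfolding F_def using f by measurable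
 define K where "K = (%(w :: real^2) (v :: real^2). if 0 < w$2 \<and> w$2 * (norm v)\<^sup>2 <= 1 then 1 else 0 :: ennreal)"
 have [measurable]: "(%p. K (fst p) (snd p)) \<in> borel_measurable (borel \<Otimes>\<^sub>M borel)"
  unfolding K_def by measurable
 have [measurable]: "(%v. K w v) \<in> borel_measurable borel" for w
  unfolding K_def by measurable
 have [measurable]: "(%w. K w v) \<in> borel_measurable borel" for v
  unfolding K_def by measurable
 let ?G = "%m. indicator cone_shell m * f (act (to_SL2 m) \<i>)"
 have mG: "?G \<in> borel_measurable borel" by (rule measurable_cone[OF fact])
 have inner: "(\<integral>\<^sup>+u. ?G (rows u v) \<partial>lborel) = ennreal ((norm v)\<^sup>2) * (\<integral>\<^sup>+w. K w v * F w \<partial>lborel)" if v: "v \<noteq> 0" for v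
 proof -
  define q where "q = (norm v)\<^sup>2"
  have q: "q > 0" "q = (v$1)\<^sup>2 + (v$2)\<^sup>2" using v by (simp add: q_def) (simp add: q_def norm_vec_def L2_set_def sum_2)
  define A where "A = mat2 (v$1 / q) (v$2 / q) (v$2 / q) (- v$1 / q)"
  have lin: "linear ((*v) A)" by simp
  have "det A * q = - 1" 
   using q(1) unfolding det_2 A_def by (simp add: field_simps) (simp add: q(2) power2_eq_square algebra_simps)
  then have dA: "det A = - 1 / q" using q(1) by (metis nonzero_eq_divide_eq less_irrefl)
  have Av: "(A *v u)$1 = (u$1 * v$1 + u$2 * v$2) / q" "(A *v u)$2 = (u$1 * v$2 - u$2 * v$1) / q" for u
   by (simp_all add: A_def matrix_vector_mult_def sum_2 diff_divide_distrib add_divide_distrib algebra_simps)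
  have G: "?G (rows u v) = K (A *v u) v * F (A *v u)" for u
  proof -
   have det: "det (rows u v) = q * (A *v u)$2" using q by (simp add: det_2 Av)
   have c: "rows u v \<in> cone_shell \<longleftrightarrow> 0 < (A *v u)$2 \<and> (A *v u)$2 * (norm v)\<^sup>2 <= 1"
    unfolding cone_shell_def mem_Collect_eq det using q(1) 
    by (simp add: q_def[symmetric] zero_less_mult_iff mult.commute)
   have "act (rows u v) \<i> = Complex ((A *v u)$1) ((A *v u)$2)"
    using q by (simp add: act_num_den num_def den_def complex_eq_iff Av Re_divide Im_divide power2_eq_square add.commute)
   then show ?thesis
    using act_to_SL2[of "rows u v" \<i>] by (auto simp: K_def F_def c indicator_def)
  qed
  have "(\<integral>\<^sup>+w. K w v * F w \<partial>lborel) = ennreal \<bar>det (matrix ((*v) A))\<bar> * (\<integral>\<^sup>+u. K (A *v u) v * F (A *v u) \<partial>lborel)"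
   by (rule nn_integral_linear2[OF lin]) (use q in \<open>auto simp: dA\<close>)
  also have "\<bar>det (matrix ((*v) A))\<bar> = 1 / q" using q by (simp add: dA)
  finally have "ennreal q * (\<integral>\<^sup>+w. K w v * F w \<partial>lborel) = ennreal q * ennreal (1 / q) * (\<integral>\<^sup>+u. ?G (rows u v) \<partial>lborel)"
   by (simp add: G mult.assoc)
  also have "ennreal q * ennreal (1 / q) = 1" using q(1) by (simp flip: ennreal_mult)
  finally show ?thesis by (simp add: q_def)
 qed
 have "(\<integral>\<^sup>+g. f (act g \<i>) \<partial>haar_SL2) = (\<integral>\<^sup>+v. \<integral>\<^sup>+u. ?G (rows u v) \<partial>lborel \<partial>lborel)"
  by (simp only: nn_integral_haar[OF fact] nn_integral_rows[OF mG])
 also have "... = (\<integral>\<^sup>+v. ennreal ((norm v)\<^sup>2) * (\<integral>\<^sup>+w. K w v * F w \<partial>lborel) \<partial>lborel)"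
 proof (rule nn_integral_cong_AE)
  have "AE v in (lborel :: (real^2) measure). v \<noteq> 0" by (rule AE_lborel_singleton)
  then show "AE v in lborel. (\<integral>\<^sup>+u. ?G (rows u v) \<partial>lborel) = ennreal ((norm v)\<^sup>2) * (\<integral>\<^sup>+w. K w v * F w \<partial>lborel)"
   by eventually_elim (rule inner)
 qed
 also have "... = (\<integral>\<^sup>+v. \<integral>\<^sup>+w. ennreal ((norm v)\<^sup>2) * (K w v * F w) \<partial>lborel \<partial>lborel)"
  by (intro nn_integral_cong nn_integral_cmult[symmetric]) simp
 also have "... = (\<integral>\<^sup>+w. \<integral>\<^sup>+v. ennreal ((norm v)\<^sup>2) * (K w v * F w) \<partial>lborel \<partial>lborel)"
  by (rule lborel_pair.Fubini') (simp add: split_beta)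
 also have "... = (\<integral>\<^sup>+(w :: real^2). proj_const * (indicator uhp (Complex (w$1) (w$2)) * (ennreal (1 / (Im (Complex (w$1) (w$2)))\<^sup>2) * f (Complex (w$1) (w$2)))) \<partial>lborel)"
 proof (rule nn_integral_cong)
  fix w :: "real^2"
  have "(\<integral>\<^sup>+v. ennreal ((norm v)\<^sup>2) * (K w v * F w) \<partial>lborel) = (\<integral>\<^sup>+v. (ennreal ((norm v)\<^sup>2) * K w v) * F w \<partial>lborel)"
   by (simp add: mult.assoc)
  also have "... = (\<integral>\<^sup>+v. ennreal ((norm v)\<^sup>2) * K w v \<partial>lborel) * F w"
   by (rule nn_integral_multc) simp
  also have "(\<integral>\<^sup>+v. ennreal ((norm v)\<^sup>2) * K w v \<partial>lborel) = indicator uhp (Complex (w$1) (w$2)) * (ennreal (1 / (w$2)\<^sup>2) * proj_const)"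
  proof (cases "w$2 > 0")
   case True
   then show ?thesis
    using nn_integral_disc_scaled[OF True] by (simp add: K_def uhp_def indicator_def of_bool_def)
  qed (simp add: K_def uhp_def)
  finally show "(\<integral>\<^sup>+v. ennreal ((norm v)\<^sup>2) * (K w v * F w) \<partial>lborel) = proj_const * (indicator uhp (Complex (w$1) (w$2)) * (ennreal (1 / (Im (Complex (w$1) (w$2)))\<^sup>2) * f (Complex (w$1) (w$2))))"
   by (simp add: F_def mult_ac)
 qed
 also have "... = proj_const * (\<integral>\<^sup>+(w :: real^2). indicator uhp (Complex (w$1) (w$2)) * (ennreal (1 / (Im (Complex (w$1) (w$2)))\<^sup>2) * f (Complex (w$1) (w$2))) \<partial>lborel)"
 proof (rule nn_integral_cmult)
  have "(%z. indicator uhp z * (ennreal (1 / (Im z)\<^sup>2) * f z)) \<in> borel_measurable borel"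
   using f by measurable
  from measurable_compose[OF measurable_Complex2 this]
  show "(%w :: real^2. indicator uhp (Complex (w$1) (w$2)) * (ennreal (1 / (Im (Complex (w$1) (w$2)))\<^sup>2) * f (Complex (w$1) (w$2)))) \<in> borel_measurable lborel"
   by simp
 qed
 also have "... = proj_const * (\<integral>\<^sup>+z. indicator uhp z * (ennreal (1 / (Im z)\<^sup>2) * f z) \<partial>lborel)"
  using f by (subst lborel_complex) (simp add: nn_integral_distr)
 finally show ?thesis by (simp add: nn_integral_hyperbolic_area[OF f])
qed

section \<open>Quotients by discrete groups\<close>

subsection \<open>Quotient topologies and fundamental sets\<close>

lemma openin_quotient_topology:
 "openin (quotient_topology T p) U \<longleftrightarrow> U \<subseteq> p ` topspace T \<and> openin T {x \<in> topspace T. p x \<in> U}"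
proof -
 have "istopology (%U. U \<subseteq> p ` topspace T \<and> openin T {x \<in> topspace T. p x \<in> U})"
 proof -
  have *: "{x \<in> topspace T. p x \<in> S \<inter> U} = {x \<in> topspace T. p x \<in> S} \<inter> {x \<in> topspace T. p x \<in> U}" for S U by auto
  have **: "{x \<in> topspace T. p x \<in> \<Union>K} = (\<Union>S\<in>K. {x \<in> topspace T. p x \<in> S})" for K by auto
  show ?thesis unfolding istopology_def * ** by blast
 qed
 then show ?thesis by (simp add: quotient_topology_def)
qed

lemma topspace_quotient_topology [simp]: "topspace (quotient_topology T p) = p ` topspace T"
proof -
 have "openin (quotient_topology T p) (p ` topspace T)"
 proof -
  have "{x \<in> topspace T. p x \<in> p ` topspace T} = topspace T" by auto
  then show ?thesis by (simp add: openin_quotient_topology)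
 qed
 moreover have "topspace (quotient_topology T p) \<subseteq> p ` topspace T"
  using openin_topspace[of "quotient_topology T p"] unfolding openin_quotient_topology by blast
 ultimately show ?thesis by (meson openin_subset subset_antisym)
qed

lemma continuous_map_quotient_topology: "continuous_map T (quotient_topology T p) p"
 by (auto simp: continuous_map_def openin_quotient_topology)

lemma continuous_map_from_quotient_topology:
 assumes "continuous_map T Y (f \<circ> p)"
 shows "continuous_map (quotient_topology T p) Y f"
 unfolding continuous_map_def topspace_quotient_topology
proof (intro conjI allI impI)
 show "f \<in> p ` topspace T \<rightarrow> topspace Y" using assms by (auto simp: continuous_map_def Pi_iff)
 fix U assume "openin Y U"
 then have "openin T {x \<in> topspace T. f (p x) \<in> U}" using assms by (auto simp: continuous_map_def)
 moreover have "{x \<in> topspace T. p x \<in> {q \<in> p ` topspace T. f q \<in> U}} = {x \<in> topspace T. f (p x) \<in> U}" by auto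
 ultimately show "openin (quotient_topology T p) {q \<in> p ` topspace T. f q \<in> U}"
  by (auto simp: openin_quotient_topology)
qed

lemma space_borel_of [simp]: "space (borel_of T) = topspace T"
 unfolding borel_of_def by (rule space_measure_of) (auto dest: openin_subset)

lemma sets_borel_of_open: "openin T U ==> U \<in> sets (borel_of T)"
 unfolding borel_of_def by (subst sets_measure_of) (auto dest: openin_subset)

lemma measurable_borel_of:
 assumes "continuous_map T euclidean f"
 shows "f \<in> borel_measurable (borel_of T)"
proof (rule borel_measurableI)
 fix S :: "'b set" assume "open S"
 then have "openin T {x \<in> topspace T. f x \<in> S}"
  using assms by (auto simp: continuous_map_def)
 moreover have "f -` S \<inter> space (borel_of T) = {x \<in> topspace T. f x \<in> S}" by auto
 ultimately show "f -` S \<inter> space (borel_of T) \<in> sets (borel_of T)" by (simp add: sets_borel_of_open)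
qed

lemma measurable_to_quotient:
 assumes "sets N = sets (restrict_space borel S)"
 shows "p \<in> N \<rightarrow>\<^sub>M borel_of (quotient_topology (top_of_set S) p)"
 unfolding borel_of_def
proof (rule measurable_measure_of)
 have sp: "space N = S" using sets_eq_imp_space_eq[OF assms] by (simp add: space_restrict_space)
 show "p \<in> space N \<rightarrow> topspace (quotient_topology (top_of_set S) p)" by (simp add: sp)
 fix U assume "U \<in> {U. openin (quotient_topology (top_of_set S) p) U}"
 then have "openin (top_of_set S) {x \<in> S. p x \<in> U}" by (simp add: openin_quotient_topology)
 then obtain T where "open T" "{x \<in> S. p x \<in> U} = S \<inter> T" by (auto simp: openin_open)
 moreover have "p -` U \<inter> space N = {x \<in> S. p x \<in> U}" by (auto simp: sp)
 ultimately show "p -` U \<inter> space N \<in> sets N" by (auto simp: assms sets_restrict_space)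
next
 show "{U. openin (quotient_topology (top_of_set S) p) U} \<subseteq> Pow (topspace (quotient_topology (top_of_set S) p))"
  using openin_subset by blast
qed

text \<open>
  By the Lindelof property countably many open sets on which the quotient map is injective cover the space;
  a point is kept in the first of them whose saturation contains it.
\<close>

lemma fundamental_set_exists:
 fixes p :: "'a::second_countable_topology => 'b"
 assumes sets: "sets \<nu> = sets (restrict_space borel S)" and S: "S \<in> sets borel"
  and loc: "\<And>x. x \<in> S ==> \<exists>U. x \<in> U \<and> openin (top_of_set S) U \<and> inj_on p U"
  and sat: "\<And>U. openin (top_of_set S) U ==> openin (top_of_set S) {x \<in> S. p x \<in> p ` U}"
 shows "\<exists>F. fundamental_set \<nu> p F"
proof (cases "S = {}")
 case True
 have "space \<nu> = {}" using sets_eq_imp_space_eq[OF sets] True by (simp add: space_restrict_space)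
 then show ?thesis by (intro exI[of _ "{}"]) (simp add: fundamental_set_def bij_betw_def)
next
 case False
 have sp: "space \<nu> = S" using sets_eq_imp_space_eq[OF sets] by (simp add: space_restrict_space)
 define \<U> where "\<U> = {U. openin (top_of_set S) U \<and> inj_on p U}"
 obtain \<U>' where \<U>': "\<U>' \<subseteq> \<U>" "countable \<U>'" "\<Union>\<U>' = \<Union>\<U>"
  using Lindelof_openin[of \<U> S] by (auto simp: \<U>_def)
 have cov: "S \<subseteq> \<Union>\<U>'" using loc unfolding \<U>'(3) by (fastforce simp: \<U>_def)
 with False have ne: "\<U>' \<noteq> {}" by auto
 define U where "U = from_nat_into \<U>'"
 have U: "openin (top_of_set S) (U n)" "inj_on p (U n)" for n
  using from_nat_into[OF ne, of n] \<U>' by (auto simp: U_def \<U>_def)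
 have covU: "\<exists>n. x \<in> U n" if "x \<in> S" for x
  using cov that range_from_nat_into[OF ne \<U>'(2)] unfolding U_def by (metis UnionE rangeE subsetD)
 have Ubor: "A \<in> sets \<nu>" if "openin (top_of_set S) A" for A
 proof -
  obtain T where "open T" "A = S \<inter> T" using \<open>openin (top_of_set S) A\<close> unfolding openin_open by blast
  then have "A \<in> (\<inter>) S ` sets borel" by (intro image_eqI[of _ _ T]) simp_all
  then show ?thesis by (simp only: sets sets_restrict_space)
 qed
 have US: "U n \<subseteq> S" for n using U(1) openin_imp_subset by blast
 define F where "F = (\<Union>n. U n - (\<Union>k<n. {x \<in> S. p x \<in> p ` U k}))"
 have "F \<in> sets \<nu>" unfolding F_def using Ubor U(1) sat by (intro sets.countable_UN) auto
 moreover have "inj_on p F"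
 proof (rule inj_onI)
  fix x y assume x: "x \<in> F" and y: "y \<in> F" and eq: "p x = p y"
  obtain n where n: "x \<in> U n" "x \<notin> (\<Union>k<n. {x \<in> S. p x \<in> p ` U k})" using x by (auto simp: F_def)
  obtain m where m: "y \<in> U m" "y \<notin> (\<Union>k<m. {x \<in> S. p x \<in> p ` U k})" using y by (auto simp: F_def)
  have S: "x \<in> S" "y \<in> S" using n m US by blast+
  have im: "p x \<in> p ` U m" "p y \<in> p ` U n"
   using imageI[OF m(1), of p] imageI[OF n(1), of p] eq by simp_all
  have "\<not> m < n" using n(2) S im by blast
  moreover have "\<not> n < m" using m(2) S im by blast
  ultimately have "n = m" by simp
  then show "x = y" using U(2)[of n] n m eq by (auto dest: inj_onD)
 qed
 moreover have "p ` F = p ` S"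
 proof
  show "p ` F \<subseteq> p ` S" using US by (auto simp: F_def)
  show "p ` S \<subseteq> p ` F"
  proof
   fix q assume "q \<in> p ` S"
   then have ex: "\<exists>n. q \<in> p ` U n" using covU by blast
   define n where "n = (LEAST n. q \<in> p ` U n)"
   have n: "q \<in> p ` U n" unfolding n_def by (rule LeastI_ex[OF ex])
   then obtain x where x: "x \<in> U n" "q = p x" by auto
   have "x \<notin> {x \<in> S. p x \<in> p ` U k}" if "k < n" for k
    using not_less_Least[of k "%n. q \<in> p ` U n"] that x by (simp add: n_def)
   then have "x \<in> F" using x by (auto simp: F_def)
   then show "q \<in> p ` F" using x by auto
  qed
 qed
 ultimately show ?thesis
  by (intro exI[of _ F]) (simp add: fundamental_set_def bij_betw_def sp)
qed

subsection \<open>Discrete groups of unimodular matrices\<close>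

locale surface_group =
 fixes \<Gamma> :: "(real^2^2) set"
 assumes surface: "compact_hyperbolic_surface_group \<Gamma>"
begin
abbreviation "pX \<equiv> coset \<Gamma>"
abbreviation "pM \<equiv> orbit \<Gamma>"
abbreviation "topX \<equiv> X_top \<Gamma>"
abbreviation "topM \<equiv> M_top \<Gamma>"
abbreviation "eigS \<equiv> eigenspace \<Gamma>"
abbreviation "quasi \<equiv> quasimode_space \<Gamma>"
abbreviation "liftX \<equiv> lift_function \<Gamma>"
abbreviation "L2M \<equiv> L2_norm_M \<Gamma>"
abbreviation "volM \<equiv> vol_M \<Gamma>"
abbreviation "volX \<equiv> vol_X \<Gamma>"
abbreviation "mlift \<equiv> microlocal_lift \<Gamma>"
abbreviation "smoothM \<equiv> smooth_functions_M \<Gamma>"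

lemma G_SL2: "\<gamma> \<in> \<Gamma> ==> \<gamma> \<in> SL2"
 using surface by (auto simp: compact_hyperbolic_surface_group_def)

lemma G_one: "mat 1 \<in> \<Gamma>"
 using surface by (auto simp: compact_hyperbolic_surface_group_def)

lemma G_mult: "\<gamma> \<in> \<Gamma> ==> \<gamma>' \<in> \<Gamma> ==> \<gamma> ** \<gamma>' \<in> \<Gamma>"
 using surface by (auto simp: compact_hyperbolic_surface_group_def)

lemma G_adj: "\<gamma> \<in> \<Gamma> ==> adj2 \<gamma> \<in> \<Gamma>"
 using surface G_SL2 matrix_inv_SL2 by (fastforce simp: compact_hyperbolic_surface_group_def)

lemma G_free: "\<gamma> \<in> \<Gamma> ==> z \<in> uhp ==> act \<gamma> z = z ==> \<gamma> = mat 1 \<or> \<gamma> = - mat 1"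
 using surface by (auto simp: compact_hyperbolic_surface_group_def)

lemma coset_eq_iff: "pX g = pX h \<longleftrightarrow> (\<exists>\<gamma>\<in>\<Gamma>. h = \<gamma> ** g)"
proof
 assume "pX g = pX h"
 moreover have "h \<in> pX h" using G_one by (force simp: coset_def)
 ultimately show "\<exists>\<gamma>\<in>\<Gamma>. h = \<gamma> ** g" by (auto simp: coset_def)
next
 assume "\<exists>\<gamma>\<in>\<Gamma>. h = \<gamma> ** g"
 then obtain \<gamma> where \<gamma>: "\<gamma> \<in> \<Gamma>" "h = \<gamma> ** g" by auto
 have "pX h \<subseteq> pX g"
  using \<gamma> G_mult by (auto simp: coset_def matrix_mul_assoc)
 moreover have "\<gamma>' ** g \<in> pX h" if "\<gamma>' \<in> \<Gamma>" for \<gamma>'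
 proof -
  have "\<gamma>' ** g = (\<gamma>' ** adj2 \<gamma>) ** h"
   using adj2_cancel(1)[OF G_SL2[OF \<gamma>(1)], of g] by (simp add: \<gamma> flip: matrix_mul_assoc)
  then show ?thesis using that \<gamma> G_mult G_adj by (auto simp: coset_def)
 qed
 ultimately show "pX g = pX h" by (auto simp: coset_def)
qed

lemma coset_mult: "\<gamma> \<in> \<Gamma> ==> pX (\<gamma> ** g) = pX g"
 by (metis coset_eq_iff)

lemma orbit_eq_iff: 
 assumes "z \<in> uhp" "w \<in> uhp"
 shows "pM z = pM w \<longleftrightarrow> (\<exists>\<gamma>\<in>\<Gamma>. w = act \<gamma> z)"
proof
 assume "pM z = pM w"
 moreover have "w \<in> pM w" using G_one by (force simp: orbit_def)
 ultimately show "\<exists>\<gamma>\<in>\<Gamma>. w = act \<gamma> z" by (auto simp: orbit_def)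
next
 assume "\<exists>\<gamma>\<in>\<Gamma>. w = act \<gamma> z"
 then obtain \<gamma> where \<gamma>: "\<gamma> \<in> \<Gamma>" "w = act \<gamma> z" by auto
 have *: "act \<gamma>' w = act (\<gamma>' ** \<gamma>) z" for \<gamma>'
  using act_mult[OF G_SL2[OF \<gamma>(1)] assms(1)] \<gamma> by simp
 have "act \<gamma>' w \<in> pM z" if "\<gamma>' \<in> \<Gamma>" for \<gamma>'
  unfolding * orbit_def using G_mult[OF that \<gamma>(1)] by blast
 then have "pM w \<subseteq> pM z" by (auto simp: orbit_def)
 moreover have "act \<gamma>' z \<in> pM w" if "\<gamma>' \<in> \<Gamma>" for \<gamma>'
 proof -
  have "act \<gamma>' z = act (\<gamma>' ** adj2 \<gamma>) w"
   unfolding * using adj2_mult(1)[OF G_SL2[OF \<gamma>(1)]] by (simp flip: matrix_mul_assoc)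
  then show ?thesis using that \<gamma> G_mult G_adj by (auto simp: orbit_def)
 qed
 ultimately show "pM z = pM w" by (auto simp: orbit_def)
qed

lemma orbit_act: "\<gamma> \<in> \<Gamma> ==> z \<in> uhp ==> pM (act \<gamma> z) = pM z"
 using orbit_eq_iff[of z "act \<gamma> z"] act_uhp G_SL2 by blast

lemma G_isolated: "\<exists>e>0. \<forall>\<gamma>\<in>\<Gamma>. norm (\<gamma> - mat 1) < e \<longrightarrow> \<gamma> = mat 1"
proof -
 have "mat 1 isolated_in \<Gamma>"
  using surface G_one by (auto simp: compact_hyperbolic_surface_group_def discrete_def)
 then show ?thesis by (auto simp: isolated_in_dist_Ex_iff dist_norm norm_minus_commute)
qed

definition iso_radius :: real where
 "iso_radius = (SOME e. e > 0 \<and> (\<forall>\<gamma>\<in>\<Gamma>. norm (\<gamma> - mat 1) < e \<longrightarrow> \<gamma> = mat 1))"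

lemma iso_radius: "iso_radius > 0" "\<gamma> \<in> \<Gamma> ==> norm (\<gamma> - mat 1) < iso_radius ==> \<gamma> = mat 1"
 using someI_ex[OF G_isolated] unfolding iso_radius_def by blast+

lemma matrix_diff_mult: "(A - B) ** C = A ** C - B ** (C :: real^2^2)" "C ** (A - B) = C ** A - C ** (B :: real^2^2)"
 for A B :: "real^2^2"
 by (simp_all add: mat2_eq_iff mult_nth2 algebra_simps)

lemma G_separated:
 assumes "\<gamma> \<in> \<Gamma>" "\<gamma>' \<in> \<Gamma>" "norm \<gamma> * norm (\<gamma>' - \<gamma>) < iso_radius"
 shows "\<gamma>' = \<gamma>"
proof -
 have "adj2 \<gamma> ** \<gamma>' - mat 1 = adj2 \<gamma> ** (\<gamma>' - \<gamma>)"
  by (simp add: matrix_diff_mult adj2_mult G_SL2 assms)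
 then have "norm (adj2 \<gamma> ** \<gamma>' - mat 1) < iso_radius"
  using norm_mult2_le[of "adj2 \<gamma>" "\<gamma>' - \<gamma>"] assms by simp
 then have "adj2 \<gamma> ** \<gamma>' = mat 1"
  using iso_radius(2) G_mult G_adj assms by blast
 then have "\<gamma> ** (adj2 \<gamma> ** \<gamma>') = \<gamma>" by simp
 then show ?thesis using adj2_cancel(2)[OF G_SL2[OF assms(1)]] by simp
qed

lemma G_finite_bounded: "finite (\<Gamma> \<inter> cball 0 R)"
proof -
 let ?d = "iso_radius / (\<bar>R\<bar> + 1)"
 have d: "?d > 0" using iso_radius by simp
 have "y = x" if "x \<in> \<Gamma> \<inter> cball 0 R" "y \<in> \<Gamma> \<inter> cball 0 R" "dist y x < ?d" for x y
 proof (rule G_separated)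
  have "norm x * norm (y - x) <= (\<bar>R\<bar> + 1) * norm (y - x)" using that by (intro mult_right_mono) auto
  also have "... < iso_radius" using that(3) by (simp add: dist_norm field_simps)
  finally show "norm x * norm (y - x) < iso_radius" .
 qed (use that in auto)
 then have "\<not> x islimpt (\<Gamma> \<inter> cball 0 R)" for x
  using discrete_imp_not_islimpt[OF d, of "\<Gamma> \<inter> cball 0 R" x] by blast
 then have "finite (cball 0 R \<inter> (\<Gamma> \<inter> cball 0 R))"
  by (intro finite_not_islimpt_in_compact) auto
 then show ?thesis by (simp add: Int_commute Int_left_commute)
qed

lemma G_countable: "countable \<Gamma>"
proof -
 have "\<Gamma> \<subseteq> (\<Union>n::nat. \<Gamma> \<inter> cball 0 (real n))"
  using real_arch_simple by auto
 moreover have "countable (\<Union>n::nat. \<Gamma> \<inter> cball 0 (real n))"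
  using G_finite_bounded by (intro countable_UN) (auto intro: countable_finite)
 ultimately show ?thesis by (rule countable_subset)
qed

text \<open>
  The elements of a bounded part of the group are uniformly separated, by discreteness at the identity and
  translation.
\<close>

lemma G_convergent:
 assumes "\<And>n. \<gamma> n \<in> \<Gamma>" "\<gamma> \<longlonglongrightarrow> g"
 shows "g \<in> \<Gamma>" "\<forall>\<^sub>F n in sequentially. \<gamma> n = g"
proof -
 obtain K where K: "\<And>n. norm (\<gamma> n) <= K" "K > 0"
  using convergent_imp_Bseq[OF convergentI[OF assms(2)]] by (auto simp: Bseq_def)
 have "iso_radius / K > 0" using K iso_radius by simp
 then obtain N where N: "\<And>m n. m >= N ==> n >= N ==> dist (\<gamma> m) (\<gamma> n) < iso_radius / K"
  using LIMSEQ_imp_Cauchy[OF assms(2)] unfolding Cauchy_def by blast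
 have eq: "\<gamma> n = \<gamma> N" if "n >= N" for n
 proof (rule G_separated)
  have "norm (\<gamma> N) * norm (\<gamma> n - \<gamma> N) <= K * norm (\<gamma> n - \<gamma> N)" by (intro mult_right_mono K) auto
  also have "... < iso_radius" using N[OF that, of N] K by (simp add: dist_norm field_simps)
  finally show "norm (\<gamma> N) * norm (\<gamma> n - \<gamma> N) < iso_radius" .
 qed (use assms in auto)
 then have ev: "\<forall>\<^sub>F n in sequentially. \<gamma> n = \<gamma> N" unfolding eventually_sequentially using eq by blast
 then have "\<gamma> \<longlonglongrightarrow> \<gamma> N" by (rule tendsto_eventually)
 then have "g = \<gamma> N" using LIMSEQ_unique assms(2) by blast
 with ev assms(1) show "g \<in> \<Gamma>" "\<forall>\<^sub>F n in sequentially. \<gamma> n = g" by auto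
qed

lemma SL2_translate_open:
 assumes "openin (top_of_set SL2) U" "g \<in> SL2"
 shows "openin (top_of_set SL2) {h \<in> SL2. g ** h \<in> U}"
proof -
 obtain T where T: "open T" "U = SL2 \<inter> T" using assms(1) by (auto simp: openin_open)
 have "continuous_on SL2 (%h. g ** h)" by (intro continuous_intros)
 then have "openin (top_of_set SL2) (SL2 \<inter> (%h. g ** h) -` T)"
  using T continuous_openin_preimage_gen by blast
 moreover have "SL2 \<inter> (%h. g ** h) -` T = {h \<in> SL2. g ** h \<in> U}" using T assms SL2_mult by auto
 ultimately show ?thesis by simp
qed

lemma coset_saturation_open:
 assumes "openin (top_of_set SL2) U"
 shows "openin (top_of_set SL2) {x \<in> SL2. pX x \<in> pX ` U}"
proof -
 have "{x \<in> SL2. pX x \<in> pX ` U} = (\<Union>\<gamma>\<in>\<Gamma>. {h \<in> SL2. \<gamma> ** h \<in> U})"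
  by (auto simp: coset_eq_iff image_iff)
 then show ?thesis using SL2_translate_open[OF assms] G_SL2 by auto
qed

lemma orbit_saturation_open:
 assumes "openin (top_of_set uhp) U"
 shows "openin (top_of_set uhp) {x \<in> uhp. pM x \<in> pM ` U}"
proof -
 have U: "U \<subseteq> uhp" using assms openin_imp_subset by blast
 have "{x \<in> uhp. pM x \<in> pM ` U} = (\<Union>\<gamma>\<in>\<Gamma>. {z \<in> uhp. act \<gamma> z \<in> U})"
 proof (intro set_eqI iffI)
  fix x assume "x \<in> {x \<in> uhp. pM x \<in> pM ` U}"
  then obtain y where "x \<in> uhp" "y \<in> U" "pM x = pM y" by auto
  then show "x \<in> (\<Union>\<gamma>\<in>\<Gamma>. {z \<in> uhp. act \<gamma> z \<in> U})" using U orbit_eq_iff[of x y] by auto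
 next
  fix x assume "x \<in> (\<Union>\<gamma>\<in>\<Gamma>. {z \<in> uhp. act \<gamma> z \<in> U})"
  then obtain \<gamma> where \<gamma>: "\<gamma> \<in> \<Gamma>" "x \<in> uhp" "act \<gamma> x \<in> U" by auto
  then have "pM x \<in> pM ` U" using orbit_act[of \<gamma> x] by (metis imageI)
  then show "x \<in> {x \<in> uhp. pM x \<in> pM ` U}" using \<gamma> by simp
 qed
 moreover have "openin (top_of_set uhp) {z \<in> uhp. act \<gamma> z \<in> U}" if "\<gamma> \<in> \<Gamma>" for \<gamma>
 proof -
  obtain T where T: "open T" "U = uhp \<inter> T" using assms by (auto simp: openin_open)
  have "continuous_on uhp (act \<gamma>)"
   using continuous_act[of uhp "%_. \<gamma>" "%z. z"] G_SL2[OF that] by (auto intro: continuous_intros)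
  then have "openin (top_of_set uhp) (uhp \<inter> act \<gamma> -` T)"
   using T continuous_openin_preimage_gen by blast
  moreover have "uhp \<inter> act \<gamma> -` T = {z \<in> uhp. act \<gamma> z \<in> U}" using T G_SL2[OF that] act_uhp by auto
  ultimately show ?thesis by simp
 qed
 ultimately show ?thesis by auto
qed

text \<open>Left multiplication by the group moves points near a given point far away.\<close>

lemma coset_inj_near:
 assumes "g \<in> SL2"
 obtains e where "e > 0" "inj_on (pX) (SL2 \<inter> ball g e)"
proof
 let ?K = "norm g + 1"
 let ?e = "min 1 (iso_radius / (2 * ?K))"
 show "?e > 0" using iso_radius by (simp add: add_nonneg_pos)
 show "inj_on (pX) (SL2 \<inter> ball g ?e)"
 proof (rule inj_onI)
  fix x y assume x: "x \<in> SL2 \<inter> ball g ?e" and y: "y \<in> SL2 \<inter> ball g ?e" and eq: "pX x = pX y"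
  then obtain \<gamma> where \<gamma>: "\<gamma> \<in> \<Gamma>" "y = \<gamma> ** x" by (auto simp: coset_eq_iff)
  have "\<gamma> = y ** adj2 x" using adj2_cancel(3)[of x \<gamma>] x \<gamma> by simp
  then have "\<gamma> - mat 1 = (y - x) ** adj2 x" using x by (simp add: matrix_diff_mult adj2_mult)
  then have "norm (\<gamma> - mat 1) <= norm (y - x) * norm x" using norm_mult2_le[of "y - x" "adj2 x"] by simp
  also have "... <= norm (y - x) * ?K"
  proof (intro mult_left_mono)
   have "norm x <= norm g + dist g x" by (metis dist_norm norm_triangle_sub norm_minus_commute)
   then show "norm x <= ?K" using x by simp
  qed simp
  also have "... < iso_radius"
  proof -
   have "norm (y - x) <= dist y g + dist g x" by (metis dist_norm dist_triangle)
   also have "... < 2 * (iso_radius / (2 * ?K))" using x y by (simp add: dist_commute)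
   also have "... = iso_radius / ?K" by (simp only: mult_divide_mult_cancel_left_if times_divide_eq_right) simp
   finally show ?thesis by (simp add: pos_less_divide_eq add_nonneg_pos)
  qed
  finally have "\<gamma> = mat 1" using iso_radius(2) \<gamma>(1) by blast
  then show "x = y" using \<gamma> by simp
 qed
qed

lemma fundamental_set_X: "\<exists>F. fundamental_set haar_SL2 (pX) F"
proof (rule fundamental_set_exists[where S = SL2])
 fix g assume g: "g \<in> SL2"
 obtain e where "e > 0" "inj_on (pX) (SL2 \<inter> ball g e)" using coset_inj_near[OF g] .
 then show "\<exists>U. g \<in> U \<and> openin (top_of_set SL2) U \<and> inj_on (pX) U"
  using g by (intro exI[of _ "SL2 \<inter> ball g e"]) auto
qed (auto simp: closed_SL2 coset_saturation_open)

text \<open>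
  The action on the upper half-plane is proper because \<open>SO(2)\<close> is compact: if elements of the group
 carry points near \<open>z\<close> to points near \<open>z\<close>, then a subsequence of them converges.
\<close>

lemma stabilizer_i_bounded:
 assumes "k \<in> SL2" "act k \<i> = \<i>" shows "norm k <= 2"
proof -
 have "num k \<i> = \<i> * den k \<i>" using assms den_nz[of k \<i>] by (simp add: act_num_den field_simps)
 then have "k$1$1 = k$2$2" "k$1$2 = - k$2$1" by (auto simp: num_def den_def complex_eq_iff)
 moreover from this have "(k$2$1)\<^sup>2 + (k$2$2)\<^sup>2 = 1" using assms(1) by (simp add: mem_SL2 power2_eq_square)
 ultimately have "(norm k)\<^sup>2 = 2" by (simp add: norm_mat2_sq)
 then have "(norm k)\<^sup>2 <= 2\<^sup>2" by simp
 then show ?thesis by (rule power2_le_imp_le) simp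
qed

lemma orbit_inj_near:
 assumes z: "z \<in> uhp"
 shows "\<exists>e>0. inj_on (pM) (uhp \<inter> ball z e)"
proof (rule ccontr)
 assume "\<not> ?thesis"
 then have "\<forall>n. \<exists>x y. x \<in> uhp \<inter> ball z (inverse (Suc n)) \<and> y \<in> uhp \<inter> ball z (inverse (Suc n)) \<and> pM x = pM y \<and> x \<noteq> y"
  unfolding inj_on_def by (metis inverse_positive_iff_positive of_nat_0_less_iff zero_less_Suc)
 then obtain x y where xy: "\<And>n. x n \<in> uhp" "\<And>n. y n \<in> uhp" "\<And>n. dist z (x n) < inverse (Suc n)"
  "\<And>n. dist z (y n) < inverse (Suc n)" "\<And>n. pM (x n) = pM (y n)" "\<And>n. x n \<noteq> y n"
  by (auto simp: mem_ball) metis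
 have lim: "s \<longlonglongrightarrow> z" if "\<And>n. dist z (s n) < inverse (Suc n)" for s
 proof (rule tendstoI)
  fix e :: real assume "e > 0"
  then have "\<forall>\<^sub>F n in sequentially. inverse (real (Suc n)) < e"
   using LIMSEQ_inverse_real_of_nat order_tendstoD(2) by blast
  then show "\<forall>\<^sub>F n in sequentially. dist (s n) z < e"
   by eventually_elim (use that in \<open>metis dist_commute less_trans\<close>)
 qed
 have xz: "x \<longlonglongrightarrow> z" and yz: "y \<longlonglongrightarrow> z" using lim xy by auto
 obtain \<gamma> where \<gamma>: "\<And>n. \<gamma> n \<in> \<Gamma>" "\<And>n. y n = act (\<gamma> n) (x n)"
 proof -
  have "\<forall>n. \<exists>\<gamma>. \<gamma> \<in> \<Gamma> \<and> y n = act \<gamma> (x n)" using orbit_eq_iff[OF xy(1,2)] xy(5) by blast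
  from choice[OF this] show ?thesis using that by blast
 qed
 define k where "k n = adj2 (upper (y n)) ** (\<gamma> n ** upper (x n))" for n
 have uSL: "upper (x n) \<in> SL2" "upper (y n) \<in> SL2" for n using xy upper_SL2 by auto
 have kSL: "k n \<in> SL2" for n unfolding k_def using uSL \<gamma> G_SL2 adj2_SL2 SL2_mult by auto
 have "act (k n) \<i> = \<i>" for n
 proof -
  have "act (k n) \<i> = act (adj2 (upper (y n))) (act (\<gamma> n) (act (upper (x n)) \<i>))"
   unfolding k_def using uSL \<gamma>(1) G_SL2 by (simp add: act_mult act_uhp SL2_mult)
  also have "... = act (adj2 (upper (y n))) (act (upper (y n)) \<i>)" using xy \<gamma> by (simp add: act_upper)
  also have "... = \<i>" using uSL by (simp add: act_adj2)
  finally show ?thesis .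
 qed
 then have "norm (k n) <= 2" for n using stabilizer_i_bounded kSL by blast
 then have "\<forall>n. k n \<in> cball 0 2" by simp
 then obtain K \<sigma> where \<sigma>: "strict_mono \<sigma>" "(k \<circ> \<sigma>) \<longlonglongrightarrow> K"
  using compact_cball[of "0 :: real^2^2" 2] unfolding compact_def by metis
 have up: "(%n. upper (s n)) \<longlonglongrightarrow> upper z" if "s \<longlonglongrightarrow> z" "\<And>n. s n \<in> uhp" for s
  using continuous_upper that z unfolding continuous_on_sequentially by (auto simp: o_def)
 have geq: "\<gamma> n = upper (y n) ** (k n ** adj2 (upper (x n)))" for n
  unfolding k_def using uSL by (simp add: matrix_mul_assoc[symmetric] adj2_cancel adj2_mult)
 have tm: "(%n. A n ** B n) \<longlonglongrightarrow> a ** b" if "A \<longlonglongrightarrow> a" "B \<longlonglongrightarrow> b" for A B :: "nat => real^2^2" and a b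
 proof -
  have "continuous_on UNIV (%p :: (real^2^2) \<times> (real^2^2). fst p ** snd p)" by (intro continuous_intros)
  then show ?thesis
   using that continuous_on_tendsto_compose[OF _ tendsto_Pair[OF that], of UNIV "%p. fst p ** snd p"] by simp
 qed
 have ta: "(%n. adj2 (A n)) \<longlonglongrightarrow> adj2 a" if "A \<longlonglongrightarrow> a" for A a
  using that continuous_on_tendsto_compose[OF continuous_adj2[OF continuous_on_id] that, of UNIV] by simp
 have sub: "(%n. s (\<sigma> n)) \<longlonglongrightarrow> l" if "s \<longlonglongrightarrow> l" for s :: "nat => 'c::topological_space" and l
  using LIMSEQ_subseq_LIMSEQ[OF that \<sigma>(1)] by (simp add: o_def)
 have "(%n. \<gamma> (\<sigma> n)) \<longlonglongrightarrow> upper z ** (K ** adj2 (upper z))"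
  unfolding geq
  by (intro tm ta sub[OF up[OF xz xy(1)]] sub[OF up[OF yz xy(2)]] \<sigma>(2)[unfolded o_def])
 from G_convergent[OF \<gamma>(1) this] obtain g where g: "g \<in> \<Gamma>" "\<forall>\<^sub>F n in sequentially. \<gamma> (\<sigma> n) = g" by blast
 have gz: "(%n. act g (x (\<sigma> n))) \<longlonglongrightarrow> act g z"
 proof -
  have "continuous_on uhp (act g)"
   using continuous_act[of uhp "%_. g" "%z. z"] G_SL2[OF g(1)] by (auto intro: continuous_intros)
  then show ?thesis
   using sub[OF xz] xy(1) z unfolding continuous_on_sequentially by (auto simp: o_def)
 qed
 have "\<forall>\<^sub>F n in sequentially. act g (x (\<sigma> n)) = y (\<sigma> n)"
  using g(2) by eventually_elim (simp add: \<gamma>)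
 then have "(%n. y (\<sigma> n)) \<longlonglongrightarrow> act g z" using gz tendsto_cong by fastforce
 then have "act g z = z" using sub[OF yz] LIMSEQ_unique by blast
 then have "g = mat 1 \<or> g = - mat 1" using G_free g z by blast
 then have "act g w = w" for w by auto
 with g(2) have "\<forall>\<^sub>F n in sequentially. y (\<sigma> n) = x (\<sigma> n)"
  by (auto elim!: eventually_mono simp: \<gamma>(2))
 then show False using xy(6) by (auto simp: eventually_sequentially) (metis order_refl)
qed

lemma sets_hyperbolic_area [simp]: "sets hyperbolic_area = sets (restrict_space borel uhp)"
 by (simp add: hyperbolic_area_def sets_restrict_space)

lemma space_hyperbolic_area [simp]: "space hyperbolic_area = uhp"
 by (simp add: hyperbolic_area_def space_restrict_space)

lemma fundamental_set_M: "\<exists>F. fundamental_set hyperbolic_area (pM) F"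
proof (rule fundamental_set_exists[where S = uhp])
 fix z assume z: "z \<in> uhp"
 obtain e where "e > 0" "inj_on (pM) (uhp \<inter> ball z e)" using orbit_inj_near[OF z] by blast
 then show "\<exists>U. z \<in> U \<and> openin (top_of_set uhp) U \<and> inj_on (pM) U"
  using z by (intro exI[of _ "uhp \<inter> ball z e"]) auto
qed (auto simp: orbit_saturation_open open_uhp)

text \<open>
  The surface is compact and covered by the images of an increasing sequence of open sets with compact
  closure, so one of them meets every orbit; the norm of a matrix is controlled by the image of \<open>\<i>\<close>.
\<close>

lemma bounded_representatives: "\<exists>R>0. \<forall>g\<in>SL2. \<exists>\<gamma>\<in>\<Gamma>. norm (\<gamma> ** g) <= R"
proof -
 define D where "D n = {z. \<bar>Re z\<bar> < real (Suc n) \<and> 1 / real (Suc n) < Im z \<and> Im z < real (Suc n)}" for n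
 have Du: "D n \<subseteq> uhp" for n by (auto simp: D_def uhp_def intro: less_trans[rotated])
 have Do: "open (D n)" for n unfolding D_def
  by (intro open_Collect_conj open_Collect_less continuous_intros)
 have Dm: "D n \<subseteq> D m" if "n <= m" for n m
 proof
  fix z assume "z \<in> D n"
  moreover have "real (Suc n) <= real (Suc m)" "1 / real (Suc m) <= 1 / real (Suc n)"
   using that by (auto intro!: divide_left_mono)
  ultimately show "z \<in> D m" by (auto simp: D_def)
 qed
 have Dc: "\<exists>n. z \<in> D n" if "z \<in> uhp" for z
 proof -
  obtain n :: nat where n: "n > max \<bar>Re z\<bar> (max (Im z) (1 / Im z))" using reals_Archimedean2 by blast
  then have "1 / Im z < real (Suc n)" by simp
  then have "1 / real (Suc n) < Im z" using that by (simp add: uhp_def field_simps)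
  then show ?thesis using n by (intro exI[of _ n]) (auto simp: D_def)
 qed
 have oO: "openin (topM) (pM ` D n)" for n
 proof -
  have "openin (top_of_set uhp) (D n)" using Do Du by (simp add: openin_open_eq open_uhp)
  from orbit_saturation_open[OF this] Du[of n] show ?thesis
   by (auto simp: M_top_def openin_quotient_topology)
 qed
 have "compact_space (topM)" using surface by (simp add: compact_hyperbolic_surface_group_def)
 moreover have "topspace (topM) \<subseteq> \<Union>(range (%n. pM ` D n))"
  using Dc by (fastforce simp: M_top_def)
 ultimately obtain \<F> where F: "finite \<F>" "\<F> \<subseteq> range (%n. pM ` D n)" "topspace (topM) \<subseteq> \<Union>\<F>"
  unfolding compact_space_alt using oO by (metis (no_types, lifting) imageE)
 then obtain I where I: "finite I" "\<F> = (%n. pM ` D n) ` I"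
  by (meson finite_subset_image)
 define N where "N = Max (insert 0 I)"
 have N: "D n \<subseteq> D N" if "n \<in> I" for n using that I by (intro Dm) (simp add: N_def)
 let ?N = "real (Suc N)"
 define R where "R = sqrt ((?N\<^sup>2 + ?N\<^sup>2) * ?N + ?N) + 1"
 have "\<exists>\<gamma>\<in>\<Gamma>. norm (\<gamma> ** g) <= R" if g: "g \<in> SL2" for g
 proof -
  have u: "act g \<i> \<in> uhp" using g act_uhp by simp
  then have "pM (act g \<i>) \<in> topspace (topM)" by (simp add: M_top_def)
  then obtain n w where w: "n \<in> I" "w \<in> D n" "pM (act g \<i>) = pM w"
   using F(3) I(2) by auto
  then have wN: "w \<in> D N" using N by blast
  then obtain \<gamma> where \<gamma>: "\<gamma> \<in> \<Gamma>" "w = act \<gamma> (act g \<i>)" using orbit_eq_iff[OF u] w Du by blast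
  define h where "h = \<gamma> ** g"
  have h: "h \<in> SL2" unfolding h_def using \<gamma> g G_SL2 SL2_mult by blast
  have hw: "act h \<i> = w" unfolding h_def \<gamma>(2) using g by (simp add: act_mult)
  have dn: "den h \<i> \<noteq> 0" using den_nz[OF h] by simp
  have d2: "(cmod (den h \<i>))\<^sup>2 = (h$2$1)\<^sup>2 + (h$2$2)\<^sup>2" by (simp add: den_def cmod_power2)
  have n2: "(cmod (num h \<i>))\<^sup>2 = (h$1$1)\<^sup>2 + (h$1$2)\<^sup>2" by (simp add: num_def cmod_power2)
  have "Im w = 1 / (cmod (den h \<i>))\<^sup>2" using Im_act[OF h, of \<i>] hw by simp
  then have "1 / ?N < 1 / (cmod (den h \<i>))\<^sup>2" using wN by (simp add: D_def)
  then have d3: "(cmod (den h \<i>))\<^sup>2 <= ?N" using dn by (simp add: field_simps)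
  have "num h \<i> = w * den h \<i>" using hw dn by (simp add: act_num_den field_simps)
  then have "(cmod (num h \<i>))\<^sup>2 = (cmod w)\<^sup>2 * (cmod (den h \<i>))\<^sup>2" by (simp add: norm_mult power_mult_distrib)
  also have "... <= (?N\<^sup>2 + ?N\<^sup>2) * ?N"
  proof (intro mult_mono d3)
   have "(Re w)\<^sup>2 <= ?N\<^sup>2" "(Im w)\<^sup>2 <= ?N\<^sup>2" using wN Du[of N] 
    by (auto simp: D_def uhp_def abs_le_square_iff[symmetric] subset_iff)
   then show "(cmod w)\<^sup>2 <= ?N\<^sup>2 + ?N\<^sup>2" by (simp add: cmod_power2)
  qed auto
  finally have "(norm h)\<^sup>2 <= (?N\<^sup>2 + ?N\<^sup>2) * ?N + ?N"
   unfolding norm_mat2_sq using d2 n2 d3 by linarith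
  then have "norm h <= sqrt ((?N\<^sup>2 + ?N\<^sup>2) * ?N + ?N)" by (rule real_le_rsqrt)
  then show ?thesis using \<gamma> by (intro bexI[of _ \<gamma>]) (auto simp: h_def R_def)
 qed
 moreover have "R > 0" by (simp add: R_def add_nonneg_pos)
 ultimately show ?thesis by blast
qed

end

section \<open>The invariant measure on the quotient\<close>

lemma ennreal_mult_divide_cancel: 
 fixes a v :: ennreal assumes "0 < v" "v < \<infinity>" shows "v * (a / v) = a"
proof -
 have "v * (a / v) = a * v / v" by (simp only: ennreal_times_divide mult.commute)
 also have "... = a" by (rule ennreal_mult_divide_eq) (use assms in auto)
 finally show ?thesis .
qed

context surface_group begin

text \<open>
  Such functions are the functions on \<open>X\<close>.
\<close>

definition G_inv :: "(real^2^2 => 'a) => bool" where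
 "G_inv \<Phi> \<longleftrightarrow> (\<forall>\<gamma>\<in>\<Gamma>. \<forall>g\<in>SL2. \<Phi> (\<gamma> ** g) = \<Phi> g)"

definition FX :: "(real^2^2) set" where
 "FX = (SOME F. fundamental_set haar_SL2 (pX) F)"

lemma FX: "FX \<in> sets SL2_borel" "bij_betw (pX) FX (pX ` SL2)" "FX \<subseteq> SL2"
proof -
 have *: "fundamental_set haar_SL2 (pX) FX"
  unfolding FX_def using fundamental_set_X by (rule someI_ex)
 then show "FX \<in> sets SL2_borel" "bij_betw (pX) FX (pX ` SL2)"
  by (simp_all add: fundamental_set_def)
 then show "FX \<subseteq> SL2" using sets.sets_into_space[of FX SL2_borel] by (simp add: space_restrict_space)
qed

lemma FX_ex1:
 assumes g: "g \<in> SL2" shows "\<exists>!\<gamma>. \<gamma> \<in> \<Gamma> \<and> \<gamma> ** g \<in> FX"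
proof -
 have "pX g \<in> pX ` FX" using FX(2) g by (auto simp: bij_betw_def)
 then obtain f where f: "f \<in> FX" "pX g = pX f" by auto
 then obtain \<gamma> where \<gamma>: "\<gamma> \<in> \<Gamma>" "f = \<gamma> ** g" by (auto simp: coset_eq_iff)
 show ?thesis
 proof (rule ex1I[of _ \<gamma>])
  fix \<gamma>' assume \<gamma>': "\<gamma>' \<in> \<Gamma> \<and> \<gamma>' ** g \<in> FX"
  then have "pX (\<gamma>' ** g) = pX f" using coset_mult f by simp
  then have "\<gamma>' ** g = \<gamma> ** g" using FX(2) \<gamma>' f \<gamma> by (metis bij_betw_def inj_onD)
  then have "(\<gamma>' ** g) ** adj2 g = (\<gamma> ** g) ** adj2 g" by simp
  then show "\<gamma>' = \<gamma>" using adj2_cancel(3)[OF g] by simp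
 qed (use \<gamma> f in auto)
qed

lemma count_G_indicator:
 "(\<integral>\<^sup>+\<gamma>. indicator A (f \<gamma>) \<partial>count_space \<Gamma>) = emeasure (count_space \<Gamma>) {\<gamma> \<in> \<Gamma>. f \<gamma> \<in> A}"
proof -
 have "(\<integral>\<^sup>+\<gamma>. indicator A (f \<gamma>) \<partial>count_space \<Gamma>) = (\<integral>\<^sup>+\<gamma>. indicator {\<gamma> \<in> \<Gamma>. f \<gamma> \<in> A} \<gamma> \<partial>count_space \<Gamma>)"
  by (rule nn_integral_cong) (simp add: indicator_def)
 also have "... = emeasure (count_space \<Gamma>) {\<gamma> \<in> \<Gamma>. f \<gamma> \<in> A}"
  by (rule nn_integral_indicator) auto
 finally show ?thesis .
qed

lemma count_FX: "g \<in> SL2 ==> (\<integral>\<^sup>+\<gamma>. indicator FX (\<gamma> ** g) \<partial>count_space \<Gamma>) = 1"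
proof -
 assume "g \<in> SL2"
 then obtain \<gamma> where "{\<gamma> \<in> \<Gamma>. \<gamma> ** g \<in> FX} = {\<gamma>}" "\<gamma> \<in> \<Gamma>" using FX_ex1 by blast
 then show ?thesis by (simp add: count_G_indicator)
qed

lemma count_FX_adj: "g \<in> SL2 ==> (\<integral>\<^sup>+\<gamma>. indicator FX (adj2 \<gamma> ** g) \<partial>count_space \<Gamma>) = 1"
proof -
 assume g: "g \<in> SL2"
 have "bij_betw adj2 \<Gamma> \<Gamma>"
  by (rule bij_betwI[where g = adj2]) (auto intro: G_adj)
 from nn_integral_bij_count_space[OF this, of "%\<gamma>. indicator FX (\<gamma> ** g)"]
 show ?thesis using count_FX[OF g] by simp
qed

lemma measurable_left_mult:
 assumes "h \<in> SL2" "f \<in> SL2_borel \<rightarrow>\<^sub>M N" shows "(%g. f (h ** g)) \<in> SL2_borel \<rightarrow>\<^sub>M N"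
proof -
 have "(%g. h ** g) \<in> SL2_borel \<rightarrow>\<^sub>M SL2_borel"
  by (intro measurable_restrict_space2 measurable_restrict_space1) (auto simp: space_restrict_space SL2_mult assms)
 then show ?thesis by (rule measurable_compose) (rule assms)
qed

lemma measurable_right_mult:
 assumes "h \<in> SL2" "f \<in> SL2_borel \<rightarrow>\<^sub>M N" shows "(%g. f (g ** h)) \<in> SL2_borel \<rightarrow>\<^sub>M N"
proof -
 have "(%g. g ** h) \<in> SL2_borel \<rightarrow>\<^sub>M SL2_borel"
  by (intro measurable_restrict_space2 measurable_restrict_space1) (auto simp: space_restrict_space SL2_mult assms)
 then show ?thesis by (rule measurable_compose) (rule assms)
qed

text \<open>
  Every point of the group is carried into the fundamental set by exactly one element of the lattice;
  inserting this as a sum over the lattice and translating gives the unfolding formula, from which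
  all comparisons between the group and the quotient follow.
\<close>

lemma unfolding_integral:
 fixes w \<Phi> :: "real^2^2 => ennreal"
 assumes w: "w \<in> borel_measurable SL2_borel" and \<Phi>: "\<Phi> \<in> borel_measurable SL2_borel" and inv: "G_inv \<Phi>"
 shows "(\<integral>\<^sup>+g. w g * \<Phi> g \<partial>haar_SL2) = 
  (\<integral>\<^sup>+g. indicator FX g * (\<Phi> g * (\<integral>\<^sup>+\<gamma>. w (\<gamma> ** g) \<partial>count_space \<Gamma>)) \<partial>haar_SL2)"
proof -
 have iFX: "indicator FX \<in> borel_measurable SL2_borel" using FX(1) by simp
 define f where "f \<gamma> g = indicator FX (adj2 \<gamma> ** g) * (w g * \<Phi> g)" for \<gamma> g
 have mf: "f \<gamma> \<in> borel_measurable SL2_borel" if "\<gamma> \<in> \<Gamma>" for \<gamma>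
  unfolding f_def
  by (intro borel_measurable_times_ennreal measurable_left_mult[OF adj2_SL2[OF G_SL2[OF that]] iFX] w \<Phi>)
 have fs: "f \<gamma> (\<gamma> ** g) = indicator FX g * (\<Phi> g * w (\<gamma> ** g))" if "\<gamma> \<in> \<Gamma>" "g \<in> SL2" for \<gamma> g
  using that inv by (simp add: f_def adj2_cancel G_SL2 G_inv_def mult.commute)
 have "(\<integral>\<^sup>+g. w g * \<Phi> g \<partial>haar_SL2) = (\<integral>\<^sup>+g. \<integral>\<^sup>+\<gamma>. f \<gamma> g \<partial>count_space \<Gamma> \<partial>haar_SL2)"
  unfolding f_def by (intro nn_integral_cong) (simp add: nn_integral_multc count_FX_adj)
 also have "... = (\<integral>\<^sup>+\<gamma>. \<integral>\<^sup>+g. f \<gamma> g \<partial>haar_SL2 \<partial>count_space \<Gamma>)"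
  by (rule nn_integral_count_space_nn_integral[OF G_countable]) (simp add: mf cong: measurable_cong_sets)
 also have "... = (\<integral>\<^sup>+\<gamma>. \<integral>\<^sup>+g. indicator FX g * (\<Phi> g * w (\<gamma> ** g)) \<partial>haar_SL2 \<partial>count_space \<Gamma>)"
 proof (rule nn_integral_cong)
  fix \<gamma> assume "\<gamma> \<in> space (count_space \<Gamma>)"
  then have \<gamma>: "\<gamma> \<in> \<Gamma>" by simp
  have "(\<integral>\<^sup>+g. f \<gamma> g \<partial>haar_SL2) = (\<integral>\<^sup>+g. f \<gamma> (\<gamma> ** g) \<partial>haar_SL2)"
   using nn_integral_haar_mult_left[OF G_SL2[OF \<gamma>] mf[OF \<gamma>]] by simp
  also have "... = (\<integral>\<^sup>+g. indicator FX g * (\<Phi> g * w (\<gamma> ** g)) \<partial>haar_SL2)"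
   using fs[OF \<gamma>] by (intro nn_integral_cong) simp
  finally show "(\<integral>\<^sup>+g. f \<gamma> g \<partial>haar_SL2) = (\<integral>\<^sup>+g. indicator FX g * (\<Phi> g * w (\<gamma> ** g)) \<partial>haar_SL2)" .
 qed
 also have "... = (\<integral>\<^sup>+g. \<integral>\<^sup>+\<gamma>. indicator FX g * (\<Phi> g * w (\<gamma> ** g)) \<partial>count_space \<Gamma> \<partial>haar_SL2)"
 proof (rule nn_integral_count_space_nn_integral[OF G_countable, symmetric])
  fix \<gamma> assume "\<gamma> \<in> \<Gamma>"
  then have "(%g. indicator FX g * (\<Phi> g * w (\<gamma> ** g))) \<in> borel_measurable SL2_borel"
   by (intro borel_measurable_times_ennreal iFX \<Phi> measurable_left_mult[OF G_SL2 w])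
  then show "(%g. indicator FX g * (\<Phi> g * w (\<gamma> ** g))) \<in> borel_measurable haar_SL2"
   by (simp cong: measurable_cong_sets)
 qed
 also have "... = (\<integral>\<^sup>+g. indicator FX g * (\<Phi> g * (\<integral>\<^sup>+\<gamma>. w (\<gamma> ** g) \<partial>count_space \<Gamma>)) \<partial>haar_SL2)"
  by (simp add: nn_integral_cmult)
 finally show ?thesis .
qed

definition vX :: ennreal where "vX = emeasure haar_SL2 FX"

lemma vX_eq: "vX = (\<integral>\<^sup>+g. indicator FX g \<partial>haar_SL2)"
 using FX(1) by (simp add: vX_def)

lemma vX_finite: "vX < \<infinity>"
proof -
 obtain R where R: "\<And>g. g \<in> SL2 ==> \<exists>\<gamma>\<in>\<Gamma>. norm (\<gamma> ** g) <= R" using bounded_representatives by blast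
 let ?w = "indicator (SL2 \<inter> cball 0 R) :: real^2^2 => ennreal"
 have wm: "?w \<in> borel_measurable SL2_borel" using SL2_borel_Int(2)[of "cball 0 R"] by simp
 have "vX <= (\<integral>\<^sup>+g. indicator FX g * (1 * (\<integral>\<^sup>+\<gamma>. ?w (\<gamma> ** g) \<partial>count_space \<Gamma>)) \<partial>haar_SL2)"
  unfolding vX_eq
 proof (rule nn_integral_mono)
  fix g assume g: "g \<in> space haar_SL2"
  then obtain \<gamma> where \<gamma>: "\<gamma> \<in> \<Gamma>" "norm (\<gamma> ** g) <= R" using R by auto
  have "1 <= emeasure (count_space \<Gamma>) {\<gamma>}" using \<gamma> by simp
  also have "... <= emeasure (count_space \<Gamma>) {\<gamma> \<in> \<Gamma>. \<gamma> ** g \<in> SL2 \<inter> cball 0 R}"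
   using \<gamma> g G_SL2 SL2_mult by (intro emeasure_mono) auto
  finally show "indicator FX g <= indicator FX g * (1 * (\<integral>\<^sup>+\<gamma>. ?w (\<gamma> ** g) \<partial>count_space \<Gamma>))"
   by (simp only: count_G_indicator) (simp split: split_indicator)
 qed
 also have "... = (\<integral>\<^sup>+g. ?w g * 1 \<partial>haar_SL2)"
  by (rule unfolding_integral[symmetric]) (auto simp: wm G_inv_def)
 also have "... = emeasure haar_SL2 (SL2 \<inter> cball 0 R)"
  using SL2_borel_Int(2)[of "cball 0 R"] by simp
 also have "... < \<infinity>" by (rule haar_finite_bounded)
 finally show ?thesis .
qed

lemma vX_pos: "vX > 0"
proof (rule ccontr)
 assume "\<not> vX > 0"
 then have z: "emeasure haar_SL2 FX = 0" by (simp add: vX_def)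
 have "FX \<in> null_sets haar_SL2" using z FX(1) by (intro null_setsI) auto
 then have "AE g in haar_SL2. g \<notin> FX" by (rule AE_not_in)
 then have ae: "AE g in haar_SL2. indicator FX g * (1 * (\<integral>\<^sup>+\<gamma>. 1 \<partial>count_space \<Gamma>)) = (0::ennreal)"
  by eventually_elim (simp add: indicator_def)
 have "emeasure haar_SL2 SL2 = (\<integral>\<^sup>+g. 1 * 1 \<partial>haar_SL2)" by simp
 also have "... = (\<integral>\<^sup>+g. indicator FX g * (1 * (\<integral>\<^sup>+\<gamma>. 1 \<partial>count_space \<Gamma>)) \<partial>haar_SL2)"
  by (rule unfolding_integral) (auto simp: G_inv_def)
 also have "... = (\<integral>\<^sup>+g. 0 \<partial>haar_SL2)" by (rule nn_integral_cong_AE[OF ae])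
 finally have "emeasure haar_SL2 SL2 = 0" by simp
 moreover have "emeasure haar_SL2 SL2 > 0" by (rule haar_open_pos) (use SL2_one in auto)
 ultimately show False by simp
qed

text \<open>The invariant probability measure on \<open>X\<close>, as a measure on the fundamental set.\<close>

definition XM :: "(real^2^2) measure" where
 "XM = density haar_SL2 (%g. indicator FX g / vX)"

lemma sets_XM [measurable_cong, simp]: "sets XM = sets SL2_borel"
 by (simp add: XM_def)

lemma space_XM [simp]: "space XM = SL2"
 by (simp add: XM_def)

lemma nn_integral_XM:
 fixes \<Phi> :: "real^2^2 => ennreal"
 assumes "\<Phi> \<in> borel_measurable SL2_borel"
 shows "vX * (\<integral>\<^sup>+g. \<Phi> g \<partial>XM) = (\<integral>\<^sup>+g. indicator FX g * \<Phi> g \<partial>haar_SL2)"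
proof -
 have m1: "indicator FX \<in> borel_measurable haar_SL2" using FX(1) by simp
 have m2: "\<Phi> \<in> borel_measurable haar_SL2" using assms by (simp cong: measurable_cong_sets)
 have m3: "(%g. indicator FX g / vX) \<in> borel_measurable haar_SL2"
  unfolding divide_ennreal_def by (intro borel_measurable_times_ennreal m1) simp
 have "(\<integral>\<^sup>+g. \<Phi> g \<partial>XM) = (\<integral>\<^sup>+g. indicator FX g / vX * \<Phi> g \<partial>haar_SL2)"
  unfolding XM_def by (intro nn_integral_density m2 m3)
 then have "vX * (\<integral>\<^sup>+g. \<Phi> g \<partial>XM) = (\<integral>\<^sup>+g. vX * (indicator FX g / vX * \<Phi> g) \<partial>haar_SL2)"
  by (simp add: nn_integral_cmult[OF borel_measurable_times_ennreal[OF m3 m2]])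
 also have "... = (\<integral>\<^sup>+g. indicator FX g * \<Phi> g \<partial>haar_SL2)"
 proof (rule nn_integral_cong)
  fix g
  have "vX * (indicator FX g / vX) = indicator FX g"
   by (rule ennreal_mult_divide_cancel[OF vX_pos vX_finite])
  then show "vX * (indicator FX g / vX * \<Phi> g) = indicator FX g * \<Phi> g"
   by (simp add: mult.assoc[symmetric])
 qed
 finally show ?thesis .
qed

lemma vX_cancel: "vX * a = vX * b ==> a = b" "vX * a <= vX * b ==> a <= b"
proof -
 have *: "vX * x / vX = x" for x
  using ennreal_mult_divide_eq[of vX x] vX_pos vX_finite by (simp add: mult.commute)
 show "a = b" if "vX * a = vX * b" using arg_cong[OF that, of "%x. x / vX"] by (simp only: *)
 show "a <= b" if "vX * a <= vX * b" using divide_right_mono_ennreal[OF that, of vX] by (simp only: *)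
qed

lemma emeasure_XM: "emeasure XM SL2 = 1"
proof -
 have "vX * emeasure XM (space XM) = vX * (\<integral>\<^sup>+g. 1 \<partial>XM)" by simp
 also have "... = vX * 1" by (subst nn_integral_XM) (simp_all add: vX_eq)
 finally show ?thesis using vX_cancel(1) by fastforce
qed

sublocale XM: finite_measure XM
 by standard (simp add: emeasure_XM)

lemma measure_XM [simp]: "measure XM SL2 = 1"
 by (simp add: measure_def emeasure_XM)

lemma unfolding_le:
 fixes w \<Phi> :: "real^2^2 => ennreal"
 assumes w: "w \<in> borel_measurable SL2_borel" and \<Phi>: "\<Phi> \<in> borel_measurable SL2_borel" and inv: "G_inv \<Phi>"
  and le: "\<And>g. g \<in> SL2 ==> (\<integral>\<^sup>+\<gamma>. w (\<gamma> ** g) \<partial>count_space \<Gamma>) <= N"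
 shows "(\<integral>\<^sup>+g. w g * \<Phi> g \<partial>haar_SL2) <= N * (vX * (\<integral>\<^sup>+g. \<Phi> g \<partial>XM))"
proof -
 have "(\<integral>\<^sup>+g. w g * \<Phi> g \<partial>haar_SL2) <= (\<integral>\<^sup>+g. N * (indicator FX g * \<Phi> g) \<partial>haar_SL2)"
  unfolding unfolding_integral[OF w \<Phi> inv]
 proof (rule nn_integral_mono)
  fix g assume "g \<in> space haar_SL2"
  then have "\<Phi> g * (\<integral>\<^sup>+\<gamma>. w (\<gamma> ** g) \<partial>count_space \<Gamma>) <= \<Phi> g * N" by (intro mult_left_mono le) auto
  then show "indicator FX g * (\<Phi> g * (\<integral>\<^sup>+\<gamma>. w (\<gamma> ** g) \<partial>count_space \<Gamma>)) <= N * (indicator FX g * \<Phi> g)"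
   by (simp add: indicator_def mult.commute)
 qed
 also have "... = N * (\<integral>\<^sup>+g. indicator FX g * \<Phi> g \<partial>haar_SL2)"
  using FX(1) \<Phi> by (intro nn_integral_cmult) (simp cong: measurable_cong_sets)
 finally show ?thesis by (simp add: nn_integral_XM[OF \<Phi>])
qed

lemma unfolding_ge:
 fixes w \<Phi> :: "real^2^2 => ennreal"
 assumes w: "w \<in> borel_measurable SL2_borel" and \<Phi>: "\<Phi> \<in> borel_measurable SL2_borel" and inv: "G_inv \<Phi>"
  and ge: "\<And>g. g \<in> SL2 ==> (\<integral>\<^sup>+\<gamma>. w (\<gamma> ** g) \<partial>count_space \<Gamma>) >= 1"
 shows "vX * (\<integral>\<^sup>+g. \<Phi> g \<partial>XM) <= (\<integral>\<^sup>+g. w g * \<Phi> g \<partial>haar_SL2)"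
 unfolding unfolding_integral[OF w \<Phi> inv] nn_integral_XM[OF \<Phi>]
proof (rule nn_integral_mono)
 fix g assume "g \<in> space haar_SL2"
 then have "\<Phi> g * 1 <= \<Phi> g * (\<integral>\<^sup>+\<gamma>. w (\<gamma> ** g) \<partial>count_space \<Gamma>)" by (intro mult_left_mono ge) auto
 then show "indicator FX g * \<Phi> g <= indicator FX g * (\<Phi> g * (\<integral>\<^sup>+\<gamma>. w (\<gamma> ** g) \<partial>count_space \<Gamma>))"
  by (simp add: indicator_def)
qed

lemma nn_integral_XM_translate:
 fixes \<Phi> :: "real^2^2 => ennreal"
 assumes \<Phi>: "\<Phi> \<in> borel_measurable SL2_borel" and inv: "G_inv \<Phi>" and h: "h \<in> SL2"
 shows "(\<integral>\<^sup>+g. \<Phi> (g ** h) \<partial>XM) = (\<integral>\<^sup>+g. \<Phi> g \<partial>XM)"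
proof (rule vX_cancel(1))
 have h': "adj2 h \<in> SL2" using h by (rule adj2_SL2)
 have iFX: "indicator FX \<in> borel_measurable SL2_borel" using FX(1) by simp
 let ?w = "%g. indicator FX (g ** adj2 h) :: ennreal"
 have wm: "?w \<in> borel_measurable SL2_borel" by (rule measurable_right_mult[OF h' iFX])
 have c: "(\<integral>\<^sup>+\<gamma>. ?w (\<gamma> ** g) \<partial>count_space \<Gamma>) = 1" if "g \<in> SL2" for g
  using count_FX[OF SL2_mult[OF that h']] by (simp add: matrix_mul_assoc)
 have "vX * (\<integral>\<^sup>+g. \<Phi> (g ** h) \<partial>XM) = (\<integral>\<^sup>+g. indicator FX g * \<Phi> (g ** h) \<partial>haar_SL2)"
  by (rule nn_integral_XM[OF measurable_right_mult[OF h \<Phi>]])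
 also have "... = (\<integral>\<^sup>+g. ?w (g ** h) * \<Phi> (g ** h) \<partial>haar_SL2)"
  by (simp add: adj2_cancel h)
 also have "... = (\<integral>\<^sup>+g. ?w g * \<Phi> g \<partial>haar_SL2)"
  using wm \<Phi> by (intro nn_integral_haar_mult_right[OF h]) simp
 also have "... = vX * (\<integral>\<^sup>+g. \<Phi> g \<partial>XM)"
  using unfolding_le[OF wm \<Phi> inv, of 1] unfolding_ge[OF wm \<Phi> inv] c by (simp add: order_antisym)
 finally show "vX * (\<integral>\<^sup>+g. \<Phi> (g ** h) \<partial>XM) = vX * (\<integral>\<^sup>+g. \<Phi> g \<partial>XM)" .
qed

lemma integral_XM_translate_real:
 fixes F :: "real^2^2 => real"
 assumes F: "F \<in> borel_measurable SL2_borel" and inv: "G_inv F" and h: "h \<in> SL2"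
  and bd: "\<And>g. g \<in> SL2 ==> \<bar>F g\<bar> <= K"
 shows "(\<integral>g. F (g ** h) \<partial>XM) = (\<integral>g. F g \<partial>XM)"
proof -
 have Fm: "F \<in> borel_measurable XM" using F by (simp cong: measurable_cong_sets)
 have Fhm: "(%g. F (g ** h)) \<in> borel_measurable XM"
  using measurable_right_mult[OF h F] by (simp cong: measurable_cong_sets)
 have Fi: "integrable XM F" "integrable XM (%g. F (g ** h))"
  using bd SL2_mult[OF _ h] by (auto intro!: XM.integrable_const_bound[where B = K] Fm Fhm)
 have nn: "0 <= F g + K" if "g \<in> SL2" for g using bd[OF that] by linarith
 have "(\<integral>g. F (g ** h) + K \<partial>XM) = enn2real (\<integral>\<^sup>+g. ennreal (F (g ** h) + K) \<partial>XM)"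
  using nn SL2_mult[OF _ h] Fhm by (intro integral_eq_nn_integral AE_I2) simp_all
 also have "... = enn2real (\<integral>\<^sup>+g. ennreal (F g + K) \<partial>XM)"
  using nn_integral_XM_translate[of "%g. ennreal (F g + K)" h] F inv h by (simp add: G_inv_def)
 also have "... = (\<integral>g. F g + K \<partial>XM)"
  using nn Fm by (intro integral_eq_nn_integral[symmetric] AE_I2) simp_all
 finally show ?thesis using Fi by simp
qed

lemma integral_XM_translate:
 fixes F :: "real^2^2 => complex"
 assumes F: "F \<in> borel_measurable SL2_borel" and inv: "G_inv F" and h: "h \<in> SL2"
  and bd: "\<And>g. g \<in> SL2 ==> cmod (F g) <= K"
 shows "(\<integral>g. F (g ** h) \<partial>XM) = (\<integral>g. F g \<partial>XM)"
proof (rule complex_eqI)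
 have i: "integrable XM F" "integrable XM (%g. F (g ** h))"
  using bd SL2_mult[OF _ h] F measurable_right_mult[OF h F]
  by (auto intro!: XM.integrable_const_bound[where B = K] cong: measurable_cong_sets)
 have "\<bar>Re (F g)\<bar> <= K" "\<bar>Im (F g)\<bar> <= K" if "g \<in> SL2" for g
  using bd[OF that] abs_Re_le_cmod[of "F g"] abs_Im_le_cmod[of "F g"] by linarith+
 then show "Re (\<integral>g. F (g ** h) \<partial>XM) = Re (\<integral>g. F g \<partial>XM)" "Im (\<integral>g. F (g ** h) \<partial>XM) = Im (\<integral>g. F g \<partial>XM)"
  using integral_XM_translate_real[of "%g. Re (F g)" h K] integral_XM_translate_real[of "%g. Im (F g)" h K]
   F inv h i by (auto simp: G_inv_def simp flip: integral_Re integral_Im)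
qed

lemma XM_nonneg_continuous_zero:
 fixes \<Phi> :: "real^2^2 => real"
 assumes c: "continuous_on SL2 \<Phi>" and inv: "G_inv \<Phi>" and z: "(\<integral>\<^sup>+g. ennreal \<bar>\<Phi> g\<bar> \<partial>XM) = 0" and g: "g \<in> SL2"
 shows "\<Phi> g = 0"
proof (rule ccontr)
 assume ne: "\<Phi> g \<noteq> 0"
 have m: "(%g. ennreal \<bar>\<Phi> g\<bar>) \<in> borel_measurable SL2_borel"
  using borel_measurable_continuous_on_restrict[OF c] by simp
 have gi: "G_inv (%g. ennreal \<bar>\<Phi> g\<bar>)" using inv by (simp add: G_inv_def)
 have "(\<integral>\<^sup>+g. 1 * ennreal \<bar>\<Phi> g\<bar> \<partial>haar_SL2) <= \<infinity> * (vX * (\<integral>\<^sup>+g. ennreal \<bar>\<Phi> g\<bar> \<partial>XM))"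
  by (rule unfolding_le[OF _ m gi]) auto
 then have "(\<integral>\<^sup>+g. ennreal \<bar>\<Phi> g\<bar> \<partial>haar_SL2) = 0" using z by simp
 then have ae: "AE g in haar_SL2. ennreal \<bar>\<Phi> g\<bar> = 0"
  using m by (subst (asm) nn_integral_0_iff_AE) (auto cong: measurable_cong_sets)
 let ?U = "SL2 \<inter> \<Phi> -` (- {0})"
 have U: "openin (top_of_set SL2) ?U"
  using c by (rule continuous_openin_preimage_gen) (simp add: open_Compl)
 have "emeasure haar_SL2 ?U = 0"
  using ae SL2_borel_open[OF U] by (subst (asm) AE_iff_measurable[of ?U]) auto
 moreover have "emeasure haar_SL2 ?U > 0" using U by (rule haar_open_pos) (use g ne in auto)
 ultimately show False by simp
qed

subsection \<open>The volume on \<open>X\<close> and the area on \<open>M\<close>\<close>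

lemma coset_measurable: "pX \<in> SL2_borel \<rightarrow>\<^sub>M borel_of (topX)"
 unfolding X_top_def by (rule measurable_to_quotient) simp

lemma orbit_measurable: "pM \<in> restrict_space borel uhp \<rightarrow>\<^sub>M borel_of (topM)"
 unfolding M_top_def by (rule measurable_to_quotient) simp

lemma vol_X_eq: "volX = distr XM (borel_of (topX)) (pX)"
proof (rule measure_eqI)
 define \<nu> where "\<nu> = quotient_measure haar_SL2 (topX) (pX)"
 have nu: "\<nu> = distr (restrict_space haar_SL2 FX) (borel_of (topX)) (pX)"
  by (simp add: \<nu>_def quotient_measure_def FX_def)
 have vol: "volX = uniform_measure \<nu> (space \<nu>)" by (simp add: vol_X_def normalized_def \<nu>_def)
 show "sets (volX) = sets (distr XM (borel_of (topX)) (pX))" by (simp add: vol nu)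
 have FXh: "FX \<in> sets haar_SL2" using FX(1) by simp
 have cm: "pX \<in> restrict_space haar_SL2 FX \<rightarrow>\<^sub>M borel_of (topX)"
  using coset_measurable by (intro measurable_restrict_space1) (simp cong: measurable_cong_sets)
 have em: "emeasure \<nu> A = emeasure haar_SL2 (pX -` A \<inter> FX)" if "A \<in> sets \<nu>" for A
  using that FXh FX(3) cm unfolding nu
  by (subst emeasure_distr) (simp_all add: emeasure_restrict_space space_restrict_space Int_absorb2[OF FX(3)] del: sets_haar)
 have sp: "pX -` space \<nu> \<inter> FX = FX" using FX(3) by (auto simp: nu X_top_def)
 have emsp: "emeasure \<nu> (space \<nu>) = vX" using em[OF sets.top] by (simp add: sp vX_def)
 fix A assume "A \<in> sets (volX)"
 then have A: "A \<in> sets \<nu>" "A \<in> sets (borel_of (topX))" by (simp_all add: vol nu)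
 let ?B = "pX -` A \<inter> SL2"
 have B: "?B \<in> sets SL2_borel" using measurable_sets[OF coset_measurable A(2)] by (simp add: space_restrict_space)
 have "vX * emeasure (volX) A = emeasure \<nu> A"
  using A sets.sets_into_space[OF A(1)] unfolding vol
  by (subst emeasure_uniform_measure) (simp_all add: emsp Int_absorb1 ennreal_mult_divide_cancel[OF vX_pos vX_finite])
 also have "... = emeasure haar_SL2 (FX \<inter> ?B)" unfolding em[OF A(1)] using FX(3) by (intro arg_cong[where f = "emeasure haar_SL2"]) auto
 also have "... = (\<integral>\<^sup>+g. indicator FX g * indicator ?B g \<partial>haar_SL2)"
 proof -
  have "(\<integral>\<^sup>+g. indicator FX g * indicator ?B g \<partial>haar_SL2) = (\<integral>\<^sup>+g. indicator (FX \<inter> ?B) g \<partial>haar_SL2)"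
   by (intro nn_integral_cong) (simp split: split_indicator)
  also have "... = emeasure haar_SL2 (FX \<inter> ?B)" using B FX(1) by (intro nn_integral_indicator) simp
  finally show ?thesis by simp
 qed
 also have "... = vX * emeasure XM ?B" using B by (subst nn_integral_XM[symmetric]) simp_all
 also have "emeasure XM ?B = emeasure (distr XM (borel_of (topX)) (pX)) A"
  using A(2) coset_measurable by (subst emeasure_distr) (simp_all cong: measurable_cong_sets)
 finally show "emeasure (volX) A = emeasure (distr XM (borel_of (topX)) (pX)) A"
  by (rule vX_cancel(1))
qed

definition FM :: "complex set" where
 "FM = (SOME F. fundamental_set hyperbolic_area (pM) F)"

lemma FM: "FM \<in> sets (restrict_space borel uhp)" "bij_betw (pM) FM (pM ` uhp)" "FM \<subseteq> uhp"
proof -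
 have *: "fundamental_set hyperbolic_area (pM) FM"
  unfolding FM_def using fundamental_set_M by (rule someI_ex)
 then show "FM \<in> sets (restrict_space borel uhp)" "bij_betw (pM) FM (pM ` uhp)"
  by (simp_all add: fundamental_set_def)
 then show "FM \<subseteq> uhp" using sets.sets_into_space[of FM "restrict_space borel uhp"] by (simp add: space_restrict_space)
qed

text \<open>
  A coset meets the preimage of a fundamental set of \<open>M\<close> once or twice, according to whether the group
 contains minus the identity.
\<close>

lemma count_FM:
 assumes g: "g \<in> SL2"
 shows "(\<integral>\<^sup>+\<gamma>. indicator FM (act (\<gamma> ** g) \<i>) \<partial>count_space \<Gamma>) >= 1"
  and "(\<integral>\<^sup>+\<gamma>. indicator FM (act (\<gamma> ** g) \<i>) \<partial>count_space \<Gamma>) <= 2"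
proof -
 have u: "act g \<i> \<in> uhp" using g act_uhp by simp
 have a: "act (\<gamma> ** g) \<i> = act \<gamma> (act g \<i>)" for \<gamma> using g by (simp add: act_mult)
 let ?A = "{\<gamma> \<in> \<Gamma>. act \<gamma> (act g \<i>) \<in> FM}"
 have "pM (act g \<i>) \<in> pM ` FM" using FM(2) u by (auto simp: bij_betw_def)
 then obtain w where w: "w \<in> FM" "pM (act g \<i>) = pM w" by auto
 then obtain \<gamma>0 where g0: "\<gamma>0 \<in> \<Gamma>" "w = act \<gamma>0 (act g \<i>)" using orbit_eq_iff[OF u] FM(3) by blast
 then have "1 = emeasure (count_space \<Gamma>) {\<gamma>0}" by simp
 also have "... <= emeasure (count_space \<Gamma>) ?A" using g0 w by (intro emeasure_mono) auto
 finally show "(\<integral>\<^sup>+\<gamma>. indicator FM (act (\<gamma> ** g) \<i>) \<partial>count_space \<Gamma>) >= 1"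
  by (simp add: a count_G_indicator)
 have sub: "?A \<subseteq> {\<gamma>0, - \<gamma>0}"
 proof
  fix \<gamma> assume \<gamma>: "\<gamma> \<in> ?A"
  then have \<gamma>S: "\<gamma> \<in> SL2" and g0S: "\<gamma>0 \<in> SL2" using G_SL2 g0 by auto
  have "pM (act \<gamma> (act g \<i>)) = pM w" using \<gamma> w orbit_act[OF _ u] by simp
  then have eq: "act \<gamma> (act g \<i>) = act \<gamma>0 (act g \<i>)" using FM(2) \<gamma> w g0 by (auto simp: bij_betw_def dest: inj_onD)
  have "act (adj2 \<gamma>0 ** \<gamma>) (act g \<i>) = act (adj2 \<gamma>0) (act \<gamma>0 (act g \<i>))"
   using act_mult[OF \<gamma>S u] eq by simp
  also have "... = act g \<i>" using act_adj2(1)[OF g0S u] .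
  finally have "adj2 \<gamma>0 ** \<gamma> = mat 1 \<or> adj2 \<gamma>0 ** \<gamma> = - mat 1"
   using G_free[OF _ u] G_mult G_adj g0 \<gamma> by blast
  then have "\<gamma>0 ** (adj2 \<gamma>0 ** \<gamma>) = \<gamma>0 \<or> \<gamma>0 ** (adj2 \<gamma>0 ** \<gamma>) = - \<gamma>0"
   by (auto simp: mat2_eq_iff mult_nth2)
  then show "\<gamma> \<in> {\<gamma>0, - \<gamma>0}" using adj2_cancel(2)[OF g0S] by simp
 qed
 then have fin: "finite ?A" by (rule finite_subset) simp
 have "card ?A <= card {\<gamma>0, - \<gamma>0}" by (rule card_mono[OF _ sub]) simp
 also have "... <= 2" by (simp add: card_insert_if)
 finally have "card ?A <= 2" .
 then have "emeasure (count_space \<Gamma>) ?A <= 2"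
 proof -
  assume c: "card ?A <= 2"
  have "emeasure (count_space \<Gamma>) ?A = of_nat (card ?A)"
   using fin by (intro emeasure_count_space_finite) auto
  also have "... <= of_nat 2" using c by (rule of_nat_mono)
  finally show ?thesis by simp
 qed
 then show "(\<integral>\<^sup>+\<gamma>. indicator FM (act (\<gamma> ** g) \<i>) \<partial>count_space \<Gamma>) <= 2"
  by (simp add: a count_G_indicator)
qed

definition vM :: ennreal where "vM = emeasure hyperbolic_area FM"

lemma nn_integral_vol_M_aux:
 fixes f :: "complex set => ennreal"
 assumes f: "f \<in> borel_measurable (borel_of (topM))"
 shows "vX * (\<integral>\<^sup>+g. f (pM (act g \<i>)) \<partial>XM) <= proj_const * (\<integral>\<^sup>+z. indicator FM z * f (pM z) \<partial>hyperbolic_area)"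
  and "proj_const * (\<integral>\<^sup>+z. indicator FM z * f (pM z) \<partial>hyperbolic_area) <= 2 * (vX * (\<integral>\<^sup>+g. f (pM (act g \<i>)) \<partial>XM))"
proof -
 have am: "(%g. act g \<i>) \<in> SL2_borel \<rightarrow>\<^sub>M restrict_space borel uhp"
  using continuous_act_i act_uhp
  by (intro measurable_restrict_space2 borel_measurable_continuous_on_restrict) (auto simp: space_restrict_space)
 have fo: "(%z. f (pM z)) \<in> borel_measurable (restrict_space borel uhp)"
  by (rule measurable_compose[OF orbit_measurable f])
 have Fm: "(%z. indicator FM z * f (pM z)) \<in> borel_measurable borel"
 proof -
  have "(%z. indicator FM z * f (pM z)) \<in> borel_measurable (restrict_space borel uhp)"
   using fo FM(1) by simp
  then have "(%z. indicator FM z * f (pM z) * indicator uhp z) \<in> borel_measurable borel"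
   by (subst (asm) borel_measurable_restrict_space_iff_ennreal) simp_all
  moreover have "indicator FM z * f (pM z) * indicator uhp z = indicator FM z * f (pM z)" for z
   using FM(3) by (auto simp: indicator_def)
  ultimately show ?thesis by simp
 qed
 have \<Phi>: "(%g. f (pM (act g \<i>))) \<in> borel_measurable SL2_borel"
  by (rule measurable_compose[OF am fo])
 have inv: "G_inv (%g. f (pM (act g \<i>)))"
  using orbit_act act_uhp by (auto simp: G_inv_def act_mult)
 have "indicator FM \<in> borel_measurable (restrict_space borel uhp)" using FM(1) by simp
 then have w: "(%g. indicator FM (act g \<i>) :: ennreal) \<in> borel_measurable SL2_borel"
  by (rule measurable_compose[OF am])
 have eq: "(\<integral>\<^sup>+g. indicator FM (act g \<i>) * f (pM (act g \<i>)) \<partial>haar_SL2) = 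
   proj_const * (\<integral>\<^sup>+z. indicator FM z * f (pM z) \<partial>hyperbolic_area)"
  by (rule nn_integral_proj[OF Fm])
 show "vX * (\<integral>\<^sup>+g. f (pM (act g \<i>)) \<partial>XM) <= proj_const * (\<integral>\<^sup>+z. indicator FM z * f (pM z) \<partial>hyperbolic_area)"
  using unfolding_ge[OF w \<Phi> inv count_FM(1)] by (simp add: eq)
 show "proj_const * (\<integral>\<^sup>+z. indicator FM z * f (pM z) \<partial>hyperbolic_area) <= 2 * (vX * (\<integral>\<^sup>+g. f (pM (act g \<i>)) \<partial>XM))"
  using unfolding_le[OF w \<Phi> inv count_FM(2)] by (simp add: eq)
qed

lemma vM: "vX <= proj_const * vM" "proj_const * vM <= 2 * vX" "0 < vM" "vM < \<infinity>"
proof -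
 have v: "vM = (\<integral>\<^sup>+z. indicator FM z * 1 \<partial>hyperbolic_area)" using FM(1) by (simp add: vM_def)
 show 1: "vX <= proj_const * vM" "proj_const * vM <= 2 * vX"
  unfolding v using nn_integral_vol_M_aux[of "%_. 1"] by (simp_all add: emeasure_XM)
 show "0 < vM"
 proof (rule ccontr)
  assume "\<not> 0 < vM"
  then have "vM = 0" by simp
  with 1(1) vX_pos show False by simp
 qed
 show "vM < \<infinity>"
 proof (rule ccontr)
  assume "\<not> vM < \<infinity>"
  then have "vM = top" by (simp add: not_less top_unique)
  then have "proj_const * vM = top" using proj_const_pos by (simp add: ennreal_mult_top)
  then have "2 * vX = top" using 1(2) by (simp add: top_unique)
  moreover have "2 * vX < top" using vX_finite by (simp add: ennreal_mult_less_top)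
  ultimately show False by simp
 qed
qed

lemma nn_integral_vol_M:
 fixes f :: "complex set => ennreal"
 assumes f: "f \<in> borel_measurable (borel_of (topM))"
 shows "vM * (\<integral>\<^sup>+p. f p \<partial>volM) = (\<integral>\<^sup>+z. indicator FM z * f (pM z) \<partial>hyperbolic_area)"
proof -
 define \<nu> where "\<nu> = quotient_measure hyperbolic_area (topM) (pM)"
 have nu: "\<nu> = distr (restrict_space hyperbolic_area FM) (borel_of (topM)) (pM)"
  by (simp add: \<nu>_def quotient_measure_def FM_def)
 have vol: "volM = uniform_measure \<nu> (space \<nu>)" by (simp add: vol_M_def normalized_def \<nu>_def)
 have FMh: "FM \<in> sets hyperbolic_area" using FM(1) by simp
 have om: "pM \<in> restrict_space hyperbolic_area FM \<rightarrow>\<^sub>M borel_of (topM)"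
  using orbit_measurable by (intro measurable_restrict_space1) (simp cong: measurable_cong_sets)
 have "f \<in> borel_measurable \<nu>" using f by (simp add: nu cong: measurable_cong_sets)
 then have nnu: "(\<integral>\<^sup>+p. h p \<partial>\<nu>) = (\<integral>\<^sup>+z. indicator FM z * h (pM z) \<partial>hyperbolic_area)" 
  if "h \<in> borel_measurable (borel_of (topM))" for h :: "complex set => ennreal"
  unfolding nu using that om FMh
  by (simp add: nn_integral_distr nn_integral_restrict_space mult.commute Int_absorb2[OF FM(3)])
 have sp: "emeasure \<nu> (space \<nu>) = vM"
  using nnu[of "%_. 1"] FM(1) by (simp add: vM_def)
 have fm: "f \<in> borel_measurable \<nu>" using f by (simp add: nu cong: measurable_cong_sets)
 have "(\<integral>\<^sup>+p. f p \<partial>volM) = (\<integral>\<^sup>+p. f p * indicator (space \<nu>) p \<partial>\<nu>) / vM"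
  unfolding vol sp[symmetric] by (rule nn_integral_uniform_measure) (use fm in auto)
 also have "(\<integral>\<^sup>+p. f p * indicator (space \<nu>) p \<partial>\<nu>) = (\<integral>\<^sup>+p. f p \<partial>\<nu>)"
  by (intro nn_integral_cong) simp
 finally show ?thesis
  using nnu[OF f] by (simp add: ennreal_mult_divide_cancel[OF vM(3,4)])
qed

text \<open>
  Both integrals unfold to integrals over the group. The factor 2 accounts for the possible presence of
  \<open>- mat 1\<close> in the group, which acts trivially on the upper half-plane.
\<close>

lemma vol_M_compare:
 fixes f :: "complex set => ennreal"
 assumes f: "f \<in> borel_measurable (borel_of (topM))"
 shows "(\<integral>\<^sup>+p. f p \<partial>volM) <= 2 * (\<integral>\<^sup>+g. f (pM (act g \<i>)) \<partial>XM)"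
  and "(\<integral>\<^sup>+g. f (pM (act g \<i>)) \<partial>XM) <= 2 * (\<integral>\<^sup>+p. f p \<partial>volM)"
proof -
 let ?a = "\<integral>\<^sup>+p. f p \<partial>volM" and ?b = "\<integral>\<^sup>+g. f (pM (act g \<i>)) \<partial>XM"
 have 1: "vX * ?b <= proj_const * (vM * ?a)" "proj_const * (vM * ?a) <= 2 * (vX * ?b)"
  using nn_integral_vol_M_aux[OF f] by (simp_all add: nn_integral_vol_M[OF f])
 have "vX * ?a <= (proj_const * vM) * ?a" by (intro mult_right_mono vM) simp
 also have "... <= 2 * (vX * ?b)" using 1(2) by (simp add: mult.assoc)
 finally have "vX * ?a <= vX * (2 * ?b)" by (simp add: mult.left_commute)
 then show "?a <= 2 * ?b" by (rule vX_cancel(2))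
 have "vX * ?b <= (proj_const * vM) * ?a" using 1(1) by (simp add: mult.assoc)
 also have "... <= (2 * vX) * ?a" by (intro mult_right_mono vM) simp
 finally have "vX * ?b <= vX * (2 * ?a)" by (simp add: mult_ac)
 then show "?b <= 2 * ?a" by (rule vX_cancel(2))
qed

end

section \<open>Calculus on the upper half-plane\<close>

subsection \<open>Closure properties of smooth functions\<close>

lemma has_derivative_cong_open:
 assumes "open S" "x \<in> S" "\<And>y. y \<in> S ==> f y = g y"
 shows "(f has_derivative D) (at x) \<longleftrightarrow> (g has_derivative D) (at x)"
proof
 show "(g has_derivative D) (at x)" if "(f has_derivative D) (at x)"
  by (rule has_derivative_transform_within_open[OF that assms])
 show "(f has_derivative D) (at x)" if "(g has_derivative D) (at x)"
  by (rule has_derivative_transform_within_open[OF that assms(1,2)]) (simp add: assms(3))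
qed

lemma frechet_derivative_cong_open:
 assumes "open S" "x \<in> S" "\<And>y. y \<in> S ==> f y = g y"
 shows "frechet_derivative f (at x) = frechet_derivative g (at x)"
proof -
 have "(f has_derivative D) (at x) \<longleftrightarrow> (g has_derivative D) (at x)" for D
  by (rule has_derivative_cong_open[OF assms])
 then show ?thesis by (simp add: frechet_derivative_def)
qed

lemma Ck_on_cong:
 assumes "open S" "\<And>x. x \<in> S ==> f x = g x"
 shows "Ck_on k S f ==> Ck_on k S g"
 using assms
proof (induction k arbitrary: f g)
 case 0
 then show ?case by (simp cong: continuous_on_cong)
next
 case (Suc k)
 have "g differentiable (at x)" if "x \<in> S" for x
 proof -
  have "f differentiable (at x)" using Suc.prems(1) that by simp
  then obtain D where "(f has_derivative D) (at x)" unfolding differentiable_def by blast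
  then have "(g has_derivative D) (at x)"
   by (rule has_derivative_transform_within_open[OF _ Suc.prems(2) that Suc.prems(3)])
  then show ?thesis by (auto simp: differentiable_def)
 qed
 moreover have "Ck_on k S (%x. frechet_derivative g (at x) v)" for v
 proof (rule Suc.IH)
  show "Ck_on k S (%x. frechet_derivative f (at x) v)" using Suc.prems by simp
  fix x assume "x \<in> S"
  then show "frechet_derivative f (at x) v = frechet_derivative g (at x) v"
   using frechet_derivative_cong_open[OF Suc.prems(2), of x f g] Suc.prems(3) by simp
 qed (use Suc.prems in auto)
 ultimately show ?case by simp
qed

lemma Ck_on_Suc_imp: "Ck_on (Suc k) S f ==> Ck_on k S f"
proof (induction k arbitrary: f)
 case 0
 then show ?case
  by (auto intro!: differentiable_imp_continuous_on simp: differentiable_on_def differentiable_at_withinI)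
qed auto

lemma Ck_on_Suc_I:
 assumes "open S" "\<And>x. x \<in> S ==> (f has_derivative D x) (at x)" "\<And>v. Ck_on k S (%x. D x v)"
 shows "Ck_on (Suc k) S f"
proof -
 have "frechet_derivative f (at x) = D x" if "x \<in> S" for x
  using frechet_derivative_at[OF assms(2)[OF that]] by simp
 then have "Ck_on k S (%x. frechet_derivative f (at x) v)" for v
  by (intro Ck_on_cong[OF assms(1) _ assms(3)]) auto
 with assms(2) show ?thesis by (auto simp: differentiable_def)
qed

lemma Ck_on_Suc_D:
 assumes "Ck_on (Suc k) S f" "x \<in> S"
 shows "(f has_derivative frechet_derivative f (at x)) (at x)"
 using assms by (auto simp: frechet_derivative_works)

lemma Ck_on_const: "open S ==> Ck_on k S (%x. c)"
proof (induction k arbitrary: c)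
 case (Suc k)
 then show ?case by (intro Ck_on_Suc_I[where D = "%x v. 0"]) auto
qed simp

lemma Ck_on_bounded_linear:
 assumes "open S" "bounded_linear h" shows "Ck_on k S h"
proof (cases k)
 case 0
 then show ?thesis using assms by (simp add: linear_continuous_on)
next
 case (Suc m)
 show ?thesis unfolding Suc using assms
  by (intro Ck_on_Suc_I[where D = "%x. h"]) (auto intro: bounded_linear_imp_has_derivative Ck_on_const)
qed

lemma Ck_on_linear_compose:
 assumes "open S" "bounded_linear h" shows "Ck_on k S f ==> Ck_on k S (%x. h (f x))"
proof (induction k arbitrary: f)
 case 0
 then show ?case using assms by (auto intro: continuous_on_compose2[OF linear_continuous_on[OF assms(2)]])
next
 case (Suc k)
 show ?case
 proof (rule Ck_on_Suc_I[OF assms(1)])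
  fix x assume "x \<in> S"
  then show "((%x. h (f x)) has_derivative (%v. h (frechet_derivative f (at x) v))) (at x)"
   using bounded_linear.has_derivative[OF assms(2) Ck_on_Suc_D[OF Suc.prems]] by blast
 next
  fix v show "Ck_on k S (%x. h (frechet_derivative f (at x) v))" using Suc by simp
 qed
qed

lemma Ck_on_add:
 assumes "open S" shows "Ck_on k S f ==> Ck_on k S g ==> Ck_on k S (%x. f x + g x)"
proof (induction k arbitrary: f g)
 case 0
 then show ?case by (auto intro: continuous_intros)
next
 case (Suc k)
 show ?case
 proof (rule Ck_on_Suc_I[OF assms])
  fix x assume "x \<in> S"
  then show "((%x. f x + g x) has_derivative (%v. frechet_derivative f (at x) v + frechet_derivative g (at x) v)) (at x)"
   using Suc.prems Ck_on_Suc_D by (blast intro: has_derivative_add)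
 next
  fix v show "Ck_on k S (%x. frechet_derivative f (at x) v + frechet_derivative g (at x) v)"
   using Suc by simp
 qed
qed

lemma Ck_on_bilinear:
 assumes "open S" "bounded_bilinear B"
 shows "Ck_on k S f ==> Ck_on k S g ==> Ck_on k S (%x. B (f x) (g x))"
proof (induction k arbitrary: f g)
 case 0
 then show ?case by (auto intro: bounded_bilinear.continuous_on[OF assms(2)])
next
 case (Suc k)
 show ?case
 proof (rule Ck_on_Suc_I[OF assms(1)])
  fix x assume "x \<in> S"
  then show "((%x. B (f x) (g x)) has_derivative 
    (%v. B (f x) (frechet_derivative g (at x) v) + B (frechet_derivative f (at x) v) (g x))) (at x)"
   by (intro bounded_bilinear.FDERIV[OF assms(2)] Ck_on_Suc_D[OF Suc.prems(1)] Ck_on_Suc_D[OF Suc.prems(2)])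
 next
  fix v
  have "Ck_on k S f" "Ck_on k S g" using Suc.prems Ck_on_Suc_imp by blast+
  then show "Ck_on k S (%x. B (f x) (frechet_derivative g (at x) v) + B (frechet_derivative f (at x) v) (g x))"
   using Suc by (intro Ck_on_add[OF assms(1)] Suc.IH) simp_all
 qed
qed

lemma Ck_on_mult: "open S ==> Ck_on k S f ==> Ck_on k S g ==> Ck_on k S (%x. f x * g x)"
 for f g :: "'a::real_normed_vector => 'b::real_normed_algebra"
 by (rule Ck_on_bilinear[OF _ bounded_bilinear_mult])

text \<open>
  The derivative of the inverse is a product that contains its square, so the induction
  on the order of differentiability closes.
\<close>

lemma Ck_on_inverse:
 fixes f :: "'a::real_normed_vector => real"
 assumes "open S" "\<And>x. x \<in> S ==> f x \<noteq> 0" shows "Ck_on k S f ==> Ck_on k S (%x. inverse (f x))"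
proof (induction k)
 case 0
 then show ?case using assms by (auto intro: continuous_intros)
next
 case (Suc k)
 show ?case
 proof (rule Ck_on_Suc_I[OF assms(1)])
  fix x assume x: "x \<in> S"
  then have "(f has_derivative frechet_derivative f (at x)) (at x)" using Suc.prems Ck_on_Suc_D by blast
  from Deriv.has_derivative_inverse[where f = f and x = x, OF assms(2)[OF x] this]
  show "((%x. inverse (f x)) has_derivative (%v. (-1) * (inverse (f x) * frechet_derivative f (at x) v * inverse (f x)))) (at x)"
   by simp
 next
  fix v
  have "Ck_on k S (%x. inverse (f x))" using Suc Ck_on_Suc_imp by blast
  then show "Ck_on k S (%x. (-1) * (inverse (f x) * frechet_derivative f (at x) v * inverse (f x)))"
   using Suc.prems by (intro Ck_on_mult Ck_on_const assms(1)) simp_all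
 qed
qed

lemma Ck_on_sin_cos:
 fixes f :: "'a::real_normed_vector => real"
 assumes "open S" shows "Ck_on k S f ==> Ck_on k S (%x. sin (f x)) \<and> Ck_on k S (%x. cos (f x))"
proof (induction k)
 case 0
 then show ?case by (auto intro: continuous_intros)
next
 case (Suc k)
 then have IH: "Ck_on k S (%x. sin (f x))" "Ck_on k S (%x. cos (f x))" using Ck_on_Suc_imp by blast+
 have d: "(f has_derivative frechet_derivative f (at x)) (at x)" if "x \<in> S" for x 
  using Suc.prems Ck_on_Suc_D that by blast
 have "Ck_on (Suc k) S (%x. sin (f x))"
 proof (rule Ck_on_Suc_I[OF assms])
  show "((%x. sin (f x)) has_derivative (%v. cos (f x) * frechet_derivative f (at x) v)) (at x)" if "x \<in> S" for x
   using d[OF that] by (auto intro!: derivative_eq_intros)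
  show "Ck_on k S (%x. cos (f x) * frechet_derivative f (at x) v)" for v
   using Suc.prems IH by (intro Ck_on_mult assms) simp_all
 qed
 moreover have "Ck_on (Suc k) S (%x. cos (f x))"
 proof (rule Ck_on_Suc_I[OF assms])
  show "((%x. cos (f x)) has_derivative (%v. (-1) * (sin (f x) * frechet_derivative f (at x) v))) (at x)" if "x \<in> S" for x
   using d[OF that] by (auto intro!: derivative_eq_intros)
  show "Ck_on k S (%x. (-1) * (sin (f x) * frechet_derivative f (at x) v))" for v
   using Suc.prems IH by (intro Ck_on_mult Ck_on_const assms) simp_all
 qed
 ultimately show ?case by simp
qed

lemma smooth_on_intros:
 assumes "open S"
 shows "smooth_on S (%x. c)"
  and "bounded_linear h ==> smooth_on S h"
  and "bounded_linear h' ==> smooth_on S f ==> smooth_on S (%x. h' (f x))"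
  and "smooth_on S f ==> smooth_on S g ==> smooth_on S (%x. f x + g x)"
  and "smooth_on S f' ==> smooth_on S g' ==> smooth_on S (%x. f' x * (g' x :: 'b::real_normed_algebra))"
  and "smooth_on S r ==> smooth_on S f ==> smooth_on S (%x. r x *\<^sub>R f x)"
  and "smooth_on S r ==> (\<And>x. x \<in> S ==> r x \<noteq> 0) ==> smooth_on S (%x. inverse (r x))"
  and "smooth_on S r ==> smooth_on S (%x. sin (r x :: real))"
  and "smooth_on S r ==> smooth_on S (%x. cos (r x))"
 using assms Ck_on_sin_cos[OF assms]
 by (simp_all add: smooth_on_def Ck_on_const Ck_on_bounded_linear Ck_on_linear_compose Ck_on_add Ck_on_mult
   Ck_on_inverse Ck_on_bilinear[OF _ bounded_bilinear_scaleR])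

lemmas smooth_on_const = smooth_on_intros(1)
 and smooth_on_linear = smooth_on_intros(2)
 and smooth_on_linear_compose = smooth_on_intros(3)
 and smooth_on_add = smooth_on_intros(4)
 and smooth_on_mult = smooth_on_intros(5)
 and smooth_on_scaleR = smooth_on_intros(6)
 and smooth_on_inverse = smooth_on_intros(7)
 and smooth_on_sin = smooth_on_intros(8)
 and smooth_on_cos = smooth_on_intros(9)

lemma smooth_on_cong: "open S ==> (\<And>x. x \<in> S ==> f x = g x) ==> smooth_on S f ==> smooth_on S g"
 unfolding smooth_on_def using Ck_on_cong[of S f g] by simp

lemma smooth_on_derivative: "smooth_on S f ==> x \<in> S ==> (f has_derivative frechet_derivative f (at x)) (at x)"
 unfolding smooth_on_def using Ck_on_Suc_D by blast

lemma smooth_on_partial: "smooth_on S f ==> smooth_on S (%x. frechet_derivative f (at x) v)"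
 unfolding smooth_on_def using Ck_on.simps(2) by blast

lemma smooth_on_continuous: "smooth_on S f ==> continuous_on S f"
 unfolding smooth_on_def using Ck_on.simps(1) by blast

subsection \<open>Symmetry of second derivatives\<close>

text \<open>
  The mean value theorem, applied twice in either order to the second difference over a small square.
\<close>

lemma mixed_partials_eq:
 fixes u u1 u2 u12 u21 :: "real => real => real"
 assumes d: "d > 0"
  and u1: "\<And>s t. \<bar>s\<bar> < d ==> \<bar>t\<bar> < d ==> ((%s. u s t) has_real_derivative u1 s t) (at s)"
  and u2: "\<And>s t. \<bar>s\<bar> < d ==> \<bar>t\<bar> < d ==> ((%t. u s t) has_real_derivative u2 s t) (at t)"
  and u12: "\<And>s t. \<bar>s\<bar> < d ==> \<bar>t\<bar> < d ==> ((%t. u1 s t) has_real_derivative u12 s t) (at t)"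
  and u21: "\<And>s t. \<bar>s\<bar> < d ==> \<bar>t\<bar> < d ==> ((%s. u2 s t) has_real_derivative u21 s t) (at s)"
  and c12: "\<And>e. e > 0 ==> \<exists>\<delta>>0. \<forall>s t. \<bar>s\<bar> < \<delta> \<longrightarrow> \<bar>t\<bar> < \<delta> \<longrightarrow> \<bar>u12 s t - u12 0 0\<bar> < e"
  and c21: "\<And>e. e > 0 ==> \<exists>\<delta>>0. \<forall>s t. \<bar>s\<bar> < \<delta> \<longrightarrow> \<bar>t\<bar> < \<delta> \<longrightarrow> \<bar>u21 s t - u21 0 0\<bar> < e"
 shows "u12 0 0 = u21 0 0"
proof (rule ccontr)
 assume ne: "u12 0 0 \<noteq> u21 0 0"
 define e where "e = \<bar>u12 0 0 - u21 0 0\<bar> / 2"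
 have e: "e > 0" using ne by (simp add: e_def)
 obtain \<delta>1 where \<delta>1: "\<delta>1 > 0" "\<And>s t. \<bar>s\<bar> < \<delta>1 ==> \<bar>t\<bar> < \<delta>1 ==> \<bar>u12 s t - u12 0 0\<bar> < e" using c12[OF e] by blast
 obtain \<delta>2 where \<delta>2: "\<delta>2 > 0" "\<And>s t. \<bar>s\<bar> < \<delta>2 ==> \<bar>t\<bar> < \<delta>2 ==> \<bar>u21 s t - u21 0 0\<bar> < e" using c21[OF e] by blast
 define h where "h = min d (min \<delta>1 \<delta>2) / 2"
 have h: "0 < h" "h < d" "h < \<delta>1" "h < \<delta>2" using d \<delta>1 \<delta>2 by (auto simp: h_def)
 have "\<exists>z. 0 < z \<and> z < h \<and> (u h h - u h 0) - (u 0 h - u 0 0) = (h - 0) * (u1 z h - u1 z 0)"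
  using h by (intro MVT2[of 0 h "%s. u s h - u s 0"]) (auto intro!: DERIV_diff u1)
 then obtain \<xi> where \<xi>: "0 < \<xi>" "\<xi> < h" "(u h h - u h 0) - (u 0 h - u 0 0) = h * (u1 \<xi> h - u1 \<xi> 0)" by auto
 have "\<exists>z. 0 < z \<and> z < h \<and> u1 \<xi> h - u1 \<xi> 0 = (h - 0) * u12 \<xi> z"
  using h \<xi> by (intro MVT2) (auto intro!: u12)
 then obtain \<eta> where \<eta>: "0 < \<eta>" "\<eta> < h" "u1 \<xi> h - u1 \<xi> 0 = h * u12 \<xi> \<eta>" by auto
 have "\<exists>z. 0 < z \<and> z < h \<and> (u h h - u 0 h) - (u h 0 - u 0 0) = (h - 0) * (u2 h z - u2 0 z)"
  using h by (intro MVT2[of 0 h "%t. u h t - u 0 t"]) (auto intro!: DERIV_diff u2)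
 then obtain \<xi>' where \<xi>': "0 < \<xi>'" "\<xi>' < h" "(u h h - u 0 h) - (u h 0 - u 0 0) = h * (u2 h \<xi>' - u2 0 \<xi>')" by auto
 have "\<exists>z. 0 < z \<and> z < h \<and> u2 h \<xi>' - u2 0 \<xi>' = (h - 0) * u21 z \<xi>'"
  using h \<xi>' by (intro MVT2[of 0 h "%s. u2 s \<xi>'"]) (auto intro!: u21)
 then obtain \<eta>' where \<eta>': "0 < \<eta>'" "\<eta>' < h" "u2 h \<xi>' - u2 0 \<xi>' = h * u21 \<eta>' \<xi>'" by auto
 have "h * (h * u12 \<xi> \<eta>) = h * (h * u21 \<eta>' \<xi>')"
  using \<xi>(3)[unfolded \<eta>(3)] \<xi>'(3)[unfolded \<eta>'(3)] by linarith
 then have "u12 \<xi> \<eta> = u21 \<eta>' \<xi>'" using h by simp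
 moreover have "\<bar>u12 \<xi> \<eta> - u12 0 0\<bar> < e" using \<xi> \<eta> h by (intro \<delta>1) auto
 moreover have "\<bar>u21 \<eta>' \<xi>' - u21 0 0\<bar> < e" using \<xi>' \<eta>' h by (intro \<delta>2) auto
 ultimately have "\<bar>u12 0 0 - u21 0 0\<bar> < 2 * e" by linarith
 then show False by (simp add: e_def)
qed

abbreviation dir :: "'a::real_normed_vector => ('a => 'b::real_normed_vector) => 'a => 'b" where
 "dir v f \<equiv> (%z. frechet_derivative f (at z) v)"

lemma smooth_on_line_derivative:
 assumes f: "smooth_on S f" and z: "z + s *\<^sub>R v \<in> S"
 shows "((%s. f (z + s *\<^sub>R v)) has_vector_derivative dir v f (z + s *\<^sub>R v)) (at s)"
proof -
 have "((%s. z + s *\<^sub>R v) has_vector_derivative v) (at s)"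
  by (auto intro!: derivative_eq_intros)
 from vector_derivative_diff_chain_within[OF this, of f] smooth_on_derivative[OF f z]
 show ?thesis by (auto simp: o_def has_derivative_at_withinI)
qed

lemma dir_symmetric_linear:
 fixes f :: "'a::real_normed_vector => 'b::real_normed_vector"
 assumes S: "open S" and f: "smooth_on S f" and z: "z \<in> S" and l: "bounded_linear (l :: 'b => real)"
 shows "l (dir v (dir w f) z) = l (dir w (dir v f) z)"
proof -
 obtain r where r: "r > 0" "ball z r \<subseteq> S" using S z openE by blast
 define K where "K = norm v + norm w + 1"
 have K: "K > 0" by (simp add: K_def add_nonneg_pos)
 have nb: "norm (s *\<^sub>R v + t *\<^sub>R w) < \<delta> * K" if "\<bar>s\<bar> < \<delta>" "\<bar>t\<bar> < \<delta>" for s t \<delta>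
 proof -
  have "norm (s *\<^sub>R v + t *\<^sub>R w) <= \<bar>s\<bar> * norm v + \<bar>t\<bar> * norm w" by (metis norm_scaleR norm_triangle_ineq)
  also have "... <= \<delta> * norm v + \<delta> * norm w" using that by (intro add_mono mult_right_mono) auto
  also have "... < \<delta> * K" using that by (simp add: K_def algebra_simps)
  finally show ?thesis .
 qed
 let ?d = "r / K"
 have inS: "z + s *\<^sub>R v + t *\<^sub>R w \<in> S" if "\<bar>s\<bar> < ?d" "\<bar>t\<bar> < ?d" for s t
  using nb[OF that] K r(2) by (auto simp: dist_norm add.assoc norm_minus_commute subset_iff mem_ball)
 have der: "((%s. l (F (z + s *\<^sub>R v + t *\<^sub>R w))) has_real_derivative l (dir v F (z + s *\<^sub>R v + t *\<^sub>R w))) (at s)"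
    "((%t. l (F (z + s *\<^sub>R v + t *\<^sub>R w))) has_real_derivative l (dir w F (z + s *\<^sub>R v + t *\<^sub>R w))) (at t)"
  if "smooth_on S F" "\<bar>s\<bar> < ?d" "\<bar>t\<bar> < ?d" for F s t
 proof -
  have "((%s. F ((z + t *\<^sub>R w) + s *\<^sub>R v)) has_vector_derivative dir v F ((z + t *\<^sub>R w) + s *\<^sub>R v)) (at s)"
   using inS[OF that(2,3)] by (intro smooth_on_line_derivative[OF that(1)]) (simp add: algebra_simps)
  then show "((%s. l (F (z + s *\<^sub>R v + t *\<^sub>R w))) has_real_derivative l (dir v F (z + s *\<^sub>R v + t *\<^sub>R w))) (at s)"
   unfolding has_real_derivative_iff_has_vector_derivative
   by (intro bounded_linear.has_vector_derivative[OF l]) (simp add: algebra_simps)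
  have "((%t. F ((z + s *\<^sub>R v) + t *\<^sub>R w)) has_vector_derivative dir w F ((z + s *\<^sub>R v) + t *\<^sub>R w)) (at t)"
   using inS[OF that(2,3)] by (intro smooth_on_line_derivative[OF that(1)]) simp
  then show "((%t. l (F (z + s *\<^sub>R v + t *\<^sub>R w))) has_real_derivative l (dir w F (z + s *\<^sub>R v + t *\<^sub>R w))) (at t)"
   unfolding has_real_derivative_iff_has_vector_derivative
   by (intro bounded_linear.has_vector_derivative[OF l])
 qed
 have cont: "\<exists>\<delta>>0. \<forall>s t. \<bar>s\<bar> < \<delta> \<longrightarrow> \<bar>t\<bar> < \<delta> \<longrightarrow> \<bar>l (F (z + s *\<^sub>R v + t *\<^sub>R w)) - l (F (z + 0 *\<^sub>R v + 0 *\<^sub>R w))\<bar> < e"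
  if F: "smooth_on S F" and e: "e > 0" for F e
 proof -
  have "continuous_on S (%x. l (F x))"
   using smooth_on_continuous[OF F] by (rule bounded_linear.continuous_on[OF l])
  then have "isCont (%x. l (F x)) z" using S z by (simp add: continuous_on_eq_continuous_at)
  then obtain \<rho> where \<rho>: "\<rho> > 0" "\<And>y. dist y z < \<rho> ==> dist (l (F y)) (l (F z)) < e"
   using e unfolding continuous_at_eps_delta by blast
  show ?thesis
  proof (intro exI[of _ "\<rho> / K"] conjI allI impI)
   fix s t assume "\<bar>s\<bar> < \<rho> / K" "\<bar>t\<bar> < \<rho> / K"
   then have "norm (s *\<^sub>R v + t *\<^sub>R w) < \<rho>" using nb[of s "\<rho> / K" t] K by simp
   then show "\<bar>l (F (z + s *\<^sub>R v + t *\<^sub>R w)) - l (F (z + 0 *\<^sub>R v + 0 *\<^sub>R w))\<bar> < e"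
    using \<rho>(2)[of "z + s *\<^sub>R v + t *\<^sub>R w"] by (simp add: dist_norm add.assoc)
  qed (use \<rho> K in simp)
 qed
 have "l (dir w (dir v f) (z + 0 *\<^sub>R v + 0 *\<^sub>R w)) = l (dir v (dir w f) (z + 0 *\<^sub>R v + 0 *\<^sub>R w))"
  using r K
  by (intro mixed_partials_eq[where d = ?d and u = "%s t. l (f (z + s *\<^sub>R v + t *\<^sub>R w))"
     and ?u1.0 = "%s t. l (dir v f (z + s *\<^sub>R v + t *\<^sub>R w))" and ?u2.0 = "%s t. l (dir w f (z + s *\<^sub>R v + t *\<^sub>R w))"
     and ?u12.0 = "%s t. l (dir w (dir v f) (z + s *\<^sub>R v + t *\<^sub>R w))" and ?u21.0 = "%s t. l (dir v (dir w f) (z + s *\<^sub>R v + t *\<^sub>R w))"]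
    der cont smooth_on_partial f) simp_all
 then show ?thesis by simp
qed

lemma dir_symmetric:
 fixes f :: "complex => complex"
 assumes "open S" "smooth_on S f" "z \<in> S"
 shows "dir v (dir w f) z = dir w (dir v f) z"
 using dir_symmetric_linear[OF assms bounded_linear_Re] dir_symmetric_linear[OF assms bounded_linear_Im]
 by (simp add: complex_eq_iff)

subsection \<open>Raising and lowering operators\<close>

definition raise :: "real => (complex => complex) => complex => complex" where
 "raise n f z = of_real (Im z) * (\<i> * dir 1 f z + dir \<i> f z) + of_real n * f z"

definition lower :: "real => (complex => complex) => complex => complex" where
 "lower n f z = of_real (Im z) * (- \<i> * dir 1 f z + dir \<i> f z) - of_real n * f z"

definition lap :: "(complex => complex) => complex => complex" where
 "lap f z = of_real ((Im z)\<^sup>2) * (dir 1 (dir 1 f) z + dir \<i> (dir \<i> f) z)"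

lemma raise_cong: "(\<And>z. z \<in> uhp ==> f z = g z) ==> z \<in> uhp ==> raise n f z = raise n g z"
proof -
 assume eq: "\<And>z. z \<in> uhp ==> f z = g z" and z: "z \<in> uhp"
 have "frechet_derivative f (at z) = frechet_derivative g (at z)"
  by (rule frechet_derivative_cong_open[OF open_uhp z eq])
 then show ?thesis by (simp add: raise_def eq[OF z])
qed

lemma dir_scale: 
 fixes f :: "complex => complex"
 assumes "smooth_on uhp f" "z \<in> uhp" shows "dir v (%z. c * f z) z = c * dir v f z"
proof -
 have "((%z. c * f z) has_derivative (%v. c * dir v f z)) (at z)"
  using smooth_on_derivative[OF assms] by (rule has_derivative_mult_right)
 then show ?thesis by (rule fun_cong[OF frechet_derivative_at, symmetric])
qed

lemma raise_scale: "smooth_on uhp f ==> z \<in> uhp ==> raise n (%z. c * f z) z = c * raise n f z"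
 by (simp add: raise_def dir_scale algebra_simps)

lemma lower_scale: "smooth_on uhp f ==> z \<in> uhp ==> lower n (%z. c * f z) z = c * lower n f z"
 by (simp add: lower_def dir_scale algebra_simps)

lemma bounded_linear_of_real_Im: "bounded_linear (%z. complex_of_real (Im z))"
 by (intro bounded_linear_compose[OF bounded_linear_of_real bounded_linear_Im])

lemma smooth_on_of_real_Im: "smooth_on uhp (%z. complex_of_real (Im z))"
 by (rule smooth_on_linear[OF open_uhp bounded_linear_of_real_Im])

lemma raise_smooth: "smooth_on uhp f ==> smooth_on uhp (raise n f)"
 unfolding raise_def
 by (intro smooth_on_const smooth_on_of_real_Im smooth_on_add smooth_on_mult smooth_on_partial open_uhp)

lemma lower_smooth: "smooth_on uhp f ==> smooth_on uhp (lower n f)"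
 unfolding lower_def diff_conv_add_uminus minus_mult_left of_real_minus[symmetric]
 by (intro smooth_on_const smooth_on_of_real_Im smooth_on_add smooth_on_mult smooth_on_partial open_uhp)

lemma dir_raise:
 assumes f: "smooth_on uhp f" and z: "z \<in> uhp"
 shows "dir v (raise n f) z = of_real (Im v) * (\<i> * dir 1 f z + dir \<i> f z)
   + of_real (Im z) * (\<i> * dir v (dir 1 f) z + dir v (dir \<i> f) z) + of_real n * dir v f z"
proof -
 note F = smooth_on_derivative[OF f z] and F1 = smooth_on_derivative[OF smooth_on_partial[OF f] z]
 have im: "((%z. complex_of_real (Im z)) has_derivative (%z. complex_of_real (Im z))) (at z)"
  by (rule bounded_linear_imp_has_derivative[OF bounded_linear_of_real_Im])
 have "(raise n f has_derivative (%v. of_real (Im v) * (\<i> * dir 1 f z + dir \<i> f z)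
   + of_real (Im z) * (\<i> * dir v (dir 1 f) z + dir v (dir \<i> f) z) + of_real n * dir v f z)) (at z)"
  unfolding raise_def
  by (rule has_derivative_eq_rhs[OF has_derivative_add[OF has_derivative_mult[OF im has_derivative_add[OF
    has_derivative_mult_right[OF F1, of "\<i>"] F1]] has_derivative_mult_right[OF F, of "of_real n"]]])
   (simp add: fun_eq_iff algebra_simps)
 then show ?thesis by (rule fun_cong[OF frechet_derivative_at, symmetric])
qed

lemma dir_lower:
 assumes f: "smooth_on uhp f" and z: "z \<in> uhp"
 shows "dir v (lower n f) z = of_real (Im v) * (- \<i> * dir 1 f z + dir \<i> f z)
   + of_real (Im z) * (- \<i> * dir v (dir 1 f) z + dir v (dir \<i> f) z) - of_real n * dir v f z"
proof -
 note F = smooth_on_derivative[OF f z] and F1 = smooth_on_derivative[OF smooth_on_partial[OF f] z]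
 have im: "((%z. complex_of_real (Im z)) has_derivative (%z. complex_of_real (Im z))) (at z)"
  by (rule bounded_linear_imp_has_derivative[OF bounded_linear_of_real_Im])
 have "(lower n f has_derivative (%v. of_real (Im v) * (- \<i> * dir 1 f z + dir \<i> f z)
   + of_real (Im z) * (- \<i> * dir v (dir 1 f) z + dir v (dir \<i> f) z) - of_real n * dir v f z)) (at z)"
  unfolding lower_def
  by (rule has_derivative_eq_rhs[OF has_derivative_diff[OF has_derivative_mult[OF im has_derivative_add[OF
    has_derivative_mult_right[OF F1, of "- \<i>"] F1]] has_derivative_mult_right[OF F, of "of_real n"]]])
   (simp add: fun_eq_iff algebra_simps)
 then show ?thesis by (rule fun_cong[OF frechet_derivative_at, symmetric])
qed

text \<open>
  Together with the formula for the opposite order this is the commutation relation of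
  \<open>E\<^sup>+\<close> and \<open>E\<^sup>-\<close> in coordinates.
\<close>

lemma lower_raise:
 assumes f: "smooth_on uhp f" and z: "z \<in> uhp"
 shows "lower (n + 1) (raise n f) z = lap f z - 2 * of_real n * \<i> * of_real (Im z) * dir 1 f z - of_real (n * (n + 1)) * f z"
proof -
 have sym: "dir \<i> (dir 1 f) z = dir 1 (dir \<i> f) z" by (rule dir_symmetric[OF open_uhp f z])
 show ?thesis
  unfolding lower_def[of _ "raise n f"] dir_raise[OF f z] sym raise_def lap_def
  by (simp add: algebra_simps power2_eq_square)
qed

lemma raise_lower:
 assumes f: "smooth_on uhp f" and z: "z \<in> uhp"
 shows "raise (n - 1) (lower n f) z = lap f z - 2 * of_real n * \<i> * of_real (Im z) * dir 1 f z - of_real (n * (n - 1)) * f z"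
proof -
 have sym: "dir \<i> (dir 1 f) z = dir 1 (dir \<i> f) z" by (rule dir_symmetric[OF open_uhp f z])
 show ?thesis
  unfolding raise_def[of _ "lower n f"] dir_lower[OF f z] sym lower_def lap_def
  by (simp add: algebra_simps power2_eq_square)
qed

lemma hyperbolic_laplacian_eq:
 assumes f: "smooth_on uhp f" and z: "z \<in> uhp"
 shows "hyperbolic_laplacian f z = lap f z"
proof -
 have pd: "partial_deriv v F w = dir v F w" if "smooth_on uhp F" "w \<in> uhp" for F v w
 proof -
  have "((%t. F (w + t *\<^sub>R v)) has_vector_derivative dir v F (w + 0 *\<^sub>R v)) (at 0)"
   by (rule smooth_on_line_derivative[OF that(1)]) (simp add: that)
  then show ?thesis
   by (simp add: partial_deriv_def vector_derivative_at scaleR_conv_of_real)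
 qed
 have "partial_deriv v (partial_deriv v f) z = dir v (dir v f) z" for v
 proof -
  have "((%t. dir v f (z + t *\<^sub>R v)) has_vector_derivative dir v (dir v f) (z + 0 *\<^sub>R v)) (at 0)"
   by (rule smooth_on_line_derivative[OF smooth_on_partial[OF f]]) (simp add: z)
  moreover have "open ((%t. z + t *\<^sub>R v) -` uhp)"
   by (intro open_vimage open_uhp continuous_intros)
  ultimately have "((%t. partial_deriv v f (z + t *\<^sub>R v)) has_vector_derivative dir v (dir v f) (z + 0 *\<^sub>R v)) (at 0)"
  proof (rule has_vector_derivative_transform_within_open)
   show "0 \<in> (%t. z + t *\<^sub>R v) -` uhp" using z by simp
   fix t assume "t \<in> (%t. z + t *\<^sub>R v) -` uhp"
   then show "dir v f (z + t *\<^sub>R v) = partial_deriv v f (z + t *\<^sub>R v)" by (simp add: pd[OF f])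
  qed
  then show ?thesis
   by (simp add: partial_deriv_def[of _ "partial_deriv v f"] vector_derivative_at scaleR_conv_of_real)
 qed
 then show ?thesis by (simp add: hyperbolic_laplacian_def lap_def)
qed

subsection \<open>The ladder generated by an eigenfunction\<close>

primrec ladder :: "real => (complex => complex) => nat => complex => complex" where
 "ladder s f 0 = f"
| "ladder s f (Suc n) = (%z. inverse (\<i> * of_real s + 1/2 + of_nat n) * raise (real n) (ladder s f n) z)"

lemma ladder_den_nz: "\<i> * of_real s + 1/2 + of_nat n \<noteq> 0"
 by (simp add: complex_eq_iff)

lemma ladder_smooth: "smooth_on uhp f ==> smooth_on uhp (ladder s f n)"
proof (induction n)
 case (Suc n)
 then show ?case unfolding ladder.simps
  by (intro smooth_on_mult smooth_on_const raise_smooth open_uhp)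
qed simp

lemma ladder_raise: "raise (real n) (ladder s f n) z = (\<i> * of_real s + 1/2 + of_nat n) * ladder s f (Suc n) z"
 using ladder_den_nz[of s n] by simp

text \<open>
  The case \<open>n = 0\<close> is the eigenvalue equation, since \<open>(\<i> s + 1/2) (\<i> s - 1/2) = - (1/4 + s\<^sup>2)\<close>; the step is the
  commutation relation.
\<close>

lemma ladder_lower:
 assumes f: "smooth_on uhp f" and eig: "\<And>z. z \<in> uhp ==> lap f z = - of_real (1/4 + s\<^sup>2) * f z"
 shows "z \<in> uhp ==> lower (real n + 1) (ladder s f (Suc n)) z = (\<i> * of_real s - 1/2 - of_nat n) * ladder s f n z"
proof (induction n arbitrary: z)
 case 0
 have "lower (0 + 1) (raise 0 f) z = - of_real (1/4 + s\<^sup>2) * f z"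
  using lower_raise[OF f 0, of 0] eig[OF 0] by simp
 then have "(\<i> * of_real s + 1/2) * lower (0 + 1) (ladder s f (Suc 0)) z = - of_real (1/4 + s\<^sup>2) * f z"
  using ladder_den_nz[of s 0] by (simp add: lower_scale raise_smooth f 0)
 also have "... = (\<i> * of_real s + 1/2) * ((\<i> * of_real s - 1/2) * f z)"
  by (simp add: algebra_simps power2_eq_square)
 finally show ?case using ladder_den_nz[of s 0] by simp
next
 case (Suc n)
 let ?f = "ladder s f" and ?m = "real (Suc n)"
 let ?a = "\<i> * of_real s + 1/2 + of_nat (Suc n)"
 have sm: "smooth_on uhp (?f k)" for k by (rule ladder_smooth[OF f])
 have "?a * lower (?m + 1) (?f (Suc (Suc n))) z = lower (?m + 1) (raise ?m (?f (Suc n))) z"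
  using ladder_den_nz[of s "Suc n"] Suc.prems by (subst ladder.simps) (simp add: lower_scale raise_smooth sm del: ladder.simps)
 also have "... = raise (?m - 1) (lower ?m (?f (Suc n))) z - 2 * of_real ?m * ?f (Suc n) z"
  unfolding lower_raise[OF sm Suc.prems] raise_lower[OF sm Suc.prems] by (simp add: algebra_simps)
 also have "raise (?m - 1) (lower ?m (?f (Suc n))) z = raise (real n) (%z. (\<i> * of_real s - 1/2 - of_nat n) * ?f n z) z"
 proof -
  have "raise (real n) (lower ?m (?f (Suc n))) z = raise (real n) (%z. (\<i> * of_real s - 1/2 - of_nat n) * ?f n z) z"
   by (rule raise_cong[OF _ Suc.prems]) (use Suc.IH in \<open>simp add: add.commute del: ladder.simps\<close>)
  then show ?thesis by simp
 qed
 also have "... = (\<i> * of_real s - 1/2 - of_nat n) * ((\<i> * of_real s + 1/2 + of_nat n) * ?f (Suc n) z)"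
  by (simp only: raise_scale[OF sm Suc.prems] ladder_raise)
 also have "... - 2 * of_real ?m * ?f (Suc n) z = ?a * ((\<i> * of_real s - 1/2 - of_nat (Suc n)) * ?f (Suc n) z)"
  by (simp add: field_simps del: ladder.simps)
 finally show ?case using ladder_den_nz[of s "Suc n"] by (simp add: add.commute del: ladder.simps)
qed

section \<open>Weight vectors as functions on the group\<close>

text \<open>
  In the coordinates of the Iwasawa decomposition, \<open>Jf g\<close> is \<open>exp (2 i \<theta>)\<close>; so \<open>WF n f\<close> is the function of
 weight \<open>2 n\<close> that corresponds to the automorphic form \<open>f\<close> on the upper half-plane.
\<close>

definition Jf :: "real^2^2 => complex" where
 "Jf g = cnj (den g \<i>) / den g \<i>"

definition WF :: "nat => (complex => complex) => real^2^2 => complex" where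
 "WF n f g = Jf g ^ n * f (act g \<i>)"

lemma den_i: "den g \<i> = Complex (g$2$2) (g$2$1)"
 by (simp add: den_def complex_eq_iff)

lemma den_i_nz: "g \<in> SL2 ==> den g \<i> \<noteq> 0"
 using den_nz[of g \<i>] by simp

lemma norm_Jf: "g \<in> SL2 ==> cmod (Jf g) = 1"
 using den_i_nz[of g] by (simp add: Jf_def norm_divide)

lemma Jf_cnj: "g \<in> SL2 ==> Jf g * cnj (Jf g) = 1"
 using norm_Jf[of g] by (simp add: complex_norm_square[symmetric])

lemma continuous_Jf: "continuous_on SL2 Jf"
 unfolding Jf_def using den_i_nz by (intro continuous_intros) (auto simp: den_def intro!: continuous_intros)

lemma continuous_WF:
 assumes "continuous_on uhp f" shows "continuous_on SL2 (WF n f)"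
proof -
 have "continuous_on SL2 (%g. f (act g \<i>))"
  by (rule continuous_on_compose2[OF assms continuous_act_i]) (auto intro: act_uhp)
 then show ?thesis unfolding WF_def by (intro continuous_intros continuous_Jf)
qed

text \<open>
  The derivative of a weight vector along a one-parameter subgroup with generator \<open>A\<close>, in terms of
 its images under the raising and the lowering operator.
\<close>

definition DWF :: "real^2^2 => nat => (complex => complex) => real^2^2 => complex" where
 "DWF A n f g = 
   of_real (A$1$1) * (WF (Suc n) (raise (real n) f) g + cnj (Jf g) * WF n (lower (real n) f) g)
  + of_real (A$1$2 + A$2$1) / (2 * \<i>) * (WF (Suc n) (raise (real n) f) g - cnj (Jf g) * WF n (lower (real n) f) g)
  + of_real (A$1$2 - A$2$1) * \<i> * of_nat n * WF n f g"

lemma has_vector_derivative_matrix: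
 fixes h :: "real => real^2^2"
 assumes "(h has_vector_derivative A) F"
 shows "((%t. (h t)$i$j) has_vector_derivative A$i$j) F"
 by (intro bounded_linear.has_vector_derivative[OF bounded_linear_vec_nth] assms)

lemma has_vector_derivative_Complex:
 assumes "(a has_vector_derivative a') F" "(b has_vector_derivative b') F"
 shows "((%t. Complex (a t) (b t)) has_vector_derivative Complex a' b') F"
proof -
 have "((%t. complex_of_real (a t) + \<i> * complex_of_real (b t)) has_vector_derivative complex_of_real a' + \<i> * complex_of_real b') F"
  by (intro has_vector_derivative_add has_vector_derivative_mult_right has_vector_derivative_of_real
    assms[folded has_real_derivative_iff_has_vector_derivative])
 then show ?thesis by (simp add: Complex_eq)
qed

lemma WF_derivative_algebra:
 fixes J c x y F1 F2 F a s b m :: complex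
 assumes J: "J * c = 1" 
 shows "m * (c * x) * (a * (J * J - 1) + \<i> * b * J - \<i> / 2 * s * (1 + J * J)) * F
   + x * (J * (2 * \<i> * a + s) * y / 2 * (F1 - \<i> * F2) + c * (- 2 * \<i> * a + s) * y / 2 * (F1 + \<i> * F2))
  = a * (J * x * (y * (\<i> * F1 + F2) + m * F) + c * (x * (y * (- \<i> * F1 + F2) - m * F)))
   + s / (2 * \<i>) * (J * x * (y * (\<i> * F1 + F2) + m * F) - c * (x * (y * (- \<i> * F1 + F2) - m * F)))
   + b * \<i> * m * (x * F)"
proof -
 define h :: complex where "h = 1 / 2"
 have h: "2 * h = 1" "\<And>z. z / 2 = h * z" by (simp_all add: h_def)
 have "1 / (2 * \<i>) = - (\<i> * h)" by (simp add: h_def complex_eq_iff)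
 then have h3: "s / (2 * \<i>) = - (\<i> * (h * s))"
  by (metis mult.assoc mult.commute mult_minus_left times_divide_eq_right mult_1_right)
 have i: "\<i> * \<i> = -1" by simp
 have A: "m * (c * x) * (a * (J * J - 1) + \<i> * b * J - \<i> * h * s * (1 + J * J)) * F
   = m * x * F * (a * (J - c) + \<i> * b - \<i> * h * s * (c + J))"
  using J by algebra
 have B: "x * (J * (2 * \<i> * a + s) * y * h * (F1 - \<i> * F2) + c * (- 2 * \<i> * a + s) * y * h * (F1 + \<i> * F2))
   = x * y * (a * (J * (\<i> * F1 + F2) + c * (- \<i> * F1 + F2))
    - \<i> * h * s * (J * (\<i> * F1 + F2) - c * (- \<i> * F1 + F2)))"
  using h(1) i by algebra
 have "m * (c * x) * (a * (J * J - 1) + \<i> * b * J - \<i> / 2 * s * (1 + J * J)) * F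
   + x * (J * (2 * \<i> * a + s) * y / 2 * (F1 - \<i> * F2) + c * (- 2 * \<i> * a + s) * y / 2 * (F1 + \<i> * F2))
  = m * x * F * (a * (J - c) + \<i> * b - \<i> * h * s * (c + J)) + x * y * (a * (J * (\<i> * F1 + F2) + c * (- \<i> * F1 + F2))
    - \<i> * h * s * (J * (\<i> * F1 + F2) - c * (- \<i> * F1 + F2)))"
  unfolding A[symmetric] B[symmetric] by (simp add: h_def)
 also have "... = a * (J * x * (y * (\<i> * F1 + F2) + m * F) + c * (x * (y * (- \<i> * F1 + F2) - m * F)))
   + s / (2 * \<i>) * (J * x * (y * (\<i> * F1 + F2) + m * F) - c * (x * (y * (- \<i> * F1 + F2) - m * F)))
   + b * \<i> * m * (x * F)"
  unfolding h3 by (simp add: ring_distribs mult_ac)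
 finally show ?thesis .
qed

lemma WF_curve_derivative:
 fixes h :: "real => real^2^2"
 assumes h: "(h has_vector_derivative A) (at 0)" and h0: "h 0 = mat 1" and hS: "\<And>t. h t \<in> SL2"
  and A: "A$2$2 = - A$1$1" and g: "g \<in> SL2" and f: "smooth_on uhp f"
 shows "((%t. WF n f (g ** h t)) has_vector_derivative DWF A n f g) (at 0)"
proof -
 let ?\<alpha> = "A$1$1" and ?\<beta> = "A$1$2" and ?\<gamma> = "A$2$1"
 define a b c d where abcd: "a = g$1$1" "b = g$1$2" "c = g$2$1" "d = g$2$2"
 define z where "z = act g \<i>"
 have zu: "z \<in> uhp" using g by (simp add: z_def act_uhp)
 define U N U' N' where U: "U = Complex d c" and N: "N = Complex b a" 
  and U': "U' = Complex (c * ?\<beta> - d * ?\<alpha>) (c * ?\<alpha> + d * ?\<gamma>)" and N': "N' = Complex (a * ?\<beta> - b * ?\<alpha>) (a * ?\<alpha> + b * ?\<gamma>)"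
 have det: "a * d - b * c = 1" using g by (simp add: mem_SL2 abcd)
 have Unz: "U \<noteq> 0" using den_i_nz[OF g] by (simp add: den_i U abcd)
 have den: "den (g ** h t) \<i> = Complex (c * (h t)$1$2 + d * (h t)$2$2) (c * (h t)$1$1 + d * (h t)$2$1)" for t
  by (simp add: den_i mult_nth2 abcd)
 have num: "num (g ** h t) \<i> = Complex (a * (h t)$1$2 + b * (h t)$2$2) (a * (h t)$1$1 + b * (h t)$2$1)" for t
  by (simp add: num_def complex_eq_iff mult_nth2 abcd)
 have entry: "((%t. (h t)$i$j) has_vector_derivative A$i$j) (at 0)" for i j
  by (rule has_vector_derivative_matrix[OF h])
 have dU: "((%t. den (g ** h t) \<i>) has_vector_derivative U') (at 0)"
  unfolding den U'
  by (rule has_vector_derivative_Complex; rule has_vector_derivative_eq_rhs[OF has_vector_derivative_add[OF has_vector_derivative_mult_right[OF entry] has_vector_derivative_mult_right[OF entry]]])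
   (simp_all add: A)
 have dN: "((%t. num (g ** h t) \<i>) has_vector_derivative N') (at 0)"
  unfolding num N'
  by (rule has_vector_derivative_Complex; rule has_vector_derivative_eq_rhs[OF has_vector_derivative_add[OF has_vector_derivative_mult_right[OF entry] has_vector_derivative_mult_right[OF entry]]])
   (simp_all add: A)
 have U0: "den (g ** h 0) \<i> = U" by (simp add: h0 den_i U abcd)
 have N0: "num (g ** h 0) \<i> = N" by (simp add: h0 num_def complex_eq_iff N abcd)
 have dcU: "((%t. cnj (den (g ** h t) \<i>)) has_vector_derivative cnj U') (at 0)"
  by (rule bounded_linear.has_vector_derivative[OF bounded_linear_cnj dU])
 have quot: "((%t. P t / Q t) has_vector_derivative (p' * Q 0 - P 0 * q') / (Q 0 * Q 0)) (at 0)"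
  if "(P has_vector_derivative p') (at 0)" "(Q has_vector_derivative q') (at 0)" "Q 0 \<noteq> 0"
  for P Q :: "real => complex" and p' q'
 proof -
  have "((%t. P t / Q t) has_derivative (%t. - P 0 * (inverse (Q 0) * (t *\<^sub>R q') * inverse (Q 0)) + (t *\<^sub>R p') / Q 0)) (at 0)"
   using has_derivative_divide[OF that(1,2)[unfolded has_vector_derivative_def] that(3)] .
  then show ?thesis unfolding has_vector_derivative_def
   by (rule has_derivative_eq_rhs) (use that(3) in \<open>auto simp: fun_eq_iff field_simps scaleR_conv_of_real\<close>)
 qed
 define J where "J = Jf g"
 have J: "J = cnj U / U" by (simp add: J_def Jf_def den_i U abcd)
 define Jc where "Jc = cnj J"
 have JJ: "J * Jc = 1" unfolding Jc_def J_def by (rule Jf_cnj[OF g])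
 let ?\<sigma> = "?\<beta> + ?\<gamma>"
 define J' where "J' = of_real ?\<alpha> * (J * J - 1) + \<i> * of_real (?\<beta> - ?\<gamma>) * J - \<i> / 2 * of_real ?\<sigma> * (1 + J * J)"
 have dJ: "((%t. Jf (g ** h t)) has_vector_derivative J') (at 0)"
 proof -
  have "(cnj U' * U - cnj U * U') / (U * U) = J'"
  proof -
   have "cnj U' * U - cnj U * U' = of_real ?\<alpha> * (cnj U * cnj U - U * U) + \<i> * of_real (?\<beta> - ?\<gamma>) * (cnj U * U) - \<i> / 2 * of_real ?\<sigma> * (U * U + cnj U * cnj U)"
    by (simp add: U U' complex_eq_iff algebra_simps)
   also have "... = J' * (U * U)" unfolding J'_def J using Unz by (simp add: field_simps)
   finally show ?thesis using Unz by (simp add: field_simps)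
  qed
  then show ?thesis
   using quot[OF dcU dU] Unz unfolding U0 Jf_def by simp
 qed
 define y where "y = Im z"
 have y: "complex_of_real y * (cnj U * U) = 1"
 proof -
  have "y = 1 / (cmod U)\<^sup>2" using Im_act[OF g, of \<i>] by (simp add: y_def z_def den_i U abcd)
  moreover have "cnj U * U = of_real ((cmod U)\<^sup>2)" by (metis complex_norm_square mult.commute)
  ultimately show ?thesis using Unz by (simp flip: of_real_mult)
 qed
 define z' where "z' = of_real y * J * (2 * \<i> * of_real ?\<alpha> + of_real ?\<sigma>)"
 have dz: "((%t. act (g ** h t) \<i>) has_vector_derivative z') (at 0)"
 proof -
  have "N' * U - N * U' = (2 * \<i> * of_real ?\<alpha> + of_real ?\<sigma>) * of_real (a * d - b * c)"
   by (simp add: U U' N N' complex_eq_iff algebra_simps)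
  then have e: "N' * U - N * U' = 2 * \<i> * of_real ?\<alpha> + of_real ?\<sigma>" by (simp add: det)
  have "z' * (U * U) = (of_real y * (cnj U * U)) * (2 * \<i> * of_real ?\<alpha> + of_real ?\<sigma>)"
   unfolding z'_def J using Unz by (simp add: field_simps)
  then have "z' * (U * U) = N' * U - N * U'" by (simp add: y e)
  then have "(N' * U - N * U') / (U * U) = z'" using Unz by (simp add: field_simps)
  then show ?thesis
   using quot[OF dN dU] Unz unfolding U0 N0 act_num_den by simp
 qed
 define F1 F2 where F: "F1 = dir 1 f z" "F2 = dir \<i> f z"
 have lin: "bounded_linear (frechet_derivative f (at z))"
  using smooth_on_derivative[OF f zu] by (rule has_derivative_bounded_linear)
 have Dv: "frechet_derivative f (at z) v = v / 2 * (F1 - \<i> * F2) + cnj v / 2 * (F1 + \<i> * F2)" for v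
 proof -
  interpret bounded_linear "frechet_derivative f (at z)" by (rule lin)
  have "v = Re v *\<^sub>R 1 + Im v *\<^sub>R \<i>" by (simp add: complex_eq_iff)
  then have "frechet_derivative f (at z) v = frechet_derivative f (at z) (Re v *\<^sub>R 1 + Im v *\<^sub>R \<i>)"
   by (rule arg_cong)
  also have "... = of_real (Re v) * F1 + of_real (Im v) * F2"
   unfolding add scaleR F by (simp only: scaleR_conv_of_real)
  also have "... = v / 2 * (F1 - \<i> * F2) + cnj v / 2 * (F1 + \<i> * F2)"
   by (simp add: complex_eq_iff field_simps)
  finally show ?thesis .
 qed
 have df: "((%t. f (act (g ** h t) \<i>)) has_vector_derivative frechet_derivative f (at z) z') (at 0)"
 proof -
  have fz: "(f has_derivative frechet_derivative f (at z)) (at (act (g ** h 0) \<i>))"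
   using smooth_on_derivative[OF f zu] by (simp add: h0 z_def)
  show ?thesis
   using has_derivative_compose[OF dz[unfolded has_vector_derivative_def] fz] 
   by (simp add: has_vector_derivative_def linear_cmul[OF bounded_linear.linear[OF lin]])
 qed
 have dp: "((%t. Jf (g ** h t) ^ n) has_vector_derivative of_nat n * J ^ (n - 1) * J') (at 0)"
 proof -
  have "((%t. Jf (g ** h t) ^ n) has_derivative (%t. of_nat n * (t *\<^sub>R J') * Jf (g ** h 0) ^ (n - 1))) (at 0)"
   by (rule has_derivative_power[OF dJ[unfolded has_vector_derivative_def]])
  then show ?thesis unfolding has_vector_derivative_def
   by (rule has_derivative_eq_rhs) (simp add: fun_eq_iff h0 J_def mult_ac scaleR_conv_of_real)
 qed
 have pw: "of_nat n * J ^ (n - 1) = of_nat n * (Jc * J ^ n)"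
  using JJ by (cases n) (simp_all add: mult.commute mult.left_commute)
 have "((%t. WF n f (g ** h t)) has_vector_derivative
   J ^ n * frechet_derivative f (at z) z' + of_nat n * J ^ (n - 1) * J' * f z) (at 0)"
  using has_vector_derivative_mult[OF dp df] by (simp add: WF_def h0 J_def z_def)
 moreover have "J ^ n * frechet_derivative f (at z) z' + of_nat n * J ^ (n - 1) * J' * f z = DWF A n f g"
 proof -
  have cz: "cnj z' = of_real y * Jc * (- 2 * \<i> * of_real ?\<alpha> + of_real ?\<sigma>)" by (simp add: z'_def Jc_def)
  have "J ^ n * frechet_derivative f (at z) z' + of_nat n * J ^ (n - 1) * J' * f z
   = of_nat n * (Jc * J ^ n) * (of_real ?\<alpha> * (J * J - 1) + \<i> * of_real (?\<beta> - ?\<gamma>) * J - \<i> / 2 * of_real ?\<sigma> * (1 + J * J)) * f z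
    + J ^ n * (J * (2 * \<i> * of_real ?\<alpha> + of_real ?\<sigma>) * of_real y / 2 * (F1 - \<i> * F2)
     + Jc * (- 2 * \<i> * of_real ?\<alpha> + of_real ?\<sigma>) * of_real y / 2 * (F1 + \<i> * F2))"
   unfolding pw Dv cz unfolding z'_def J'_def by (simp add: mult_ac add.commute)
  also have "... = DWF A n f g"
   unfolding WF_derivative_algebra[OF JJ] DWF_def WF_def raise_def lower_def J_def[symmetric] Jc_def[symmetric] z_def[symmetric] F[symmetric] y_def[symmetric]
   by (simp add: mult_ac)
  finally show ?thesis .
 qed
 ultimately show ?thesis by simp
qed

subsection \<open>One-parameter subgroups\<close>

definition aflow :: "real => real^2^2" where "aflow t = mat2 (exp t) 0 0 (exp (- t))"
definition nplus :: "real => real^2^2" where "nplus p = mat2 1 p 0 1"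
definition nminus :: "real => real^2^2" where "nminus q = mat2 1 0 q 1"
definition rot :: "real => real^2^2" where "rot \<theta> = mat2 (cos \<theta>) (sin \<theta>) (- sin \<theta>) (cos \<theta>)"

lemma has_vector_derivative_mat2:
 assumes "(a has_vector_derivative a') F" "(b has_vector_derivative b') F" "(c has_vector_derivative c') F" "(d has_vector_derivative d') F"
 shows "((%t. mat2 (a t) (b t) (c t) (d t)) has_vector_derivative mat2 a' b' c' d') F"
proof -
 have e: "mat2 p q r s = p *\<^sub>R mat2 1 0 0 0 + q *\<^sub>R mat2 0 1 0 0 + r *\<^sub>R mat2 0 0 1 0 + s *\<^sub>R mat2 0 0 0 1" for p q r s
  by (simp add: mat2_eq_iff)
 have sc: "((%t. u t *\<^sub>R (M :: real^2^2)) has_vector_derivative u' *\<^sub>R M) F" if "(u has_vector_derivative u') F" for u u' M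
  using bounded_linear.has_vector_derivative[OF bounded_linear_scaleR_left that] .
 show ?thesis unfolding e[of "a _"] e[of a'] by (intro has_vector_derivative_add sc assms)
qed

definition one_param :: "(real => real^2^2) => real^2^2 => bool" where
 "one_param h A \<longleftrightarrow> (\<forall>t. h t \<in> SL2) \<and> (\<forall>s t. h (s + t) = h s ** h t) \<and> h 0 = mat 1 \<and> A$2$2 = - A$1$1 \<and>
   (h has_vector_derivative A) (at 0)"

lemma one_param_aflow: "one_param aflow (mat2 1 0 0 (-1))"
 unfolding one_param_def aflow_def
 by (auto simp: mat2_in_SL2 mat2_eq_iff mult_nth2 exp_add[symmetric] intro!: has_vector_derivative_mat2
   has_vector_derivative_const derivative_eq_intros simp flip: has_real_derivative_iff_has_vector_derivative)

lemma one_param_nplus: "one_param nplus (mat2 0 1 0 0)"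
 unfolding one_param_def nplus_def
 by (auto simp: mat2_in_SL2 mat2_eq_iff mult_nth2 intro!: has_vector_derivative_mat2
   has_vector_derivative_const derivative_eq_intros simp flip: has_real_derivative_iff_has_vector_derivative)

lemma one_param_nminus: "one_param nminus (mat2 0 0 1 0)"
 unfolding one_param_def nminus_def
 by (auto simp: mat2_in_SL2 mat2_eq_iff mult_nth2 intro!: has_vector_derivative_mat2
   has_vector_derivative_const derivative_eq_intros simp flip: has_real_derivative_iff_has_vector_derivative)

lemma WF_flow_derivative:
 assumes h: "one_param h A" and g: "g \<in> SL2" and f: "smooth_on uhp f"
 shows "((%t. WF n f (g ** h t)) has_vector_derivative DWF A n f (g ** h t)) (at t)"
proof -
 have "((%u. WF n f ((g ** h t) ** h u)) has_vector_derivative DWF A n f (g ** h t)) (at 0)"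
  using h g SL2_mult by (intro WF_curve_derivative f) (auto simp: one_param_def)
 then have *: "((%u. WF n f (g ** h (t + u))) has_vector_derivative DWF A n f (g ** h t)) (at (t - t))"
  using h by (simp add: one_param_def matrix_mul_assoc)
 have "((%u. u - t) has_vector_derivative 1) (at t)"
  by (auto intro!: derivative_eq_intros)
 from vector_diff_chain_at[OF this, of "%u. WF n f (g ** h (t + u))"] * show ?thesis
  by (simp add: o_def)
qed

lemma sums_mat2:
 assumes "a sums a'" "b sums b'" "c sums c'" "d sums d'"
 shows "(%n. mat2 (a n) (b n) (c n) (d n)) sums mat2 a' b' c' d'"
proof -
 have e: "mat2 p q r s = p *\<^sub>R mat2 1 0 0 0 + q *\<^sub>R mat2 0 1 0 0 + r *\<^sub>R mat2 0 0 1 0 + s *\<^sub>R mat2 0 0 0 1" for p q r s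
  by (simp add: mat2_eq_iff)
 show ?thesis unfolding e[of "a _"] e[of a'] by (intro sums_add sums_scaleR_left assms)
qed

lemma mexp_diag: "mexp (t *\<^sub>R mat2 (1/2) 0 0 (-1/2)) = aflow (t / 2)"
proof -
 have p: "(((**) (t *\<^sub>R mat2 (1/2) 0 0 (-1/2))) ^^ n) (mat 1) = mat2 ((t/2)^n) 0 0 ((- (t/2))^n)" for n
  by (induction n) (simp_all add: mat2_eq_iff mult_nth2)
 have e: "(%n. (1 / fact n) *\<^sub>R mat2 ((t/2)^n) 0 0 ((- (t/2))^n)) = (%n. mat2 ((t/2)^n /\<^sub>R fact n) 0 0 ((- (t/2))^n /\<^sub>R fact n))"
  by (simp add: fun_eq_iff mat2_eq_iff field_simps)
 have "(%n. mat2 ((t/2)^n /\<^sub>R fact n) 0 0 ((- (t/2))^n /\<^sub>R fact n)) sums aflow (t / 2)"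
  unfolding aflow_def by (intro sums_mat2 exp_converges sums_zero)
 then show ?thesis unfolding mexp_def p e by (rule sums_unique[symmetric])
qed

lemma mexp_antidiag: "mexp (t *\<^sub>R mat2 0 (1/2) (1/2) 0) = mat2 (cosh (t/2)) (sinh (t/2)) (sinh (t/2)) (cosh (t/2))"
proof -
 define x where "x = t / 2"
 have p: "(((**) (t *\<^sub>R mat2 0 (1/2) (1/2) 0)) ^^ n) (mat 1) = mat2 ((x^n + (- x)^n)/2) ((x^n - (- x)^n)/2) ((x^n - (- x)^n)/2) ((x^n + (- x)^n)/2)" for n
 proof (induction n)
  case (Suc n)
  have M: "t *\<^sub>R mat2 0 (1/2) (1/2) 0 = mat2 0 x x 0" by (simp add: mat2_eq_iff x_def)
  show ?case unfolding funpow.simps o_apply Suc.IH unfolding M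
   by (simp add: mat2_eq_iff mult_nth2 algebra_simps add_divide_distrib diff_divide_distrib)
 qed (simp add: mat2_eq_iff)
 have c: "(%n. (x^n /\<^sub>R fact n + (-x)^n /\<^sub>R fact n) / 2) sums cosh x"
  unfolding cosh_def by (simp add: scaleR_conv_of_real) 
   (use sums_divide[OF sums_add[OF exp_converges[of x] exp_converges[of "-x"]], of 2] in \<open>simp add: field_simps\<close>)
 have s: "(%n. (x^n /\<^sub>R fact n - (-x)^n /\<^sub>R fact n) / 2) sums sinh x"
  unfolding sinh_def by (simp add: scaleR_conv_of_real) 
   (use sums_divide[OF sums_diff[OF exp_converges[of x] exp_converges[of "-x"]], of 2] in \<open>simp add: field_simps\<close>)
 have e: "(%n. (1 / fact n) *\<^sub>R mat2 ((x^n + (- x)^n)/2) ((x^n - (- x)^n)/2) ((x^n - (- x)^n)/2) ((x^n + (- x)^n)/2))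
  = (%n. mat2 ((x^n /\<^sub>R fact n + (-x)^n /\<^sub>R fact n) / 2) ((x^n /\<^sub>R fact n - (-x)^n /\<^sub>R fact n) / 2)
    ((x^n /\<^sub>R fact n - (-x)^n /\<^sub>R fact n) / 2) ((x^n /\<^sub>R fact n + (-x)^n /\<^sub>R fact n) / 2))"
  by (simp add: fun_eq_iff mat2_eq_iff field_simps)
 show ?thesis unfolding mexp_def p e x_def[symmetric] by (rule sums_unique[symmetric, OF sums_mat2[OF c s s c]])
qed

lemma one_param_mexp_diag: "one_param (%t. mexp (t *\<^sub>R mat2 (1/2) 0 0 (-1/2))) (mat2 (1/2) 0 0 (-1/2))"
 unfolding one_param_def mexp_diag aflow_def
 by (auto simp: mat2_in_SL2 mat2_eq_iff mult_nth2 exp_add[symmetric] add_divide_distrib intro!: has_vector_derivative_mat2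
   has_vector_derivative_const derivative_eq_intros simp flip: has_real_derivative_iff_has_vector_derivative)

lemma one_param_mexp_antidiag: "one_param (%t. mexp (t *\<^sub>R mat2 0 (1/2) (1/2) 0)) (mat2 0 (1/2) (1/2) 0)"
 unfolding one_param_def mexp_antidiag
 by (auto simp: mat2_in_SL2 mat2_eq_iff mult_nth2 cosh_add sinh_add add_divide_distrib hyperbolic_pythagoras 
   power2_eq_square[symmetric] mult.commute add.commute intro!: has_vector_derivative_mat2
   has_vector_derivative_const derivative_eq_intros simp flip: has_real_derivative_iff_has_vector_derivative)

subsection \<open>The operators \<open>E\<^sup>+\<close> and \<open>E\<^sup>-\<close>\<close>

context surface_group begin

lemma translate_coset: "translate (pX g) h = pX (g ** h)"
 by (auto simp: translate_def coset_def image_image matrix_mul_assoc)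

lemma pullback_coset: "g \<in> SL2 ==> pullback \<phi> (pX g) = \<phi> (pM (act g \<i>))"
 by (simp add: pullback_def coset_def orbit_def image_image act_mult)

lemma lie_deriv_WF:
 assumes F: "\<And>g. g \<in> SL2 ==> F (pX g) = WF n f g" and f: "smooth_on uhp f" and g: "g \<in> SL2"
  and h: "one_param (%t. mexp (t *\<^sub>R A)) A"
 shows "lie_deriv A F (pX g) = DWF A n f g"
  and "lie_deriv A (%x. cnj (F x)) (pX g) = cnj (DWF A n f g)"
proof -
 have hS: "mexp (t *\<^sub>R A) \<in> SL2" for t using h by (simp add: one_param_def)
 have F': "F (translate (pX g) (mexp (t *\<^sub>R A))) = WF n f (g ** mexp (t *\<^sub>R A))" for t
  by (simp add: translate_coset F SL2_mult g hS)
 have d: "((%t. WF n f (g ** mexp (t *\<^sub>R A))) has_vector_derivative DWF A n f g) (at 0)"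
  using h g by (intro WF_curve_derivative f) (auto simp: one_param_def)
 then show "lie_deriv A F (pX g) = DWF A n f g"
  unfolding lie_deriv_def F' by (rule vector_derivative_at)
 have "((%t. cnj (WF n f (g ** mexp (t *\<^sub>R A)))) has_vector_derivative cnj (DWF A n f g)) (at 0)"
  by (rule bounded_linear.has_vector_derivative[OF bounded_linear_cnj d])
 then show "lie_deriv A (%x. cnj (F x)) (pX g) = cnj (DWF A n f g)"
  unfolding lie_deriv_def F' by (rule vector_derivative_at)
qed

lemma E_WF:
 assumes F: "\<And>g. g \<in> SL2 ==> F (pX g) = WF n f g" and f: "smooth_on uhp f" and g: "g \<in> SL2"
 shows "E_plus F (pX g) = WF (Suc n) (raise (real n) f) g"
  and "E_minus (%x. cnj (F x)) (pX g) = cnj (WF (Suc n) (raise (real n) f) g)"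
proof -
 let ?P = "WF (Suc n) (raise (real n) f) g" and ?M = "cnj (Jf g) * WF n (lower (real n) f) g"
 have 1: "DWF (mat2 (1/2) 0 0 (-1/2)) n f g = (?P + ?M) / 2"
  by (simp add: DWF_def)
 have 2: "DWF (mat2 0 (1/2) (1/2) 0) n f g = (?P - ?M) / (2 * \<i>)"
  by (simp add: DWF_def)
 have "(?P + ?M) / 2 + \<i> * ((?P - ?M) / (2 * \<i>)) = ?P" by (simp add: field_simps)
 then have 3: "DWF (mat2 (1/2) 0 0 (-1/2)) n f g + \<i> * DWF (mat2 0 (1/2) (1/2) 0) n f g = ?P"
  unfolding 1 2 .
 have l: "lie_deriv (mat2 (1/2) 0 0 (-1/2)) F (pX g) = DWF (mat2 (1/2) 0 0 (-1/2)) n f g"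
  "lie_deriv (mat2 0 (1/2) (1/2) 0) F (pX g) = DWF (mat2 0 (1/2) (1/2) 0) n f g"
  "lie_deriv (mat2 (1/2) 0 0 (-1/2)) (%x. cnj (F x)) (pX g) = cnj (DWF (mat2 (1/2) 0 0 (-1/2)) n f g)"
  "lie_deriv (mat2 0 (1/2) (1/2) 0) (%x. cnj (F x)) (pX g) = cnj (DWF (mat2 0 (1/2) (1/2) 0) n f g)"
  by (intro lie_deriv_WF f g one_param_mexp_diag one_param_mexp_antidiag; simp add: F)+
 show "E_plus F (pX g) = ?P"
  unfolding E_plus_def l by (rule 3)
 show "E_minus (%x. cnj (F x)) (pX g) = cnj ?P"
  unfolding E_minus_def l using arg_cong[OF 3, of cnj] by simp
qed

definition lift_M :: "(complex set => complex) => complex => complex" where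
 "lift_M \<phi> z = \<phi> (pM z)"

definition up :: "real => (complex => complex) => nat => real^2^2 => complex" where
 "up s f n = WF n (ladder s f n)"

lemma up_Suc: "up s f (Suc n) g = inverse (\<i> * of_real s + 1/2 + of_nat n) * WF (Suc n) (raise (real n) (ladder s f n)) g"
 unfolding up_def WF_def ladder.simps by (simp only: mult.left_commute)

lemma weight_up_coset:
 assumes "smooth_on uhp (lift_M \<phi>)"
 shows "g \<in> SL2 ==> weight_up s \<phi> n (pX g) = up s (lift_M \<phi>) n g"
proof (induction n arbitrary: g)
 case 0
 then show ?case by (simp add: up_def WF_def pullback_coset lift_M_def)
next
 case (Suc n)
 have "E_plus (weight_up s \<phi> n) (pX g) = WF (Suc n) (raise (real n) (ladder s (lift_M \<phi>) n)) g"
  using Suc.IH by (intro E_WF(1) ladder_smooth assms Suc.prems) (simp add: up_def)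
 then show ?case unfolding weight_up.simps up_Suc divide_inverse by (simp only: mult.commute)
qed

lemma weight_down_coset:
 assumes "smooth_on uhp (lift_M \<phi>)"
 shows "g \<in> SL2 ==> weight_down s \<phi> n (pX g) = cnj (up (- s) (%z. cnj (lift_M \<phi> z)) n g)"
proof (induction n arbitrary: g)
 case 0
 then show ?case by (simp add: up_def WF_def pullback_coset lift_M_def)
next
 case (Suc n)
 let ?f = "%z. cnj (lift_M \<phi> z)"
 have sm: "smooth_on uhp ?f"
  by (rule smooth_on_linear_compose[OF open_uhp bounded_linear_cnj assms])
 have IH: "cnj (weight_down s \<phi> n (pX g)) = WF n (ladder (- s) ?f n) g" if "g \<in> SL2" for g
  using Suc.IH[OF that] by (simp add: up_def)
 have "E_minus (%x. cnj (cnj (weight_down s \<phi> n x))) (pX g) = cnj (WF (Suc n) (raise (real n) (ladder (- s) ?f n)) g)"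
  by (intro E_WF(2) ladder_smooth sm Suc.prems) (rule IH)
 then have "E_minus (weight_down s \<phi> n) (pX g) = cnj (WF (Suc n) (raise (real n) (ladder (- s) ?f n)) g)"
  by simp
 moreover have "cnj (inverse (\<i> * of_real (- s) + 1/2 + of_nat n)) = inverse (\<i> * of_real s + 1/2 + of_nat n)"
  by simp
 ultimately show ?case unfolding weight_down.simps up_Suc divide_inverse complex_cnj_mult by (simp only: mult.commute)
qed

end

section \<open>Square-integrable structure on the quotient\<close>

context surface_group begin

text \<open>
  Since \<open>X\<close> is compact, these functions are bounded and hence integrable with all their products.
\<close>

definition nice :: "(real^2^2 => complex) => bool" where
 "nice F \<longleftrightarrow> continuous_on SL2 F \<and> G_inv F"

lemma nice_bounded_ex:
 assumes "nice F" shows "\<exists>K>0. \<forall>g\<in>SL2. cmod (F g) <= K"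
proof -
 obtain R where R: "\<And>g. g \<in> SL2 ==> \<exists>\<gamma>\<in>\<Gamma>. norm (\<gamma> ** g) <= R" using bounded_representatives by blast
 have "compact (SL2 \<inter> cball 0 R)" using closed_SL2 by (intro closed_Int_compact) auto
 moreover have "continuous_on (SL2 \<inter> cball 0 R) F"
  using assms by (auto simp: nice_def intro: continuous_on_subset)
 ultimately have "bounded (F ` (SL2 \<inter> cball 0 R))" by (intro compact_imp_bounded compact_continuous_image)
 then obtain K where K: "K > 0" "\<And>g. g \<in> SL2 \<inter> cball 0 R ==> cmod (F g) <= K"
  unfolding bounded_pos by auto
 have "cmod (F g) <= K" if g: "g \<in> SL2" for g
 proof -
  obtain \<gamma> where \<gamma>: "\<gamma> \<in> \<Gamma>" "norm (\<gamma> ** g) <= R" using R[OF g] by blast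
  then have "cmod (F (\<gamma> ** g)) <= K" using g G_SL2 SL2_mult by (intro K) auto
  then show ?thesis using assms \<gamma> g by (simp add: nice_def G_inv_def)
 qed
 with K(1) show ?thesis by blast
qed

lemma nice_bounded:
 assumes "nice F" obtains K where "K > 0" "\<And>g. g \<in> SL2 ==> cmod (F g) <= K"
 using nice_bounded_ex[OF assms] by blast

lemma nice_measurable: "nice F ==> F \<in> borel_measurable SL2_borel"
 unfolding nice_def by (blast intro: borel_measurable_continuous_on_restrict)

lemma nice_measurable_XM: "nice F ==> F \<in> borel_measurable XM"
 using nice_measurable by (simp cong: measurable_cong_sets)

lemma nice_integrable: "nice F ==> integrable XM F"
proof -
 assume F: "nice F"
 obtain K where "\<And>g. g \<in> SL2 ==> cmod (F g) <= K" using nice_bounded[OF F] by blast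
 then show ?thesis by (intro XM.integrable_const_bound[where B = K] nice_measurable_XM F AE_I2) simp
qed

lemma nice_const: "nice (%g. c)"
 by (simp add: nice_def G_inv_def)

lemma nice_add: "nice F ==> nice H ==> nice (%g. F g + H g)"
 by (simp add: nice_def G_inv_def continuous_on_add)

lemma nice_diff: "nice F ==> nice H ==> nice (%g. F g - H g)"
 by (simp add: nice_def G_inv_def continuous_on_diff)

lemma nice_mult: "nice F ==> nice H ==> nice (%g. F g * H g)"
 by (simp add: nice_def G_inv_def continuous_on_mult)

lemma nice_cnj: "nice F ==> nice (%g. cnj (F g))"
 by (simp add: nice_def G_inv_def continuous_on_cnj)

lemma nice_sum: "(\<And>i. i \<in> I ==> nice (F i)) ==> nice (%g. \<Sum>i\<in>I. F i g)"
 by (induction I rule: infinite_finite_induct) (auto intro: nice_const nice_add)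

lemma nice_translate: 
 assumes F: "nice F" and h: "h \<in> SL2" shows "nice (%g. F (g ** h))"
proof -
 have "continuous_on SL2 (%g. F (g ** h))"
 proof (rule continuous_on_compose2[of SL2 F SL2 "%g. g ** h"])
  show "continuous_on SL2 F" using F by (simp add: nice_def)
  show "continuous_on SL2 (%g. g ** h)" by (intro continuous_intros)
  show "(%g. g ** h) ` SL2 \<subseteq> SL2" using h SL2_mult by blast
 qed
 moreover have "F ((\<gamma> ** g) ** h) = F (g ** h)" if "\<gamma> \<in> \<Gamma>" "g \<in> SL2" for \<gamma> g
  using F that SL2_mult[OF that(2) h] unfolding nice_def G_inv_def matrix_mul_assoc[symmetric] by blast
 ultimately show ?thesis unfolding nice_def G_inv_def by blast
qed

lemmas nice_intros = nice_const nice_add nice_diff nice_mult nice_cnj nice_translate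

lemma nice_integral_translate:
 assumes F: "nice F" and h: "h \<in> SL2" shows "(\<integral>g. F (g ** h) \<partial>XM) = (\<integral>g. F g \<partial>XM)"
proof -
 obtain K where "\<And>g. g \<in> SL2 ==> cmod (F g) <= K" using nice_bounded[OF F] by blast
 then show ?thesis using F h by (intro integral_XM_translate nice_measurable) (auto simp: nice_def)
qed

definition inner2 :: "(real^2^2 => complex) => (real^2^2 => complex) => complex" where
 "inner2 F H = (\<integral>g. F g * cnj (H g) \<partial>XM)"

definition nrm2 :: "(real^2^2 => complex) => real" where
 "nrm2 F = (\<integral>g. (cmod (F g))\<^sup>2 \<partial>XM)"

lemma nrm2_nonneg: "nrm2 F >= 0"
 unfolding nrm2_def by (rule integral_nonneg_AE) simp

lemma nice_integrable2: "nice F ==> nice H ==> integrable XM (%g. F g * cnj (H g))"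
 by (intro nice_integrable nice_intros)

lemma nice_integrable_sq: "nice F ==> integrable XM (%g. (cmod (F g))\<^sup>2)"
 using integrable_Re[OF nice_integrable2[of F F]] by (simp add: complex_mult_cnj cmod_power2)

lemma inner2_self: "nice F ==> inner2 F F = of_real (nrm2 F)"
 unfolding inner2_def nrm2_def
 by (simp add: complex_norm_square[symmetric] nice_integrable_sq flip: of_real_power)

lemma inner2_add_left: "nice F ==> nice F' ==> nice H ==> inner2 (%g. F g + F' g) H = inner2 F H + inner2 F' H"
 unfolding inner2_def by (simp add: ring_distribs nice_integrable2)

lemma inner2_scale_left: "inner2 (%g. c * F g) H = c * inner2 F H"
 unfolding inner2_def by (simp add: mult.assoc)

lemma integral_cnj_XM: "(\<integral>g. cnj (F g) \<partial>XM) = cnj (\<integral>g. F g \<partial>XM)"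
 by (rule integral_bounded_linear'[OF bounded_linear_cnj bounded_linear_cnj]) simp

lemma inner2_cnj: "cnj (inner2 F H) = inner2 H F"
proof -
 have "cnj (inner2 F H) = (\<integral>g. cnj (F g * cnj (H g)) \<partial>XM)"
  unfolding inner2_def by (rule integral_cnj_XM[symmetric])
 then show ?thesis by (simp add: inner2_def mult.commute)
qed

lemma inner2_scale_right: "inner2 F (%g. c * H g) = cnj c * inner2 F H"
 using arg_cong[OF inner2_scale_left[of c H F], of cnj] by (simp add: inner2_cnj)

lemma inner2_add_right: "nice F ==> nice H ==> nice H' ==> inner2 F (%g. H g + H' g) = inner2 F H + inner2 F H'"
 using arg_cong[OF inner2_add_left[of H H' F], of cnj] by (simp add: inner2_cnj)

lemma inner2_sum_left: "(\<And>i. i \<in> I ==> nice (F i)) ==> nice H ==> inner2 (%g. \<Sum>i\<in>I. F i g) H = (\<Sum>i\<in>I. inner2 (F i) H)"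
 unfolding inner2_def sum_distrib_right by (intro Bochner_Integration.integral_sum nice_integrable2)

lemma inner2_sum_right: "(\<And>i. i \<in> I ==> nice (H i)) ==> nice F ==> inner2 F (%g. \<Sum>i\<in>I. H i g) = (\<Sum>i\<in>I. inner2 F (H i))"
 unfolding inner2_def cnj_sum sum_distrib_left by (intro Bochner_Integration.integral_sum nice_integrable2)

lemma nrm2_scale: "nrm2 (%g. c * F g) = (cmod c)\<^sup>2 * nrm2 F"
 unfolding nrm2_def by (simp add: norm_mult power_mult_distrib)

lemma nrm2_add: "nice F ==> nice H ==> nrm2 (%g. F g + H g) = nrm2 F + nrm2 H + 2 * Re (inner2 F H)"
proof -
 assume n: "nice F" "nice H"
 have "of_real (nrm2 (%g. F g + H g)) = inner2 (%g. F g + H g) (%g. F g + H g)"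
  by (simp add: inner2_self nice_add n)
 also have "... = of_real (nrm2 F) + of_real (nrm2 H) + (inner2 F H + cnj (inner2 F H))"
  by (simp add: inner2_add_left inner2_add_right nice_add n inner2_self inner2_cnj)
 also have "... = of_real (nrm2 F + nrm2 H + 2 * Re (inner2 F H))" by (simp add: complex_add_cnj)
 finally show ?thesis by (simp only: of_real_eq_iff)
qed

lemma nrm2_eq_0: "nice F ==> nrm2 F = 0 ==> g \<in> SL2 ==> F g = 0"
proof -
 assume F: "nice F" and z: "nrm2 F = 0" and g: "g \<in> SL2"
 have "(\<integral>\<^sup>+g. ennreal \<bar>(cmod (F g))\<^sup>2\<bar> \<partial>XM) = ennreal (nrm2 F)"
  unfolding nrm2_def using nn_integral_eq_integral[OF nice_integrable_sq[OF F]] by simp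
 then have "(cmod (F g))\<^sup>2 = 0"
  using F g z by (intro XM_nonneg_continuous_zero) (auto simp: nice_def G_inv_def intro!: continuous_intros)
 then show ?thesis by simp
qed

lemma inner2_Cauchy_Schwarz:
 assumes F: "nice F" and H: "nice H" shows "(cmod (inner2 F H))\<^sup>2 <= nrm2 F * nrm2 H"
proof (cases "nrm2 H = 0")
 case True
 then have "H g = 0" if "g \<in> SL2" for g using nrm2_eq_0[OF H] that by blast
 then have "inner2 F H = (\<integral>g. 0 \<partial>XM)" unfolding inner2_def by (intro Bochner_Integration.integral_cong) auto
 then show ?thesis using True by simp
next
 case False
 then have pos: "nrm2 H > 0" using nrm2_nonneg[of H] by simp
 define a b where "a = nrm2 H" and "b = inner2 F H"
 have "0 <= nrm2 (%g. of_real a * F g + (- b) * H g)" by (rule nrm2_nonneg)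
 also have "... = a\<^sup>2 * nrm2 F + (cmod b)\<^sup>2 * a + 2 * Re (of_real a * (cnj (- b) * b))"
 proof -
  have "nrm2 (%g. of_real a * F g + (- b) * H g) = nrm2 (%g. of_real a * F g) + nrm2 (%g. (- b) * H g)
    + 2 * Re (inner2 (%g. of_real a * F g) (%g. (- b) * H g))"
   by (intro nrm2_add nice_mult nice_const F H)
  then show ?thesis unfolding inner2_scale_left inner2_scale_right nrm2_scale a_def[symmetric] b_def[symmetric]
   by (simp only: norm_of_real norm_minus_cancel power2_abs)
 qed
 also have "Re (of_real a * (cnj (- b) * b)) = - a * (cmod b)\<^sup>2"
 proof -
  have "cnj (- b) * b = - of_real ((cmod b)\<^sup>2)" using complex_norm_square[of b] by (simp add: mult.commute)
  then show ?thesis by simp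
 qed
 finally have "0 <= a * (a * nrm2 F - (cmod b)\<^sup>2)" by (simp add: power2_eq_square algebra_simps)
 then have "(cmod b)\<^sup>2 <= a * nrm2 F" using pos by (simp add: a_def zero_le_mult_iff)
 then show ?thesis by (simp add: a_def b_def mult.commute)
qed

definition nrm :: "(real^2^2 => complex) => real" where "nrm F = sqrt (nrm2 F)"

lemma nrm_nonneg: "nrm F >= 0" by (simp add: nrm_def nrm2_nonneg)

lemma nrm_sq: "(nrm F)\<^sup>2 = nrm2 F" by (simp add: nrm_def nrm2_nonneg)

lemma inner2_le:
 assumes "nice F" "nice H" shows "cmod (inner2 F H) <= nrm F * nrm H"
proof (rule power2_le_imp_le)
 show "(cmod (inner2 F H))\<^sup>2 <= (nrm F * nrm H)\<^sup>2"
  using inner2_Cauchy_Schwarz[OF assms] by (simp add: power_mult_distrib nrm_sq)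
qed (simp add: nrm_nonneg)

lemma nrm_scale: "nrm (%g. c * F g) = cmod c * nrm F"
 by (simp add: nrm_def nrm2_scale real_sqrt_mult)

lemma nrm_triangle: "nice F ==> nice H ==> nrm (%g. F g + H g) <= nrm F + nrm H"
proof (rule power2_le_imp_le)
 assume n: "nice F" "nice H"
 have "Re (inner2 F H) <= nrm F * nrm H" using inner2_le[OF n] complex_Re_le_cmod order_trans by blast
 then show "(nrm (%g. F g + H g))\<^sup>2 <= (nrm F + nrm H)\<^sup>2"
  by (simp add: nrm_sq nrm2_add n power2_sum)
qed (simp add: nrm_nonneg)

lemma inner2_translate: "nice F ==> nice H ==> h \<in> SL2 ==> inner2 (%g. F (g ** h)) (%g. H (g ** h)) = inner2 F H"
 unfolding inner2_def using nice_integral_translate[of "%g. F g * cnj (H g)" h] by (simp add: nice_intros)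

lemma nrm2_translate: "nice F ==> h \<in> SL2 ==> nrm2 (%g. F (g ** h)) = nrm2 F"
 using inner2_translate[of F F h] inner2_self[of F] inner2_self[OF nice_translate[of F h]] by simp

lemma nrm_translate: "nice F ==> h \<in> SL2 ==> nrm (%g. F (g ** h)) = nrm F"
 by (simp add: nrm_def nrm2_translate)

lemma nrm2_cong: "(\<And>g. g \<in> SL2 ==> F g = H g) ==> nrm2 F = nrm2 H"
 unfolding nrm2_def by (intro Bochner_Integration.integral_cong) auto

lemma nrm_cong: "(\<And>g. g \<in> SL2 ==> F g = H g) ==> nrm F = nrm H"
 unfolding nrm_def using nrm2_cong[of F H] by simp

lemma inner2_cong: "(\<And>g. g \<in> SL2 ==> F g = F' g) ==> (\<And>g. g \<in> SL2 ==> H g = H' g) ==> inner2 F H = inner2 F' H'"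
 unfolding inner2_def by (intro Bochner_Integration.integral_cong) auto

subsection \<open>Derivatives along one-parameter subgroups\<close>

definition flow_deriv :: "(real => real^2^2) => (real^2^2 => complex) => (real^2^2 => complex) => bool" where
 "flow_deriv h F D \<longleftrightarrow> (\<exists>A. one_param h A) \<and> nice F \<and> nice D \<and>
   (\<forall>g\<in>SL2. \<forall>t. ((%t. F (g ** h t)) has_vector_derivative D (g ** h t)) (at t))"

lemma scaled_difference_tendsto:
 fixes \<phi> :: "real => complex"
 assumes "(\<phi> has_vector_derivative d) (at 0)" "\<phi> 0 = 0"
 shows "(%n. of_nat (Suc n) * \<phi> (t / real (Suc n))) \<longlonglongrightarrow> of_real t * d"
proof -
 define u where "u n = t / real (Suc n)" for n
 have u0: "u \<longlonglongrightarrow> 0"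
 proof -
  have "u = (%n. t * inverse (real (Suc n)))" by (simp add: fun_eq_iff u_def divide_inverse)
  then show ?thesis using tendsto_mult[OF tendsto_const[of t] LIMSEQ_inverse_real_of_nat] by simp
 qed
 have ident: "of_nat (Suc n) * \<phi> (u n) - of_real t * d = of_nat (Suc n) * (\<phi> (u n) - u n *\<^sub>R d)" for n
  by (simp add: u_def scaleR_conv_of_real right_diff_distrib del: of_nat_Suc)
 show ?thesis
 proof (cases "t = 0")
  case True
  then show ?thesis using assms(2) by simp
 next
  case False
  then have un: "u n \<noteq> 0" for n by (simp add: u_def)
  have "(%h. norm (\<phi> (0 + h) - \<phi> 0 - h *\<^sub>R d) / norm h) \<midarrow>0\<rightarrow> 0"
   using assms(1) unfolding has_vector_derivative_def has_derivative_at by blast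
  moreover have "filterlim u (at 0) sequentially" using u0 un by (simp add: filterlim_at)
  ultimately have "(%n. norm (\<phi> (0 + u n) - \<phi> 0 - u n *\<^sub>R d) / norm (u n)) \<longlonglongrightarrow> 0"
   by (rule filterlim_compose)
  then have l: "(%n. \<bar>t\<bar> * (norm (\<phi> (u n) - u n *\<^sub>R d) / \<bar>u n\<bar>)) \<longlonglongrightarrow> 0"
   using assms(2) by (intro tendsto_mult_right_zero) simp
  have "\<bar>t\<bar> * (norm (\<phi> (u n) - u n *\<^sub>R d) / \<bar>u n\<bar>) = norm (of_nat (Suc n) * \<phi> (u n) - of_real t * d)" for n
  proof -
   have "\<bar>t\<bar> / \<bar>u n\<bar> = real (Suc n)" using False by (simp add: u_def del: of_nat_Suc)
   moreover have "\<bar>t\<bar> * (norm (\<phi> (u n) - u n *\<^sub>R d) / \<bar>u n\<bar>) = (\<bar>t\<bar> / \<bar>u n\<bar>) * norm (\<phi> (u n) - u n *\<^sub>R d)"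
    by simp
   ultimately show ?thesis unfolding ident norm_mult norm_of_nat by simp
  qed
  then have "(%n. of_nat (Suc n) * \<phi> (u n) - of_real t * d) \<longlonglongrightarrow> 0"
   using l by (simp add: tendsto_norm_zero_iff)
  then show ?thesis unfolding u_def by (rule LIM_zero_cancel)
 qed
qed

lemma difference_bound:
 fixes \<phi> :: "real => complex"
 assumes "\<And>t. (\<phi> has_vector_derivative d t) (at t)" "\<And>t. cmod (d t) <= K" "\<phi> 0 = 0"
 shows "cmod (\<phi> t) <= K * \<bar>t\<bar>"
proof -
 have "norm (\<phi> t - \<phi> 0) <= K * norm (t - 0)"
 proof (rule differentiable_bound[where S = UNIV])
  show "(\<phi> has_derivative (%u. u *\<^sub>R d t)) (at t within UNIV)" for t
   using assms(1)[of t] by (simp add: has_vector_derivative_def)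
  show "onorm (%u. u *\<^sub>R d t) <= K" for t
   using assms(2)[of t] by (intro onorm_le) (simp add: mult.commute[of K] mult_left_mono)
 qed auto
 then show ?thesis using assms(3) by simp
qed

text \<open>By invariance, difference quotients along a flow have integral 0.\<close>

lemma flow_deriv_integral_zero:
 assumes fd: "flow_deriv h F D" shows "(\<integral>g. D g \<partial>XM) = 0"
proof -
 obtain A where A: "one_param h A" using fd by (auto simp: flow_deriv_def)
 then have h0: "h 0 = mat 1" and hS: "\<And>t. h t \<in> SL2" by (auto simp: one_param_def)
 have F: "nice F" and D: "nice D" using fd by (auto simp: flow_deriv_def)
 have der: "((%t. F (g ** h t)) has_vector_derivative D (g ** h t)) (at t)" if "g \<in> SL2" for g t
  using fd that by (auto simp: flow_deriv_def)
 obtain K where K: "\<And>g. g \<in> SL2 ==> cmod (D g) <= K" "K > 0" using nice_bounded_ex[OF D] by auto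
 define q where "q n g = of_nat (Suc n) * (F (g ** h (1 / real (Suc n))) - F g)" for n g
 have d0: "((%t. F (g ** h t) - F g) has_vector_derivative D (g ** h t)) (at t)" if "g \<in> SL2" for g t
  using has_vector_derivative_diff[OF der[OF that] has_vector_derivative_const[of "F g"]] by simp
 have lim: "(%n. q n g) \<longlonglongrightarrow> D g" if "g \<in> SL2" for g
  using scaled_difference_tendsto[of "%t. F (g ** h t) - F g" "D g" 1] d0[OF that, of 0] h0 by (simp add: q_def)
 have bd: "cmod (q n g) <= K" if "g \<in> SL2" for n g
 proof -
  have "cmod (F (g ** h (1 / real (Suc n))) - F g) <= K * \<bar>1 / real (Suc n)\<bar>"
   using K that hS SL2_mult h0 by (intro difference_bound[OF d0[OF that]]) auto
  then have "real (Suc n) * cmod (F (g ** h (1 / real (Suc n))) - F g) <= real (Suc n) * (K * \<bar>1 / real (Suc n)\<bar>)"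
   by (intro mult_left_mono) simp_all
  then show ?thesis by (simp add: q_def norm_mult del: of_nat_Suc)
 qed
 have nq: "nice (q n)" for n unfolding q_def by (intro nice_intros F hS)
 have iq: "(\<integral>g. q n g \<partial>XM) = 0" for n
  unfolding q_def using nice_integral_translate[OF F hS] nice_integrable[OF F] nice_integrable[OF nice_translate[OF F hS]]
  by simp
 have "(%n. \<integral>g. q n g \<partial>XM) \<longlonglongrightarrow> (\<integral>g. D g \<partial>XM)"
  by (rule integral_dominated_convergence[where w = "%_. K"])
   (auto intro!: AE_I2 nice_measurable_XM nq D lim bd)
 then show ?thesis unfolding iq by (simp add: LIMSEQ_const_iff)
qed

text \<open>
  If a function is an approximate eigenfunction of the generator, then translation along the flow
  multiplies it by a phase, up to an error that grows linearly. Translations preserve the norm,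
  so the error for time \<open>t\<close> is at most \<open>n\<close> times the error for time \<open>t / n\<close>.
\<close>

lemma flow_estimate:
 assumes fd: "flow_deriv h F D"
 shows "nrm (%g. F (g ** h t) - cis (\<omega> * t) * F g) <= \<bar>t\<bar> * nrm (%g. D g - \<i> * of_real \<omega> * F g)"
proof -
 obtain A where A: "one_param h A" using fd by (auto simp: flow_deriv_def)
 then have h0: "h 0 = mat 1" and hS: "\<And>t. h t \<in> SL2" and hadd: "\<And>s t. h (s + t) = h s ** h t"
  by (auto simp: one_param_def)
 have F: "nice F" and D: "nice D" using fd by (auto simp: flow_deriv_def)
 have der: "((%t. F (g ** h t)) has_vector_derivative D (g ** h t)) (at t)" if "g \<in> SL2" for g t
  using fd that by (auto simp: flow_deriv_def)
 define a where "a s = nrm (%g. F (g ** h s) - cis (\<omega> * s) * F g)" for s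
 have na: "nice (%g. F (g ** h s) - cis (\<omega> * s) * F g)" for s by (intro nice_intros F hS)
 have sub: "a (s + u) <= a s + a u" for s u
 proof -
  have "a (s + u) = nrm (%g. (F ((g ** h s) ** h u) - cis (\<omega> * u) * F (g ** h s)) + cis (\<omega> * u) * (F (g ** h s) - cis (\<omega> * s) * F g))"
   unfolding a_def by (intro nrm_cong) (simp add: hadd matrix_mul_assoc algebra_simps cis_mult[symmetric] flip: cis_mult)
  also have "... <= nrm (%g. F ((g ** h s) ** h u) - cis (\<omega> * u) * F (g ** h s)) + nrm (%g. cis (\<omega> * u) * (F (g ** h s) - cis (\<omega> * s) * F g))"
   by (intro nrm_triangle nice_mult nice_const na nice_translate[OF na hS])
  also have "nrm (%g. F ((g ** h s) ** h u) - cis (\<omega> * u) * F (g ** h s)) = a u"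
   unfolding a_def by (rule nrm_translate[OF na hS])
  also have "nrm (%g. cis (\<omega> * u) * (F (g ** h s) - cis (\<omega> * s) * F g)) = a s"
   by (simp add: nrm_scale a_def)
  finally show ?thesis by simp
 qed
 have mult: "a (real (Suc n) * s) <= real (Suc n) * a s" for n s
 proof (induction n)
  case (Suc n)
  have "a (real (Suc (Suc n)) * s) = a (real (Suc n) * s + s)" by (simp add: algebra_simps)
  also have "... <= a (real (Suc n) * s) + a s" by (rule sub)
  finally show ?case using Suc by (simp add: algebra_simps)
 qed simp
 define q where "q n g = of_nat (Suc n) * (F (g ** h (t / real (Suc n))) - cis (\<omega> * (t / real (Suc n))) * F g)" for n g
 have le: "a t <= nrm (q n)" for n
  using mult[of n "t / real (Suc n)"] unfolding a_def q_def nrm_scale by (simp del: of_nat_Suc)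
 obtain K where K: "\<And>g. g \<in> SL2 ==> cmod (D g) <= K" "K > 0" using nice_bounded_ex[OF D] by auto
 obtain K' where K': "K' > 0" "\<And>g. g \<in> SL2 ==> cmod (F g) <= K'" using nice_bounded_ex[OF F] by auto
 have d0: "((%t. F (g ** h t) - cis (\<omega> * t) * F g) has_vector_derivative D (g ** h t) - \<i> * of_real \<omega> * cis (\<omega> * t) * F g) (at t)" 
  if "g \<in> SL2" for g t
 proof -
  have lin: "((%t. \<omega> * t) has_vector_derivative \<omega>) (at t)"
   using has_vector_derivative_mult_right[OF has_vector_derivative_id, of \<omega>] by simp
  have c: "(cis has_vector_derivative \<i> * cis x) (at x)" for x
  proof -
   have "((%x. Complex (cos x) (sin x)) has_vector_derivative Complex (- sin x) (cos x)) (at x)"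
    by (rule has_vector_derivative_Complex; unfold has_real_derivative_iff_has_vector_derivative[symmetric];
     auto intro!: derivative_eq_intros)
   moreover have "(%x. Complex (cos x) (sin x)) = cis" by (simp add: fun_eq_iff complex_eq_iff)
   moreover have "Complex (- sin x) (cos x) = \<i> * cis x" by (simp add: complex_eq_iff)
   ultimately show ?thesis by simp
  qed
  have "((%t. cis (\<omega> * t)) has_vector_derivative \<omega> *\<^sub>R (\<i> * cis (\<omega> * t))) (at t)"
   using vector_diff_chain_at[OF lin, of cis] c[of "\<omega> * t"] by (simp add: o_def)
  from has_vector_derivative_diff[OF der[OF that] has_vector_derivative_mult_left[OF this, of "F g"]]
  show ?thesis by (simp add: scaleR_conv_of_real mult_ac)
 qed
 define E where "E g = D g - \<i> * of_real \<omega> * F g" for g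
 have lim: "(%n. q n g) \<longlonglongrightarrow> of_real t * E g" if "g \<in> SL2" for g
  using scaled_difference_tendsto[of "%t. F (g ** h t) - cis (\<omega> * t) * F g" "E g" t] d0[OF that, of 0] h0
  by (simp add: q_def E_def)
 let ?K = "K + \<bar>\<omega>\<bar> * K'"
 have bd: "cmod (q n g) <= ?K * \<bar>t\<bar>" if "g \<in> SL2" for n g
 proof -
  have "cmod (F (g ** h (t / real (Suc n))) - cis (\<omega> * (t / real (Suc n))) * F g) <= ?K * \<bar>t / real (Suc n)\<bar>"
  proof (rule difference_bound[OF d0[OF that]])
   fix u
   have "cmod (D (g ** h u) - \<i> * of_real \<omega> * cis (\<omega> * u) * F g) <= cmod (D (g ** h u)) + cmod (\<i> * of_real \<omega> * cis (\<omega> * u) * F g)"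
    by (rule norm_triangle_ineq4)
   also have "... <= K + \<bar>\<omega>\<bar> * K'"
    using K(1)[OF SL2_mult[OF that hS]] K'(2)[OF that] by (intro add_mono) (auto simp: norm_mult intro!: mult_left_mono)
   finally show "cmod (D (g ** h u) - \<i> * of_real \<omega> * cis (\<omega> * u) * F g) <= ?K" .
  qed (simp add: h0)
  then have "real (Suc n) * cmod (F (g ** h (t / real (Suc n))) - cis (\<omega> * (t / real (Suc n))) * F g) <= real (Suc n) * (?K * \<bar>t / real (Suc n)\<bar>)"
   by (intro mult_left_mono) simp_all
  then show ?thesis by (simp add: q_def norm_mult del: of_nat_Suc)
 qed
 have nq: "nice (q n)" for n unfolding q_def by (intro nice_intros F hS)
 have nE: "nice (%g. of_real t * E g)" unfolding E_def by (intro nice_intros F D)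
 have "(%n. nrm2 (q n)) \<longlonglongrightarrow> nrm2 (%g. of_real t * E g)"
  unfolding nrm2_def
 proof (rule integral_dominated_convergence[where w = "%_. (?K * \<bar>t\<bar>)\<^sup>2"])
  show "(%g. (cmod (of_real t * E g))\<^sup>2) \<in> borel_measurable XM" using nice_measurable_XM[OF nE] by measurable
  show "(%g. (cmod (q n g))\<^sup>2) \<in> borel_measurable XM" for n using nice_measurable_XM[OF nq] by measurable
  show "AE g in XM. (%n. (cmod (q n g))\<^sup>2) \<longlonglongrightarrow> (cmod (of_real t * E g))\<^sup>2"
   using lim by (intro AE_I2 tendsto_intros) auto
  show "AE g in XM. norm ((cmod (q n g))\<^sup>2) <= (?K * \<bar>t\<bar>)\<^sup>2" for n
   using bd by (intro AE_I2) (auto intro!: power_mono)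
 qed simp
 then have "(%n. nrm (q n)) \<longlonglongrightarrow> nrm (%g. of_real t * E g)" unfolding nrm_def by (rule tendsto_real_sqrt)
 then have "a t <= nrm (%g. of_real t * E g)" using le by (intro LIMSEQ_le_const) auto
 then show ?thesis by (simp add: a_def nrm_scale E_def)
qed

end

section \<open>Orthogonality of weight vectors\<close>

lemma vector_derivative_unique:
 fixes f :: "real => complex"
 shows "(f has_vector_derivative a) (at t) ==> (f has_vector_derivative b) (at t) ==> a = b"
 using vector_derivative_at by blast

context surface_group begin

lemma eigenspace_smooth: "\<phi> \<in> eigS s ==> smooth_on uhp (lift_M \<phi>)"
 by (simp add: eigenspace_def smooth_functions_M_def lift_M_def[abs_def])

lemma eigenspace_lap: "\<phi> \<in> eigS s ==> z \<in> uhp ==> lap (lift_M \<phi>) z = - of_real (1/4 + s\<^sup>2) * lift_M \<phi> z"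
 using hyperbolic_laplacian_eq[OF eigenspace_smooth, of \<phi> s z]
 by (simp add: eigenspace_def lift_M_def[abs_def])

definition U :: "real => (complex set => complex) => nat => real^2^2 => complex" where
 "U s \<phi> n = up s (lift_M \<phi>) n"

lemma U_0: "U s \<phi> 0 g = \<phi> (pM (act g \<i>))"
 by (simp add: U_def up_def WF_def lift_M_def)

lemma nice_U:
 assumes "smooth_on uhp (lift_M \<phi>)" shows "nice (U s \<phi> n)"
 unfolding nice_def
proof
 show "continuous_on SL2 (U s \<phi> n)"
  unfolding U_def up_def by (rule continuous_WF[OF smooth_on_continuous[OF ladder_smooth[OF assms]]])
 have "U s \<phi> n (\<gamma> ** g) = U s \<phi> n g" if "\<gamma> \<in> \<Gamma>" "g \<in> SL2" for \<gamma> g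
  unfolding U_def using that G_SL2 SL2_mult coset_mult
  by (simp flip: weight_up_coset[OF assms])
 then show "G_inv (U s \<phi> n)" by (simp add: G_inv_def)
qed

lemma flow_deriv_U:
 assumes sm: "smooth_on uhp (lift_M \<phi>)" and h: "one_param h A"
 shows "flow_deriv h (U s \<phi> n) (DWF A n (ladder s (lift_M \<phi>) n))"
 unfolding flow_deriv_def
proof (intro conjI ballI allI exI[of _ A] h nice_U sm)
 let ?f = "ladder s (lift_M \<phi>) n"
 have smf: "smooth_on uhp ?f" by (rule ladder_smooth[OF sm])
 have U: "U s \<phi> n = WF n ?f" by (simp add: U_def up_def)
 show der: "((%t. U s \<phi> n (g ** h t)) has_vector_derivative DWF A n ?f (g ** h t)) (at t)" if "g \<in> SL2" for g t
  unfolding U by (rule WF_flow_derivative[OF h that smf])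
 have cW: "continuous_on SL2 (WF k f)" if "smooth_on uhp f" for k f
  by (rule continuous_WF[OF smooth_on_continuous[OF that]])
 have "continuous_on SL2 (DWF A n ?f)" unfolding DWF_def[abs_def]
  by (intro continuous_on_add continuous_on_mult continuous_on_diff continuous_on_const continuous_on_cnj
    continuous_Jf cW raise_smooth lower_smooth smf)
 moreover have "DWF A n ?f (\<gamma> ** g) = DWF A n ?f g" if g: "\<gamma> \<in> \<Gamma>" "g \<in> SL2" for \<gamma> g
 proof -
  have hS: "h t \<in> SL2" and h0: "h 0 = mat 1" for t using h by (auto simp: one_param_def)
  have "U s \<phi> n ((\<gamma> ** g) ** h t) = U s \<phi> n (g ** h t)" for t
  proof -
   have "U s \<phi> n (\<gamma> ** (g ** h t)) = U s \<phi> n (g ** h t)"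
    using nice_U[OF sm, of s n] g(1) SL2_mult[OF g(2) hS] unfolding nice_def G_inv_def by blast
   then show ?thesis by (simp only: matrix_mul_assoc)
  qed
  then have "((%t. U s \<phi> n (g ** h t)) has_vector_derivative DWF A n ?f ((\<gamma> ** g) ** h 0)) (at 0)"
   using der[OF SL2_mult[OF G_SL2[OF g(1)] g(2)], of 0] by simp
  from vector_derivative_unique[OF this der[OF g(2), of 0]] show ?thesis by (simp add: h0)
 qed
 ultimately show "nice (DWF A n ?f)" by (simp add: nice_def G_inv_def)
qed

lemma raised_U: "WF (Suc n) (raise (real n) (ladder s (lift_M \<phi>) n)) g = (\<i> * of_real s + 1/2 + of_nat n) * U s \<phi> (Suc n) g"
 using ladder_den_nz[of s n] by (simp add: U_def up_Suc)

lemma lowered_U: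
 assumes \<phi>: "\<phi> \<in> eigS s'" "s'\<^sup>2 = s\<^sup>2" and g: "g \<in> SL2"
 shows "cnj (Jf g) * WF (Suc n) (lower (real (Suc n)) (ladder s (lift_M \<phi>) (Suc n))) g = (\<i> * of_real s - 1/2 - of_nat n) * U s \<phi> n g"
proof -
 have eig: "lap (lift_M \<phi>) z = - of_real (1/4 + s\<^sup>2) * lift_M \<phi> z" if "z \<in> uhp" for z
  using eigenspace_lap[OF \<phi>(1) that] \<phi>(2) by simp
 have l: "lower (real (Suc n)) (ladder s (lift_M \<phi>) (Suc n)) (act g \<i>) = (\<i> * of_real s - 1/2 - of_nat n) * ladder s (lift_M \<phi>) n (act g \<i>)"
  using ladder_lower[OF eigenspace_smooth[OF \<phi>(1)] eig, of "act g \<i>" n] act_uhp[OF g i_uhp] by (simp add: add.commute del: ladder.simps)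
 have J: "cnj (Jf g) * (Jf g * z) = z" for z
 proof -
  have "cnj (Jf g) * (Jf g * z) = (Jf g * cnj (Jf g)) * z" by (simp only: mult_ac)
  then show ?thesis unfolding Jf_cnj[OF g] by simp
 qed
 show ?thesis unfolding WF_def U_def up_def l power_Suc
  unfolding mult.assoc J by (simp only: mult.left_commute)
qed

lemma eigenspace_cnj: "\<phi> \<in> eigS s ==> (%p. cnj (\<phi> p)) \<in> eigS s"
proof -
 assume \<phi>: "\<phi> \<in> eigS s"
 let ?f = "lift_M \<phi>" and ?h = "%z. cnj (lift_M \<phi> z)"
 have sm: "smooth_on uhp ?f" by (rule eigenspace_smooth[OF \<phi>])
 have sc: "smooth_on uhp ?h" by (rule smooth_on_linear_compose[OF open_uhp bounded_linear_cnj sm])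
 have dc: "dir v (%z. cnj (F z)) z = cnj (dir v F z)" if "smooth_on uhp F" "z \<in> uhp" for F v z
 proof -
  have "((%z. cnj (F z)) has_derivative (%v. cnj (dir v F z))) (at z)"
   by (rule bounded_linear.has_derivative[OF bounded_linear_cnj smooth_on_derivative[OF that]])
  then show ?thesis by (rule fun_cong[OF frechet_derivative_at, symmetric])
 qed
 have ddc: "dir v (dir v ?h) z = cnj (dir v (dir v ?f) z)" if "z \<in> uhp" for v z
 proof -
  have "dir v (dir v ?h) z = dir v (%z. cnj (dir v ?f z)) z"
   by (rule fun_cong[OF frechet_derivative_cong_open[OF open_uhp that]]) (rule dc[OF sm])
  also have "... = cnj (dir v (dir v ?f) z)" by (rule dc[OF smooth_on_partial[OF sm] that])
  finally show ?thesis .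
 qed
 have "hyperbolic_laplacian ?h z = - of_real (1/4 + s\<^sup>2) * ?h z" if z: "z \<in> uhp" for z
 proof -
  have "hyperbolic_laplacian ?h z = cnj (lap ?f z)"
   unfolding hyperbolic_laplacian_eq[OF sc z] lap_def ddc[OF z] by simp
  then show ?thesis using eigenspace_lap[OF \<phi> z] by simp
 qed
 then show ?thesis using \<phi> sc by (simp add: eigenspace_def smooth_functions_M_def lift_M_def[abs_def])
qed

subsection \<open>Integration by parts\<close>

lemma flow_deriv_product:
 assumes "flow_deriv h F D" "flow_deriv h H E"
 shows "flow_deriv h (%g. F g * cnj (H g)) (%g. F g * cnj (E g) + D g * cnj (H g))"
proof -
 have n: "nice F" "nice D" "nice H" "nice E" using assms by (auto simp: flow_deriv_def)
 obtain A where A: "one_param h A" using assms by (auto simp: flow_deriv_def)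
 have "((%t. F (g ** h t) * cnj (H (g ** h t))) has_vector_derivative F (g ** h t) * cnj (E (g ** h t)) + D (g ** h t) * cnj (H (g ** h t))) (at t)"
  if "g \<in> SL2" for g t
  using assms that unfolding flow_deriv_def
  by (intro has_vector_derivative_mult bounded_linear.has_vector_derivative[OF bounded_linear_cnj]) auto
 then show ?thesis unfolding flow_deriv_def using n A by (auto intro!: nice_intros)
qed

lemma integration_by_parts:
 assumes "flow_deriv h F D" "flow_deriv h H E" shows "inner2 D H + inner2 F E = 0"
proof -
 have n: "nice F" "nice D" "nice H" "nice E" using assms by (auto simp: flow_deriv_def)
 have "(\<integral>g. F g * cnj (E g) + D g * cnj (H g) \<partial>XM) = 0"
  by (rule flow_deriv_integral_zero[OF flow_deriv_product[OF assms]])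
 then show ?thesis using n by (simp add: inner2_def nice_integrable2 add.commute)
qed

text \<open>
  Combining the two flows in the directions of \<open>E\<^sup>+\<close>, integration by parts says that \<open>- E\<^sup>-\<close> is the
 adjoint of \<open>E\<^sup>+\<close>.
\<close>

lemma inner_U_step:
 assumes \<phi>: "\<phi> \<in> eigS r" "r\<^sup>2 = s\<^sup>2" and \<psi>: "\<psi> \<in> eigS r'" "r'\<^sup>2 = s'\<^sup>2"
 shows "(\<i> * of_real s + 1/2 + of_nat n) * inner2 (U s \<phi> (Suc n)) (U s' \<psi> (Suc n))
  = (\<i> * of_real s' + 1/2 + of_nat n) * inner2 (U s \<phi> n) (U s' \<psi> n)"
proof -
 note sm = eigenspace_smooth[OF \<phi>(1)] eigenspace_smooth[OF \<psi>(1)]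
 let ?A1 = "mat2 (1/2) 0 0 (-1/2)" and ?A2 = "mat2 0 (1/2) (1/2) 0"
 let ?F = "U s \<phi> n" and ?H = "U s' \<psi> (Suc n)"
 define D1 D2 E1 E2 where D: "D1 = DWF ?A1 n (ladder s (lift_M \<phi>) n)" "D2 = DWF ?A2 n (ladder s (lift_M \<phi>) n)"
  "E1 = DWF ?A1 (Suc n) (ladder s' (lift_M \<psi>) (Suc n))" "E2 = DWF ?A2 (Suc n) (ladder s' (lift_M \<psi>) (Suc n))"
 have fd: "flow_deriv (%t. mexp (t *\<^sub>R ?A1)) ?F D1" "flow_deriv (%t. mexp (t *\<^sub>R ?A1)) ?H E1"
   "flow_deriv (%t. mexp (t *\<^sub>R ?A2)) ?F D2" "flow_deriv (%t. mexp (t *\<^sub>R ?A2)) ?H E2"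
  unfolding D by (intro flow_deriv_U sm one_param_mexp_diag one_param_mexp_antidiag)+
 have n: "nice ?F" "nice ?H" "nice D1" "nice D2" "nice E1" "nice E2" using fd by (auto simp: flow_deriv_def)
 have I: "inner2 D1 ?H + inner2 ?F E1 = 0" "inner2 D2 ?H + inner2 ?F E2 = 0"
  by (rule integration_by_parts[OF fd(1,2)], rule integration_by_parts[OF fd(3,4)])
 have raise: "D1 g + \<i> * D2 g = (\<i> * of_real s + 1/2 + of_nat n) * U s \<phi> (Suc n) g" for g
  unfolding D DWF_def raised_U by (simp add: field_simps)
 have lower: "E1 g + (- \<i>) * E2 g = (\<i> * of_real s' - 1/2 - of_nat n) * U s' \<psi> n g" if "g \<in> SL2" for g
 proof -
  define P M where PM: "P = WF (Suc (Suc n)) (raise (real (Suc n)) (ladder s' (lift_M \<psi>) (Suc n))) g"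
   "M = cnj (Jf g) * WF (Suc n) (lower (real (Suc n)) (ladder s' (lift_M \<psi>) (Suc n))) g"
  have "E1 g = (P + M) / 2" "E2 g = (P - M) / (2 * \<i>)" unfolding D DWF_def PM by simp_all
  moreover have "(- \<i>) * ((P - M) / (2 * \<i>)) = (M - P) / 2" by (simp add: field_simps)
  ultimately have "E1 g + (- \<i>) * E2 g = (P + M) / 2 + (M - P) / 2" by (simp only:)
  also have "... = M" by (simp add: field_simps)
  finally have "E1 g + (- \<i>) * E2 g = M" .
  then show ?thesis unfolding PM lowered_U[OF \<psi> that] .
 qed
 have "inner2 (%g. D1 g + \<i> * D2 g) ?H + inner2 ?F (%g. E1 g + (- \<i>) * E2 g) 
   = (inner2 D1 ?H + inner2 ?F E1) + \<i> * (inner2 D2 ?H + inner2 ?F E2)"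
  unfolding inner2_add_left[OF n(3) nice_mult[OF nice_const n(4)] n(2)]
   inner2_add_right[OF n(1) n(5) nice_mult[OF nice_const n(6)]] inner2_scale_left inner2_scale_right
  by (simp add: algebra_simps)
 also have "... = 0" unfolding I by simp
 also have "inner2 ?F (%g. E1 g + (- \<i>) * E2 g) = inner2 ?F (%g. (\<i> * of_real s' - 1/2 - of_nat n) * U s' \<psi> n g)"
  by (rule inner2_cong) (simp_all only: lower)
 finally have "(\<i> * of_real s + 1/2 + of_nat n) * inner2 (U s \<phi> (Suc n)) ?H
   + cnj (\<i> * of_real s' - 1/2 - of_nat n) * inner2 ?F (U s' \<psi> n) = 0"
  unfolding raise inner2_scale_left inner2_scale_right .
 moreover have "cnj (\<i> * of_real s' - 1/2 - of_nat n) = - (\<i> * of_real s' + 1/2 + of_nat n)" by simp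
 ultimately have "(\<i> * of_real s + 1/2 + of_nat n) * inner2 (U s \<phi> (Suc n)) ?H
   - (\<i> * of_real s' + 1/2 + of_nat n) * inner2 ?F (U s' \<psi> n) = 0"
  by (simp only: mult_minus_left diff_conv_add_uminus)
 then show ?thesis by (rule eq_iff_diff_eq_0[THEN iffD2])
qed

lemma inner_U_same:
 assumes \<phi>: "\<phi> \<in> eigS r" "r\<^sup>2 = s\<^sup>2" and \<psi>: "\<psi> \<in> eigS r'" "r'\<^sup>2 = s\<^sup>2"
 shows "inner2 (U s \<phi> n) (U s \<psi> n) = inner2 (U s \<phi> 0) (U s \<psi> 0)"
proof (induction n)
 case (Suc n)
 then show ?case using inner_U_step[OF \<phi> \<psi>, of n] ladder_den_nz[of s n] by simp
qed simp

text \<open>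
  For weights 0 and 1 the step formula, read in both orders, gives two linear equations, whose
  determinant is the difference of the squares of the parameters.
\<close>

lemma inner_U_distinct:
 assumes \<phi>: "\<phi> \<in> eigS r" "r\<^sup>2 = s\<^sup>2" and \<psi>: "\<psi> \<in> eigS r'" "r'\<^sup>2 = s'\<^sup>2" and ne: "s\<^sup>2 \<noteq> s'\<^sup>2"
 shows "inner2 (U s \<phi> n) (U s' \<psi> n) = 0"
proof (induction n)
 case 0
 define I0 I1 where I: "I0 = inner2 (U s \<phi> 0) (U s' \<psi> 0)" "I1 = inner2 (U s \<phi> 1) (U s' \<psi> 1)"
 have 1: "(\<i> * of_real s + 1/2) * I1 = (\<i> * of_real s' + 1/2) * I0"
  using inner_U_step[OF \<phi> \<psi>, of 0] by (simp add: I)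
 have "(\<i> * of_real s' + 1/2) * cnj I1 = (\<i> * of_real s + 1/2) * cnj I0"
  using inner_U_step[OF \<psi> \<phi>, of 0] by (simp add: I inner2_cnj)
 from arg_cong[OF this, of cnj] have 2: "(1/2 - \<i> * of_real s') * I1 = (1/2 - \<i> * of_real s) * I0" by simp
 have "(1/2 - \<i> * of_real s') * ((\<i> * of_real s' + 1/2) * I0) = (\<i> * of_real s + 1/2) * ((1/2 - \<i> * of_real s') * I1)"
  using 1 by (simp add: mult.left_commute)
 also have "... = (\<i> * of_real s + 1/2) * ((1/2 - \<i> * of_real s) * I0)" by (simp only: 2)
 finally have "(of_real (s'\<^sup>2) - of_real (s\<^sup>2)) * I0 = 0" by (simp add: algebra_simps power2_eq_square)
 then have "complex_of_real (s'\<^sup>2 - s\<^sup>2) * I0 = 0" by (simp only: of_real_diff)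
 moreover have "complex_of_real (s'\<^sup>2 - s\<^sup>2) \<noteq> 0" using ne unfolding of_real_eq_0_iff by simp
 ultimately have "I0 = 0" by (simp only: mult_eq_0_iff) blast
 then show ?case by (simp add: I)
next
 case (Suc n)
 then show ?case using inner_U_step[OF \<phi> \<psi>, of n] ladder_den_nz[of s n] by simp
qed

lemma rot_SL2: "rot \<theta> \<in> SL2"
 by (simp add: rot_def mat2_in_SL2 power2_eq_square[symmetric])

lemma U_rot:
 assumes g: "g \<in> SL2" shows "U s \<phi> n (g ** rot \<theta>) = cis (2 * real n * \<theta>) * U s \<phi> n g"
proof -
 have "act (g ** rot \<theta>) \<i> = act g (act (rot \<theta>) \<i>)" by (rule act_mult[OF rot_SL2 i_uhp])
 also have "act (rot \<theta>) \<i> = \<i>"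
 proof -
  have "num (rot \<theta>) \<i> = \<i> * den (rot \<theta>) \<i>" by (simp add: num_def den_def rot_def complex_eq_iff)
  then show ?thesis using den_i_nz[OF rot_SL2, of \<theta>] by (simp add: act_num_den)
 qed
 finally have a: "act (g ** rot \<theta>) \<i> = act g \<i>" .
 have d: "den (g ** rot \<theta>) \<i> = den g \<i> * cis (- \<theta>)"
  by (simp add: den_i mult_nth2 rot_def complex_eq_iff algebra_simps)
 have "Jf (g ** rot \<theta>) = cis (2 * \<theta>) * Jf g"
 proof -
  have "Jf (g ** rot \<theta>) = Jf g * (cnj (cis (- \<theta>)) / cis (- \<theta>))"
   unfolding Jf_def d using den_i_nz[OF g] by simp
  also have "cnj (cis (- \<theta>)) / cis (- \<theta>) = cis (2 * \<theta>)" by (simp add: cis_cnj cis_divide)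
  finally show ?thesis by simp
 qed
 moreover have "cis (2 * \<theta>) ^ n = cis (2 * real n * \<theta>)"
  using Complex.DeMoivre[of "2 * \<theta>" n] by (simp only: mult.left_commute mult.assoc)
 ultimately show ?thesis by (simp only: U_def up_def WF_def a power_mult_distrib mult.assoc)
qed

text \<open>
  Translation by a rotation is unitary and multiplies the two functions by different characters.
\<close>

lemma inner_rot_zero:
 assumes F: "nice F" "\<And>g \<theta>. g \<in> SL2 ==> F (g ** rot \<theta>) = cis (a * \<theta>) * F g"
  and H: "nice H" "\<And>g \<theta>. g \<in> SL2 ==> H (g ** rot \<theta>) = cis (b * \<theta>) * H g" and ne: "a \<noteq> b"
 shows "inner2 F H = 0"
proof -
 define \<theta> where "\<theta> = pi / (a - b)"
 have "inner2 F H = inner2 (%g. F (g ** rot \<theta>)) (%g. H (g ** rot \<theta>))"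
  by (rule inner2_translate[OF F(1) H(1) rot_SL2, symmetric])
 also have "... = inner2 (%g. cis (a * \<theta>) * F g) (%g. cis (b * \<theta>) * H g)"
  by (rule inner2_cong) (simp_all add: F H)
 also have "... = cis (a * \<theta>) * cnj (cis (b * \<theta>)) * inner2 F H"
  by (simp add: inner2_scale_left inner2_scale_right)
 also have "cis (a * \<theta>) * cnj (cis (b * \<theta>)) = cis ((a - b) * \<theta>)" by (simp add: cis_cnj cis_mult algebra_simps)
 also have "(a - b) * \<theta> = pi" using ne by (simp add: \<theta>_def)
 finally show ?thesis by simp
qed

lemma inner_U_weights:
 assumes "smooth_on uhp (lift_M \<phi>)" "smooth_on uhp (lift_M \<psi>)" "n \<noteq> m"
 shows "inner2 (U s \<phi> n) (U s' \<psi> m) = 0"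
 using assms by (intro inner_rot_zero[where a = "2 * real n" and b = "2 * real m"] nice_U U_rot) auto

lemma inner_U_cnj_weights:
 assumes "smooth_on uhp (lift_M \<phi>)" "smooth_on uhp (lift_M \<psi>)" "n \<noteq> 0 \<or> m \<noteq> 0"
 shows "inner2 (%g. cnj (U s \<phi> n g)) (U s' \<psi> m) = 0"
 using assms by (intro inner_rot_zero[where a = "- 2 * real n" and b = "2 * real m"] nice_U nice_cnj U_rot)
  (auto simp: U_rot cis_cnj)

end

section \<open>Coefficients of the test vector\<close>

text \<open>
  The coefficients of the test vector: a bump that vanishes to second order at both ends, so that its
  second differences are of order \<open>1 / L\<^sup>2\<close> throughout, unlike those of the coefficients of the
 microlocal lift.
\<close>

definition bump :: "nat => nat => real" where
 "bump L n = (if n <= L then (sin (pi * real n / real L))\<^sup>2 else 0)"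

definition bump_pred :: "nat => nat => real" where
 "bump_pred L n = (if n = 0 then 0 else bump L (n - 1))"

lemma bump_bounds: "0 <= bump L n" "bump L n <= 1"
 using abs_sin_le_one[of "pi * real n / real L"] by (auto simp: bump_def abs_square_le_1)

lemma bump_pred_bounds: "0 <= bump_pred L n" "bump_pred L n <= 1"
 using bump_bounds by (auto simp: bump_pred_def)

lemma bump_ends: "bump L 0 = 0" "L < n ==> bump L n = 0"
 by (auto simp: bump_def)

lemma sin_sq_le: "(sin x)\<^sup>2 <= x\<^sup>2" for x :: real
 using abs_sin_x_le_abs_x[of x] by (simp add: abs_le_square_iff[symmetric])

lemma sin_sq_le_abs: "(sin x)\<^sup>2 <= \<bar>x\<bar>" for x :: real
proof -
 have "(sin x)\<^sup>2 = \<bar>sin x\<bar> * \<bar>sin x\<bar>" by (simp add: power2_eq_square flip: abs_mult)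
 also have "... <= 1 * \<bar>x\<bar>" using abs_sin_le_one[of x] abs_sin_x_le_abs_x[of x] by (intro mult_mono) auto
 finally show ?thesis by simp
qed

lemma sin_sq_cos: "(sin x)\<^sup>2 = (1 - cos (2 * x)) / 2" for x :: real
 using cos_double_sin[of x] by simp

lemma bump_differences:
 assumes L: "L >= 1" and h: "h = pi / real L"
 shows "\<bar>bump_pred L n + bump L (Suc n) - 2 * bump L n\<bar> <= 2 * h\<^sup>2"
  and "\<bar>bump_pred L n - bump L (Suc n)\<bar> <= 2 * h"
proof -
 have hp: "h > 0" using L h by simp
 have Lh: "real L * h = pi" using L h by simp
 have b: "bump L k = (sin (real k * h))\<^sup>2" if "k <= L" for k using that h by (simp add: bump_def mult.commute)
 consider "n = 0" | "0 < n" "n < L" | "n = L" "0 < n" | "n > L" by linarith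
 then have "\<bar>bump_pred L n + bump L (Suc n) - 2 * bump L n\<bar> <= 2 * h\<^sup>2 \<and> \<bar>bump_pred L n - bump L (Suc n)\<bar> <= 2 * h"
 proof cases
  case 1
  then have "bump L (Suc n) = (sin h)\<^sup>2" "bump L n = 0" "bump_pred L n = 0"
   using L b[of 1] by (auto simp: bump_pred_def bump_ends)
  moreover have "(sin h)\<^sup>2 <= 2 * h\<^sup>2" "(sin h)\<^sup>2 <= 2 * h"
   using sin_sq_le[of h] sin_sq_le_abs[of h] hp zero_le_power2[of h] by linarith+
  ultimately show ?thesis by simp
 next
  case 2
  define x where "x = real n * h"
  have e: "bump_pred L n = (sin (x - h))\<^sup>2" "bump L (Suc n) = (sin (x + h))\<^sup>2" "bump L n = (sin x)\<^sup>2"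
   using 2 b[of "n - 1"] b[of "Suc n"] b[of n] by (auto simp: bump_pred_def x_def algebra_simps of_nat_diff)
  have c: "cos (2 * (x - h)) = cos (2 * x) * cos (2 * h) + sin (2 * x) * sin (2 * h)"
    "cos (2 * (x + h)) = cos (2 * x) * cos (2 * h) - sin (2 * x) * sin (2 * h)"
   by (simp_all add: ring_distribs cos_add cos_diff)
  have "bump_pred L n + bump L (Suc n) - 2 * bump L n = cos (2 * x) * (1 - cos (2 * h))"
   unfolding e sin_sq_cos c by (simp add: field_simps)
  also have "1 - cos (2 * h) = 2 * (sin h)\<^sup>2" using sin_sq_cos[of h] by simp
  finally have "\<bar>bump_pred L n + bump L (Suc n) - 2 * bump L n\<bar> = \<bar>cos (2 * x)\<bar> * (2 * (sin h)\<^sup>2)"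
   by (simp add: abs_mult)
  also have "... <= 1 * (2 * h\<^sup>2)" using sin_sq_le[of h] abs_cos_le_one[of "2 * x"] by (intro mult_mono) auto
  finally have 1: "\<bar>bump_pred L n + bump L (Suc n) - 2 * bump L n\<bar> <= 2 * h\<^sup>2" by simp
  have "bump_pred L n - bump L (Suc n) = - (sin (2 * x) * sin (2 * h))"
   unfolding e sin_sq_cos c by (simp add: field_simps)
  then have "\<bar>bump_pred L n - bump L (Suc n)\<bar> = \<bar>sin (2 * x)\<bar> * \<bar>sin (2 * h)\<bar>" by (simp add: abs_mult)
  also have "... <= 1 * (2 * h)" using abs_sin_le_one[of "2 * x"] abs_sin_x_le_abs_x[of "2 * h"] hp by (intro mult_mono) auto
  finally show ?thesis using 1 by simp
 next
  case 3
  have "real (n - 1) * h = pi - h" using 3 Lh by (simp add: of_nat_diff algebra_simps)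
  then have "bump_pred L n = (sin h)\<^sup>2" using 3 b[of "n - 1"] by (simp add: bump_pred_def sin_diff)
  moreover have "bump L n = 0" using 3 b[of n] Lh by simp
  moreover have "(sin h)\<^sup>2 <= 2 * h\<^sup>2" "(sin h)\<^sup>2 <= 2 * h"
   using sin_sq_le[of h] sin_sq_le_abs[of h] hp zero_le_power2[of h] by linarith+
  ultimately show ?thesis using 3 by (simp add: bump_ends)
 next
  case 4
  have "bump_pred L n = 0"
  proof (cases "n = Suc L")
   case True
   then show ?thesis using b[of L] Lh by (simp add: bump_pred_def)
  qed (use 4 in \<open>auto simp: bump_pred_def bump_ends\<close>)
  then show ?thesis using 4 hp by (simp add: bump_ends)
 qed
 then show "\<bar>bump_pred L n + bump L (Suc n) - 2 * bump L n\<bar> <= 2 * h\<^sup>2" "\<bar>bump_pred L n - bump L (Suc n)\<bar> <= 2 * h"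
  by simp_all
qed

lemma sum_cos_zero:
 assumes "L >= 2" shows "(\<Sum>n<L. cos (2 * pi * real n / real L)) = 0"
proof -
 define x where "x = cis (2 * pi / real L)"
 have xn: "cos (2 * pi * real n / real L) = Re (x ^ n)" for n
  by (simp add: x_def Complex.DeMoivre mult.commute)
 have "x ^ L = 1" using assms by (simp add: x_def Complex.DeMoivre)
 moreover have "x \<noteq> 1"
 proof
  assume "x = 1"
  then have "cos (2 * pi / real L) = 1" by (simp add: x_def complex_eq_iff)
  moreover have "cos (2 * pi / real L) < cos 0"
   using assms by (intro cos_monotone_0_pi) (auto simp: field_simps)
  ultimately show False by simp
 qed
 ultimately have "(\<Sum>n<L. x ^ n) = 0" by (simp add: sum_gp_strict)
 then show ?thesis unfolding xn by (metis Re_sum zero_complex.sel(1))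
qed

text \<open>
  The bump is symmetric under \<open>n \<mapsto> L - n\<close>, so its mean against the tent is half of its sum.
\<close>

lemma sum_bump:
 assumes L: "L >= 2" shows "(\<Sum>n\<le>L. (real L - real n) / real L * bump L n) = real L / 4"
proof -
 let ?S = "\<Sum>n\<le>L. (real L - real n) / real L * bump L n"
 have sym: "bump L (L - n) = bump L n" if "n <= L" for n
 proof -
  have "pi * real (L - n) / real L = pi - pi * real n / real L" using that L by (simp add: of_nat_diff field_simps)
  then show ?thesis by (simp add: bump_def that sin_diff)
 qed
 have "?S = (\<Sum>n\<le>L. (real L - real (L - n)) / real L * bump L (L - n))"
  by (rule sum.reindex_bij_witness[of _ "%n. L - n" "%n. L - n"]) auto
 also have "... = (\<Sum>n\<le>L. real n / real L * bump L n)"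
  by (intro sum.cong) (auto simp: sym of_nat_diff)
 finally have "2 * ?S = ?S + (\<Sum>n\<le>L. real n / real L * bump L n)" by simp
 also have "... = (\<Sum>n\<le>L. bump L n)"
  unfolding sum.distrib[symmetric] using L by (intro sum.cong) (auto simp: field_simps)
 also have "... = (\<Sum>n<L. bump L n)"
  by (simp add: lessThan_Suc_atMost[symmetric] bump_def)
 also have "... = (\<Sum>n<L. 1/2 - cos (2 * pi * real n / real L) / 2)"
 proof (intro sum.cong refl)
  fix n assume "n \<in> {..<L}"
  then show "bump L n = 1/2 - cos (2 * pi * real n / real L) / 2"
   using sin_sq_cos[of "pi * real n / real L"] by (simp add: bump_def diff_divide_distrib mult.assoc)
 qed
 also have "... = real L / 2" using sum_cos_zero[OF L] by (simp add: sum_subtractf sum_divide_distrib[symmetric])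
 finally show ?thesis by simp
qed

section \<open>Combinations of weight vectors\<close>

context surface_group begin

text \<open>
  Distinct squares, because an eigenspace depends only on the square of its parameter.
\<close>

definition fam :: "real set => (real => complex set => complex) => bool" where
 "fam I \<phi> \<longleftrightarrow> finite I \<and> (\<forall>s\<in>I. \<phi> s \<in> eigS s) \<and> (\<forall>s\<in>I. \<forall>t\<in>I. s \<noteq> t \<longrightarrow> s\<^sup>2 \<noteq> t\<^sup>2)"

definition mass :: "real set => (real => complex set => complex) => real" where
 "mass I \<phi> = (\<Sum>s\<in>I. nrm2 (U s (\<phi> s) 0))"

definition comb :: "real set => (real => complex set => complex) => nat => (nat => real => complex) => real^2^2 => complex" where
 "comb I \<phi> N c g = (\<Sum>p\<in>{..N} \<times> I. c (fst p) (snd p) * U (snd p) (\<phi> (snd p)) (fst p) g)"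

lemma mass_nonneg: "mass I \<phi> >= 0"
 unfolding mass_def by (intro sum_nonneg nrm2_nonneg)

lemma fam_smooth: "fam I \<phi> ==> s \<in> I ==> smooth_on uhp (lift_M (\<phi> s))"
 unfolding fam_def using eigenspace_smooth by blast

lemma nice_comb: "fam I \<phi> ==> nice (comb I \<phi> N c)"
 unfolding comb_def[abs_def] using fam_smooth by (intro nice_sum nice_mult nice_const nice_U) auto

lemma inner_comb:
 assumes f: "fam I \<phi>"
 shows "inner2 (comb I \<phi> N c) (comb I \<phi> N b) = (\<Sum>n\<le>N. \<Sum>s\<in>I. c n s * cnj (b n s) * of_real (nrm2 (U s (\<phi> s) 0)))"
proof -
 let ?P = "{..N} \<times> I"
 let ?u = "%p. U (snd p) (\<phi> (snd p)) (fst p)"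
 have fin: "finite ?P" using f by (simp add: fam_def)
 have nu: "nice (?u p)" if "p \<in> ?P" for p using that fam_smooth[OF f] by (intro nice_U) auto
 have io: "inner2 (?u p) (?u q) = (if p = q then of_real (nrm2 (U (snd p) (\<phi> (snd p)) 0)) else 0)" if "p \<in> ?P" "q \<in> ?P" for p q
 proof -
  obtain n s m t where pq: "p = (n, s)" "q = (m, t)" by (cases p; cases q)
  have st: "s \<in> I" "t \<in> I" using that pq by auto
  have e: "\<phi> s \<in> eigS s" "\<phi> t \<in> eigS t" using f st by (auto simp: fam_def)
  show ?thesis
  proof (cases "n = m")
   case False
   then show ?thesis using inner_U_weights[OF fam_smooth[OF f st(1)] fam_smooth[OF f st(2)]] by (simp add: pq)
  next
   case nm: True
   show ?thesis
   proof (cases "s = t")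
    case True
    then show ?thesis using nm inner_U_same[OF e(1) refl e(1) refl, of n] inner2_self[OF nice_U[OF fam_smooth[OF f st(1)]]]
     by (simp add: pq)
   next
    case False
    then have "s\<^sup>2 \<noteq> t\<^sup>2" using f st by (auto simp: fam_def)
    then show ?thesis using nm False inner_U_distinct[OF e(1) refl e(2) refl] by (simp add: pq)
   qed
  qed
 qed
 have ncu: "nice (%g. z p * ?u p g)" if "p \<in> ?P" for p z using nu[OF that] by (intro nice_mult nice_const)
 have "inner2 (comb I \<phi> N c) (comb I \<phi> N b) = (\<Sum>p\<in>?P. inner2 (%g. c (fst p) (snd p) * ?u p g) (comb I \<phi> N b))"
 proof -
  have "comb I \<phi> N c = (%g. \<Sum>p\<in>?P. c (fst p) (snd p) * ?u p g)" by (simp add: comb_def fun_eq_iff)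
  then show ?thesis by (simp only:) (intro inner2_sum_left nice_comb f ncu)
 qed
 also have "... = (\<Sum>p\<in>?P. \<Sum>q\<in>?P. c (fst p) (snd p) * cnj (b (fst q) (snd q)) * inner2 (?u p) (?u q))"
 proof (rule sum.cong[OF refl])
  fix p assume p: "p \<in> ?P"
  have "inner2 (%g. c (fst p) (snd p) * ?u p g) (comb I \<phi> N b) = (\<Sum>q\<in>?P. inner2 (%g. c (fst p) (snd p) * ?u p g) (%g. b (fst q) (snd q) * ?u q g))"
   unfolding comb_def[abs_def] by (intro inner2_sum_right ncu p)
  then show "inner2 (%g. c (fst p) (snd p) * ?u p g) (comb I \<phi> N b) = (\<Sum>q\<in>?P. c (fst p) (snd p) * cnj (b (fst q) (snd q)) * inner2 (?u p) (?u q))"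
   by (simp only: inner2_scale_left inner2_scale_right mult_ac)
 qed
 also have "... = (\<Sum>p\<in>?P. \<Sum>q\<in>?P. if q = p then c (fst p) (snd p) * cnj (b (fst p) (snd p)) * of_real (nrm2 (U (snd p) (\<phi> (snd p)) 0)) else 0)"
  by (intro sum.cong refl) (simp add: io)
 also have "... = (\<Sum>p\<in>?P. c (fst p) (snd p) * cnj (b (fst p) (snd p)) * of_real (nrm2 (U (snd p) (\<phi> (snd p)) 0)))"
  using fin by (intro sum.cong refl) (simp add: sum.delta)
 also have "... = (\<Sum>n\<le>N. \<Sum>s\<in>I. c n s * cnj (b n s) * of_real (nrm2 (U s (\<phi> s) 0)))"
  by (simp add: sum.cartesian_product split_beta)
 finally show ?thesis .
qed

lemma nrm2_comb_le:
 assumes f: "fam I \<phi>" and B: "\<And>n s. n <= N ==> s \<in> I ==> cmod (c n s) <= B"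
 shows "nrm2 (comb I \<phi> N c) <= real (Suc N) * B\<^sup>2 * mass I \<phi>"
proof -
 have "complex_of_real (nrm2 (comb I \<phi> N c)) = of_real (\<Sum>n\<le>N. \<Sum>s\<in>I. (cmod (c n s))\<^sup>2 * nrm2 (U s (\<phi> s) 0))"
  unfolding inner2_self[OF nice_comb[OF f], symmetric] inner_comb[OF f]
  by (simp only: of_real_sum of_real_mult complex_norm_square)
 then have "nrm2 (comb I \<phi> N c) = (\<Sum>n\<le>N. \<Sum>s\<in>I. (cmod (c n s))\<^sup>2 * nrm2 (U s (\<phi> s) 0))" by (simp only: of_real_eq_iff)
 also have "... <= (\<Sum>n\<le>N. \<Sum>s\<in>I. B\<^sup>2 * nrm2 (U s (\<phi> s) 0))"
  using B by (intro sum_mono mult_right_mono power_mono nrm2_nonneg) auto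
 also have "... = real (Suc N) * B\<^sup>2 * mass I \<phi>" by (simp add: mass_def sum_distrib_left mult.assoc)
 finally show ?thesis .
qed

lemma nrm_comb_le:
 assumes f: "fam I \<phi>" and B: "\<And>n s. n <= N ==> s \<in> I ==> cmod (c n s) <= B" "0 <= B"
 shows "nrm (comb I \<phi> N c) <= B * sqrt (real (Suc N)) * sqrt (mass I \<phi>)"
proof -
 have "nrm (comb I \<phi> N c) <= sqrt (real (Suc N) * B\<^sup>2 * mass I \<phi>)"
  unfolding nrm_def using nrm2_comb_le[OF f, of N c B] B by simp
 also have "... = B * sqrt (real (Suc N)) * sqrt (mass I \<phi>)"
  using B by (simp add: real_sqrt_mult del: of_nat_Suc)
 finally show ?thesis .
qed

text \<open>The coefficients of the derivative of a combination along the one-parameter subgroup generated by \<open>A\<close>.\<close>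

definition dcoeff :: "real^2^2 => real => nat => nat => real => complex" where
 "dcoeff A \<omega> L n s = 
   of_real (bump_pred L n) * (\<i> * of_real s + of_real (real n - 1/2)) * (of_real (A$1$1) + of_real (A$1$2 + A$2$1) / (2 * \<i>))
  + of_real (bump L (Suc n)) * (\<i> * of_real s - of_real (real n + 1/2)) * (of_real (A$1$1) - of_real (A$1$2 + A$2$1) / (2 * \<i>))
  + of_real (bump L n) * (of_real (A$1$2 - A$2$1) * \<i> * of_nat n - \<i> * of_real \<omega>)"

abbreviation test :: "real set => (real => complex set => complex) => nat => real^2^2 => complex" where
 "test I \<phi> L \<equiv> comb I \<phi> L (%n s. of_real (bump L n))"

lemma DWF_U_Suc:
 assumes \<phi>: "\<phi> \<in> eigS s" and g: "g \<in> SL2"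
 shows "DWF A (Suc m) (ladder s (lift_M \<phi>) (Suc m)) g = 
   (\<i> * of_real s + 1/2 + of_nat (Suc m)) * (of_real (A$1$1) + of_real (A$1$2 + A$2$1) / (2 * \<i>)) * U s \<phi> (Suc (Suc m)) g
  + (\<i> * of_real s - 1/2 - of_nat m) * (of_real (A$1$1) - of_real (A$1$2 + A$2$1) / (2 * \<i>)) * U s \<phi> m g
  + of_real (A$1$2 - A$2$1) * \<i> * of_nat (Suc m) * U s \<phi> (Suc m) g"
proof -
 have W: "WF (Suc m) (ladder s (lift_M \<phi>) (Suc m)) g = U s \<phi> (Suc m) g" by (simp only: U_def up_def)
 define x y where xy: "x = (\<i> * of_real s + 1/2 + of_nat (Suc m)) * U s \<phi> (Suc (Suc m)) g"
  "y = (\<i> * of_real s - 1/2 - of_nat m) * U s \<phi> m g"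
 have alg: "a * (x + y) + b * ((x - y) / d) + e = (a + b / d) * x + (a - b / d) * y + e" for a b d e :: complex
  by (simp add: ring_distribs add_divide_distrib diff_divide_distrib)
 show ?thesis unfolding DWF_def raised_U lowered_U[OF \<phi> refl g] W xy[symmetric]
  using alg[of "of_real (A$1$1)" "of_real (A$1$2 + A$2$1)" "2 * \<i>"] by (simp add: xy mult_ac)
qed

text \<open>
  Subtracting the eigenvalue \<open>\<i> \<omega>\<close> and collecting the terms of equal weight moves the differentiation from
  the functions to the coefficients. The lowest weight causes no term of weight \<open>- 2\<close> because
  the bump vanishes at 0.
\<close>

lemma flow_deriv_test:
 assumes f: "fam I \<phi>" and h: "one_param h A"
 obtains D where "flow_deriv h (test I \<phi> L) D" 
  "\<And>g. g \<in> SL2 ==> D g - \<i> * of_real \<omega> * test I \<phi> L g = comb I \<phi> (Suc L) (dcoeff A \<omega> L) g"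
proof -
 let ?P = "{..L} \<times> I"
 define E where "E p = DWF A (fst p) (ladder (snd p) (lift_M (\<phi> (snd p))) (fst p))" for p :: "nat \<times> real"
 define D where "D g = (\<Sum>p\<in>?P. of_real (bump L (fst p)) * E p g)" for g
 have fd: "flow_deriv h (U (snd p) (\<phi> (snd p)) (fst p)) (E p)" if "p \<in> ?P" for p
  unfolding E_def using that fam_smooth[OF f] by (intro flow_deriv_U h) auto
 have "flow_deriv h (test I \<phi> L) D"
  unfolding flow_deriv_def
 proof (intro conjI ballI allI exI[of _ A] h nice_comb f)
  show "nice D" unfolding D_def[abs_def] using fd by (intro nice_sum nice_mult nice_const) (auto simp: flow_deriv_def)
  show "((%t. test I \<phi> L (g ** h t)) has_vector_derivative D (g ** h t)) (at t)" if "g \<in> SL2" for g t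
   unfolding comb_def D_def using fd that
   by (intro has_vector_derivative_sum has_vector_derivative_mult_right) (auto simp: flow_deriv_def)
 qed
 moreover have "D g - \<i> * of_real \<omega> * test I \<phi> L g = comb I \<phi> (Suc L) (dcoeff A \<omega> L) g" if g: "g \<in> SL2" for g
 proof -
  define kp km b where k: "kp = complex_of_real (A$1$1) + of_real (A$1$2 + A$2$1) / (2 * \<i>)"
   "km = complex_of_real (A$1$1) - of_real (A$1$2 + A$2$1) / (2 * \<i>)" "b = complex_of_real (A$1$2 - A$2$1) * \<i>"
  have dk: "dcoeff A \<omega> L n s = of_real (bump_pred L n) * (\<i> * of_real s + of_real (real n - 1/2)) * kp
    + of_real (bump L (Suc n)) * (\<i> * of_real s - of_real (real n + 1/2)) * km
    + of_real (bump L n) * (b * of_nat n - \<i> * of_real \<omega>)" for n s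
   by (simp only: dcoeff_def k)
  have main: "(\<Sum>n\<le>L. of_real (bump L n) * E (n, s) g) - \<i> * of_real \<omega> * (\<Sum>n\<le>L. of_real (bump L n) * U s (\<phi> s) n g)
    = (\<Sum>n\<le>Suc L. dcoeff A \<omega> L n s * U s (\<phi> s) n g)" if s: "s \<in> I" for s
  proof -
   define u where "u n = U s (\<phi> s) n g" for n
   have e: "\<phi> s \<in> eigS s" using f s by (simp add: fam_def)
   let ?g = "%n. complex_of_real (bump L n)"
   define x where "x n = ?g n * ((\<i> * of_real s + 1/2 + of_nat n) * kp * u (Suc n))" for n
   define y where "y n = ?g n * ((\<i> * of_real s + 1/2 - of_nat n) * km * u (n - 1))" for n
   define z where "z n = ?g n * (b * of_nat n * u n)" for n
   have E: "?g n * E (n, s) g = x n + y n + z n" for n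
   proof (cases n)
    case 0
    then show ?thesis by (simp add: bump_ends x_def y_def z_def)
   next
    case (Suc m)
    have "E (n, s) g = (\<i> * of_real s + 1/2 + of_nat n) * kp * u (Suc n) + (\<i> * of_real s + 1/2 - of_nat n) * km * u (n - 1) + b * of_nat n * u n"
     unfolding E_def fst_conv snd_conv Suc DWF_U_Suc[OF e g] k[symmetric] u_def[symmetric]
     by simp
    then show ?thesis by (simp only: x_def y_def z_def ring_distribs)
   qed
   have sx: "(\<Sum>n\<le>L. x n) = (\<Sum>n\<le>Suc L. of_real (bump_pred L n) * ((\<i> * of_real s + of_real (real n - 1/2)) * kp * u n))"
    unfolding sum.atMost_Suc_shift by (simp add: bump_pred_def x_def algebra_simps)
   have sy: "(\<Sum>n\<le>L. y n) = (\<Sum>n\<le>Suc L. ?g (Suc n) * ((\<i> * of_real s - of_real (real n + 1/2)) * km * u n))"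
   proof -
    have "(\<Sum>n\<le>Suc L. ?g (Suc n) * ((\<i> * of_real s - of_real (real n + 1/2)) * km * u n)) = (\<Sum>n\<le>Suc L. y (Suc n))"
     by (intro sum.cong refl) (simp add: y_def algebra_simps)
    also have "... = (\<Sum>n\<le>Suc (Suc L). y n) - y 0" unfolding sum.atMost_Suc_shift[of y "Suc L"] by simp
    also have "y 0 = 0" by (simp add: y_def bump_ends)
    also have "(\<Sum>n\<le>Suc (Suc L). y n) = (\<Sum>n\<le>L. y n) + y (Suc L) + y (Suc (Suc L))" by simp
    also have "... = (\<Sum>n\<le>L. y n)" by (simp add: y_def bump_ends)
    finally show ?thesis by simp
   qed
   have sz: "(\<Sum>n\<le>L. z n) = (\<Sum>n\<le>Suc L. z n)" by (simp add: z_def bump_ends)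
   have su: "(\<Sum>n\<le>L. ?g n * u n) = (\<Sum>n\<le>Suc L. ?g n * u n)" by (simp add: bump_ends)
   have "(\<Sum>n\<le>L. ?g n * E (n, s) g) - \<i> * of_real \<omega> * (\<Sum>n\<le>L. ?g n * u n)
    = (\<Sum>n\<le>L. x n) + (\<Sum>n\<le>L. y n) + (\<Sum>n\<le>L. z n) - \<i> * of_real \<omega> * (\<Sum>n\<le>L. ?g n * u n)"
    by (simp add: E sum.distrib)
   also have "... = (\<Sum>n\<le>Suc L. dcoeff A \<omega> L n s * u n)"
    unfolding sx sy sz su sum_distrib_left sum.distrib[symmetric] sum_subtractf[symmetric]
    by (intro sum.cong refl) (simp only: dk z_def ring_distribs mult_ac add_diff_eq)
   finally show ?thesis by (simp only: u_def)
  qed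
  have "D g - \<i> * of_real \<omega> * test I \<phi> L g = (\<Sum>s\<in>I. (\<Sum>n\<le>L. of_real (bump L n) * E (n, s) g) - \<i> * of_real \<omega> * (\<Sum>n\<le>L. of_real (bump L n) * U s (\<phi> s) n g))"
   unfolding D_def comb_def sum_subtractf sum_distrib_left[symmetric]
   by (simp add: sum.cartesian_product' split_beta sum.swap[of _ I])
  also have "... = (\<Sum>s\<in>I. \<Sum>n\<le>Suc L. dcoeff A \<omega> L n s * U s (\<phi> s) n g)"
   by (intro sum.cong refl main)
  also have "... = comb I \<phi> (Suc L) (dcoeff A \<omega> L) g"
   unfolding comb_def by (subst sum.swap) (simp add: sum.cartesian_product split_beta del: sum.atMost_Suc)
  finally show ?thesis .
 qed
 ultimately show ?thesis by (rule that)
qed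

lemma cmod_ii_add: "cmod (\<i> * of_real a + of_real b) <= \<bar>a\<bar> + \<bar>b\<bar>"
 using norm_triangle_ineq[of "\<i> * of_real a" "of_real b"] by (simp add: norm_mult)

text \<open>
  The coefficient contains \<open>s\<close> times a second difference of the bump, \<open>n\<close> times a first difference, and
  \<open>2 (s - r)\<close>; with \<open>r\<close> of size \<open>L\<^sup>2\<close> each of them is bounded.
\<close>

lemma dcoeff_flow_bound:
 assumes L: "L >= 1" and r: "r <= 4 * (real L)\<^sup>2" "C <= r" "0 <= C" and s: "\<bar>s - r\<bar> <= C" and n: "n <= Suc L"
 shows "cmod (dcoeff (mat2 1 0 0 (-1)) (2 * r) L n s) <= 16 * pi\<^sup>2 + 2 * C + 4 * pi + 1"
proof -
 define h where "h = pi / real L"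
 note d = bump_differences[OF L h_def]
 let ?m = "bump_pred L n" and ?p = "bump L (Suc n)" and ?g = "bump L n"
 have e: "dcoeff (mat2 1 0 0 (-1)) (2 * r) L n s = \<i> * of_real (s * (?m + ?p - 2 * ?g) + 2 * (s - r) * ?g) + of_real (real n * (?m - ?p) - (?m + ?p) / 2)"
  by (simp add: dcoeff_def field_simps)
 have "cmod (dcoeff (mat2 1 0 0 (-1)) (2 * r) L n s) <= \<bar>s * (?m + ?p - 2 * ?g) + 2 * (s - r) * ?g\<bar> + \<bar>real n * (?m - ?p) - (?m + ?p) / 2\<bar>"
  unfolding e by (rule cmod_ii_add)
 moreover have "\<bar>s * (?m + ?p - 2 * ?g) + 2 * (s - r) * ?g\<bar> <= 16 * pi\<^sup>2 + 2 * C"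
 proof -
  have "\<bar>s\<bar> * \<bar>?m + ?p - 2 * ?g\<bar> <= (2 * (4 * (real L)\<^sup>2)) * (2 * h\<^sup>2)"
   using s r by (intro mult_mono d) auto
  also have "... = 16 * pi\<^sup>2" using L by (simp add: h_def power_divide field_simps)
  finally have 1: "\<bar>s * (?m + ?p - 2 * ?g)\<bar> <= 16 * pi\<^sup>2" by (simp add: abs_mult)
  have "\<bar>2 * (s - r)\<bar> * \<bar>?g\<bar> <= (2 * C) * 1" using s bump_bounds[of L n] r by (intro mult_mono) auto
  then have "\<bar>2 * (s - r) * ?g\<bar> <= 2 * C" by (simp add: abs_mult)
  with 1 show ?thesis by linarith
 qed
 moreover have "\<bar>real n * (?m - ?p) - (?m + ?p) / 2\<bar> <= 4 * pi + 1"
 proof -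
  have "real n * \<bar>?m - ?p\<bar> <= (2 * real L) * (2 * h)" using n L by (intro mult_mono d) auto
  also have "... = 4 * pi" using L by (simp add: h_def)
  finally have "\<bar>real n * (?m - ?p)\<bar> <= 4 * pi" by (simp add: abs_mult)
  moreover have "0 <= ?m + ?p" "?m + ?p <= 2" using bump_bounds[of L "Suc n"] bump_pred_bounds[of L n] by auto
  moreover have "\<bar>x - y / 2\<bar> <= a + 1" if "\<bar>x\<bar> <= a" "0 <= y" "y <= 2" for x y a :: real using that by linarith
  ultimately show ?thesis by blast
 qed
 ultimately show ?thesis by linarith
qed

lemma dcoeff_unipotent_bound:
 assumes L: "L >= 1" and r: "r <= 4 * (real L)\<^sup>2" "C <= r" "0 <= C" and s: "\<bar>s - r\<bar> <= C" and n: "n <= Suc L"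
  and A: "A = mat2 0 1 0 0 \<or> A = mat2 0 0 1 0"
 shows "cmod (dcoeff A 0 L n s) <= (8 * pi + 5) * real L"
proof -
 define h where "h = pi / real L"
 note d = bump_differences[OF L h_def]
 let ?m = "bump_pred L n" and ?p = "bump L (Suc n)" and ?g = "bump L n"
 obtain \<sigma> :: real where A': "A$1$1 = 0" "A$1$2 + A$2$1 = 1" "A$1$2 - A$2$1 = \<sigma>" "\<bar>\<sigma>\<bar> = 1" using A by auto
 have e: "dcoeff A 0 L n s = (\<i> * of_real (- (real n * (?m + ?p) - (?m - ?p) / 2) / 2 + \<sigma> * real n * ?g) + of_real (s * (?m - ?p) / 2))"
  unfolding dcoeff_def A' by (simp add: complex_eq_iff field_simps)
 have "cmod (dcoeff A 0 L n s) <= \<bar>- (real n * (?m + ?p) - (?m - ?p) / 2) / 2 + \<sigma> * real n * ?g\<bar> + \<bar>s * (?m - ?p) / 2\<bar>"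
  unfolding e by (rule cmod_ii_add)
 moreover have "\<bar>s * (?m - ?p) / 2\<bar> <= 8 * pi * real L"
 proof -
  have "\<bar>s\<bar> * \<bar>?m - ?p\<bar> <= (2 * (4 * (real L)\<^sup>2)) * (2 * h)" using s r by (intro mult_mono d) auto
  also have "... = 16 * pi * real L" using L by (simp add: h_def power2_eq_square field_simps)
  finally show ?thesis by (simp add: abs_mult)
 qed
 moreover have "\<bar>- (real n * (?m + ?p) - (?m - ?p) / 2) / 2 + \<sigma> * real n * ?g\<bar> <= 5 * real L"
 proof -
  have b: "0 <= ?m" "?m <= 1" "0 <= ?p" "?p <= 1" "0 <= ?g" "?g <= 1" using bump_bounds bump_pred_bounds by auto
  have nL: "real n <= 2 * real L" using n L by linarith
  have 1: "real n * (?m + ?p) <= (2 * real L) * 2" using nL b by (intro mult_mono) auto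
  have 2: "0 <= real n * (?m + ?p)" using b by simp
  have "\<bar>\<sigma> * real n * ?g\<bar> = real n * ?g" using A'(4) b by (simp add: abs_mult)
  also have "... <= (2 * real L) * 1" using nL b by (intro mult_mono) auto
  finally have 3: "\<bar>\<sigma> * real n * ?g\<bar> <= 2 * real L" by simp
  have "real L >= 1" using L by simp
  moreover have "\<bar>?m - ?p\<bar> <= 1" using b by linarith
  moreover have "\<bar>- (x - y / 2) / 2 + z\<bar> <= 5 * l" if "x <= (2 * l) * 2" "0 <= x" "\<bar>z\<bar> <= 2 * l" "l >= 1" "\<bar>y\<bar> <= 1" for x y z l :: real
   using that by (simp add: abs_le_iff add_divide_distrib diff_divide_distrib)
  ultimately show ?thesis using 1 2 3 by blast
 qed
 ultimately show ?thesis by (simp add: algebra_simps)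
qed

end

section \<open>The test vector over a tube\<close>

text \<open>
  The Gauss decomposition; the time of the flow is the logarithm of the upper left entry.
\<close>

lemma tube_decomposition:
 assumes h: "h \<in> tube \<delta> \<epsilon>" and \<delta>: "\<delta> <= 1/2"
 obtains q p where "h = nminus q ** aflow (ln (h$1$1)) ** nplus p" "\<bar>q\<bar> <= 2 * \<epsilon>" "\<bar>p\<bar> <= 2 * \<epsilon>" "\<bar>ln (h$1$1)\<bar> <= 2 * \<delta>"
proof
 have hS: "h \<in> SL2" and a: "\<bar>h$1$1 - 1\<bar> <= \<delta>" and b: "\<bar>h$1$2\<bar> <= \<epsilon>" "\<bar>h$2$1\<bar> <= \<epsilon>"
  using h by (auto simp: tube_def)
 have half: "h$1$1 >= 1/2" using a \<delta> by linarith
 then have nz: "h$1$1 \<noteq> 0" by auto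
 have det: "h$1$1 * h$2$2 = 1 + h$1$2 * h$2$1" using hS by (simp add: mem_SL2)
 show "h = nminus (h$2$1 / h$1$1) ** aflow (ln (h$1$1)) ** nplus (h$1$2 / h$1$1)"
  using half nz det
  by (simp add: mat2_eq_iff mult_nth2 nminus_def aflow_def nplus_def exp_minus field_simps)
 have "\<bar>x / h$1$1\<bar> <= 2 * \<epsilon>" if "\<bar>x\<bar> <= \<epsilon>" for x
 proof -
  have "\<bar>x\<bar> <= (2 * \<epsilon>) * (1/2)" using that by simp
  also have "... <= (2 * \<epsilon>) * h$1$1" using half that by (intro mult_left_mono) auto
  finally show ?thesis using half by (simp add: field_simps)
 qed
 then show "\<bar>h$2$1 / h$1$1\<bar> <= 2 * \<epsilon>" "\<bar>h$1$2 / h$1$1\<bar> <= 2 * \<epsilon>" using b by blast+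
 define x where "x = h$1$1 - 1"
 have x: "\<bar>x\<bar> <= \<delta>" "\<bar>x\<bar> <= 1/2" using a \<delta> by (auto simp: x_def)
 have "\<bar>ln (1 + x) - x\<bar> <= 2 * x\<^sup>2" by (rule abs_ln_one_plus_x_minus_x_bound[OF x(2)])
 moreover have "2 * x\<^sup>2 <= \<bar>x\<bar>"
 proof -
  have "\<bar>x\<bar> * \<bar>x\<bar> <= (1/2) * \<bar>x\<bar>" using x by (intro mult_right_mono) auto
  then show ?thesis by (simp add: power2_eq_square flip: abs_mult)
 qed
 ultimately show "\<bar>ln (h$1$1)\<bar> <= 2 * \<delta>" using x by (simp add: x_def)
qed

context surface_group begin

text \<open>
  The sum of the unipotent and flow bounds on the coefficients, each times twice the
  number of factors in the decomposition of the tube.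
\<close>

definition drift :: "real => real" where
 "drift C = 4 * (8 * pi + 5) + 2 * (16 * pi\<^sup>2 + 2 * C + 4 * pi + 1)"

text \<open>
  Moving the test vector within the tube multiplies it by a phase that depends only on the flow time.
  The unipotent derivatives have size \<open>L\<close>, which is compensated by the width \<open>\<delta> / L\<close>, and the
 deviation from an eigenvector of the geodesic flow is bounded.
\<close>

lemma test_tube_estimate:
 assumes f: "fam I \<phi>" and I: "\<And>s. s \<in> I ==> \<bar>s - r\<bar> <= C"
  and L: "L >= 1" and r: "r <= 4 * (real L)\<^sup>2" "C <= r" "0 <= C"
  and h: "h \<in> tube \<delta> (\<delta> / real L)" and \<delta>: "\<delta> <= 1/2"
 shows "nrm (%g. test I \<phi> L (g ** h) - cis (2 * r * ln (h$1$1)) * test I \<phi> L g)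
   <= \<delta> * drift C * sqrt (real L + 2) * sqrt (mass I \<phi>)"
proof -
 obtain q p where h_eq: "h = nminus q ** aflow (ln (h$1$1)) ** nplus p"
  and q: "\<bar>q\<bar> <= 2 * (\<delta> / real L)" and p: "\<bar>p\<bar> <= 2 * (\<delta> / real L)" and t: "\<bar>ln (h$1$1)\<bar> <= 2 * \<delta>"
  using tube_decomposition[OF h \<delta>] by blast
 define t where "t = ln (h$1$1)"
 define G where "G = test I \<phi> L"
 define m where "m = sqrt (real L + 2) * sqrt (mass I \<phi>)"
 have m0: "0 <= m" by (simp add: m_def mass_nonneg)
 let ?A = "nplus p" and ?B = "aflow t" and ?D = "nminus q" and ?c = "cis (2 * r * t)"
 have hS: "h = ?D ** ?B ** ?A" using h_eq by (simp add: t_def)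
 have S: "?A \<in> SL2" "?B \<in> SL2" "?D \<in> SL2"
  using one_param_nplus one_param_aflow one_param_nminus by (auto simp: one_param_def)
 have nG: "nice G" unfolding G_def by (rule nice_comb[OF f])
 have step: "nrm (%g. G (g ** k u) - cis (\<omega> * u) * G g) <= \<bar>u\<bar> * (K * m)"
  if op: "one_param k A" and K: "0 <= K" "\<And>n s. n <= Suc L ==> s \<in> I ==> cmod (dcoeff A \<omega> L n s) <= K" for k A \<omega> u K
 proof -
  obtain D where D: "flow_deriv k G D" "\<And>g. g \<in> SL2 ==> D g - \<i> * of_real \<omega> * G g = comb I \<phi> (Suc L) (dcoeff A \<omega> L) g"
   using flow_deriv_test[OF f op, of L \<omega>] unfolding G_def by metis
  have "nrm (%g. G (g ** k u) - cis (\<omega> * u) * G g) <= \<bar>u\<bar> * nrm (%g. D g - \<i> * of_real \<omega> * G g)"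
   by (rule flow_estimate[OF D(1)])
  also have "nrm (%g. D g - \<i> * of_real \<omega> * G g) = nrm (comb I \<phi> (Suc L) (dcoeff A \<omega> L))"
   by (rule nrm_cong) (rule D(2))
  also have "\<bar>u\<bar> * \<dots> <= \<bar>u\<bar> * (K * m)"
   using nrm_comb_le[OF f, of "Suc L" "dcoeff A \<omega> L" K] K by (intro mult_left_mono) (simp_all add: m_def mult.assoc add.commute)
  finally show ?thesis .
 qed
 let ?Ku = "(8 * pi + 5) * real L" and ?Ka = "16 * pi\<^sup>2 + 2 * C + 4 * pi + 1"
 have Ka: "0 <= ?Ka" using r(3) by simp
 have Ku: "0 <= ?Ku" by simp
 note ub = dcoeff_unipotent_bound[OF L r I]
 note fb = dcoeff_flow_bound[OF L r I]
 have bu: "cmod (dcoeff A 0 L n s) <= ?Ku" if "A = mat2 0 1 0 0 \<or> A = mat2 0 0 1 0" "n <= Suc L" "s \<in> I" for A n s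
  by (rule ub[OF that(3) that(2) that(1)])
 have ba: "cmod (dcoeff (mat2 1 0 0 (-1)) (2 * r) L n s) <= ?Ka" if "n <= Suc L" "s \<in> I" for n s
  by (rule fb[OF that(2) that(1)])
 have e1: "nrm (%g. G (g ** ?A) - cis (0 * p) * G g) <= \<bar>p\<bar> * (?Ku * m)"
  by (rule step[OF one_param_nplus Ku bu]) auto
 have e2: "nrm (%g. G (g ** ?B) - ?c * G g) <= \<bar>t\<bar> * (?Ka * m)"
  by (rule step[OF one_param_aflow Ka ba])
 have e3: "nrm (%g. G (g ** ?D) - cis (0 * q) * G g) <= \<bar>q\<bar> * (?Ku * m)"
  by (rule step[OF one_param_nminus Ku bu]) auto
 define P1 P2 P3 where P: "P1 g = G (g ** ?A) - cis (0 * p) * G g" "P2 g = G (g ** ?B) - ?c * G g"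
  "P3 g = G (g ** ?D) - cis (0 * q) * G g" for g
 have nP: "nice P1" "nice P2" "nice P3" unfolding P[abs_def] by (intro nice_intros nG S)+
 have "(%g. G (g ** h) - ?c * G g) = (%g. P1 (g ** (?D ** ?B)) + (P2 (g ** ?D) + ?c * P3 g))"
  by (simp add: P hS matrix_mul_assoc algebra_simps fun_eq_iff)
 then have "nrm (%g. G (g ** h) - ?c * G g) <= nrm (%g. P1 (g ** (?D ** ?B))) + nrm (%g. P2 (g ** ?D) + ?c * P3 g)"
  by (simp only:) (intro nrm_triangle nice_intros nP SL2_mult S)
 also have "nrm (%g. P2 (g ** ?D) + ?c * P3 g) <= nrm (%g. P2 (g ** ?D)) + nrm (%g. ?c * P3 g)"
  by (intro nrm_triangle nice_intros nP S)
 also have "nrm (%g. P1 (g ** (?D ** ?B))) + (nrm (%g. P2 (g ** ?D)) + nrm (%g. ?c * P3 g)) = nrm P1 + (nrm P2 + nrm P3)"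
  by (simp add: nrm_translate nP S SL2_mult nrm_scale)
 also have "... <= \<bar>p\<bar> * (?Ku * m) + (\<bar>t\<bar> * (?Ka * m) + \<bar>q\<bar> * (?Ku * m))"
  using e1 e2 e3 unfolding P[abs_def] by (intro add_mono)
 also have "... <= (2 * (\<delta> / real L)) * (?Ku * m) + ((2 * \<delta>) * (?Ka * m) + (2 * (\<delta> / real L)) * (?Ku * m))"
  using q p t Ka Ku m0 by (intro add_mono mult_right_mono) (auto simp: t_def)
 also have "(2 * (\<delta> / real L)) * (?Ku * m) = 2 * \<delta> * ((8 * pi + 5) * m)" using L by simp
 also have "2 * \<delta> * ((8 * pi + 5) * m) + ((2 * \<delta>) * (?Ka * m) + 2 * \<delta> * ((8 * pi + 5) * m)) = \<delta> * (4 * (8 * pi + 5) + 2 * ?Ka) * m"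
  by (simp add: algebra_simps)
 finally show ?thesis by (simp add: G_def t_def m_def drift_def mult.assoc)
qed

section \<open>The lift as a combination of weight vectors\<close>

definition lift_norm :: "nat => real" where
 "lift_norm L = sqrt (3 * real L / (2 * (real L)\<^sup>2 + 1))"

text \<open>
  The vectors of negative weight are complex conjugates of vectors of positive weight of the
  conjugate eigenfunction, with spectral parameter \<open>- s\<close>.
\<close>

definition lift_comb :: "real set => (real => complex set => complex) => nat => real^2^2 => complex" where
 "lift_comb I \<phi> L g =
   comb I \<phi> L (%n s. of_real (lift_norm L * ((real L - real n) / real L))) g
  + cnj (comb (uminus ` I) (%s p. cnj (\<phi> (- s) p)) L
    (%n s. if n = 0 then 0 else of_real (lift_norm L * ((real L - real n) / real L))) g)"

lemma fam_cnj: "fam I \<phi> ==> fam (uminus ` I) (%s p. cnj (\<phi> (- s) p))"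
 unfolding fam_def using eigenspace_cnj by (auto simp: eigenspace_def)

lemma nrm2_U0_cnj: "nrm2 (U s (%p. cnj (\<phi> p)) 0) = nrm2 (U s' \<phi> 0)"
 unfolding nrm2_def by (simp add: U_0)

lemma mass_cnj: "mass (uminus ` I) (%s p. cnj (\<phi> (- s) p)) = mass I \<phi>"
 unfolding mass_def by (subst sum.reindex) (auto intro!: sum.cong nrm2_U0_cnj)

lemma nice_lift_comb: "fam I \<phi> ==> nice (lift_comb I \<phi> L)"
 unfolding lift_comb_def[abs_def] by (intro nice_intros nice_comb fam_cnj)

lemma nrm_cnj: "nrm (%g. cnj (F g)) = nrm F"
 by (simp add: nrm_def nrm2_def)

lemma lift_norm_bounds:
 assumes L: "L >= 2"
 shows "0 < lift_norm L" "lift_norm L * sqrt (real (Suc L)) <= 3/2" "sqrt (real L) <= lift_norm L * real L"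
proof -
 have l: "real L >= 2" using L by simp
 then have pos: "2 * (real L)\<^sup>2 + 1 > 0" by (intro add_nonneg_pos) auto
 show "0 < lift_norm L" using l pos by (simp add: lift_norm_def)
 show "lift_norm L * sqrt (real (Suc L)) <= 3/2"
 proof -
  have "3 * real L / (2 * (real L)\<^sup>2 + 1) * real (Suc L) <= (3/2)\<^sup>2"
  proof -
   have "2 * real L <= real L * real L" using l by (intro mult_right_mono) auto
   then have "3 * real L * real (Suc L) <= (3/2)\<^sup>2 * (2 * (real L)\<^sup>2 + 1)"
    by (simp add: power2_eq_square algebra_simps)
   then show ?thesis using pos by (simp add: pos_divide_le_eq)
  qed
  then have "sqrt (3 * real L / (2 * (real L)\<^sup>2 + 1) * real (Suc L)) <= sqrt ((3/2)\<^sup>2)" by (rule real_sqrt_le_mono)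
  then show ?thesis unfolding lift_norm_def real_sqrt_mult[symmetric] by simp
 qed
 have "real L <= 3 * real L / (2 * (real L)\<^sup>2 + 1) * (real L)\<^sup>2"
 proof -
  have "1 * 1 <= real L * real L" using l by (intro mult_mono) auto
  then have "real L * (2 * (real L)\<^sup>2 + 1) <= real L * (3 * (real L)\<^sup>2)" by (intro mult_left_mono) (auto simp: power2_eq_square)
  then have "real L <= real L * (3 * (real L)\<^sup>2) / (2 * (real L)\<^sup>2 + 1)" using pos by (simp add: pos_le_divide_eq)
  then show ?thesis by (simp add: mult_ac)
 qed
 then have "sqrt (real L) <= sqrt (3 * real L / (2 * (real L)\<^sup>2 + 1) * (real L)\<^sup>2)" by (rule real_sqrt_le_mono)
 then show "sqrt (real L) <= lift_norm L * real L" 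
  unfolding lift_norm_def real_sqrt_mult[of "3 * real L / (2 * (real L)\<^sup>2 + 1)" "(real L)\<^sup>2"] by simp
qed

lemma nrm_lift_comb_le:
 assumes f: "fam I \<phi>" and L: "L >= 2" shows "nrm (lift_comb I \<phi> L) <= 3 * sqrt (mass I \<phi>)"
proof -
 note b = lift_norm_bounds[OF L]
 let ?N = "lift_norm L"
 have c: "cmod (of_real (?N * ((real L - real n) / real L))) <= ?N" if "n <= L" for n
 proof -
  have "0 <= (real L - real n) / real L" "(real L - real n) / real L <= 1" using that L by (auto simp: field_simps)
  moreover have "\<bar>?N * x\<bar> <= ?N" if "0 <= x" "x <= 1" for x using that b(1) by (simp add: abs_mult mult_left_le)
  ultimately show ?thesis unfolding norm_of_real by blast
 qed
 define F H where FH: "F = comb I \<phi> L (%n s. of_real (lift_norm L * ((real L - real n) / real L)))"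
  "H = comb (uminus ` I) (%s p. cnj (\<phi> (- s) p)) L
    (%n s. if n = 0 then 0 else of_real (lift_norm L * ((real L - real n) / real L)))"
 have n: "nice F" "nice H" unfolding FH by (intro nice_comb f fam_cnj)+
 have "nrm (lift_comb I \<phi> L) = nrm (%g. F g + cnj (H g))" by (simp add: lift_comb_def[abs_def] FH)
 also have "... <= nrm F + nrm (%g. cnj (H g))" by (intro nrm_triangle nice_intros n)
 also have "nrm (%g. cnj (H g)) = nrm H" by (rule nrm_cnj)
 also have "nrm F <= ?N * sqrt (real (Suc L)) * sqrt (mass I \<phi>)"
  unfolding FH by (rule nrm_comb_le[OF f]) (use c b in auto)
 also have "nrm H <= ?N * sqrt (real (Suc L)) * sqrt (mass I \<phi>)"
  unfolding FH mass_cnj[of I \<phi>, symmetric] using c b(1) by (intro nrm_comb_le fam_cnj f) (auto simp del: of_real_mult)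
 also have "?N * sqrt (real (Suc L)) * sqrt (mass I \<phi>) + ?N * sqrt (real (Suc L)) * sqrt (mass I \<phi>) = 
   2 * (?N * sqrt (real (Suc L))) * sqrt (mass I \<phi>)" by simp
 also have "... <= 3 * sqrt (mass I \<phi>)" using b(2) mass_nonneg by (intro mult_right_mono) auto
 finally show ?thesis by simp
qed

lemma inner_cnj_comb:
 assumes f: "fam I \<phi>" and f': "fam J \<kappa>" and b: "\<And>s. b 0 s = 0"
 shows "inner2 (%g. cnj (comb J \<kappa> N c g)) (comb I \<phi> N b) = 0"
proof -
 let ?v = "%p. U (snd p) (\<kappa> (snd p)) (fst p)" and ?u = "%p. U (snd p) (\<phi> (snd p)) (fst p)"
 have nu: "nice (?u p)" if "p \<in> {..N} \<times> I" for p using that fam_smooth[OF f] by (intro nice_U) auto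
 have nv: "nice (?v p)" if "p \<in> {..N} \<times> J" for p using that fam_smooth[OF f'] by (intro nice_U) auto
 have tm: "inner2 (%g. cnj (c (fst p) (snd p)) * cnj (?v p g)) (%g. b (fst q) (snd q) * ?u q g) = 0"
  if pq: "p \<in> {..N} \<times> J" "q \<in> {..N} \<times> I" for p q
 proof (cases "fst q = 0")
  case True
  then show ?thesis unfolding inner2_scale_right by (simp add: b)
 next
  case False
  then have "inner2 (%g. cnj (?v p g)) (?u q) = 0"
   using pq by (intro inner_U_cnj_weights fam_smooth[OF f] fam_smooth[OF f']) auto
  then show ?thesis unfolding inner2_scale_left inner2_scale_right by simp
 qed
 have "inner2 (%g. cnj (comb J \<kappa> N c g)) (comb I \<phi> N b)
   = (\<Sum>p\<in>{..N} \<times> J. inner2 (%g. cnj (c (fst p) (snd p)) * cnj (?v p g)) (comb I \<phi> N b))"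
  unfolding comb_def[of J] cnj_sum complex_cnj_mult using nv by (intro inner2_sum_left nice_intros nice_comb f)
 also have "... = (\<Sum>p\<in>{..N} \<times> J. \<Sum>q\<in>{..N} \<times> I. inner2 (%g. cnj (c (fst p) (snd p)) * cnj (?v p g)) (%g. b (fst q) (snd q) * ?u q g))"
  unfolding comb_def[abs_def] using nu nv by (intro sum.cong refl inner2_sum_right nice_intros)
 also have "... = 0" by (intro sum.neutral ballI tm)
 finally show ?thesis .
qed

text \<open>
  The conjugate part of the lift has weights below 0 and is orthogonal to the test vector. The rest is the sum of
  the tent against the bump.
\<close>

lemma inner_lift_test:
 assumes f: "fam I \<phi>" and L: "L >= 2"
 shows "inner2 (lift_comb I \<phi> L) (test I \<phi> L) = of_real (lift_norm L * (real L / 4) * mass I \<phi>)"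
proof -
 let ?c = "%n s. of_real (lift_norm L * ((real L - real n) / real L))"
 define F H where FH: "F = comb I \<phi> L ?c"
  "H = comb (uminus ` I) (%s p. cnj (\<phi> (- s) p)) L
    (%n s. if n = 0 then 0 else of_real (lift_norm L * ((real L - real n) / real L)))"
 have n: "nice F" "nice H" unfolding FH by (intro nice_comb f fam_cnj)+
 have "inner2 (lift_comb I \<phi> L) (test I \<phi> L) = inner2 (%g. F g + cnj (H g)) (test I \<phi> L)"
  by (simp add: lift_comb_def[abs_def] FH)
 also have "... = inner2 F (test I \<phi> L) + inner2 (%g. cnj (H g)) (test I \<phi> L)"
  by (intro inner2_add_left nice_intros n nice_comb f)
 also have "inner2 (%g. cnj (H g)) (test I \<phi> L) = 0"
  unfolding FH by (intro inner_cnj_comb f fam_cnj) (simp add: bump_ends)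
 also have "inner2 F (test I \<phi> L) = (\<Sum>n\<le>L. \<Sum>s\<in>I. of_real (lift_norm L * ((real L - real n) / real L * bump L n) * nrm2 (U s (\<phi> s) 0)))"
  unfolding FH inner_comb[OF f] by (intro sum.cong refl) simp
 also have "... = of_real (\<Sum>n\<le>L. lift_norm L * ((real L - real n) / real L * bump L n) * mass I \<phi>)"
  unfolding mass_def sum_distrib_left of_real_sum ..
 also have "(\<Sum>n\<le>L. lift_norm L * ((real L - real n) / real L * bump L n) * mass I \<phi>) = lift_norm L * (real L / 4) * mass I \<phi>"
  unfolding sum_bump[OF L, symmetric] sum_distrib_left sum_distrib_right ..
 finally show ?thesis by simp
qed

text \<open>
  Translating the lift by an element of the tube and undoing the phase preserves a positive proportion
  of the correlation with the test vector.
\<close>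

lemma tube_correlation:
 assumes f: "fam I \<phi>" and I: "\<And>s. s \<in> I ==> \<bar>s - r\<bar> <= C"
  and L: "L >= 2" and r: "r <= 4 * (real L)\<^sup>2" "C <= r" "0 <= C"
  and h: "h \<in> tube \<delta> (\<delta> / real L)"
  and \<delta>: "0 <= \<delta>" "\<delta> <= 1/2" "\<delta> * drift C <= 1/48"
 shows "sqrt (real L) / 8 * mass I \<phi>
   <= Re (cis (- (2 * r * ln (h$1$1))) * inner2 (%g. lift_comb I \<phi> L (g ** h)) (test I \<phi> L))"
proof -
 let ?P = "lift_comb I \<phi> L" and ?G = "test I \<phi> L"
 define w where "w = cis (2 * r * ln (h$1$1))"
 have wc: "cis (- (2 * r * ln (h$1$1))) = cnj w" by (simp add: w_def cis_cnj)
 have hS: "h \<in> SL2" using h by (simp add: tube_def)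
 have n: "nice ?P" "nice ?G" by (intro nice_lift_comb nice_comb f)+
 define E where "E g = ?G (g ** h) - w * ?G g" for g
 have nE: "nice E" unfolding E_def[abs_def] by (intro nice_intros n hS)
 have E: "nrm E <= 1/48 * (sqrt (real L + 2) * sqrt (mass I \<phi>))"
 proof -
  have "nrm E <= \<delta> * drift C * sqrt (real L + 2) * sqrt (mass I \<phi>)"
   unfolding E_def[abs_def] w_def using L by (intro test_tube_estimate f I r h \<delta>) auto
  also have "... = \<delta> * drift C * (sqrt (real L + 2) * sqrt (mass I \<phi>))" by (simp only: mult.assoc)
  also have "... <= 1/48 * (sqrt (real L + 2) * sqrt (mass I \<phi>))" using \<delta>(3) mass_nonneg by (intro mult_right_mono) auto
  finally show ?thesis .
 qed
 have dec: "?G (g ** h) = w * ?G g + E g" for g by (simp add: E_def)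
 have "inner2 ?P ?G = inner2 (%g. ?P (g ** h)) (%g. ?G (g ** h))"
  by (rule inner2_translate[OF n hS, symmetric])
 also have "... = inner2 (%g. ?P (g ** h)) (%g. w * ?G g) + inner2 (%g. ?P (g ** h)) E"
  unfolding dec by (intro inner2_add_right nice_intros n hS nE)
 also have "inner2 (%g. ?P (g ** h)) (%g. w * ?G g) = cnj w * inner2 (%g. ?P (g ** h)) ?G" by (rule inner2_scale_right)
 finally have "lift_norm L * (real L / 4) * mass I \<phi> = Re (cnj w * inner2 (%g. ?P (g ** h)) ?G) + Re (inner2 (%g. ?P (g ** h)) E)"
  unfolding inner_lift_test[OF f L] by (metis Re_complex_of_real plus_complex.simps(1))
 moreover have "Re (inner2 (%g. ?P (g ** h)) E) <= sqrt (real L) / 8 * mass I \<phi>"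
 proof -
  have "Re (inner2 (%g. ?P (g ** h)) E) <= nrm (%g. ?P (g ** h)) * nrm E"
   using inner2_le[OF nice_translate[OF n(1) hS] nE] complex_Re_le_cmod order_trans by blast
  also have "nrm (%g. ?P (g ** h)) = nrm ?P" by (rule nrm_translate[OF n(1) hS])
  also have "nrm ?P * nrm E <= (3 * sqrt (mass I \<phi>)) * (1/48 * (sqrt (real L + 2) * sqrt (mass I \<phi>)))"
   using nrm_lift_comb_le[OF f L] E mass_nonneg by (intro mult_mono) (auto simp: nrm_nonneg)
  also have "... = 1/16 * sqrt (real L + 2) * mass I \<phi>" using mass_nonneg[of I \<phi>] by simp
  also have "... <= 1/16 * (2 * sqrt (real L)) * mass I \<phi>"
  proof -
   have "sqrt (real L + 2) <= sqrt (2\<^sup>2 * real L)" using L by (intro real_sqrt_le_mono) simp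
   then have "sqrt (real L + 2) <= 2 * sqrt (real L)" unfolding real_sqrt_mult by simp
   then show ?thesis using mass_nonneg by (intro mult_right_mono mult_left_mono) auto
  qed
  finally show ?thesis by simp
 qed
 moreover have "sqrt (real L) / 4 * mass I \<phi> <= lift_norm L * (real L / 4) * mass I \<phi>"
  using lift_norm_bounds(3)[OF L] mass_nonneg by (intro mult_right_mono) auto
 ultimately show ?thesis unfolding wc by (simp add: field_simps)
qed

end

section \<open>Spectral decompositions and linearity of the lift\<close>

lemma dir_lincomb:
 assumes "smooth_on S f" "smooth_on S h" "z \<in> S"
 shows "dir v (%z. (a::complex) * f z + b * h z) z = a * dir v f z + b * dir v h z"
proof -
 have "((%z. a * f z + b * h z) has_derivative (%v. a * dir v f z + b * dir v h z)) (at z)"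
  by (intro has_derivative_add has_derivative_mult_right smooth_on_derivative[where S = S] assms)
 then show ?thesis by (rule fun_cong[OF frechet_derivative_at, symmetric])
qed

lemma raise_lincomb:
 assumes "smooth_on uhp f" "smooth_on uhp h" "z \<in> uhp"
 shows "raise n (%z. a * f z + b * h z) z = a * raise n f z + b * raise n h z"
 unfolding raise_def dir_lincomb[OF assms] by (simp add: algebra_simps)

lemma ladder_lincomb:
 assumes f: "smooth_on uhp f" and h: "smooth_on uhp h"
 shows "z \<in> uhp ==> ladder s (%z. a * f z + b * h z) n z = a * ladder s f n z + b * ladder s h n z"
proof (induction n arbitrary: z)
 case (Suc n)
 have "raise (real n) (ladder s (%z. a * f z + b * h z) n) z = raise (real n) (%z. a * ladder s f n z + b * ladder s h n z) z"
  by (rule raise_cong[OF Suc.IH Suc.prems])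
 also have "... = a * raise (real n) (ladder s f n) z + b * raise (real n) (ladder s h n) z"
  by (rule raise_lincomb[OF ladder_smooth[OF f] ladder_smooth[OF h] Suc.prems])
 finally show ?case by (simp add: ring_distribs mult_ac)
qed simp

lemma smooth_on_lincomb:
 assumes "open S" "smooth_on S f" "smooth_on S h" shows "smooth_on S (%z. (a::complex) * f z + b * h z)"
 by (intro smooth_on_add smooth_on_mult smooth_on_const assms)

lemma sum_fun_apply: "(\<Sum>i\<in>A. f i) x = (\<Sum>i\<in>A. f i x)" for f :: "'i => 'a => complex"
 by (induction A rule: infinite_finite_induct) auto

lemma sum_symmetric_interval:
 fixes f :: "int => complex"
 shows "(\<Sum>n\<in>{- int k..int k}. f n) = (\<Sum>n\<le>k. f (int n)) + (\<Sum>n\<le>k. if n = 0 then 0 else f (- int n))"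
proof (induction k)
 case (Suc k)
 have "{- int (Suc k)..int (Suc k)} = insert (- int (Suc k)) (insert (int (Suc k)) {- int k..int k})" by auto
 then have "(\<Sum>n\<in>{- int (Suc k)..int (Suc k)}. f n) = f (- int (Suc k)) + (f (int (Suc k)) + (\<Sum>n\<in>{- int k..int k}. f n))"
  by (simp del: of_nat_Suc)
 then show ?case using Suc by (simp del: of_nat_Suc)
qed simp

context surface_group begin

lemma U_lincomb:
 assumes "smooth_on uhp (lift_M \<phi>)" "smooth_on uhp (lift_M \<psi>)" "g \<in> SL2"
 shows "U s (%p. a * \<phi> p + b * \<psi> p) n g = a * U s \<phi> n g + b * U s \<psi> n g"
proof -
 have e: "lift_M (%p. a * \<phi> p + b * \<psi> p) = (%z. a * lift_M \<phi> z + b * lift_M \<psi> z)"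
  by (simp add: lift_M_def fun_eq_iff)
 show ?thesis unfolding U_def up_def WF_def e ladder_lincomb[OF assms(1,2) act_uhp[OF assms(3) i_uhp]]
  by (simp add: algebra_simps)
qed

lemma eigenspace_lincomb:
 assumes "\<phi> \<in> eigS s" "\<psi> \<in> eigS s" shows "(%p. a * \<phi> p + b * \<psi> p) \<in> eigS s"
proof -
 note sm = eigenspace_smooth[OF assms(1)] eigenspace_smooth[OF assms(2)]
 let ?h = "%z. a * lift_M \<phi> z + b * lift_M \<psi> z"
 have sc: "smooth_on uhp ?h" by (intro smooth_on_lincomb open_uhp sm)
 have dd: "dir v (dir v ?h) z = a * dir v (dir v (lift_M \<phi>)) z + b * dir v (dir v (lift_M \<psi>)) z" if "z \<in> uhp" for v z
 proof -
  have "dir v (dir v ?h) z = dir v (%z. a * dir v (lift_M \<phi>) z + b * dir v (lift_M \<psi>) z) z"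
   by (rule fun_cong[OF frechet_derivative_cong_open[OF open_uhp that]]) (rule dir_lincomb[OF sm])
  also have "... = a * dir v (dir v (lift_M \<phi>)) z + b * dir v (dir v (lift_M \<psi>)) z"
   by (rule dir_lincomb[OF smooth_on_partial[OF sm(1)] smooth_on_partial[OF sm(2)] that])
  finally show ?thesis .
 qed
 have "hyperbolic_laplacian ?h z = - of_real (1/4 + s\<^sup>2) * ?h z" if z: "z \<in> uhp" for z
 proof -
  have "hyperbolic_laplacian ?h z = a * lap (lift_M \<phi>) z + b * lap (lift_M \<psi>) z"
   unfolding hyperbolic_laplacian_eq[OF sc z] lap_def dd[OF z] by (simp add: algebra_simps)
  then show ?thesis unfolding eigenspace_lap[OF assms(1) z] eigenspace_lap[OF assms(2) z] by (simp add: algebra_simps)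
 qed
 then show ?thesis using assms sc by (simp add: eigenspace_def smooth_functions_M_def lift_M_def[abs_def])
qed

definition pull :: "(complex set => complex) => real^2^2 => complex" where
 "pull \<psi> g = \<psi> (pM (act g \<i>))"

text \<open>
  Keeping an explicit index set \<open>I\<close>, possibly larger than the support, allows two decompositions
  to be added without cancellation changing the index set.
\<close>

definition decomp :: "real => real => (complex set => complex) => real set => (real => complex set => complex) => bool" where
 "decomp a b \<psi> I \<phi> \<longleftrightarrow> 0 < a \<and> finite I \<and> I \<subseteq> {a..b} \<and> (\<forall>s. \<phi> s \<in> eigS s) \<and> (\<forall>s. s \<notin> I \<longrightarrow> \<phi> s = 0) \<and>
   (\<forall>p. \<psi> p = (\<Sum>s\<in>I. \<phi> s p))"

lemma decomp_fam: "decomp a b \<psi> I \<phi> ==> fam I \<phi>"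
proof -
 assume d: "decomp a b \<psi> I \<phi>"
 then have "0 <= s" if "s \<in> I" for s using that by (force simp: decomp_def)
 then have "s\<^sup>2 \<noteq> t\<^sup>2" if "s \<in> I" "t \<in> I" "s \<noteq> t" for s t using that power2_eq_iff_nonneg[of s t] by blast
 then show "fam I \<phi>" using d by (simp add: decomp_def fam_def)
qed

lemma decomp_smooth: "decomp a b \<psi> I \<phi> ==> smooth_on uhp (lift_M (\<phi> s))"
 unfolding decomp_def using eigenspace_smooth by blast

lemma zero_eigenspace: "0 \<in> eigS s"
proof -
 have sm: "smooth_on uhp (%z. 0 :: complex)" by (rule smooth_on_const[OF open_uhp])
 have "frechet_derivative (%z::complex. 0 :: complex) (at z) = (%v. 0)" for z
  by (rule frechet_derivative_at[symmetric]) simp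
 then have "hyperbolic_laplacian (%z. 0) z = 0" if "z \<in> uhp" for z
  unfolding hyperbolic_laplacian_eq[OF sm that] by (simp add: lap_def)
 then show ?thesis using sm by (simp add: eigenspace_def smooth_functions_M_def)
qed

lemma decomp_lincomb:
 assumes "decomp a b \<psi> I \<phi>" "decomp a b \<psi>' I' \<phi>'"
 shows "decomp a b (%p. x * \<psi> p + y * \<psi>' p) (I \<union> I') (%s p. x * \<phi> s p + y * \<phi>' s p)"
proof -
 have fin: "finite (I \<union> I')" using assms by (auto simp: decomp_def)
 have z: "\<phi> s p = 0" if "s \<notin> I" for s p using assms(1) that by (simp add: decomp_def)
 have z': "\<phi>' s p = 0" if "s \<notin> I'" for s p using assms(2) that by (simp add: decomp_def)
 have "(\<Sum>s\<in>I. \<phi> s p) = (\<Sum>s\<in>I \<union> I'. \<phi> s p)" for p by (intro sum.mono_neutral_left fin) (auto simp: z)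
 moreover have "(\<Sum>s\<in>I'. \<phi>' s p) = (\<Sum>s\<in>I \<union> I'. \<phi>' s p)" for p by (intro sum.mono_neutral_left fin) (auto simp: z')
 ultimately have "x * \<psi> p + y * \<psi>' p = (\<Sum>s\<in>I \<union> I'. x * \<phi> s p + y * \<phi>' s p)" for p
  using assms by (simp add: decomp_def sum.distrib sum_distrib_left)
 then show ?thesis using assms fin eigenspace_lincomb[of "\<phi> s" s "\<phi>' s" x y for s]
  unfolding decomp_def by (auto simp: fun_eq_iff z z' )
qed

lemma quasimode_decomp:
 assumes "\<psi> \<in> quasi C r" "C < r"
 shows "\<exists>I \<phi>. decomp (r - C) (r + C) \<psi> I \<phi>"
 using assms(1) unfolding quasimode_space_def
proof (induction rule: cfun.span_induct_alt)
 case base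
 have "decomp (r - C) (r + C) 0 {} (%s. 0)" using assms(2) by (simp add: decomp_def zero_eigenspace)
 then show ?case by blast
next
 case (step c x y)
 obtain s where s: "s \<in> {r - C..r + C}" "x \<in> eigS s" using step(1) by blast
 have d: "decomp (r - C) (r + C) x {s} (%t. if t = s then x else 0)"
  using assms(2) s by (simp add: decomp_def zero_eigenspace)
 obtain I \<phi> where "decomp (r - C) (r + C) y I \<phi>" using step(2) by blast
 from decomp_lincomb[OF d this, of c 1]
 have "decomp (r - C) (r + C) (cscale c x + y) ({s} \<union> I) (%t p. c * (if t = s then x else 0) p + 1 * \<phi> t p)"
  by (simp add: cscale_def plus_fun_def)
 then show ?case by blast
qed

lemma pull_comb:
 assumes "decomp a b \<psi> I \<phi>" shows "pull \<psi> = comb I \<phi> 0 (%n s. 1)"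
 using assms by (simp add: pull_def comb_def fun_eq_iff decomp_def sum.cartesian_product' U_0)

lemma nice_pull: "decomp a b \<psi> I \<phi> ==> nice (pull \<psi>)"
 using pull_comb nice_comb decomp_fam by metis

text \<open>
  Eigenfunctions with different parameters are orthogonal.
\<close>

lemma mass_eq:
 assumes "decomp a b \<psi> I \<phi>" shows "mass I \<phi> = nrm2 (pull \<psi>)"
proof -
 have "inner2 (pull \<psi>) (pull \<psi>) = of_real (mass I \<phi>)"
  unfolding pull_comb[OF assms] inner_comb[OF decomp_fam[OF assms]] by (simp add: mass_def)
 then have "complex_of_real (nrm2 (pull \<psi>)) = of_real (mass I \<phi>)" by (simp only: inner2_self[OF nice_pull[OF assms]])
 then show ?thesis by (simp only: of_real_eq_iff)
qed

lemma smooth_pull_zero: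
 assumes "\<psi> \<in> smoothM" "\<And>g. g \<in> SL2 ==> pull \<psi> g = 0" shows "\<psi> p = 0"
proof (cases "p \<in> pM ` uhp")
 case True
 then obtain z where z: "z \<in> uhp" "p = pM z" by blast
 then show ?thesis using assms(2)[OF upper_SL2[OF z(1)]] act_upper[OF z(1)] by (simp add: pull_def)
qed (use assms(1) in \<open>auto simp: smooth_functions_M_def\<close>)

lemma decomp_zero:
 assumes "decomp a b \<psi> I \<phi>" "nrm2 (pull \<psi>) = 0" shows "\<phi> s p = 0"
proof (cases "s \<in> I")
 case True
 have "mass I \<phi> = 0" unfolding mass_eq[OF assms(1)] by (rule assms(2))
 then have "nrm2 (U s (\<phi> s) 0) = 0"
  using True assms(1) by (simp add: mass_def sum_nonneg_eq_0_iff nrm2_nonneg decomp_def)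
 then have "U s (\<phi> s) 0 g = 0" if "g \<in> SL2" for g
  using nrm2_eq_0[OF nice_U[OF decomp_smooth[OF assms(1)]]] that by blast
 then show ?thesis using assms(1)
  by (intro smooth_pull_zero[of "\<phi> s"]) (auto simp: decomp_def eigenspace_def pull_def U_0)
qed (use assms(1) in \<open>simp add: decomp_def\<close>)

lemma decomp_unique:
 assumes "decomp a b \<psi> I \<phi>" "decomp a b \<psi> I' \<phi>'" shows "\<phi> = \<phi>'"
proof -
 have d: "decomp a b (%p. 1 * \<psi> p + (-1) * \<psi> p) (I \<union> I') (%s p. 1 * \<phi> s p + (-1) * \<phi>' s p)"
  by (rule decomp_lincomb[OF assms])
 have "1 * \<phi> s p + (-1) * \<phi>' s p = 0" for s p
  by (rule decomp_zero[OF d]) (simp add: nrm2_def pull_def)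
 then show ?thesis by (simp add: fun_eq_iff)
qed

lemma decomp_spectral:
 assumes d: "decomp a b \<psi> I \<phi>" shows "(THE \<phi>. spectral_decomposition \<Gamma> \<psi> \<phi>) = \<phi>"
proof (rule the_equality)
 have supp: "{s. \<phi> s \<noteq> 0} \<subseteq> I" and fin: "finite I" and I: "I \<subseteq> {a..b}" "0 < a" using d by (auto simp: decomp_def)
 have "(\<Sum>s | \<phi> s \<noteq> 0. \<phi> s p) = (\<Sum>s\<in>I. \<phi> s p)" for p
  by (rule sum.mono_neutral_left[OF fin supp]) auto
 then have "\<psi> = (\<Sum>s | \<phi> s \<noteq> 0. \<phi> s)" using d by (simp add: fun_eq_iff sum_fun_apply decomp_def)
 moreover have "s > 0" if "\<phi> s \<noteq> 0" for s using supp I that by force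
 ultimately show "spectral_decomposition \<Gamma> \<psi> \<phi>"
  using d finite_subset[OF supp fin] by (simp add: spectral_decomposition_def decomp_def)
next
 fix \<phi>' assume s: "spectral_decomposition \<Gamma> \<psi> \<phi>'"
 let ?J = "{s. \<phi>' s \<noteq> 0} \<union> I"
 have finI: "finite I" using d by (simp add: decomp_def)
 have fin: "finite ?J" and pos: "\<forall>s\<in>?J. 0 < s" using s d by (auto simp: spectral_decomposition_def decomp_def subset_iff) (fastforce+)?
 define m M where "m = Min (insert 1 ?J)" and "M = Max (insert 1 ?J)"
 have m: "0 < m" using fin pos by (simp add: m_def)
 have sub: "?J \<subseteq> {m..M}" using fin by (auto simp: m_def M_def)
 have "decomp m M \<psi> {s. \<phi>' s \<noteq> 0} \<phi>'" using s m sub fin unfolding decomp_def spectral_decomposition_def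
  by (auto simp: sum_fun_apply)
 moreover have "decomp m M \<psi> I \<phi>" using d m sub finI unfolding decomp_def by auto
 ultimately show "\<phi>' = \<phi>" by (rule decomp_unique)
qed

lemma U_zero:
 assumes d: "decomp a b \<psi> I \<phi>" and z: "\<phi> s = 0" and g: "g \<in> SL2"
 shows "U t (\<phi> s) n g = 0" "U t (%p. cnj (\<phi> s p)) n g = 0"
proof -
 have sm: "smooth_on uhp (lift_M (\<phi> s))" by (rule decomp_smooth[OF d])
 have e: "\<phi> s = (%p. 0 * \<phi> s p + 0 * \<phi> s p)" "(%p. cnj (\<phi> s p)) = (%p. 0 * \<phi> s p + 0 * \<phi> s p)"
  using z by (auto simp: fun_eq_iff)
 show "U t (\<phi> s) n g = 0" by (subst e(1), subst U_lincomb[OF sm sm g]) simp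
 show "U t (%p. cnj (\<phi> s p)) n g = 0" by (subst e(2), subst U_lincomb[OF sm sm g]) simp
qed

lemma comb_alt: "comb I \<phi> N c g = (\<Sum>n\<le>N. \<Sum>s\<in>I. c n s * U s (\<phi> s) n g)"
 by (simp add: comb_def sum.cartesian_product split_beta)

lemma weight_down_U:
 "smooth_on uhp (lift_M \<phi>) ==> g \<in> SL2 ==> weight_down s \<phi> n (pX g) = cnj (U (- s) (%p. cnj (\<phi> p)) n g)"
 by (simp add: weight_down_coset U_def lift_M_def[abs_def])

lemma lift_function_comb:
 assumes d: "decomp a b \<psi> I \<phi>" and g: "g \<in> SL2" and L: "int L = \<lfloor>sqrt r\<rfloor>"
 shows "liftX r \<psi> (pX g) = lift_comb I \<phi> L g"
proof -
 have fin: "finite I" and supp: "{s. \<phi> s \<noteq> 0} \<subseteq> I" using d by (auto simp: decomp_def)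
 note sm = decomp_smooth[OF d]
 have up: "weight_component \<Gamma> \<psi> (int n) (pX g) = (\<Sum>s\<in>I. U s (\<phi> s) n g)" for n
 proof -
  have "weight_component \<Gamma> \<psi> (int n) (pX g) = (\<Sum>s | \<phi> s \<noteq> 0. U s (\<phi> s) n g)"
   unfolding weight_component_def Let_def decomp_spectral[OF d] sum_fun_apply
   by (intro sum.cong refl) (simp add: weight_eigen_def weight_up_coset[OF sm g] U_def)
  also have "... = (\<Sum>s\<in>I. U s (\<phi> s) n g)"
  proof (rule sum.mono_neutral_left[OF fin supp], rule ballI)
   fix s assume "s \<in> I - {s. \<phi> s \<noteq> 0}"
   then have "\<phi> s = 0" by simp
   then show "U s (\<phi> s) n g = 0" by (rule U_zero[OF d _ g])
  qed
  finally show ?thesis .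
 qed
 have down: "weight_component \<Gamma> \<psi> (- int n) (pX g) = (\<Sum>s\<in>I. cnj (U (- s) (%p. cnj (\<phi> s p)) n g))" if "n \<noteq> 0" for n
 proof -
  have "weight_component \<Gamma> \<psi> (- int n) (pX g) = (\<Sum>s | \<phi> s \<noteq> 0. cnj (U (- s) (%p. cnj (\<phi> s p)) n g))"
   unfolding weight_component_def Let_def decomp_spectral[OF d] sum_fun_apply
   using that by (intro sum.cong refl) (simp add: weight_eigen_def weight_down_U[OF sm g])
  also have "... = (\<Sum>s\<in>I. cnj (U (- s) (%p. cnj (\<phi> s p)) n g))"
  proof (rule sum.mono_neutral_left[OF fin supp], rule ballI)
   fix s assume "s \<in> I - {s. \<phi> s \<noteq> 0}"
   then have "\<phi> s = 0" by simp
   then have "U (- s) (%p. cnj (\<phi> s p)) n g = 0" by (rule U_zero[OF d _ g])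
   then show "cnj (U (- s) (%p. cnj (\<phi> s p)) n g) = 0" by simp
  qed
  finally show ?thesis .
 qed
 define f where "f n = complex_of_real (of_int (int L - \<bar>n\<bar>) / of_int (int L)) * weight_component \<Gamma> \<psi> n (pX g)" for n
 define k where "k = complex_of_real (lift_norm L)"
 have 1: "k * (\<Sum>n\<le>L. f (int n)) = comb I \<phi> L (%n s. of_real (lift_norm L * ((real L - real n) / real L))) g"
  unfolding comb_alt sum_distrib_left f_def up k_def by (intro sum.cong refl) (simp add: mult_ac)
 have 2: "k * (\<Sum>n\<le>L. if n = 0 then 0 else f (- int n)) = cnj (comb (uminus ` I) (%s p. cnj (\<phi> (- s) p)) L
    (%n s. if n = 0 then 0 else of_real (lift_norm L * ((real L - real n) / real L))) g)"
 proof -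
  have "k * (if n = 0 then 0 else f (- int n)) = cnj (\<Sum>s\<in>uminus ` I. 
    (if n = 0 then 0 else of_real (lift_norm L * ((real L - real n) / real L))) * U s (%p. cnj (\<phi> (- s) p)) n g)" for n
  proof (cases "n = 0")
   case False
   have "k * f (- int n) = (\<Sum>s\<in>I. cnj (of_real (lift_norm L * ((real L - real n) / real L)) * U (- s) (%p. cnj (\<phi> s p)) n g))"
    unfolding f_def down[OF False] sum_distrib_left k_def by (intro sum.cong refl) (simp add: mult_ac)
   also have "... = (\<Sum>s\<in>uminus ` I. cnj (of_real (lift_norm L * ((real L - real n) / real L)) * U s (%p. cnj (\<phi> (- s) p)) n g))"
    by (subst sum.reindex) auto
   finally show ?thesis unfolding cnj_sum using False by (simp only: if_False)
  qed simp
  then show ?thesis unfolding comb_alt sum_distrib_left cnj_sum by (intro sum.cong refl) (simp only: cnj_sum)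
 qed
 have "liftX r \<psi> (pX g) = k * (\<Sum>n\<in>{- int L..int L}. f n)"
  unfolding lift_function_def Let_def L[symmetric] f_def k_def lift_norm_def by simp
 also have "... = k * (\<Sum>n\<le>L. f (int n)) + k * (\<Sum>n\<le>L. if n = 0 then 0 else f (- int n))"
  unfolding sum_symmetric_interval ring_distribs ..
 finally show ?thesis unfolding lift_comb_def 1 2 .
qed

lemma comb_lincomb:
 assumes sm: "\<And>s. s \<in> I ==> smooth_on uhp (lift_M (\<phi> s))" "\<And>s. s \<in> I ==> smooth_on uhp (lift_M (\<psi> s))" and g: "g \<in> SL2"
 shows "comb I (%s p. x * \<phi> s p + y * \<psi> s p) N c g = x * comb I \<phi> N c g + y * comb I \<psi> N c g"
 unfolding comb_alt sum_distrib_left sum.distrib[symmetric]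
 by (intro sum.cong refl) (simp add: U_lincomb[OF sm g] algebra_simps)

lemma lift_M_cnj_smooth: "smooth_on uhp (lift_M \<phi>) ==> smooth_on uhp (lift_M (%p. cnj (\<phi> p)))"
 using smooth_on_linear_compose[OF open_uhp bounded_linear_cnj, of "lift_M \<phi>"] by (simp add: lift_M_def[abs_def])

text \<open>
  By uniqueness, the decomposition of a combination is the combination of the decompositions.
\<close>

lemma lift_function_lincomb:
 assumes d: "decomp a b \<psi> I \<phi>" "decomp a b \<psi>' I' \<phi>'" and g: "g \<in> SL2" and L: "int L = \<lfloor>sqrt r\<rfloor>"
 shows "liftX r (%p. x * \<psi> p + y * \<psi>' p) (pX g)
   = x * liftX r \<psi> (pX g) + y * liftX r \<psi>' (pX g)"
proof -
 let ?J = "I \<union> I'"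
 have d': "decomp a b \<psi> ?J \<phi>" "decomp a b \<psi>' ?J \<phi>'"
  using decomp_lincomb[OF d, of 1 0] decomp_lincomb[OF d, of 0 1] by simp_all
 note sm = decomp_smooth[OF d(1)] decomp_smooth[OF d(2)]
 note smc = lift_M_cnj_smooth[OF sm(1)] lift_M_cnj_smooth[OF sm(2)]
 have c: "(%s p. cnj (x * \<phi> (- s) p + y * \<phi>' (- s) p)) = (%s p. cnj x * cnj (\<phi> (- s) p) + cnj y * cnj (\<phi>' (- s) p))"
  by (simp add: fun_eq_iff)
 have "liftX r (%p. x * \<psi> p + y * \<psi>' p) (pX g) = lift_comb ?J (%s p. x * \<phi> s p + y * \<phi>' s p) L g"
  by (rule lift_function_comb[OF decomp_lincomb[OF d] g L])
 also have "... = x * lift_comb ?J \<phi> L g + y * lift_comb ?J \<phi>' L g"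
  unfolding lift_comb_def c comb_lincomb[OF sm g]
  by (subst comb_lincomb[OF smc g]) (simp add: algebra_simps)
 also have "... = x * liftX r \<psi> (pX g) + y * liftX r \<psi>' (pX g)"
  unfolding lift_function_comb[OF d'(1) g L] lift_function_comb[OF d'(2) g L] ..
 finally show ?thesis .
qed

end

section \<open>Averages over a tube\<close>

context surface_group begin

text \<open>
  The phase undoes the one that the flow time \<open>ln (h$1$1)\<close> produces.
\<close>

definition tube_average :: "real => (real^2^2) set => (real^2^2 => complex) => real^2^2 => complex" where
 "tube_average r B F g = (\<integral>h. cis (- (2 * r * ln (h$1$1))) * F (g ** h) \<partial>restrict_space haar_SL2 B)"

lemma haar_tube_finite:
 assumes "\<delta> <= 1/2" "\<epsilon> <= 1" shows "emeasure haar_SL2 (tube \<delta> \<epsilon>) < \<infinity>"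
proof -
 have "norm h <= 10" if h: "h \<in> tube \<delta> \<epsilon>" for h
 proof -
  have a: "\<bar>h$1$1 - 1\<bar> <= 1/2" "\<bar>h$1$2\<bar> <= 1" "\<bar>h$2$1\<bar> <= 1" and S: "h \<in> SL2"
   using h assms by (auto simp: tube_def)
  have "\<bar>h$1$2\<bar> * \<bar>h$2$1\<bar> <= 1 * 1" using a by (intro mult_mono) auto
  moreover have "h$1$1 * h$2$2 = 1 + h$1$2 * h$2$1" using S by (simp add: mem_SL2)
  ultimately have "\<bar>h$1$1 * h$2$2\<bar> <= 2" by (simp add: abs_mult[symmetric])
  moreover have "1/2 * \<bar>h$2$2\<bar> <= \<bar>h$1$1\<bar> * \<bar>h$2$2\<bar>" using a(1) by (intro mult_right_mono) (linarith, simp)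
  ultimately have "\<bar>h$2$2\<bar> <= 4" by (simp add: abs_mult)
  then show ?thesis using norm_mat2_le[of h] a by linarith
 qed
 then have "tube \<delta> \<epsilon> \<subseteq> SL2 \<inter> cball 0 10" by (auto simp: tube_def)
 then have "emeasure haar_SL2 (tube \<delta> \<epsilon>) <= emeasure haar_SL2 (SL2 \<inter> cball 0 10)"
  using SL2_borel_Int[of "cball 0 10"] by (intro emeasure_mono) auto
 then show ?thesis using haar_finite_bounded[of 10] by (rule le_less_trans)
qed

lemma measurable_translates:
 assumes F: "F \<in> borel_measurable SL2_borel" and B: "B \<in> sets SL2_borel"
 shows "(%p. F (fst p ** snd p)) \<in> borel_measurable (XM \<Otimes>\<^sub>M restrict_space haar_SL2 B)"
proof -
 have BS: "B \<subseteq> SL2" using sets.sets_into_space[OF B] by (simp add: space_restrict_space)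
 have 1: "(%g. g) \<in> XM \<rightarrow>\<^sub>M borel"
  by (subst measurable_cong_sets[OF sets_XM refl]) (rule measurable_restrict_space1, simp)
 have 2: "(%h. h) \<in> restrict_space haar_SL2 B \<rightarrow>\<^sub>M borel"
  by (rule measurable_restrict_space1, subst measurable_cong_sets[OF sets_haar refl], rule measurable_restrict_space1) simp
 have "(%p. (fst p, snd p)) \<in> XM \<Otimes>\<^sub>M restrict_space haar_SL2 B \<rightarrow>\<^sub>M borel \<Otimes>\<^sub>M borel"
  by (intro measurable_Pair measurable_compose[OF measurable_fst 1] measurable_compose[OF measurable_snd 2])
 moreover have "(%p. fst p ** snd p) \<in> (borel :: (real^2^2) measure) \<Otimes>\<^sub>M (borel :: (real^2^2) measure) \<rightarrow>\<^sub>M borel"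
  unfolding borel_prod by (intro borel_measurable_continuous_onI continuous_intros)
 ultimately have "(%p. fst (fst p, snd p) ** snd (fst p, snd p)) \<in> XM \<Otimes>\<^sub>M restrict_space haar_SL2 B \<rightarrow>\<^sub>M borel"
  by (rule measurable_compose)
 then have "(%p. fst p ** snd p) \<in> XM \<Otimes>\<^sub>M restrict_space haar_SL2 B \<rightarrow>\<^sub>M SL2_borel"
  using BS by (intro measurable_restrict_space2) (auto simp: space_pair_measure space_restrict_space SL2_mult)
 then show ?thesis by (rule measurable_compose[OF _ F])
qed

lemma restrict_haar:
 assumes B: "B \<in> sets SL2_borel"
 shows "B \<subseteq> SL2" "space (restrict_space haar_SL2 B) = B" "emeasure (restrict_space haar_SL2 B) B = emeasure haar_SL2 B"
proof -
 show BS: "B \<subseteq> SL2" using sets.sets_into_space[OF B] by (simp add: space_restrict_space)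
 show "space (restrict_space haar_SL2 B) = B" using BS by (auto simp: space_restrict_space)
 show "emeasure (restrict_space haar_SL2 B) B = emeasure haar_SL2 B"
  using B BS by (intro emeasure_restrict_space) (simp_all add: Int_absorb2)
qed

lemma finite_measure_restrict:
 "B \<in> sets SL2_borel ==> emeasure haar_SL2 B < \<infinity> ==> finite_measure (restrict_space haar_SL2 B)"
 by (rule finite_measureI) (simp add: restrict_haar)

lemma phase_measurable: "(%h. cis (- (2 * r * ln (h$1$1)))) \<in> borel_measurable (restrict_space haar_SL2 B)"
proof (rule measurable_restrict_space1, subst measurable_cong_sets[OF sets_haar refl], rule measurable_restrict_space1)
 have [measurable]: "(%h::real^2^2. h$1$1) \<in> borel_measurable borel" by (intro borel_measurable_continuous_onI continuous_intros)
 have [measurable]: "cis \<in> borel_measurable borel" by (intro borel_measurable_continuous_onI continuous_intros)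
 show "(%h::real^2^2. cis (- (2 * r * ln (h$1$1)))) \<in> borel_measurable borel" by measurable
qed

lemma nice_tube_average:
 assumes F: "nice F" and B: "B \<in> sets SL2_borel" and fin: "emeasure haar_SL2 B < \<infinity>"
 shows "nice (tube_average r B F)"
proof -
 let ?N = "restrict_space haar_SL2 B"
 interpret N: finite_measure ?N by (rule finite_measure_restrict[OF B fin])
 have BS: "B \<subseteq> SL2" using sets.sets_into_space[OF B] by (simp add: space_restrict_space)
 obtain K where K: "K > 0" "\<And>g. g \<in> SL2 ==> cmod (F g) <= K" using nice_bounded_ex[OF F] by auto
 have ms: "(%h. cis (- (2 * r * ln (h$1$1))) * F (g ** h)) \<in> borel_measurable ?N" if "g \<in> SL2" for g
  using measurable_left_mult[OF that nice_measurable[OF F]]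
  by (intro borel_measurable_times phase_measurable measurable_restrict_space1) simp
 have "continuous_on SL2 (tube_average r B F)"
  unfolding continuous_on_sequentially
 proof (intro allI ballI impI, elim conjE)
  fix x :: "nat => real^2^2" and a assume a: "a \<in> SL2" and x: "\<forall>n. x n \<in> SL2" "x \<longlonglongrightarrow> a"
  have "(%n. tube_average r B F (x n)) \<longlonglongrightarrow> tube_average r B F a"
   unfolding tube_average_def
  proof (rule integral_dominated_convergence[where w = "%_. K"])
   show "AE h in ?N. (%n. cis (- (2 * r * ln (h$1$1))) * F (x n ** h)) \<longlonglongrightarrow> cis (- (2 * r * ln (h$1$1))) * F (a ** h)"
   proof (intro AE_I2 tendsto_mult tendsto_const)
    fix h assume "h \<in> space ?N"
    then have hS: "h \<in> SL2" using BS by (auto simp: space_restrict_space)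
    have "continuous_on SL2 (%g. F (g ** h))" using nice_translate[OF F hS] by (simp add: nice_def)
    then show "(%n. F (x n ** h)) \<longlonglongrightarrow> F (a ** h)" using a x unfolding continuous_on_sequentially comp_def by blast
   qed
   show "AE h in ?N. norm (cis (- (2 * r * ln (h$1$1))) * F (x n ** h)) <= K" for n
    using K x BS by (intro AE_I2) (auto simp: norm_mult space_restrict_space SL2_mult subset_iff)
  qed (use ms a x in auto)
  then show "(tube_average r B F \<circ> x) \<longlonglongrightarrow> tube_average r B F a" by (simp add: comp_def)
 qed
 moreover have "tube_average r B F (\<gamma> ** g) = tube_average r B F g" if "\<gamma> \<in> \<Gamma>" "g \<in> SL2" for \<gamma> g
  unfolding tube_average_def
 proof (intro Bochner_Integration.integral_cong refl)
  fix h assume "h \<in> space ?N"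
  then have "g ** h \<in> SL2" using BS that SL2_mult by (auto simp: space_restrict_space)
  then have "F (\<gamma> ** (g ** h)) = F (g ** h)" using F that unfolding nice_def G_inv_def by blast
  then show "cis (- (2 * r * ln (h$1$1))) * F ((\<gamma> ** g) ** h) = cis (- (2 * r * ln (h$1$1))) * F (g ** h)"
   by (simp only: matrix_mul_assoc)
 qed
 ultimately show ?thesis by (simp add: nice_def G_inv_def)
qed

lemma inner_tube_average:
 assumes F: "nice F" and H: "nice H" and B: "B \<in> sets SL2_borel" and fin: "emeasure haar_SL2 B < \<infinity>"
 shows "inner2 (tube_average r B F) H
   = (\<integral>h. cis (- (2 * r * ln (h$1$1))) * inner2 (%g. F (g ** h)) H \<partial>restrict_space haar_SL2 B)" (is "_ = ?rhs")
  and "integrable (restrict_space haar_SL2 B) (%h. cis (- (2 * r * ln (h$1$1))) * inner2 (%g. F (g ** h)) H)"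
proof -
 let ?N = "restrict_space haar_SL2 B"
 interpret N: finite_measure ?N by (rule finite_measure_restrict[OF B fin])
 interpret P: pair_sigma_finite XM ?N ..
 have BS: "B \<subseteq> SL2" using sets.sets_into_space[OF B] by (simp add: space_restrict_space)
 obtain K where K: "K > 0" "\<And>g. g \<in> SL2 ==> cmod (F g) <= K" using nice_bounded_ex[OF F] by auto
 obtain K' where K': "K' > 0" "\<And>g. g \<in> SL2 ==> cmod (H g) <= K'" using nice_bounded_ex[OF H] by auto
 define f where "f g h = cis (- (2 * r * ln (h$1$1))) * F (g ** h) * cnj (H g)" for g h :: "real^2^2"
 have m: "case_prod f \<in> borel_measurable (XM \<Otimes>\<^sub>M ?N)"
 proof -
  have "(%p. cnj (H (fst p))) \<in> borel_measurable (XM \<Otimes>\<^sub>M ?N)"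
   by (rule measurable_compose[OF measurable_fst nice_measurable_XM[OF nice_cnj[OF H]]])
  moreover have "(%p. cis (- (2 * r * ln (snd p$1$1)))) \<in> borel_measurable (XM \<Otimes>\<^sub>M ?N)"
   by (rule measurable_compose[OF measurable_snd phase_measurable])
  ultimately show ?thesis unfolding f_def split_beta'
   by (intro borel_measurable_times measurable_translates nice_measurable F B)
 qed
 have fm: "finite_measure (XM \<Otimes>\<^sub>M ?N)" by (rule finite_measure_pair_measure) unfold_locales
 have i: "integrable (XM \<Otimes>\<^sub>M ?N) (case_prod f)"
 proof (rule finite_measure.integrable_const_bound[OF fm _ m, where B = "K * K'"])
  show "AE x in XM \<Otimes>\<^sub>M ?N. norm (case x of (g, h) => f g h) <= K * K'"
  proof (rule AE_I2, safe)
   fix g h assume "(g, h) \<in> space (XM \<Otimes>\<^sub>M ?N)"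
   then have "g \<in> SL2" "h \<in> SL2" using BS by (auto simp: space_pair_measure space_restrict_space)
   then have "cmod (F (g ** h)) * cmod (H g) <= K * K'" using K K' SL2_mult by (intro mult_mono) auto
   then show "norm (f g h) <= K * K'" by (simp add: f_def norm_mult)
  qed
 qed
 have e: "(\<integral>g. f g h \<partial>XM) = cis (- (2 * r * ln (h$1$1))) * inner2 (%g. F (g ** h)) H" for h
  unfolding f_def inner2_def by (simp add: mult.assoc)
 have "(\<integral>h. f g h \<partial>?N) = tube_average r B F g * cnj (H g)" for g
  unfolding f_def tube_average_def by simp
 then have "inner2 (tube_average r B F) H = (\<integral>g. (\<integral>h. f g h \<partial>?N) \<partial>XM)" by (simp add: inner2_def)
 also have "... = (\<integral>h. (\<integral>g. f g h \<partial>XM) \<partial>?N)" by (rule P.Fubini_integral[OF i, symmetric])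
 finally show "inner2 (tube_average r B F) H = ?rhs" unfolding e .
 show "integrable ?N (%h. cis (- (2 * r * ln (h$1$1))) * inner2 (%g. F (g ** h)) H)"
  using P.integrable_snd[OF i] unfolding e .
qed

text \<open>Cauchy--Schwarz over the tube.\<close>

lemma tube_average_le:
 assumes F: "nice F" and B: "B \<in> sets SL2_borel" and fin: "emeasure haar_SL2 B < \<infinity>" and g: "g \<in> SL2"
 shows "ennreal ((cmod (tube_average r B F g))\<^sup>2)
   <= (\<integral>\<^sup>+h. indicator B h * ennreal ((cmod (F (g ** h)))\<^sup>2) \<partial>haar_SL2) * emeasure haar_SL2 B"
proof -
 let ?N = "restrict_space haar_SL2 B"
 interpret N: finite_measure ?N by (rule finite_measure_restrict[OF B fin])
 have BS: "B \<subseteq> SL2" using sets.sets_into_space[OF B] by (simp add: space_restrict_space)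
 obtain K where K: "K > 0" "\<And>g. g \<in> SL2 ==> cmod (F g) <= K" using nice_bounded_ex[OF F] by auto
 have mF: "(%h. F (g ** h)) \<in> borel_measurable ?N"
  using measurable_left_mult[OF g nice_measurable[OF F]] by (intro measurable_restrict_space1) simp
 have ms: "(%h. cis (- (2 * r * ln (h$1$1))) * F (g ** h)) \<in> borel_measurable ?N"
  by (intro borel_measurable_times phase_measurable mF)
 have int: "integrable ?N (%h. cis (- (2 * r * ln (h$1$1))) * F (g ** h))"
  using K g BS by (intro N.integrable_const_bound[where B = K] ms AE_I2) (auto simp: norm_mult space_restrict_space SL2_mult subset_iff)
 have "ennreal (cmod (tube_average r B F g)) <= (\<integral>\<^sup>+h. ennreal (cmod (F (g ** h))) * 1 \<partial>?N)"
  using integral_norm_bound_ennreal[OF int] by (simp add: tube_average_def norm_mult)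
 then have "(ennreal (cmod (tube_average r B F g)))\<^sup>2 <= (\<integral>\<^sup>+h. ennreal (cmod (F (g ** h))) * 1 \<partial>?N)\<^sup>2"
  by (intro power_mono) auto
 also have "... <= (\<integral>\<^sup>+h. (ennreal (cmod (F (g ** h))))\<^sup>2 \<partial>?N) * (\<integral>\<^sup>+h. 1\<^sup>2 \<partial>?N)"
  by (rule Cauchy_Schwarz_nn_integral) (use mF in measurable)
 also have "(\<integral>\<^sup>+h. 1\<^sup>2 \<partial>?N) = emeasure haar_SL2 B" by (simp add: restrict_haar[OF B])
 also have "(\<integral>\<^sup>+h. (ennreal (cmod (F (g ** h))))\<^sup>2 \<partial>?N) = (\<integral>\<^sup>+h. indicator B h * ennreal ((cmod (F (g ** h)))\<^sup>2) \<partial>haar_SL2)"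
  using B restrict_haar(1)[OF B] by (subst nn_integral_restrict_space) (auto simp: Int_absorb2 mult.commute ennreal_power intro!: nn_integral_cong)
 finally show ?thesis by (simp add: ennreal_power)
qed

text \<open>
  Integrate the correlation estimate over the tube and use Cauchy--Schwarz on \<open>X\<close>; the test vector has
  square norm at most \<open>L + 1\<close> times the mass.
\<close>

lemma nrm2_tube_average_ge:
 assumes d: "decomp a b \<psi> I \<phi>" and I: "\<And>s. s \<in> I ==> \<bar>s - r\<bar> <= C"
  and L: "L >= 2" and r: "r <= 4 * (real L)\<^sup>2" "C <= r" "0 <= C"
  and \<delta>: "0 <= \<delta>" "\<delta> <= 1/2" "\<delta> * drift C <= 1/48"
 shows "(measure haar_SL2 (tube \<delta> (\<delta> / real L)))\<^sup>2 / 128 * nrm2 (pull \<psi>)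
   <= nrm2 (tube_average r (tube \<delta> (\<delta> / real L)) (lift_comb I \<phi> L))"
proof -
 let ?B = "tube \<delta> (\<delta> / real L)" and ?P = "lift_comb I \<phi> L" and ?G = "test I \<phi> L"
 let ?N = "restrict_space haar_SL2 ?B" and ?m = "mass I \<phi>"
 define \<beta> where "\<beta> = measure haar_SL2 ?B"
 have f: "fam I \<phi>" by (rule decomp_fam[OF d])
 have "\<delta> / real L <= 1" using \<delta> L by (simp add: field_simps)
 then have fin: "emeasure haar_SL2 ?B < \<infinity>" using \<delta> by (intro haar_tube_finite) auto
 interpret N: finite_measure ?N by (rule finite_measure_restrict[OF tube_sets fin])
 have mN: "measure ?N (space ?N) = \<beta>"
  by (simp add: measure_def restrict_haar[OF tube_sets] \<beta>_def)
 have n: "nice ?P" "nice ?G" by (intro nice_lift_comb nice_comb f)+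
 note ia = inner_tube_average[OF n tube_sets fin]
 have nT: "nice (tube_average r ?B ?P)" by (rule nice_tube_average[OF n(1) tube_sets fin])
 have "\<beta> * (sqrt (real L) / 8 * ?m) = (\<integral>h. sqrt (real L) / 8 * ?m \<partial>?N)" by (simp add: mN)
 also have "... <= (\<integral>h. Re (cis (- (2 * r * ln (h$1$1))) * inner2 (%g. ?P (g ** h)) ?G) \<partial>?N)"
  by (intro integral_mono integrable_Re ia(2) N.integrable_const tube_correlation[OF f I L r _ \<delta>]) (auto simp: space_restrict_space)
 also have "... = Re (inner2 (tube_average r ?B ?P) ?G)" unfolding ia(1) by (rule integral_Re[OF ia(2)])
 also have "... <= nrm (tube_average r ?B ?P) * nrm ?G"
  using inner2_le[OF nT n(2)] complex_Re_le_cmod order_trans by blast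
 finally have main: "\<beta> * (sqrt (real L) / 8 * ?m) <= nrm (tube_average r ?B ?P) * nrm ?G" .
 have "nrm2 ?G <= real (Suc L) * 1\<^sup>2 * ?m" using bump_bounds by (intro nrm2_comb_le f) auto
 also have "... <= (2 * real L) * ?m" using L mass_nonneg by (intro mult_right_mono) auto
 finally have G: "nrm2 ?G <= (2 * real L) * ?m" .
 have "(\<beta> * (sqrt (real L) / 8 * ?m))\<^sup>2 <= (nrm (tube_average r ?B ?P) * nrm ?G)\<^sup>2"
  using main mass_nonneg[of I \<phi>] by (intro power_mono) (auto simp: \<beta>_def)
 also have "... = nrm2 (tube_average r ?B ?P) * nrm2 ?G" by (simp add: power_mult_distrib nrm_sq)
 also have "... <= nrm2 (tube_average r ?B ?P) * ((2 * real L) * ?m)" using G by (intro mult_left_mono nrm2_nonneg)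
 also have "(\<beta> * (sqrt (real L) / 8 * ?m))\<^sup>2 = (\<beta>\<^sup>2 / 128 * ?m) * ((2 * real L) * ?m)"
  by (simp add: power_mult_distrib power_divide power2_eq_square)
 finally have *: "(\<beta>\<^sup>2 / 128 * ?m) * ((2 * real L) * ?m) <= nrm2 (tube_average r ?B ?P) * ((2 * real L) * ?m)" .
 have "\<beta>\<^sup>2 / 128 * ?m <= nrm2 (tube_average r ?B ?P)"
 proof (cases "?m = 0")
  case False
  then have "0 < (2 * real L) * ?m" using mass_nonneg[of I \<phi>] L by (intro mult_pos_pos) auto
  with * show ?thesis by (rule mult_right_le_imp_le)
 qed (simp add: nrm2_nonneg)
 then show ?thesis unfolding mass_eq[OF d] \<beta>_def .
qed

end

section \<open>Choosing the quasimode\<close>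

context surface_group begin

lemma quasimode_smooth: "\<psi> \<in> quasi C r ==> \<psi> \<in> smoothM"
 unfolding quasimode_space_def
proof (induction rule: cfun.span_induct_alt)
 case base
 show ?case using zero_eigenspace[of 0] unfolding eigenspace_def by blast
next
 case (step c x y)
 then have x: "x \<in> smoothM" by (auto simp: eigenspace_def)
 have "smooth_on uhp (%z. c * x (pM z) + 1 * y (pM z))"
  using x step(2) by (intro smooth_on_lincomb open_uhp) (auto simp: smooth_functions_M_def)
 then show ?case using x step(2) by (auto simp: smooth_functions_M_def cscale_def)
qed

lemma smooth_functions_lift: "\<psi> \<in> smoothM ==> smooth_on uhp (lift_M \<psi>)"
 by (simp add: smooth_functions_M_def lift_M_def[abs_def])

lemma nice_pull_smooth:
 assumes "\<psi> \<in> smoothM" shows "nice (pull \<psi>)"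
proof -
 have "pull \<psi> = U 0 \<psi> 0" by (simp add: fun_eq_iff pull_def U_0)
 then show ?thesis using nice_U[OF smooth_functions_lift[OF assms]] by simp
qed

lemma smooth_measurable:
 assumes "\<psi> \<in> smoothM" shows "\<psi> \<in> borel_measurable (borel_of (topM))"
proof (rule measurable_borel_of)
 have "continuous_on uhp (%z. \<psi> (pM z))"
  using smooth_on_continuous[OF smooth_functions_lift[OF assms]] by (simp add: lift_M_def[abs_def])
 then show "continuous_map (topM) euclidean \<psi>"
  unfolding M_top_def by (intro continuous_map_from_quotient_topology) (simp add: o_def)
qed

lemma L2_norm_M_bounds:
 assumes d: "\<psi> \<in> smoothM"
 shows "(L2M \<psi>)\<^sup>2 <= 2 * nrm2 (pull \<psi>)" "nrm2 (pull \<psi>) <= 2 * (L2M \<psi>)\<^sup>2"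
proof -
 define f where "f p = ennreal ((cmod (\<psi> p))\<^sup>2)" for p
 have m: "f \<in> borel_measurable (borel_of (topM))"
  unfolding f_def using smooth_measurable[OF d] by measurable
 have sv: "sets (volM) = sets (borel_of (topM))" by (simp add: vol_M_def normalized_def quotient_measure_def)
 have X: "(\<integral>\<^sup>+g. f (pM (act g \<i>)) \<partial>XM) = ennreal (nrm2 (pull \<psi>))"
  unfolding nrm2_def f_def using nn_integral_eq_integral[OF nice_integrable_sq[OF nice_pull_smooth[OF d]]] by (simp add: pull_def)
 note c = vol_M_compare[OF m, unfolded X]
 have "(L2M \<psi>)\<^sup>2 = (\<integral>p. (cmod (\<psi> p))\<^sup>2 \<partial>volM)" by (simp add: L2_norm_M_def)
 also have "... = enn2real (\<integral>\<^sup>+p. f p \<partial>volM)" unfolding f_def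
  using smooth_measurable[OF d] by (intro integral_eq_nn_integral) (auto simp: measurable_cong_sets[OF sv refl])
 finally have e: "(L2M \<psi>)\<^sup>2 = enn2real (\<integral>\<^sup>+p. f p \<partial>volM)" .
 have c1: "(\<integral>\<^sup>+p. f p \<partial>volM) <= ennreal (2 * nrm2 (pull \<psi>))"
  using c(1) nrm2_nonneg by (simp add: ennreal_mult)
 then have fin: "(\<integral>\<^sup>+p. f p \<partial>volM) = ennreal ((L2M \<psi>)\<^sup>2)"
  unfolding e using le_less_trans[OF c1 ennreal_less_top] by simp
 show "(L2M \<psi>)\<^sup>2 <= 2 * nrm2 (pull \<psi>)" using c1 nrm2_nonneg unfolding fin by simp
 have "ennreal (nrm2 (pull \<psi>)) <= ennreal (2 * (L2M \<psi>)\<^sup>2)" using c(2) unfolding fin by (simp add: ennreal_mult)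
 then show "nrm2 (pull \<psi>) <= 2 * (L2M \<psi>)\<^sup>2" by simp
qed

lemma L2_norm_M_scale: "L2M (cscale c \<psi>) = cmod c * L2M \<psi>"
 by (simp add: L2_norm_M_def cscale_def norm_mult power_mult_distrib real_sqrt_mult)

lemma L2_norm_M_nonneg: "L2M \<psi> >= 0"
 by (simp add: L2_norm_M_def)

lemma smooth_pull_pos:
 assumes "\<psi> \<in> smoothM" "\<psi> \<noteq> 0" shows "nrm2 (pull \<psi>) > 0"
proof (rule ccontr)
 assume "\<not> nrm2 (pull \<psi>) > 0"
 then have "nrm2 (pull \<psi>) = 0" using nrm2_nonneg[of "pull \<psi>"] by simp
 then have "\<psi> p = 0" for p using nrm2_eq_0[OF nice_pull_smooth[OF assms(1)]] by (intro smooth_pull_zero[OF assms(1)])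
 with assms(2) show False by (simp add: fun_eq_iff)
qed

lemma L2_norm_M_pos:
 assumes "\<psi> \<in> smoothM" "\<psi> \<noteq> 0" shows "L2M \<psi> > 0"
proof -
 have "0 < (L2M \<psi>)\<^sup>2" using smooth_pull_pos[OF assms] L2_norm_M_bounds(2)[OF assms(1)] by linarith
 then show ?thesis using L2_norm_M_nonneg[of \<psi>] by (simp add: less_le)
qed

lemma pull_sum: "pull (b + (\<Sum>k\<in>A. cscale (c k) (e k))) g = pull b g + (\<Sum>k\<in>A. c k * pull (e k) g)"
 by (simp add: pull_def sum_fun_apply cscale_def)

text \<open>Gram--Schmidt orthonormalisation.\<close>

lemma orthonormal_family:
 assumes C: "C < r"
 shows "finite B ==> cfun.independent B ==> B \<subseteq> quasi C r ==>
  \<exists>e. (\<forall>k<card B. e k \<in> cfun.span B) \<and>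
    (\<forall>k<card B. \<forall>l<card B. inner2 (pull (e k)) (pull (e l)) = (if k = l then 1 else 0))"
proof (induction B rule: finite_induct)
 case empty
 then show ?case by simp
next
 case (insert b B)
 let ?n = "card B"
 have sub: "cfun.subspace (quasi C r)" unfolding quasimode_space_def by (rule cfun.subspace_span)
 have spQ: "cfun.span (insert b B) \<subseteq> quasi C r" by (rule cfun.span_minimal[OF insert.prems(2) sub])
 have npull: "nice (pull \<psi>)" if "\<psi> \<in> cfun.span (insert b B)" for \<psi>
  using nice_pull_smooth[OF quasimode_smooth] that spQ by blast
 have ind: "cfun.independent B" "b \<notin> cfun.span B" using insert.prems(1) insert.hyps(2) by (auto simp: cfun.independent_insert)
 obtain e where e0: "(\<forall>k<?n. e k \<in> cfun.span B) \<and> (\<forall>k<?n. \<forall>l<?n. inner2 (pull (e k)) (pull (e l)) = (if k = l then 1 else 0))"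
  using insert.IH[OF ind(1)] insert.prems(2) by blast
 have e: "\<And>k. k < ?n ==> e k \<in> cfun.span B"
  "\<And>k l. k < ?n ==> l < ?n ==> inner2 (pull (e k)) (pull (e l)) = (if k = l then 1 else 0)"
  using e0 by blast+
 have mono: "cfun.span B \<subseteq> cfun.span (insert b B)" by (rule cfun.span_mono) auto
 define c where "c k = - inner2 (pull b) (pull (e k))" for k
 define w where "w = b + (\<Sum>k<?n. cscale (c k) (e k))"
 have bs: "b \<in> cfun.span (insert b B)" by (rule cfun.span_base) simp
 have ws: "w \<in> cfun.span (insert b B)" unfolding w_def
  using e(1) mono by (intro cfun.span_add cfun.span_sum cfun.span_scale bs) auto
 have nb: "nice (pull b)" by (rule npull[OF bs])
 have ne: "nice (pull (e k))" if "k < ?n" for k using e(1)[OF that] mono by (intro npull) auto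
 have pw: "pull w = (%g. pull b g + (\<Sum>k<?n. c k * pull (e k) g))" by (simp add: fun_eq_iff w_def pull_sum)
 have orth: "inner2 (pull w) (pull (e l)) = 0" if l: "l < ?n" for l
 proof -
  have "inner2 (pull w) (pull (e l)) = inner2 (pull b) (pull (e l)) + inner2 (%g. \<Sum>k<?n. c k * pull (e k) g) (pull (e l))"
   unfolding pw using ne by (intro inner2_add_left nb ne l nice_sum nice_mult nice_const) auto
  also have "inner2 (%g. \<Sum>k<?n. c k * pull (e k) g) (pull (e l)) = (\<Sum>k<?n. inner2 (%g. c k * pull (e k) g) (pull (e l)))"
   using ne l by (intro inner2_sum_left nice_mult nice_const) auto
  also have "... = (\<Sum>k<?n. if k = l then c k else 0)" using l by (intro sum.cong refl) (auto simp: inner2_scale_left e(2))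
  also have "... = c l" using l by simp
  finally show ?thesis by (simp add: c_def)
 qed
 have "w \<noteq> 0"
 proof
  assume "w = 0"
  then have "b = - (\<Sum>k<?n. cscale (c k) (e k))" by (simp add: w_def eq_neg_iff_add_eq_0)
  also have "... \<in> cfun.span B" using e(1) by (intro cfun.span_neg cfun.span_sum cfun.span_scale) auto
  finally show False using ind(2) by simp
 qed
 then have pos: "nrm2 (pull w) > 0" using smooth_pull_pos[OF quasimode_smooth] ws spQ by blast
 define a where "a = complex_of_real (1 / sqrt (nrm2 (pull w)))"
 define e' where "e' = e(?n := cscale a w)"
 have pa: "pull (cscale a w) = (%g. a * pull w g)" by (simp add: pull_def cscale_def fun_eq_iff)
 have nw: "nice (pull w)" by (rule npull[OF ws])
 have norm1: "inner2 (pull (cscale a w)) (pull (cscale a w)) = 1"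
  unfolding pa inner2_scale_left inner2_scale_right inner2_self[OF nw]
  unfolding a_def using pos by (simp flip: of_real_mult add: field_simps)
 have o1: "inner2 (pull (cscale a w)) (pull (e l)) = 0" if "l < ?n" for l
  unfolding pa inner2_scale_left orth[OF that] by simp
 have o2: "inner2 (pull (e l)) (pull (cscale a w)) = 0" if "l < ?n" for l
  using o1[OF that] inner2_cnj[of "pull (cscale a w)" "pull (e l)"] by simp
 have cB: "card (insert b B) = Suc ?n" using insert.hyps by simp
 show ?case unfolding cB
 proof (intro exI[of _ e'] conjI allI impI)
  show "e' k \<in> cfun.span (insert b B)" if "k < Suc ?n" for k
   using that e(1)[of k] mono ws by (auto simp: e'_def less_Suc_eq intro: cfun.span_scale)
  show "inner2 (pull (e' k)) (pull (e' l)) = (if k = l then 1 else 0)" if "k < Suc ?n" "l < Suc ?n" for k l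
   using that by (auto simp: e'_def less_Suc_eq norm1 o1 o2 e(2))
 qed
qed

lemma lift_function_sum:
 fixes n :: nat
 assumes C: "C < r" and e: "\<And>k. k < n ==> e k \<in> quasi C r" and g: "g \<in> SL2" and L: "int L = \<lfloor>sqrt r\<rfloor>"
 shows "liftX r (\<Sum>k<n. cscale (c k) (e k)) (pX g) = (\<Sum>k<n. c k * liftX r (e k) (pX g))"
 using e
proof (induction n)
 case 0
 have "(0 :: complex set => complex) \<in> quasi C r" unfolding quasimode_space_def by (rule cfun.span_zero)
 then obtain I \<phi> where d: "decomp (r - C) (r + C) 0 I \<phi>" using quasimode_decomp[OF _ C] by blast
 have "(%p. 0 * (0 :: complex set => complex) p + 0 * (0 :: complex set => complex) p) = 0" by (simp add: fun_eq_iff)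
 then show ?case using lift_function_lincomb[OF d d g L, of 0 0] by simp
next
 case (Suc n)
 have sub: "cfun.subspace (quasi C r)" unfolding quasimode_space_def by (rule cfun.subspace_span)
 have "(\<Sum>k<n. cscale (c k) (e k)) \<in> quasi C r"
  using Suc.prems by (intro cfun.subspace_sum[OF sub] cfun.subspace_scale[OF sub]) auto
 then obtain I \<phi> where d: "decomp (r - C) (r + C) (\<Sum>k<n. cscale (c k) (e k)) I \<phi>" using quasimode_decomp[OF _ C] by blast
 obtain I' \<phi>' where d': "decomp (r - C) (r + C) (e n) I' \<phi>'" using quasimode_decomp[OF Suc.prems C, of n] by blast
 have "(\<Sum>k<Suc n. cscale (c k) (e k)) = (%p. 1 * (\<Sum>k<n. cscale (c k) (e k)) p + c n * e n p)"
  by (simp add: fun_eq_iff cscale_def)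
 then show ?case using lift_function_lincomb[OF d d' g L, of 1 "c n"] Suc.IH Suc.prems by simp
qed

text \<open>
  Over an orthonormal family the squares of the averages add up to a function with large mean, so at
  some point the evaluation functional is large; it is represented by a combination of the family, and
  this combination is the quasimode.
\<close>

lemma concentrated_quasimode:
 assumes C: "0 < C" "C < r" and L: "int L = \<lfloor>sqrt r\<rfloor>" "L >= 2" and c: "0 < c"
  and \<delta>: "0 < \<delta>" "\<delta> <= 1/2" "\<delta> * drift C <= 1/48"
  and S: "cfun.subspace S" "S \<subseteq> quasi C r" "real (cfun.dim S) >= c * r"
 obtains \<psi> g where "\<psi> \<in> S" "L2M \<psi> = 1" "g \<in> SL2"
  "ennreal (c * \<delta>^4 / 2^18) <= (\<integral>\<^sup>+h. indicator (tube \<delta> (\<delta> / real L)) h * ennreal ((cmod (liftX r \<psi> (pX (g ** h))))\<^sup>2) \<partial>haar_SL2)"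
proof -
 let ?B = "tube \<delta> (\<delta> / real L)"
 define \<beta> where "\<beta> = measure haar_SL2 ?B"
 have r0: "0 < r" using C by simp
 have Lr: "real L <= sqrt r" "sqrt r < real L + 1" using L(1) by linarith+
 have Lr2: "(real L)\<^sup>2 <= r" using power_mono[OF Lr(1), of 2] r0 by simp
 have "sqrt r <= 2 * real L" using Lr L(2) by linarith
 then have "(sqrt r)\<^sup>2 <= (2 * real L)\<^sup>2" by (intro power_mono) (use r0 in auto)
 then have r4: "r <= 4 * (real L)\<^sup>2" using r0 by (simp add: power_mult_distrib)
 have e1: "\<delta> / real L <= \<delta>" "0 < \<delta> / real L" using \<delta> L(2) by (simp_all add: field_simps)
 have fin: "emeasure haar_SL2 ?B < \<infinity>" using \<delta> e1 by (intro haar_tube_finite) auto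
 have em: "emeasure haar_SL2 ?B = ennreal \<beta>" unfolding \<beta>_def using fin by (simp add: emeasure_eq_ennreal_measure less_top)
 have "ennreal (\<delta>\<^sup>2 * (\<delta> / real L)\<^sup>2 / 1024) <= ennreal \<beta>" using haar_tube_ge[OF e1(2) e1(1)] \<delta> unfolding em by simp
 then have \<beta>: "\<delta>\<^sup>2 * (\<delta> / real L)\<^sup>2 / 1024 <= \<beta>" by (simp add: \<beta>_def)
 have \<beta>0: "\<beta> > 0"
 proof -
  have "0 < \<delta>\<^sup>2 * (\<delta> / real L)\<^sup>2 / 1024" using \<delta> L by simp
  then show ?thesis using \<beta> by linarith
 qed
 obtain B where B: "B \<subseteq> S" "cfun.independent B" "S \<subseteq> cfun.span B" "card B = cfun.dim S"
  using cfun.basis_exists[of S] by blast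
 define d where "d = card B"
 have d: "real d >= c * r" using S(3) B(4) by (simp add: d_def)
 then have "real d > 0" using mult_pos_pos[OF c r0] by linarith
 then have d0: "d > 0" by simp
 then have finB: "finite B" using d_def card_gt_0_iff by blast
 have spB: "cfun.span B \<subseteq> S" by (rule cfun.span_minimal[OF B(1) S(1)])
 obtain e where e: "\<And>k. k < d ==> e k \<in> S"
  and on: "\<And>k l. k < d ==> l < d ==> inner2 (pull (e k)) (pull (e l)) = (if k = l then 1 else 0)"
  using orthonormal_family[OF C(2) finB B(2)] B(1) S(2) spB unfolding d_def by blast
 have eQ: "e k \<in> quasi C r" if "k < d" for k using e[OF that] S(2) by blast
 define \<Lambda> where "\<Lambda> \<psi> g = liftX r \<psi> (pX g)" for \<psi> g
 obtain I \<phi> where D: "\<And>k. k < d ==> decomp (r - C) (r + C) (e k) (I k) (\<phi> k)"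
  using quasimode_decomp[OF eQ C(2)] by metis
 have \<Lambda>e: "\<Lambda> (e k) g = lift_comb (I k) (\<phi> k) L g" if "k < d" "g \<in> SL2" for k g
  unfolding \<Lambda>_def by (rule lift_function_comb[OF D[OF that(1)] that(2) L(1)])
 have nP: "nice (lift_comb (I k) (\<phi> k) L)" if "k < d" for k by (rule nice_lift_comb[OF decomp_fam[OF D[OF that]]])
 have BS: "?B \<subseteq> SL2" by (auto simp: tube_def)
 have TA: "tube_average r ?B F g = tube_average r ?B F' g" if "g \<in> SL2" "\<And>g. g \<in> SL2 ==> F g = F' g" for F F' g
  unfolding tube_average_def using that BS SL2_mult
  by (intro Bochner_Integration.integral_cong refl) (auto simp: restrict_haar[OF tube_sets] subset_iff)
 define T where "T k = tube_average r ?B (lift_comb (I k) (\<phi> k) L)" for k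
 have nT: "nice (T k)" if "k < d" for k unfolding T_def by (rule nice_tube_average[OF nP[OF that] tube_sets fin])
 have Tge: "\<beta>\<^sup>2 / 128 <= nrm2 (T k)" if k: "k < d" for k
 proof -
  have "complex_of_real (nrm2 (pull (e k))) = 1" using on[OF k k] inner2_self[OF nice_pull[OF D[OF k]]] by simp
  then have 1: "nrm2 (pull (e k)) = 1" by (simp only: of_real_eq_1_iff)
  have "s \<in> I k ==> \<bar>s - r\<bar> <= C" for s using D[OF k] by (auto simp: decomp_def subset_iff abs_le_iff) (force+)?
  from nrm2_tube_average_ge[OF D[OF k] this L(2) r4 _ _ _ \<delta>(2,3)] C \<delta> show ?thesis
   by (simp add: 1 T_def \<beta>_def)
 qed
 define Q where "Q g = (\<Sum>k<d. (cmod (T k g))\<^sup>2)" for g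
 have iQ: "integrable XM Q" unfolding Q_def using nT by (intro Bochner_Integration.integrable_sum nice_integrable_sq) auto
 have "real d * (\<beta>\<^sup>2 / 128) <= (\<Sum>k<d. nrm2 (T k))" using sum_mono[of "{..<d}" "%_. \<beta>\<^sup>2 / 128", OF Tge] by simp
 also have "... = (\<integral>g. Q g \<partial>XM)" unfolding Q_def nrm2_def
  using nT by (intro Bochner_Integration.integral_sum[symmetric] nice_integrable_sq) auto
 finally have mean: "real d * (\<beta>\<^sup>2 / 128) <= (\<integral>g. Q g \<partial>XM)" .
 obtain g where g: "g \<in> SL2" "real d * (\<beta>\<^sup>2 / 128) <= Q g"
 proof (rule ccontr)
  assume "\<not> thesis"
  then have lt: "Q g < real d * (\<beta>\<^sup>2 / 128)" if "g \<in> SL2" for g using that \<open>\<And>g. [|g \<in> SL2; real d * (\<beta>\<^sup>2 / 128) <= Q g|] ==> thesis\<close> not_le by blast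
  have "(\<integral>g. Q g \<partial>XM) < (\<integral>g. real d * (\<beta>\<^sup>2 / 128) \<partial>XM)"
  proof (rule XM.integral_less_AE_space[OF iQ])
   show "AE g in XM. Q g < real d * (\<beta>\<^sup>2 / 128)" by (rule AE_I2, rule lt) simp
  qed (simp_all add: emeasure_XM)
  then show False using mean by simp
 qed
 define A where "A = Q g"
 have A: "real d * (\<beta>\<^sup>2 / 128) <= A" using g by (simp add: A_def)
 have A0: "A > 0"
 proof -
  have "0 < real d * (\<beta>\<^sup>2 / 128)" using d0 \<beta>0 by simp
  then show ?thesis using A by linarith
 qed
 \<comment> \<open>The vector that represents evaluation of the average at \<open>g\<close>: \<open>T \<psi> g = \<parallel>\<psi>\<parallel>\<^sup>2 = A\<close>.\<close>
 define \<psi> where "\<psi> = (\<Sum>k<d. cscale (cnj (T k g)) (e k))"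
 have \<psi>S: "\<psi> \<in> S" unfolding \<psi>_def using e by (intro cfun.subspace_sum[OF S(1)] cfun.subspace_scale[OF S(1)]) auto
 obtain J \<kappa> where D\<psi>: "decomp (r - C) (r + C) \<psi> J \<kappa>" using quasimode_decomp[OF _ C(2), of \<psi>] \<psi>S S(2) by blast
 have n\<psi>: "nice (pull (e k))" if "k < d" for k by (rule nice_pull[OF D[OF that]])
 have nrm\<psi>: "nrm2 (pull \<psi>) = A"
 proof -
  have p: "pull \<psi> = (%x. \<Sum>k<d. cnj (T k g) * pull (e k) x)"
   using pull_sum[of 0 "%k. cnj (T k g)" e "{..<d}"] by (simp add: fun_eq_iff \<psi>_def) (simp add: pull_def)
  have "inner2 (pull \<psi>) (pull \<psi>) = (\<Sum>k<d. inner2 (%x. cnj (T k g) * pull (e k) x) (pull \<psi>))"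
   by (subst p) (intro inner2_sum_left nice_mult nice_const n\<psi> nice_pull[OF D\<psi>], auto)
  also have "... = (\<Sum>k<d. cnj (T k g) * T k g)"
  proof (intro sum.cong refl)
   fix k assume k: "k \<in> {..<d}"
   have "inner2 (pull (e k)) (pull \<psi>) = (\<Sum>l<d. inner2 (pull (e k)) (%x. cnj (T l g) * pull (e l) x))"
    unfolding p using k by (intro inner2_sum_right nice_mult nice_const n\<psi>) auto
   also have "... = (\<Sum>l<d. if l = k then T l g else 0)" using k by (intro sum.cong refl) (auto simp: inner2_scale_right on)
   also have "... = T k g" using k by simp
   finally show "inner2 (%x. cnj (T k g) * pull (e k) x) (pull \<psi>) = cnj (T k g) * T k g" by (simp add: inner2_scale_left)
  qed
  also have "... = of_real A" unfolding A_def Q_def of_real_sum complex_norm_square by (simp add: mult.commute)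
  finally have "complex_of_real (nrm2 (pull \<psi>)) = of_real A" by (simp only: inner2_self[OF nice_pull[OF D\<psi>]])
  then show ?thesis by (simp only: of_real_eq_iff)
 qed
 have \<Lambda>\<psi>: "\<Lambda> \<psi> x = lift_comb J \<kappa> L x" if "x \<in> SL2" for x
  unfolding \<Lambda>_def by (rule lift_function_comb[OF D\<psi> that L(1)])
 have nP\<psi>: "nice (lift_comb J \<kappa> L)" by (rule nice_lift_comb[OF decomp_fam[OF D\<psi>]])
 have T\<psi>: "tube_average r ?B (lift_comb J \<kappa> L) g = of_real A"
 proof -
  let ?N = "restrict_space haar_SL2 ?B"
  interpret N: finite_measure ?N by (rule finite_measure_restrict[OF tube_sets fin])
  have "tube_average r ?B (lift_comb J \<kappa> L) g = tube_average r ?B (%x. \<Sum>k<d. cnj (T k g) * lift_comb (I k) (\<phi> k) L x) g"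
  proof (rule TA[OF g(1)])
   fix x :: "real^2^2" assume x: "x \<in> SL2"
   have "lift_comb J \<kappa> L x = \<Lambda> \<psi> x" by (rule \<Lambda>\<psi>[OF x, symmetric])
   also have "... = (\<Sum>k<d. cnj (T k g) * \<Lambda> (e k) x)" unfolding \<Lambda>_def \<psi>_def by (rule lift_function_sum[OF C(2) eQ x L(1)])
   also have "... = (\<Sum>k<d. cnj (T k g) * lift_comb (I k) (\<phi> k) L x)" using x by (intro sum.cong refl) (simp add: \<Lambda>e)
   finally show "lift_comb J \<kappa> L x = (\<Sum>k<d. cnj (T k g) * lift_comb (I k) (\<phi> k) L x)" .
  qed
  also have "... = (\<integral>h. (\<Sum>k<d. cnj (T k g) * (cis (- (2 * r * ln (h$1$1))) * lift_comb (I k) (\<phi> k) L (g ** h))) \<partial>?N)"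
   unfolding tube_average_def by (simp add: sum_distrib_left mult.left_commute)
  also have "... = (\<Sum>k<d. (\<integral>h. cnj (T k g) * (cis (- (2 * r * ln (h$1$1))) * lift_comb (I k) (\<phi> k) L (g ** h)) \<partial>?N))"
  proof (rule Bochner_Integration.integral_sum)
   fix k assume "k \<in> {..<d}"
   then have k: "k < d" by simp
   obtain K where K: "K > 0" "\<And>g. g \<in> SL2 ==> cmod (lift_comb (I k) (\<phi> k) L g) <= K" using nice_bounded_ex[OF nP[OF k]] by auto
   have "(%h. lift_comb (I k) (\<phi> k) L (g ** h)) \<in> borel_measurable ?N"
    using measurable_left_mult[OF g(1) nice_measurable[OF nP[OF k]]] by (intro measurable_restrict_space1) simp
   then have "integrable ?N (%h. cis (- (2 * r * ln (h$1$1))) * lift_comb (I k) (\<phi> k) L (g ** h))"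
    using K g BS by (intro N.integrable_const_bound[where B = K] borel_measurable_times phase_measurable AE_I2)
     (auto simp: norm_mult restrict_haar[OF tube_sets] SL2_mult subset_iff)
   then show "integrable ?N (%h. cnj (T k g) * (cis (- (2 * r * ln (h$1$1))) * lift_comb (I k) (\<phi> k) L (g ** h)))"
    by (rule integrable_mult_right)
  qed
  also have "... = (\<Sum>k<d. cnj (T k g) * T k g)" by (simp add: T_def tube_average_def)
  also have "... = of_real A" unfolding A_def Q_def of_real_sum complex_norm_square by (simp add: mult.commute)
  finally show ?thesis .
 qed
 let ?int = "%\<psi>. \<integral>\<^sup>+h. indicator ?B h * ennreal ((cmod (\<Lambda> \<psi> (g ** h)))\<^sup>2) \<partial>haar_SL2"
 have "?int \<psi> = (\<integral>\<^sup>+h. indicator ?B h * ennreal ((cmod (lift_comb J \<kappa> L (g ** h)))\<^sup>2) \<partial>haar_SL2)"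
  using g(1) by (intro nn_integral_cong) (simp add: \<Lambda>\<psi> SL2_mult)
 then have CS: "ennreal (A\<^sup>2) <= ?int \<psi> * ennreal \<beta>"
  using tube_average_le[OF nP\<psi> tube_sets fin g(1), of r] unfolding T\<psi> em by simp
 define l where "l = L2M \<psi>"
 have l2: "l\<^sup>2 <= 2 * A" "A <= 2 * l\<^sup>2" using L2_norm_M_bounds[OF quasimode_smooth, of \<psi> C r] \<psi>S S(2) unfolding nrm\<psi> l_def by auto
 have l0: "l > 0"
 proof -
  have "l\<^sup>2 > 0" using l2 A0 by linarith
  then show ?thesis using L2_norm_M_nonneg[of \<psi>] by (simp add: l_def less_le)
 qed
 define \<psi>' where "\<psi>' = cscale (of_real (1 / l)) \<psi>"
 have S': "\<psi>' \<in> S" unfolding \<psi>'_def by (rule cfun.subspace_scale[OF S(1) \<psi>S])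
 have n': "L2M \<psi>' = 1" unfolding \<psi>'_def L2_norm_M_scale norm_of_real l_def[symmetric] using l0 by simp
 have \<Lambda>': "\<Lambda> \<psi>' x = of_real (1 / l) * \<Lambda> \<psi> x" if "x \<in> SL2" for x
  using lift_function_sum[OF C(2), of 1 "%_. \<psi>" x L "%_. of_real (1 / l)"] \<psi>S S(2) that L(1)
  by (simp add: \<Lambda>_def \<psi>'_def subset_iff)
 have "?int \<psi>' = (\<integral>\<^sup>+h. ennreal (1 / l\<^sup>2) * (indicator ?B h * ennreal ((cmod (\<Lambda> \<psi> (g ** h)))\<^sup>2)) \<partial>haar_SL2)"
  using g(1) l0 by (intro nn_integral_cong)
   (simp add: \<Lambda>' SL2_mult norm_mult norm_divide power_divide ennreal_mult[symmetric] split: split_indicator)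
 also have "... = ennreal (1 / l\<^sup>2) * ?int \<psi>"
 proof (rule nn_integral_cmult)
  have "(%h. \<Lambda> \<psi> (g ** h)) \<in> borel_measurable SL2_borel"
   using measurable_left_mult[OF g(1) nice_measurable[OF nP\<psi>]]
   by (rule measurable_cong[THEN iffD1, rotated]) (use g(1) \<Lambda>\<psi> SL2_mult in \<open>auto simp: space_restrict_space\<close>)
  then show "(%h. indicator ?B h * ennreal ((cmod (\<Lambda> \<psi> (g ** h)))\<^sup>2)) \<in> borel_measurable haar_SL2"
   using tube_sets[of \<delta> "\<delta> / real L"] by (simp cong: measurable_cong_sets)
 qed
 finally have i': "?int \<psi>' = ennreal (1 / l\<^sup>2) * ?int \<psi>" .
 have "ennreal (A / 2) <= ?int \<psi>' * ennreal \<beta>"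
 proof -
  have "A / 2 * l\<^sup>2 <= A / 2 * (2 * A)" using l2 A0 by (intro mult_left_mono) auto
  then have "A / 2 <= 1 / l\<^sup>2 * A\<^sup>2" using l0 by (simp add: field_simps power2_eq_square)
  then have "ennreal (A / 2) <= ennreal (1 / l\<^sup>2 * A\<^sup>2)" by (rule ennreal_leI)
  also have "... = ennreal (1 / l\<^sup>2) * ennreal (A\<^sup>2)" by (intro ennreal_mult) auto
  also have "... <= ennreal (1 / l\<^sup>2) * (?int \<psi> * ennreal \<beta>)" by (rule mult_left_mono[OF CS]) simp
  finally show ?thesis unfolding i' by (simp only: mult.assoc)
 qed
 moreover have "ennreal (c * \<delta>^4 / 2^18) * ennreal \<beta> <= ennreal (A / 2)"
 proof -
  \<comment> \<open>The constant \<open>2^18\<close> is 1024 from the volume of the tube, 128 from the average, and 2 from comparing the norms on \<open>M\<close> and \<open>X\<close>.\<close>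
  have "c * \<delta>^4 / 2^18 = c * (real L)\<^sup>2 * (\<delta>\<^sup>2 * (\<delta> / real L)\<^sup>2 / 1024) / 256"
   using L(2) by (simp add: power_divide power2_eq_square eval_nat_numeral)
  also have "... <= c * r * (\<delta>\<^sup>2 * (\<delta> / real L)\<^sup>2 / 1024) / 256"
   using c Lr2 by (intro divide_right_mono mult_right_mono mult_left_mono) auto
  also have "... <= c * r * \<beta> / 256" using c r0 \<beta> by (intro divide_right_mono mult_left_mono) auto
  also have "... <= real d * \<beta> / 256" using d \<beta>0 by (intro divide_right_mono mult_right_mono) auto
  finally have "c * \<delta>^4 / 2^18 * \<beta> <= real d * \<beta> / 256 * \<beta>" using \<beta>0 by (intro mult_right_mono) auto
  also have "... = real d * (\<beta>\<^sup>2 / 128) / 2" by (simp add: power2_eq_square)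
  also have "... <= A / 2" using A by simp
  finally show ?thesis using c \<delta> \<beta>0 by (simp add: ennreal_mult[symmetric] ennreal_leI)
 qed
 ultimately have le: "ennreal (c * \<delta>^4 / 2^18) * ennreal \<beta> <= ?int \<psi>' * ennreal \<beta>" by (rule order_trans[rotated])
 have "ennreal (c * \<delta>^4 / 2^18) <= ?int \<psi>'"
 proof -
  have "ennreal \<beta> * ennreal (1 / \<beta>) = 1" using \<beta>0 by (simp add: ennreal_mult[symmetric] flip: ennreal_1)
  then have "x * ennreal \<beta> * ennreal (1 / \<beta>) = x" for x by (simp only: mult.assoc mult_1_right)
  then show ?thesis using mult_right_mono[OF le, of "ennreal (1 / \<beta>)"] by simp
 qed
 then show ?thesis using that[OF S' n' g(1)] unfolding \<Lambda>_def by blast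
qed

end

section \<open>Embedded discs around a segment of a geodesic\<close>

lemma tube_near_one:
 assumes h: "h \<in> tube \<eta> \<eta>" and \<eta>: "\<eta> <= 1/2" shows "norm (h - mat 1) <= 6 * \<eta>"
proof -
 have a: "\<bar>h$1$1 - 1\<bar> <= \<eta>" "\<bar>h$1$2\<bar> <= \<eta>" "\<bar>h$2$1\<bar> <= \<eta>" and S: "h \<in> SL2" using h by (auto simp: tube_def)
 have half: "1/2 <= h$1$1" using a(1) \<eta> by linarith
 have \<eta>0: "0 <= \<eta>" using a(1) by linarith
 have det: "h$1$1 * h$2$2 = 1 + h$1$2 * h$2$1" using S by (simp add: mem_SL2)
 have "\<bar>h$1$2 * h$2$1\<bar> <= \<eta> * (1/2)" unfolding abs_mult using a \<eta> \<eta>0 by (intro mult_mono) auto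
 then have "\<bar>h$1$1 * h$2$2 - h$1$1\<bar> <= 3/2 * \<eta>" using det a(1) by linarith
 then have "\<bar>h$1$1\<bar> * \<bar>h$2$2 - 1\<bar> <= 3/2 * \<eta>" by (simp add: abs_mult[symmetric] algebra_simps)
 moreover have "1/2 * \<bar>h$2$2 - 1\<bar> <= \<bar>h$1$1\<bar> * \<bar>h$2$2 - 1\<bar>" using half by (intro mult_right_mono) auto
 ultimately have "1/2 * \<bar>h$2$2 - 1\<bar> <= 3/2 * \<eta>" by (rule order_trans[rotated])
 then have "\<bar>h$2$2 - 1\<bar> <= 3 * \<eta>" by simp
 then show ?thesis using norm_mat2_le[of "h - mat 1"] a by (simp add: mat_def)
qed

text \<open>
  Coordinates on a neighbourhood of the identity; the diagonal group is \<open>b = c = 0\<close>.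
\<close>

definition slab :: "real => real => real => real^2^2" where
 "slab a b c = mat2 (1 + a) b c ((1 + b * c) / (1 + a))"

lemma slab_tube: "\<bar>a\<bar> <= \<eta> ==> \<bar>b\<bar> <= \<eta> ==> \<bar>c\<bar> <= \<eta> ==> \<eta> <= 1/2 ==> slab a b c \<in> tube \<eta> \<eta>"
 by (auto simp: tube_def slab_def mat2_in_SL2)

lemma slab_inj: "slab a b c = slab a' b' c' ==> a = a' \<and> b = b' \<and> c = c'"
 by (simp add: slab_def mat2_eq_iff)

lemma bounded_linear_entry: "bounded_linear (%m :: real^2^2. m $ i $ j)"
 by (intro bounded_linear_compose[OF bounded_linear_vec_nth bounded_linear_vec_nth, unfolded o_def])

lemma bounded_linear_left_mult:
 fixes g :: "real^2^2"
 shows "bounded_linear (%m :: real^2^2. g ** m)"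
proof -
 have "linear (%m :: real^2^2. g ** m)" by (rule linearI) (simp_all add: mat2_eq_iff mult_nth2 algebra_simps)
 then show ?thesis by (simp only: linear_conv_bounded_linear)
qed

lemma slab_smooth:
 fixes a b c :: "real^3 => real" and g :: "real^2^2"
 assumes W: "open W" and s: "smooth_on W a" "smooth_on W b" "smooth_on W c" and nz: "\<And>w. w \<in> W ==> 1 + a w \<noteq> 0"
 shows "smooth_on W (%w. g ** slab (a w) (b w) (c w))"
proof -
 have "smooth_on W (%w. (1 + a w) *\<^sub>R mat2 1 0 0 0 + (b w *\<^sub>R mat2 0 1 0 0 + (c w *\<^sub>R mat2 0 0 1 0 + ((1 + b w * c w) * inverse (1 + a w)) *\<^sub>R mat2 0 0 0 1)))"
  by (intro smooth_on_add smooth_on_scaleR smooth_on_const smooth_on_mult smooth_on_inverse W s nz)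
 then have "smooth_on W (%w. slab (a w) (b w) (c w))"
  by (rule smooth_on_cong[OF W, rotated]) (simp add: slab_def mat2_eq_iff divide_inverse)
 then show ?thesis by (rule smooth_on_linear_compose[OF W bounded_linear_left_mult])
qed

text \<open>
  Three entries of \<open>adj2 g ** \<sigma>\<close> recover \<open>a\<close>, \<open>b\<close>, \<open>c\<close>, so a kernel vector of the derivative is killed by their derivatives.
\<close>

lemma slab_immersion:
 fixes a b c :: "real^3 => real" and g :: "real^2^2"
 assumes W: "open W" and w: "w \<in> W" and sm: "smooth_on W (%w. g ** slab (a w) (b w) (c w))" and g: "g \<in> SL2"
  and d: "(a has_derivative a') (at w)" "(b has_derivative b') (at w)" "(c has_derivative c') (at w)"
  and inj: "\<And>v. a' v = 0 ==> b' v = 0 ==> c' v = 0 ==> v = 0"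
 shows "inj (frechet_derivative (%w. g ** slab (a w) (b w) (c w)) (at w))"
proof -
 let ?\<sigma> = "%w. g ** slab (a w) (b w) (c w)"
 define D where "D = frechet_derivative ?\<sigma> (at w)"
 have D: "(?\<sigma> has_derivative D) (at w)" unfolding D_def by (rule smooth_on_derivative[OF sm w])
 have lin: "linear D" by (rule has_derivative_linear[OF D])
 have e: "((%x. (adj2 g ** ?\<sigma> x)$i$j) has_derivative (%v. (adj2 g ** D v)$i$j)) (at w)" for i j
  by (rule bounded_linear.has_derivative[OF bounded_linear_entry bounded_linear.has_derivative[OF bounded_linear_left_mult D]])
 have s: "adj2 g ** ?\<sigma> x = slab (a x) (b x) (c x)" for x by (simp add: adj2_cancel g)
 have a: "(a has_derivative (%v. (adj2 g ** D v)$1$1)) (at w)"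
  using has_derivative_diff[OF e[of 1 1] has_derivative_const[of 1]] unfolding s by (simp add: slab_def)
 have b: "(b has_derivative (%v. (adj2 g ** D v)$1$2)) (at w)" using e[of 1 2] unfolding s by (simp add: slab_def)
 have c: "(c has_derivative (%v. (adj2 g ** D v)$2$1)) (at w)" using e[of 2 1] unfolding s by (simp add: slab_def)
 have eq: "a' = (%v. (adj2 g ** D v)$1$1)" "b' = (%v. (adj2 g ** D v)$1$2)" "c' = (%v. (adj2 g ** D v)$2$1)"
  using has_derivative_unique[OF d(1) a] has_derivative_unique[OF d(2) b] has_derivative_unique[OF d(3) c] by auto
 have "v = 0" if "D v = 0" for v
  by (rule inj) (simp_all add: eq that mult_nth2)
 then have "inj D" using linear_injective_0[OF lin] by blast
 then show ?thesis by (simp add: D_def)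
qed

context surface_group begin

text \<open>
  Around each point of norm at most \<open>R\<close> the quotient map is injective at this scale:
  conjugation by such a point expands distances to the identity by at most \<open>R\<^sup>2\<close>.
\<close>

definition inj_radius :: "real => real" where
 "inj_radius R = min 1 (iso_radius / (8 * R\<^sup>2))"

lemma inj_radius_pos: "R > 0 ==> inj_radius R > 0"
 using iso_radius(1) by (simp add: inj_radius_def)

lemma coset_inj_uniform:
 assumes R: "0 < R" and g: "g \<in> SL2" "norm g <= R" and h: "h \<in> SL2" "norm (h - mat 1) <= inj_radius R"
  and h': "h' \<in> SL2" "norm (h' - mat 1) <= inj_radius R" and \<gamma>: "\<gamma> \<in> \<Gamma>" "\<gamma> ** (g ** h) = g ** h'"
 shows "\<gamma> = mat 1"
proof (rule iso_radius(2)[OF \<gamma>(1)])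
 let ?\<kappa> = "inj_radius R"
 have k: "?\<kappa> <= 1" "?\<kappa> <= iso_radius / (8 * R\<^sup>2)" "0 < ?\<kappa>" using inj_radius_pos[OF R] by (auto simp: inj_radius_def)
 have "\<gamma> = (\<gamma> ** (g ** h)) ** adj2 (g ** h)" using g h by (simp add: adj2_cancel SL2_mult)
 also have "... = g ** (h' ** adj2 h) ** adj2 g" unfolding \<gamma>(2) by (simp add: adj2_mul matrix_mul_assoc)
 finally have "\<gamma> - mat 1 = g ** (h' ** adj2 h) ** adj2 g - g ** (h ** adj2 h) ** adj2 g"
  using g h by (simp add: adj2_mult)
 also have "... = g ** ((h' - h) ** adj2 h) ** adj2 g" by (simp only: matrix_diff_mult)
 finally have e: "\<gamma> - mat 1 = g ** ((h' - h) ** adj2 h) ** adj2 g" .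
 have "norm (mat 1 :: real^2^2) <= 2" using norm_mat2_le[of "mat 1"] by (simp add: mat_def)
 then have nh: "norm h <= 3" using h(2) k norm_triangle_ineq[of "h - mat 1" "mat 1"] by simp
 have "norm (h' - h) <= norm (h' - mat 1) + norm (h - mat 1)" using norm_triangle_ineq4[of "h' - mat 1" "h - mat 1"] by simp
 then have nd: "norm (h' - h) <= 2 * ?\<kappa>" using h h' by linarith
 have "norm (\<gamma> - mat 1) <= norm (g ** ((h' - h) ** adj2 h)) * norm (adj2 g)" unfolding e by (rule norm_mult2_le)
 also have "... <= norm g * norm ((h' - h) ** adj2 h) * norm (adj2 g)" by (intro mult_right_mono norm_mult2_le) auto
 also have "... <= norm g * (norm (h' - h) * norm (adj2 h)) * norm (adj2 g)" by (intro mult_right_mono mult_left_mono norm_mult2_le) auto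
 also have "... <= R * (2 * ?\<kappa> * 3) * R" using g nd nh R k by (intro mult_mono) auto
 also have "... = 6 * R\<^sup>2 * ?\<kappa>" by (simp add: power2_eq_square)
 also have "... <= 6 * R\<^sup>2 * (iso_radius / (8 * R\<^sup>2))" using k R by (intro mult_left_mono) auto
 also have "... < iso_radius" using R iso_radius(1) by (simp add: field_simps)
 finally show "norm (\<gamma> - mat 1) < iso_radius" .
qed

lemma coset_slab_inj:
 assumes R: "0 < R" and g: "g \<in> SL2" "norm g <= R" and \<eta>: "\<eta> <= 1/2" "6 * \<eta> <= inj_radius R"
  and v: "\<bar>a\<bar> <= \<eta>" "\<bar>b\<bar> <= \<eta>" "\<bar>c\<bar> <= \<eta>" "\<bar>a'\<bar> <= \<eta>" "\<bar>b'\<bar> <= \<eta>" "\<bar>c'\<bar> <= \<eta>"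
  and eq: "pX (g ** slab a b c) = pX (g ** slab a' b' c')"
 shows "a = a' \<and> b = b' \<and> c = c'"
proof -
 have t: "slab a b c \<in> tube \<eta> \<eta>" "slab a' b' c' \<in> tube \<eta> \<eta>" using v \<eta>(1) by (auto intro!: slab_tube)
 obtain \<gamma> where \<gamma>: "\<gamma> \<in> \<Gamma>" "g ** slab a' b' c' = \<gamma> ** (g ** slab a b c)" using eq by (auto simp: coset_eq_iff)
 have "\<gamma> = mat 1"
  using tube_near_one[OF t(1) \<eta>(1)] tube_near_one[OF t(2) \<eta>(1)] \<eta>(2) t \<gamma>
  by (intro coset_inj_uniform[OF R g, of "slab a b c" "slab a' b' c'"]) (auto simp: tube_def)
 then have "adj2 g ** (g ** slab a' b' c') = adj2 g ** (g ** slab a b c)" using \<gamma> by simp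
 then show ?thesis using slab_inj g by (simp add: adj2_cancel) metis
qed

definition disc :: "real^2^2 => real => (real^2^2) set set" where
 "disc g \<rho> = {pX (g ** slab a b 0) | a b. a\<^sup>2 + b\<^sup>2 <= \<rho>\<^sup>2}"

lemma square_sum_bounds:
 fixes a b :: real assumes "a\<^sup>2 + b\<^sup>2 <= \<rho>\<^sup>2" "0 <= \<rho>" shows "\<bar>a\<bar> <= \<rho>" "\<bar>b\<bar> <= \<rho>"
 using assms abs_le_square_iff[of a \<rho>] abs_le_square_iff[of b \<rho>] zero_le_power2[of a] zero_le_power2[of b] by linarith+

lemma disc_compact:
 assumes g: "g \<in> SL2" and \<rho>: "0 < \<rho>" "\<rho> <= 1/2"
 shows "compactin (topX) (disc g \<rho>)"
proof -
 define K where "K = {p :: real \<times> real. (fst p)\<^sup>2 + (snd p)\<^sup>2 <= \<rho>\<^sup>2}"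
 have b: "\<bar>fst p\<bar> <= \<rho>" "\<bar>snd p\<bar> <= \<rho>" if "p \<in> K" for p using that square_sum_bounds[of "fst p" "snd p" \<rho>] \<rho> by (auto simp: K_def)
 have "bounded K"
 proof (rule boundedI)
  fix p assume "p \<in> K"
  then show "norm p <= \<rho> + \<rho>" using b[of p] norm_Pair_le[of "fst p" "snd p"] by simp
 qed
 moreover have "closed K" unfolding K_def by (intro closed_Collect_le continuous_intros)
 ultimately have K: "compact K" by (simp add: compact_eq_bounded_closed)
 let ?f = "%p. g ** slab (fst p) (snd p) 0"
 have nz: "1 + fst p \<noteq> 0" if "p \<in> K" for p using b[OF that] \<rho> by linarith
 have "continuous_on K ?f" unfolding slab_def by (intro continuous_intros) (use nz in auto)
 then have c: "compact (?f ` K)" by (rule compact_continuous_image[OF _ K])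
 have s: "?f ` K \<subseteq> SL2" using nz by (auto intro!: SL2_mult g simp: slab_def mat2_in_SL2)
 have "compactin (top_of_set SL2) (?f ` K)" using c s by (simp add: compactin_subtopology)
 then have "compactin (topX) (pX ` ?f ` K)"
  unfolding X_top_def by (rule image_compactin[OF _ continuous_map_quotient_topology])
 moreover have "pX ` ?f ` K = disc g \<rho>" by (force simp: disc_def K_def image_iff)
 ultimately show ?thesis by simp
qed

lemma local_parametrization_slab:
 fixes a b c :: "real^3 => real" and g :: "real^2^2"
 assumes R: "0 < R" and g: "g \<in> SL2" "norm g <= R" and \<eta>: "\<eta> <= 1/2" "6 * \<eta> <= inj_radius R"
  and W: "open W" and bd: "\<And>w. w \<in> W ==> \<bar>a w\<bar> <= \<eta> \<and> \<bar>b w\<bar> <= \<eta> \<and> \<bar>c w\<bar> <= \<eta>"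
  and s: "smooth_on W a" "smooth_on W b" "smooth_on W c"
  and inj: "\<And>w w'. w \<in> W ==> w' \<in> W ==> a w = a w' ==> b w = b w' ==> c w = c w' ==> w = w'"
  and d: "\<And>w. w \<in> W ==> (a has_derivative a' w) (at w)" "\<And>w. w \<in> W ==> (b has_derivative b' w) (at w)"
   "\<And>w. w \<in> W ==> (c has_derivative c' w) (at w)"
  and di: "\<And>w v. w \<in> W ==> a' w v = 0 ==> b' w v = 0 ==> c' w v = 0 ==> v = 0"
 shows "local_parametrization \<Gamma> W (%w. g ** slab (a w) (b w) (c w))"
 unfolding local_parametrization_def
proof (intro conjI ballI W)
 have t: "slab (a w) (b w) (c w) \<in> tube \<eta> \<eta>" if "w \<in> W" for w using bd[OF that] \<eta> by (intro slab_tube) auto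
 have nz: "1 + a w \<noteq> 0" if "w \<in> W" for w using bd[OF that] \<eta>(1) by linarith
 show sm: "smooth_on W (%w. g ** slab (a w) (b w) (c w))" by (rule slab_smooth[OF W s nz])
 show "(%w. g ** slab (a w) (b w) (c w)) ` W \<subseteq> SL2" using t by (auto intro!: SL2_mult g simp: tube_def)
 show "inj_on (%w. pX (g ** slab (a w) (b w) (c w))) W"
 proof (rule inj_onI)
  fix w w' assume w: "w \<in> W" "w' \<in> W" "pX (g ** slab (a w) (b w) (c w)) = pX (g ** slab (a w') (b w') (c w'))"
  have "a w = a w' \<and> b w = b w' \<and> c w = c w'"
   by (rule coset_slab_inj[OF R g \<eta> _ _ _ _ _ _ w(3)]) (use bd w in auto)
  then show "w = w'" using inj w by blast
 qed
 show "inj (frechet_derivative (%w. g ** slab (a w) (b w) (c w)) (at w))" if "w \<in> W" for w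
  by (rule slab_immersion[OF W that sm g(1) d(1)[OF that] d(2)[OF that] d(3)[OF that]]) (rule di[OF that])
qed

lemma disc_slab_iff:
 assumes R: "0 < R" and g: "g \<in> SL2" "norm g <= R" and \<eta>: "\<eta> <= 1/2" "6 * \<eta> <= inj_radius R" and \<rho>: "0 < \<rho>" "\<rho> <= \<eta>"
  and v: "\<bar>a\<bar> <= \<eta>" "\<bar>b\<bar> <= \<eta>" "\<bar>c\<bar> <= \<eta>"
 shows "pX (g ** slab a b c) \<in> disc g \<rho> \<longleftrightarrow> c = 0 \<and> a\<^sup>2 + b\<^sup>2 <= \<rho>\<^sup>2"
proof
 assume "pX (g ** slab a b c) \<in> disc g \<rho>"
 then obtain a' b' where e: "pX (g ** slab a b c) = pX (g ** slab a' b' 0)" "a'\<^sup>2 + b'\<^sup>2 <= \<rho>\<^sup>2" by (auto simp: disc_def)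
 have b: "\<bar>a'\<bar> <= \<eta>" "\<bar>b'\<bar> <= \<eta>" "\<bar>0::real\<bar> <= \<eta>" using square_sum_bounds[OF e(2)] \<rho> by auto
 have "a = a' \<and> b = b' \<and> c = 0" by (rule coset_slab_inj[OF R g \<eta> v b e(1)])
 then show "c = 0 \<and> a\<^sup>2 + b\<^sup>2 <= \<rho>\<^sup>2" using e(2) by simp
qed (auto simp: disc_def)

lemma bounded_linear_coord: "bounded_linear (%w :: real^3. w $ i)" by (rule bounded_linear_vec_nth)

text \<open>
  Interior points have the affine chart; near the boundary circle polar coordinates around the
  centre turn the disc into a half-slice.
\<close>

lemma disc_surface:
 assumes R: "0 < R" and g: "g \<in> SL2" "norm g <= R" and \<rho>: "0 < \<rho>" "\<rho> <= 1/4" "12 * \<rho> <= inj_radius R"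
 shows "compact_embedded_surface \<Gamma> (disc g \<rho>)"
 unfolding compact_embedded_surface_def
proof (intro conjI ballI disc_compact g)
 show "0 < \<rho>" "\<rho> <= 1/2" using \<rho> by auto
 fix p assume "p \<in> disc g \<rho>"
 then obtain a b where p: "p = pX (g ** slab a b 0)" "a\<^sup>2 + b\<^sup>2 <= \<rho>\<^sup>2" by (auto simp: disc_def)
 let ?\<eta> = "2 * \<rho>"
 have \<eta>: "?\<eta> <= 1/2" "6 * ?\<eta> <= inj_radius R" using \<rho> by auto
 have \<rho>\<eta>: "0 < \<rho>" "\<rho> <= ?\<eta>" using \<rho> by auto
 let ?goal = "%W \<sigma>. local_parametrization \<Gamma> W \<sigma> \<and> p \<in> (%w. pX (\<sigma> w)) ` W \<and>
    ({w\<in>W. pX (\<sigma> w) \<in> disc g \<rho>} = {w\<in>W. w$3 = 0} \<or>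
     {w\<in>W. pX (\<sigma> w) \<in> disc g \<rho>} = {w\<in>W. w$3 = 0 \<and> w$1 >= 0})"
 show "\<exists>W \<sigma>. ?goal W \<sigma>"
 proof (cases "a\<^sup>2 + b\<^sup>2 < \<rho>\<^sup>2")
  case True
  define W where "W = {w :: real^3. (w$1)\<^sup>2 + (w$2)\<^sup>2 < \<rho>\<^sup>2 \<and> \<bar>w$3\<bar> < \<rho>}"
  let ?\<sigma> = "%w :: real^3. g ** slab (w$1) (w$2) (w$3)"
  have W: "open W" unfolding W_def by (intro open_Collect_conj open_Collect_less continuous_intros)
  have bd: "\<bar>w$1\<bar> <= ?\<eta> \<and> \<bar>w$2\<bar> <= ?\<eta> \<and> \<bar>w$3\<bar> <= ?\<eta>" if "w \<in> W" for w
  proof -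
   have "(w$1)\<^sup>2 + (w$2)\<^sup>2 <= \<rho>\<^sup>2" "\<bar>w$3\<bar> < \<rho>" using that by (auto simp: W_def)
   then show ?thesis using square_sum_bounds[of "w$1" "w$2" \<rho>] \<rho> by auto
  qed
  have lp: "local_parametrization \<Gamma> W ?\<sigma>"
  proof (rule local_parametrization_slab[OF R g \<eta> W bd, where a' = "%w v. v$1" and b' = "%w v. v$2" and c' = "%w v. v$3"])
   show "smooth_on W (%w. w$1)" "smooth_on W (%w. w$2)" "smooth_on W (%w. w$3)"
    by (intro smooth_on_linear[OF W] bounded_linear_coord)+
   show "((%w. w$1) has_derivative (%v. v$1)) (at w)" "((%w. w$2) has_derivative (%v. v$2)) (at w)"
     "((%w. w$3) has_derivative (%v. v$3)) (at w)" for w :: "real^3"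
    by (intro bounded_linear_imp_has_derivative bounded_linear_coord)+
  qed (auto simp: vec_eq_iff forall_3)
  have "(vector [a, b, 0] :: real^3) \<in> W" using True \<rho> by (simp add: W_def)
  then have "p \<in> (%w. pX (?\<sigma> w)) ` W" unfolding p(1) by (rule rev_image_eqI) simp
  moreover have "{w\<in>W. pX (?\<sigma> w) \<in> disc g \<rho>} = {w\<in>W. w$3 = 0}"
  proof (rule Collect_cong, rule conj_cong[OF refl])
   fix w assume w: "w \<in> W"
   then show "pX (?\<sigma> w) \<in> disc g \<rho> \<longleftrightarrow> w$3 = 0"
    using disc_slab_iff[OF R g \<eta> \<rho>\<eta>, of "w$1" "w$2" "w$3"] bd[OF w] by (auto simp: W_def)
  qed
  ultimately show ?thesis using lp by blast
 next
  case False
  then have eq: "a\<^sup>2 + b\<^sup>2 = \<rho>\<^sup>2" using p(2) by simp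
  have "(a / \<rho>)\<^sup>2 + (b / \<rho>)\<^sup>2 = 1" using eq \<rho> by (simp add: power_divide add_divide_distrib[symmetric])
  then obtain \<theta> where \<theta>: "a / \<rho> = cos \<theta>" "b / \<rho> = sin \<theta>" using sincos_total_2pi by metis
  define W where "W = {w :: real^3. \<bar>w$1\<bar> < \<rho> / 2 \<and> \<bar>w$2\<bar> < 1 \<and> \<bar>w$3\<bar> < \<rho>}"
  define A where "A w = (\<rho> - w$1) * cos (w$2 + \<theta>)" for w :: "real^3"
  define B where "B w = (\<rho> - w$1) * sin (w$2 + \<theta>)" for w :: "real^3"
  let ?\<sigma> = "%w :: real^3. g ** slab (A w) (B w) (w$3)"
  have W: "open W" unfolding W_def by (intro open_Collect_conj open_Collect_less continuous_intros)
  have pos: "0 < \<rho> - w$1" "\<rho> - w$1 <= ?\<eta>" if "w \<in> W" for w using that \<rho> by (auto simp: W_def)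
  have bd: "\<bar>A w\<bar> <= ?\<eta> \<and> \<bar>B w\<bar> <= ?\<eta> \<and> \<bar>w$3\<bar> <= ?\<eta>" if "w \<in> W" for w
  proof -
   have "\<bar>(\<rho> - w$1) * x\<bar> <= ?\<eta>" if "\<bar>x\<bar> <= 1" for x
   proof -
    have "\<bar>\<rho> - w$1\<bar> * \<bar>x\<bar> <= ?\<eta> * 1" using pos[OF \<open>w \<in> W\<close>] that by (intro mult_mono) auto
    then show ?thesis by (simp add: abs_mult)
   qed
   then show ?thesis using that \<rho> by (auto simp: A_def B_def W_def)
  qed
  have AB: "(A w)\<^sup>2 + (B w)\<^sup>2 = (\<rho> - w$1)\<^sup>2" for w
   unfolding A_def B_def power_mult_distrib distrib_left[symmetric] by simp
  have lp: "local_parametrization \<Gamma> W ?\<sigma>"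
  proof (rule local_parametrization_slab[OF R g \<eta> W bd,
    where a' = "%w v. (\<rho> - w$1) * (- sin (w$2 + \<theta>) * v$2) + (- v$1) * cos (w$2 + \<theta>)"
     and b' = "%w v. (\<rho> - w$1) * (cos (w$2 + \<theta>) * v$2) + (- v$1) * sin (w$2 + \<theta>)" and c' = "%w v. v$3"])
   have lin: "smooth_on W (%w. w$i)" for i by (intro smooth_on_linear[OF W] bounded_linear_coord)
   have rad: "smooth_on W (%w. \<rho> + (- 1) * w$1)" by (intro smooth_on_add smooth_on_const smooth_on_mult lin W)
   show "smooth_on W A" "smooth_on W B"
    unfolding A_def B_def using rad by (auto intro!: smooth_on_mult smooth_on_cos smooth_on_sin smooth_on_add smooth_on_const lin W)
   show "smooth_on W (%w. w$3)" by (rule lin)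
   have cd: "((%w. w$i) has_derivative (%v. v$i)) (at w)" for i and w :: "real^3"
    by (intro bounded_linear_imp_has_derivative bounded_linear_coord)
   have r: "((%w. \<rho> - w$1) has_derivative (%v. - v$1)) (at w)" for w :: "real^3"
    using has_derivative_diff[OF has_derivative_const[of \<rho>] cd[of 1]] by simp
   have t: "((%w. w$2 + \<theta>) has_derivative (%v. v$2)) (at w)" for w :: "real^3"
    using has_derivative_add[OF cd[of 2] has_derivative_const[of \<theta>]] by simp
   have c: "((%w. cos (w$2 + \<theta>)) has_derivative (%v. - sin (w$2 + \<theta>) * v$2)) (at w)"
     "((%w. sin (w$2 + \<theta>)) has_derivative (%v. cos (w$2 + \<theta>) * v$2)) (at w)" for w :: "real^3"
    using has_derivative_compose[OF t has_field_derivative_imp_has_derivative[OF DERIV_cos]]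
     has_derivative_compose[OF t has_field_derivative_imp_has_derivative[OF DERIV_sin]] by auto
   show "(A has_derivative (%v. (\<rho> - w$1) * (- sin (w$2 + \<theta>) * v$2) + (- v$1) * cos (w$2 + \<theta>))) (at w)"
     "(B has_derivative (%v. (\<rho> - w$1) * (cos (w$2 + \<theta>) * v$2) + (- v$1) * sin (w$2 + \<theta>))) (at w)" for w
    unfolding A_def[abs_def] B_def[abs_def] by (intro has_derivative_mult r c)+
   show "((%w. w$3) has_derivative (%v. v$3)) (at w)" for w :: "real^3" by (rule cd)
   show "w = w'" if w: "w \<in> W" "w' \<in> W" "A w = A w'" "B w = B w'" "w$3 = w'$3" for w w'
   proof -
    have "(\<rho> - w$1)\<^sup>2 = (\<rho> - w'$1)\<^sup>2" using AB[of w] AB[of w'] w by simp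
    then have 1: "w$1 = w'$1" using power2_eq_imp_eq[of "\<rho> - w$1" "\<rho> - w'$1"] pos[OF w(1)] pos[OF w(2)] by simp
    then have "cos (w$2 + \<theta>) = cos (w'$2 + \<theta>)" "sin (w$2 + \<theta>) = sin (w'$2 + \<theta>)"
     using w pos[OF w(2)] by (auto simp: A_def B_def)
    then have "cos ((w$2 + \<theta>) - (w'$2 + \<theta>)) = 1"
     unfolding cos_diff by (simp add: power2_eq_square[symmetric])
    then obtain n :: int where n: "w$2 - w'$2 = of_int n * 2 * pi" using cos_one_2pi_int by auto
    have "\<bar>w$2 - w'$2\<bar> < 2" using w by (auto simp: W_def)
    then have "\<bar>of_int n :: real\<bar> * (2 * pi) < 2" unfolding n by (simp add: abs_mult)
    moreover have "2 < 2 * pi" using pi_gt3 by simp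
    ultimately have "\<bar>of_int n :: real\<bar> * (2 * pi) < 1 * (2 * pi)" by linarith
    then have "\<bar>of_int n :: real\<bar> < 1" using mult_less_cancel_right_pos[of "2 * pi"] pi_gt_zero by simp
    then have "n = 0" by linarith
    then show ?thesis using 1 n w(5) by (simp add: vec_eq_iff forall_3)
   qed
   show "v = 0" if w: "w \<in> W" and "(\<rho> - w$1) * (- sin (w$2 + \<theta>) * v$2) + (- v$1) * cos (w$2 + \<theta>) = 0"
    "(\<rho> - w$1) * (cos (w$2 + \<theta>) * v$2) + (- v$1) * sin (w$2 + \<theta>) = 0" "v$3 = 0" for w v :: "real^3"
   proof -
    define C S x y where d: "C = cos (w$2 + \<theta>)" "S = sin (w$2 + \<theta>)" "x = (\<rho> - w$1) * v$2" "y = v$1"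
    have CS: "C\<^sup>2 + S\<^sup>2 = 1" by (simp add: d)
    have 1: "y * C = - x * S" "x * C = y * S" using that(2,3) unfolding d[symmetric] by (auto simp: algebra_simps d)
    have "x * (C\<^sup>2 + S\<^sup>2) = (x * C) * C + x * S * S" by (simp add: power2_eq_square algebra_simps)
    also have "... = (y * C) * S + x * S * S" unfolding 1(2) by simp
    also have "... = 0" unfolding 1(1) by simp
    finally have x: "x = 0" unfolding CS by simp
    have "y * (C\<^sup>2 + S\<^sup>2) = (y * C) * C + (y * S) * S" by (simp add: power2_eq_square algebra_simps)
    also have "... = 0" unfolding 1(1) 1(2)[symmetric] x by simp
    finally have y: "y = 0" unfolding CS by simp
    show "v = 0" using x y that(4) pos[OF w] by (simp add: vec_eq_iff forall_3 d)
   qed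
  qed
  have "(0 :: real^3) \<in> W" using \<rho> by (simp add: W_def)
  moreover have "A 0 = a" "B 0 = b" using \<theta> \<rho> by (auto simp: A_def B_def field_simps)
  ultimately have "p \<in> (%w. pX (?\<sigma> w)) ` W" unfolding p(1) by (intro rev_image_eqI[of 0]) auto
  moreover have "{w\<in>W. pX (?\<sigma> w) \<in> disc g \<rho>} = {w\<in>W. w$3 = 0 \<and> w$1 >= 0}"
  proof (rule Collect_cong, rule conj_cong[OF refl])
   fix w assume w: "w \<in> W"
   have "(\<rho> - w$1)\<^sup>2 <= \<rho>\<^sup>2 \<longleftrightarrow> w$1 >= 0"
    using abs_le_square_iff[of "\<rho> - w$1" \<rho>] pos[OF w] \<rho> by auto
   then show "pX (?\<sigma> w) \<in> disc g \<rho> \<longleftrightarrow> w$3 = 0 \<and> w$1 >= 0"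
    using disc_slab_iff[OF R g \<eta> \<rho>\<eta>, of "A w" "B w" "w$3"] bd[OF w] by (simp add: AB)
  qed
  ultimately show ?thesis using lp by blast
 qed
qed

end

section \<open>Distance to a segment of a geodesic\<close>

lemma tube_norm:
 assumes "h \<in> tube \<delta> \<epsilon>" "\<delta> <= 1/2" "\<epsilon> <= 1/2" shows "norm h <= 5"
proof -
 have "h \<in> tube (1/2) (1/2)" using assms by (auto simp: tube_def)
 then have "norm (h - mat 1) <= 3" using tube_near_one[of h "1/2"] by simp
 moreover have "norm (mat 1 :: real^2^2) <= 2" using norm_mat2_le[of "mat 1"] by (simp add: mat_def)
 ultimately show ?thesis using norm_triangle_ineq[of "h - mat 1" "mat 1"] by simp
qed

context surface_group begin

definition seg_point :: "real^2^2 => (real^2^2) \<times> real => real^2^2" where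
 "seg_point g p = fst p ** (g ** mat2 (snd p) 0 0 (1 / snd p))"

text \<open>
  The distance from \<open>x\<close> to the translates of the segment, measured at the identity by \<open>adj2 x\<close>. In this form it is
  invariant under the group on the left.
\<close>

definition gap :: "real^2^2 => real => real^2^2 => real" where
 "gap g \<delta> x = (INF p\<in>\<Gamma> \<times> {a. \<bar>a - 1\<bar> <= \<delta>}. norm (adj2 x ** seg_point g p - mat 1))"

lemma gap_le: "p \<in> \<Gamma> \<times> {a. \<bar>a - 1\<bar> <= \<delta>} ==> gap g \<delta> x <= norm (adj2 x ** seg_point g p - mat 1)"
 unfolding gap_def by (rule cINF_lower) (auto intro!: bdd_belowI[of _ 0])

lemma gap_ge:
 assumes "0 <= \<delta>" "\<And>p. p \<in> \<Gamma> \<times> {a. \<bar>a - 1\<bar> <= \<delta>} ==> m <= norm (adj2 x ** seg_point g p - mat 1)"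
 shows "m <= gap g \<delta> x"
 unfolding gap_def using assms G_one by (intro cINF_greatest) (auto intro!: exI[of _ 1])

lemma gap_nonneg: "0 <= \<delta> ==> 0 <= gap g \<delta> x"
 by (rule gap_ge) auto

lemma gap_invariant_le:
 assumes \<delta>: "0 <= \<delta>" and \<gamma>: "\<gamma> \<in> \<Gamma>" shows "gap g \<delta> (\<gamma> ** x) <= gap g \<delta> x"
proof (rule gap_ge[OF \<delta>])
 fix p assume p: "p \<in> \<Gamma> \<times> {a. \<bar>a - 1\<bar> <= \<delta>}"
 have "adj2 (\<gamma> ** x) ** seg_point g (\<gamma> ** fst p, snd p) = adj2 x ** (adj2 \<gamma> ** (\<gamma> ** seg_point g p))"
  by (simp add: seg_point_def adj2_mul matrix_mul_assoc)
 also have "... = adj2 x ** seg_point g p" using \<gamma> by (simp add: adj2_cancel G_SL2)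
 finally have "adj2 (\<gamma> ** x) ** seg_point g (\<gamma> ** fst p, snd p) = adj2 x ** seg_point g p" .
 moreover have "(\<gamma> ** fst p, snd p) \<in> \<Gamma> \<times> {a. \<bar>a - 1\<bar> <= \<delta>}" using p \<gamma> G_mult by auto
 ultimately show "gap g \<delta> (\<gamma> ** x) <= norm (adj2 x ** seg_point g p - mat 1)" using gap_le by metis
qed

lemma gap_invariant:
 assumes \<delta>: "0 <= \<delta>" and \<gamma>: "\<gamma> \<in> \<Gamma>" shows "gap g \<delta> (\<gamma> ** x) = gap g \<delta> x"
proof (rule antisym[OF gap_invariant_le[OF assms]])
 have "gap g \<delta> (adj2 \<gamma> ** (\<gamma> ** x)) <= gap g \<delta> (\<gamma> ** x)" by (rule gap_invariant_le[OF \<delta> G_adj[OF \<gamma>]])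
 then show "gap g \<delta> x <= gap g \<delta> (\<gamma> ** x)" using \<gamma> by (simp add: adj2_cancel G_SL2)
qed

lemma gap_compare:
 assumes \<delta>: "0 <= \<delta>" and x: "x \<in> SL2"
 shows "gap g \<delta> x' <= (1 + norm (adj2 x' ** x - mat 1)) * gap g \<delta> x + norm (adj2 x' ** x - mat 1)"
proof -
 define e where "e = norm (adj2 x' ** x - mat 1)"
 have e: "0 <= e" by (simp add: e_def)
 have "(gap g \<delta> x' - e) / (1 + e) <= gap g \<delta> x"
 proof (rule gap_ge[OF \<delta>])
  fix p assume p: "p \<in> \<Gamma> \<times> {a. \<bar>a - 1\<bar> <= \<delta>}"
  define u k where uk: "u = adj2 x ** seg_point g p" "k = adj2 x' ** x"
  have "adj2 x' ** seg_point g p = k ** u" using x by (simp add: uk matrix_mul_assoc[symmetric] adj2_cancel)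
  then have "adj2 x' ** seg_point g p - mat 1 = (u - mat 1) + (k - mat 1) ** (u - mat 1) + (k - mat 1)"
   by (simp add: matrix_diff_mult)
  then have "gap g \<delta> x' <= norm ((u - mat 1) + (k - mat 1) ** (u - mat 1) + (k - mat 1))" using gap_le[OF p, of g x'] by (simp only:)
  also have "... <= norm (u - mat 1) + norm ((k - mat 1) ** (u - mat 1)) + norm (k - mat 1)"
   by (intro norm_triangle_le add_mono norm_triangle_ineq order_refl)
  also have "... <= norm (u - mat 1) + e * norm (u - mat 1) + e"
   using norm_mult2_le[of "k - mat 1" "u - mat 1"] by (simp add: e_def uk)
  finally have "gap g \<delta> x' - e <= norm (u - mat 1) * (1 + e)" by (simp add: algebra_simps)
  then show "(gap g \<delta> x' - e) / (1 + e) <= norm (adj2 x ** seg_point g p - mat 1)"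
   using e by (simp add: pos_divide_le_eq uk)
 qed
 then have "gap g \<delta> x' - e <= gap g \<delta> x * (1 + e)" using e by (simp add: pos_divide_le_eq)
 then show ?thesis unfolding e_def[symmetric] by (simp add: algebra_simps)
qed

lemma gap_continuous:
 assumes \<delta>: "0 <= \<delta>" shows "continuous_on SL2 (gap g \<delta>)"
 unfolding continuous_on_sequentially
proof (intro allI ballI impI, elim conjE)
 fix x :: "nat => real^2^2" and a assume a: "a \<in> SL2" and x: "\<forall>n. x n \<in> SL2" and lim: "x \<longlonglongrightarrow> a"
 define e e' where "e n = norm (adj2 (x n) ** a - mat 1)" and "e' n = norm (adj2 a ** x n - mat 1)" for n
 have "continuous_on UNIV (%y. norm (adj2 y ** a - mat 1))" "continuous_on UNIV (%y. norm (adj2 a ** y - mat 1))"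
  by (intro continuous_intros)+
 then have ic: "isCont (%y. norm (adj2 y ** a - mat 1)) a" "isCont (%y. norm (adj2 a ** y - mat 1)) a"
  by (simp_all add: continuous_on_eq_continuous_at)
 have "e \<longlonglongrightarrow> norm (adj2 a ** a - mat 1)" "e' \<longlonglongrightarrow> norm (adj2 a ** a - mat 1)"
  unfolding e_def[abs_def] e'_def[abs_def]
  by (rule isCont_tendsto_compose[OF ic(1) lim], rule isCont_tendsto_compose[OF ic(2) lim])
 then have e: "e \<longlonglongrightarrow> 0" "e' \<longlonglongrightarrow> 0" using a by (simp_all add: adj2_mult)
 have up: "gap g \<delta> (x n) <= (1 + e n) * gap g \<delta> a + e n" for n unfolding e_def by (rule gap_compare[OF \<delta> a])
 have lo: "(gap g \<delta> a - e' n) / (1 + e' n) <= gap g \<delta> (x n)" for n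
 proof -
  have "gap g \<delta> a <= (1 + e' n) * gap g \<delta> (x n) + e' n" unfolding e'_def using x by (intro gap_compare[OF \<delta>]) simp
  moreover have "0 <= e' n" by (simp add: e'_def)
  ultimately show ?thesis by (simp add: pos_divide_le_eq algebra_simps)
 qed
 have "(%n. (1 + e n) * gap g \<delta> a + e n) \<longlonglongrightarrow> (1 + 0) * gap g \<delta> a + 0" by (intro tendsto_intros e)
 then have l1: "(%n. (1 + e n) * gap g \<delta> a + e n) \<longlonglongrightarrow> gap g \<delta> a" by simp
 have "(%n. (gap g \<delta> a - e' n) / (1 + e' n)) \<longlonglongrightarrow> (gap g \<delta> a - 0) / (1 + 0)" by (intro tendsto_intros e) simp
 then have l2: "(%n. (gap g \<delta> a - e' n) / (1 + e' n)) \<longlonglongrightarrow> gap g \<delta> a" by simp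
 show "(gap g \<delta> \<circ> x) \<longlonglongrightarrow> gap g \<delta> a"
  using tendsto_sandwich[OF always_eventually always_eventually l2 l1] lo up by (simp add: o_def)
qed

text \<open>
  The infimum is approached by \<open>\<gamma> g d\<close> with \<open>d\<close> in a compact segment. A subsequence of the \<open>d\<close> converges, hence also the
  \<open>\<gamma>\<close>, to an element of the group.
\<close>

lemma gap_zero:
 assumes \<delta>: "0 <= \<delta>" "\<delta> <= 1/2" and g: "g \<in> SL2" and x: "x \<in> SL2" and z: "gap g \<delta> x = 0"
 shows "\<exists>a. \<bar>a - 1\<bar> <= \<delta> \<and> pX x = pX (g ** mat2 a 0 0 (1 / a))"
proof -
 have ex: "\<exists>p. p \<in> \<Gamma> \<times> {a. \<bar>a - 1\<bar> <= \<delta>} \<and> norm (adj2 x ** seg_point g p - mat 1) < 1 / real (Suc n)" for n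
 proof (rule ccontr)
  assume "\<not> ?thesis"
  then have "1 / real (Suc n) <= gap g \<delta> x" by (intro gap_ge[OF \<delta>(1)]) (meson not_le)
  then show False using z by simp
 qed
 then obtain p where p: "\<And>n. p n \<in> \<Gamma> \<times> {a. \<bar>a - 1\<bar> <= \<delta>}" "\<And>n. norm (adj2 x ** seg_point g (p n) - mat 1) < 1 / real (Suc n)"
  by metis
 have "compact {1 - \<delta>..1 + \<delta>}" by simp
 moreover have "snd (p n) \<in> {1 - \<delta>..1 + \<delta>}" for n using p(1)[of n] by (auto simp: abs_le_iff)
 ultimately obtain a \<tau> where a: "a \<in> {1 - \<delta>..1 + \<delta>}" and \<tau>: "strict_mono \<tau>" "((%n. snd (p n)) \<circ> \<tau>) \<longlonglongrightarrow> a"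
  unfolding compact_def by meson
 have a1: "\<bar>a - 1\<bar> <= \<delta>" "a \<noteq> 0" using a \<delta> by (auto simp: abs_le_iff)
 define q where "q n = p (\<tau> n)" for n
 define d where "d a = mat2 a 0 0 (1 / a)" for a :: real
 have dS: "d b \<in> SL2" if "b \<noteq> 0" for b using that by (simp add: d_def mat2_in_SL2)
 have qb: "snd (q n) \<noteq> 0" for n using p(1)[of "\<tau> n"] \<delta> by (auto simp: q_def abs_le_iff)
 have sq: "(%n. snd (q n)) \<longlonglongrightarrow> a" using \<tau>(2) by (simp add: o_def q_def)
 have "(%n. norm (adj2 x ** seg_point g (q n) - mat 1)) \<longlonglongrightarrow> 0"
 proof (rule tendsto_sandwich[OF always_eventually always_eventually tendsto_const])
  show "(%n. 1 / real (Suc (\<tau> n))) \<longlonglongrightarrow> 0"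
   using LIMSEQ_subseq_LIMSEQ[OF LIMSEQ_inverse_real_of_nat \<tau>(1)] by (simp add: o_def inverse_eq_divide)
  show "\<forall>n. norm (adj2 x ** seg_point g (q n) - mat 1) <= 1 / real (Suc (\<tau> n))" using p(2) by (simp add: q_def less_imp_le)
 qed simp
 then have u: "(%n. adj2 x ** seg_point g (q n)) \<longlonglongrightarrow> mat 1" by (simp add: tendsto_norm_zero_iff LIM_zero_iff)
 have dcont: "(%n. d (snd (q n))) \<longlonglongrightarrow> d a"
  unfolding d_def using a1(2)
  by (intro continuous_on_tendsto_compose[OF _ sq, of "- {0}"] continuous_intros) (auto simp: qb)
 have "(%n. (x ** (adj2 x ** seg_point g (q n))) ** adj2 (g ** d (snd (q n)))) \<longlonglongrightarrow> (x ** mat 1) ** adj2 (g ** d a)"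
 proof -
  have "continuous_on UNIV (%y. (x ** fst y) ** adj2 (g ** snd y) :: real^2^2)" by (intro continuous_intros)
  from continuous_on_tendsto_compose[OF this tendsto_Pair[OF u dcont]] show ?thesis by simp
 qed
 moreover have "(x ** (adj2 x ** seg_point g (q n))) ** adj2 (g ** d (snd (q n))) = fst (q n)" for n
  using x g dS[OF qb] by (simp add: adj2_cancel seg_point_def d_def[symmetric] SL2_mult)
 ultimately have "(%n. fst (q n)) \<longlonglongrightarrow> x ** adj2 (g ** d a)" by simp
 moreover have "fst (q n) \<in> \<Gamma>" for n using p(1)[of "\<tau> n"] by (auto simp: q_def)
 ultimately have G: "x ** adj2 (g ** d a) \<in> \<Gamma>" using G_convergent(1)[of "%n. fst (q n)"] by blast
 have "x = (x ** adj2 (g ** d a)) ** (g ** d a)" using g dS[OF a1(2)] by (simp add: adj2_cancel SL2_mult)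
 then have "pX x = pX (g ** d a)" using coset_mult[OF G] by metis
 then show ?thesis using a1 by (auto simp: d_def)
qed

lemma gap_tube_le:
 assumes h: "h \<in> tube \<delta> \<epsilon>" and \<delta>: "0 <= \<delta>" "\<delta> <= 1/2" "\<epsilon> <= 1/2"
 shows "gap g \<delta> (y ** h) <= 25 * norm (adj2 y ** g - mat 1) + 20 * \<epsilon>"
proof -
 define d where "d = mat2 (h$1$1) 0 0 (1 / h$1$1)"
 define K where "K = adj2 y ** g"
 have a: "\<bar>h$1$1 - 1\<bar> <= \<delta>" "\<bar>h$1$2\<bar> <= \<epsilon>" "\<bar>h$2$1\<bar> <= \<epsilon>" and S: "h \<in> SL2" using h by (auto simp: tube_def)
 have half: "1/2 <= h$1$1" using a(1) \<delta> by linarith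
 have \<epsilon>0: "0 <= \<epsilon>" using a(2) by linarith
 have dt: "d \<in> tube \<delta> 0" using a half by (auto simp: d_def tube_def mat2_in_SL2)
 have nd: "norm d <= 5" using tube_norm[OF dt \<delta>(2)] by simp
 have nh: "norm h <= 5" using h \<delta> by (intro tube_norm)
 have det: "h$1$1 * h$2$2 = 1 + h$1$2 * h$2$1" using S by (simp add: mem_SL2)
 have "\<bar>h$1$2 * h$2$1\<bar> <= \<epsilon> * 1" unfolding abs_mult using a \<delta> \<epsilon>0 by (intro mult_mono) auto
 moreover have "h$1$2 * h$2$1 = h$1$1 * (h$2$2 - 1 / h$1$1)" using det half by (simp add: field_simps)
 ultimately have "\<bar>h$1$1\<bar> * \<bar>h$2$2 - 1 / h$1$1\<bar> <= \<epsilon>" by (simp add: abs_mult)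
 moreover have "1/2 * \<bar>h$2$2 - 1 / h$1$1\<bar> <= \<bar>h$1$1\<bar> * \<bar>h$2$2 - 1 / h$1$1\<bar>" using half by (intro mult_right_mono) auto
 ultimately have "1/2 * \<bar>h$2$2 - 1 / h$1$1\<bar> <= \<epsilon>" by (rule order_trans[rotated])
 then have "norm (d - h) <= 4 * \<epsilon>" using norm_mat2_le[of "d - h"] a by (simp add: d_def abs_minus_commute)
 moreover have "norm ((K - mat 1) ** d) <= norm (K - mat 1) * 5"
  using norm_mult2_le[of "K - mat 1" d] nd mult_left_mono[OF nd, of "norm (K - mat 1)"] by simp
 ultimately have Kd: "norm ((K - mat 1) ** d + (d - h)) <= norm (K - mat 1) * 5 + 4 * \<epsilon>"
  using norm_triangle_ineq[of "(K - mat 1) ** d" "d - h"] by linarith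
 have "gap g \<delta> (y ** h) <= norm (adj2 (y ** h) ** seg_point g (mat 1, h$1$1) - mat 1)"
  using a G_one by (intro gap_le) auto
 also have "adj2 (y ** h) ** seg_point g (mat 1, h$1$1) - mat 1 = adj2 h ** ((K - mat 1) ** d + (d - h))"
  using S by (simp add: seg_point_def adj2_mul K_def d_def[symmetric] matrix_diff_mult matrix_add_ldistrib matrix_mul_assoc adj2_mult)
 also have "norm ... <= norm (adj2 h) * norm ((K - mat 1) ** d + (d - h))" by (rule norm_mult2_le)
 also have "... <= 5 * (norm (K - mat 1) * 5 + 4 * \<epsilon>)" using nh Kd by (intro mult_mono) auto
 finally show ?thesis by (simp add: K_def)
qed

definition gap_X :: "real^2^2 => real => (real^2^2) set => real" where
 "gap_X g \<delta> p = gap g \<delta> (SOME x. x \<in> SL2 \<and> pX x = p)"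

lemma gap_X_coset:
 assumes \<delta>: "0 <= \<delta>" and x: "x \<in> SL2" shows "gap_X g \<delta> (pX x) = gap g \<delta> x"
proof -
 define y where "y = (SOME y. y \<in> SL2 \<and> pX y = pX x)"
 have "y \<in> SL2 \<and> pX y = pX x" unfolding y_def by (rule someI[of _ x]) (simp add: x)
 then obtain \<gamma> where \<gamma>: "\<gamma> \<in> \<Gamma>" "x = \<gamma> ** y" by (auto simp: coset_eq_iff)
 have "gap g \<delta> x = gap g \<delta> y" unfolding \<gamma>(2) by (rule gap_invariant[OF \<delta> \<gamma>(1)])
 then show ?thesis unfolding gap_X_def y_def[symmetric] by (rule sym)
qed

lemma continuous_map_X_top:
 fixes F :: "(real^2^2) set => 'a::topological_space"
 assumes "continuous_on SL2 f" "\<And>x. x \<in> SL2 ==> F (pX x) = f x"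
 shows "continuous_map (topX) euclidean F"
 unfolding X_top_def using assms
 by (intro continuous_map_from_quotient_topology) (simp add: o_def cong: continuous_on_cong)

lemma topspace_X: "topspace (topX) = pX ` SL2"
 by (simp add: X_top_def topspace_quotient_topology)

section \<open>Mass of the lift near a segment\<close>

text \<open>
  The translated tube embeds into \<open>X\<close>, so by unfolding an integral over it is at most an
  integral over \<open>X\<close>.
\<close>

lemma lift_mass_lower:
 assumes d: "decomp a b \<psi> I \<phi>" and L: "int L = \<lfloor>sqrt r\<rfloor>"
  and R: "0 < R" and y: "y \<in> SL2" "norm y <= R"
  and \<delta>: "\<epsilon> <= \<delta>" "\<delta> <= 1/2" "6 * \<delta> <= inj_radius R"
  and c0: "ennreal c0 <= (\<integral>\<^sup>+h. indicator (tube \<delta> \<epsilon>) h * ennreal ((cmod (liftX r \<psi> (pX (y ** h))))\<^sup>2) \<partial>haar_SL2)"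
  and f: "continuous_map (topX) euclideanreal f" "\<And>p. 0 <= f p" "\<And>p. f p <= 1"
   "\<And>h. h \<in> tube \<delta> \<epsilon> ==> 1/2 <= f (pX (y ** h))"
 shows "ennreal c0 <= 2 * (vX * ennreal (\<integral>p. f p \<partial>mlift r \<psi>))"
proof -
 let ?l = "liftX r \<psi>" and ?P = "lift_comb I \<phi> L" and ?B = "tube \<delta> \<epsilon>"
 have lP: "?l (pX x) = ?P x" if "x \<in> SL2" for x by (rule lift_function_comb[OF d that L])
 have nP: "nice ?P" by (rule nice_lift_comb[OF decomp_fam[OF d]])
 have BS: "?B \<subseteq> SL2" by (auto simp: tube_def)
 have "continuous_map (topX) euclidean ?l"
  using nP lP by (intro continuous_map_X_top[of ?P]) (simp_all add: nice_def)
 then have ml: "?l \<in> borel_measurable (borel_of (topX))" by (rule measurable_borel_of)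
 have mf: "f \<in> borel_measurable (borel_of (topX))" by (rule measurable_borel_of[OF f(1)])
 have sX: "sets (volX) = sets (borel_of (topX))" by (simp add: vol_X_eq)
 note mX = measurable_cong_sets[OF sX refl]
 define \<Phi> where "\<Phi> x = ennreal ((cmod (?l (pX x)))\<^sup>2) * ennreal (f (pX x))" for x
 have m\<Phi>X: "(%p. ennreal ((cmod (?l p))\<^sup>2) * ennreal (f p)) \<in> borel_measurable (borel_of (topX))"
  using ml mf by measurable
 have m\<Phi>: "\<Phi> \<in> borel_measurable SL2_borel" unfolding \<Phi>_def by (rule measurable_compose[OF coset_measurable m\<Phi>X])
 have cX: "pX \<in> XM \<rightarrow>\<^sub>M borel_of (topX)" using coset_measurable by (simp cong: measurable_cong_sets)
 have "(\<integral>\<^sup>+p. ennreal (f p) \<partial>mlift r \<psi>) = (\<integral>\<^sup>+p. ennreal ((cmod (?l p))\<^sup>2) * ennreal (f p) \<partial>volX)"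
  unfolding microlocal_lift_def using ml mf by (intro nn_integral_density) (simp_all add: mX)
 also have "... = (\<integral>\<^sup>+x. \<Phi> x \<partial>XM)"
  unfolding vol_X_eq \<Phi>_def by (rule nn_integral_distr[OF cX]) (simp add: m\<Phi>X)
 finally have J: "(\<integral>\<^sup>+p. ennreal (f p) \<partial>mlift r \<psi>) = (\<integral>\<^sup>+x. \<Phi> x \<partial>XM)" .
 obtain K where K: "K > 0" "\<And>x. x \<in> SL2 ==> cmod (?P x) <= K" using nice_bounded_ex[OF nP] by auto
 have "(\<integral>\<^sup>+x. \<Phi> x \<partial>XM) <= (\<integral>\<^sup>+x. ennreal (K\<^sup>2) * 1 \<partial>XM)"
 proof (rule nn_integral_mono)
  fix x assume "x \<in> space XM"
  then have x: "x \<in> SL2" by simp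
  have "(cmod (?P x))\<^sup>2 <= K\<^sup>2" using K(2)[OF x] by (intro power_mono) auto
  then show "\<Phi> x <= ennreal (K\<^sup>2) * 1" unfolding \<Phi>_def lP[OF x]
   using f(3)[of "pX x"] by (intro mult_mono ennreal_leI) (auto simp: ennreal_le_1)
 qed
 also have "... < \<infinity>" by (simp add: emeasure_XM)
 finally have Jfin: "(\<integral>\<^sup>+x. \<Phi> x \<partial>XM) < \<infinity>" .
 have "(\<integral>p. f p \<partial>mlift r \<psi>) = enn2real (\<integral>\<^sup>+p. ennreal (f p) \<partial>mlift r \<psi>)"
  using mf f(2) by (intro integral_eq_nn_integral) (auto simp: microlocal_lift_def mX)
 then have eJ: "ennreal (\<integral>p. f p \<partial>mlift r \<psi>) = (\<integral>\<^sup>+x. \<Phi> x \<partial>XM)" unfolding J using Jfin by simp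
 define w where "w x = (indicator ?B (adj2 y ** x) :: ennreal)" for x
 have mw: "w \<in> borel_measurable SL2_borel" unfolding w_def
  using tube_sets by (intro measurable_left_mult adj2_SL2 y) simp
 have inv: "G_inv \<Phi>" by (simp add: G_inv_def \<Phi>_def coset_mult)
 have cnt: "(\<integral>\<^sup>+\<gamma>. w (\<gamma> ** x) \<partial>count_space \<Gamma>) <= 1" if x: "x \<in> SL2" for x
 proof -
  let ?S = "{\<gamma> \<in> \<Gamma>. adj2 y ** (\<gamma> ** x) \<in> ?B}"
  have "\<gamma>' = \<gamma>" if g: "\<gamma> \<in> ?S" "\<gamma>' \<in> ?S" for \<gamma> \<gamma>'
  proof -
   define h h' where h: "h = adj2 y ** (\<gamma> ** x)" "h' = adj2 y ** (\<gamma>' ** x)"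
   have hB: "h \<in> tube \<delta> \<delta>" "h' \<in> tube \<delta> \<delta>" using g \<delta> by (auto simp: h tube_def)
   have GG: "\<gamma> \<in> \<Gamma>" "\<gamma>' \<in> \<Gamma>" using g by auto
   have yh: "y ** h = \<gamma> ** x" "y ** h' = \<gamma>' ** x" using y by (simp_all add: h adj2_cancel)
   have "(\<gamma>' ** adj2 \<gamma>) ** (y ** h) = \<gamma>' ** (adj2 \<gamma> ** (\<gamma> ** x))" unfolding yh by (simp only: matrix_mul_assoc)
   also have "... = y ** h'" unfolding yh using GG by (simp add: adj2_cancel G_SL2)
   finally have e: "(\<gamma>' ** adj2 \<gamma>) ** (y ** h) = y ** h'" .
   have "\<gamma>' ** adj2 \<gamma> = mat 1"
    using tube_near_one[OF hB(1) \<delta>(2)] tube_near_one[OF hB(2) \<delta>(2)] \<delta>(3) hB GG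
    by (intro coset_inj_uniform[OF R y _ _ _ _ _ e] G_mult G_adj) (auto simp: tube_def)
   then have "(\<gamma>' ** adj2 \<gamma>) ** \<gamma> = mat 1 ** \<gamma>" by simp
   then show ?thesis using GG by (simp add: adj2_cancel G_SL2)
  qed
  then have "?S = {} \<or> (\<exists>\<gamma>. ?S = {\<gamma>})" by blast
  then have "emeasure (count_space \<Gamma>) ?S <= 1"
  proof
   assume s: "?S = {}"
   show ?thesis unfolding s by simp
  next
   assume "\<exists>\<gamma>. ?S = {\<gamma>}"
   then obtain \<gamma> where s: "?S = {\<gamma>}" by blast
   then have "\<gamma> \<in> \<Gamma>" by blast
   then show ?thesis unfolding s by simp
  qed
  then show ?thesis unfolding w_def using count_G_indicator[of ?B "%\<gamma>. adj2 y ** (\<gamma> ** x)"] by simp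
 qed
 have u1: "(\<integral>\<^sup>+x. w x * \<Phi> x \<partial>haar_SL2) <= 1 * (vX * (\<integral>\<^sup>+x. \<Phi> x \<partial>XM))" by (rule unfolding_le[OF mw m\<Phi> inv cnt])
 have u2: "(\<integral>\<^sup>+x. w x * \<Phi> x \<partial>haar_SL2) = (\<integral>\<^sup>+h. w (y ** h) * \<Phi> (y ** h) \<partial>haar_SL2)"
  using mw m\<Phi> by (intro nn_integral_haar_mult_left[OF y(1), symmetric]) simp
 have "ennreal c0 <= 2 * (\<integral>\<^sup>+h. w (y ** h) * \<Phi> (y ** h) \<partial>haar_SL2)"
 proof -
  have mwy: "(%h. w (y ** h) * \<Phi> (y ** h)) \<in> borel_measurable haar_SL2"
   using measurable_left_mult[OF y(1) mw] measurable_left_mult[OF y(1) m\<Phi>] by (simp cong: measurable_cong_sets)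
  have "(\<integral>\<^sup>+h. indicator ?B h * ennreal ((cmod (?l (pX (y ** h))))\<^sup>2) \<partial>haar_SL2) <= (\<integral>\<^sup>+h. 2 * (w (y ** h) * \<Phi> (y ** h)) \<partial>haar_SL2)"
  proof (rule nn_integral_mono)
   fix h
   show "indicator ?B h * ennreal ((cmod (?l (pX (y ** h))))\<^sup>2) <= 2 * (w (y ** h) * \<Phi> (y ** h))"
   proof (cases "h \<in> ?B")
    case True
    then have "1 <= 2 * f (pX (y ** h))" using f(4) by fastforce
    then have "ennreal ((cmod (?l (pX (y ** h))))\<^sup>2 * 1) <= ennreal ((cmod (?l (pX (y ** h))))\<^sup>2 * (2 * f (pX (y ** h))))"
     by (intro ennreal_leI mult_left_mono) auto
    also have "... = 2 * \<Phi> (y ** h)" using f(2) by (simp add: \<Phi>_def ennreal_mult mult_ac)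
    finally show ?thesis using True y by (simp add: w_def adj2_cancel)
   qed simp
  qed
  also have "... = 2 * (\<integral>\<^sup>+h. w (y ** h) * \<Phi> (y ** h) \<partial>haar_SL2)" by (rule nn_integral_cmult[OF mwy])
  finally show ?thesis using c0 by (rule order_trans[rotated])
 qed
 also have "... <= 2 * (1 * (vX * (\<integral>\<^sup>+x. \<Phi> x \<partial>XM)))" unfolding u2[symmetric] by (rule mult_left_mono[OF u1]) simp
 finally show ?thesis unfolding eJ by simp
qed

text \<open>
  Mass that stays near the segment along a subsequence cannot leave it in a weak-* limit.
\<close>

lemma weak_limit_concentrates:
 assumes \<mu>: "finite_measure \<mu>" "sets \<mu> = sets (borel_of (topX))"
  and lim: "\<And>f. continuous_map (topX) euclideanreal f ==> (%k. \<integral>p. f p \<partial>\<nu> k) \<longlonglongrightarrow> (\<integral>p. f p \<partial>\<mu>)"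
  and \<delta>: "0 <= \<delta>" and c1: "0 < c1"
  and mass: "\<And>e. 0 < e ==> \<forall>\<^sub>F k in sequentially. c1 <= (\<integral>p. max 0 (1 - gap_X g \<delta> p / e) \<partial>\<nu> k)"
 shows "{p \<in> topspace (topX). gap_X g \<delta> p = 0} \<in> sets \<mu>" "emeasure \<mu> {p \<in> topspace (topX). gap_X g \<delta> p = 0} > 0"
proof -
 interpret finite_measure \<mu> by (rule \<mu>(1))
 have cm: "continuous_map (topX) euclideanreal (gap_X g \<delta>)"
  by (rule continuous_map_X_top[OF gap_continuous[OF \<delta>] gap_X_coset[OF \<delta>]])
 have sp: "space \<mu> = topspace (topX)" using sets_eq_imp_space_eq[OF \<mu>(2)] by simp
 have m: "gap_X g \<delta> \<in> borel_measurable \<mu>"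
  unfolding measurable_cong_sets[OF \<mu>(2) refl] by (rule measurable_borel_of[OF cm])
 have nn: "0 <= gap_X g \<delta> p" for p unfolding gap_X_def by (rule gap_nonneg[OF \<delta>])
 define E where "E n = {p \<in> space \<mu>. gap_X g \<delta> p < 1 / real (Suc n)}" for n
 have E: "E n \<in> sets \<mu>" for n unfolding E_def using m by measurable
 have ge: "c1 <= measure \<mu> (E n)" for n
 proof -
  define e where "e = 1 / real (Suc n)"
  have e: "e > 0" by (simp add: e_def)
  define f where "f p = max 0 (1 - gap_X g \<delta> p / e)" for p
  have "continuous_map (topX) euclideanreal f"
   unfolding f_def
  proof (rule continuous_map_X_top)
   show "continuous_on SL2 (%x. max 0 (1 - gap g \<delta> x / e))" using e by (intro continuous_intros gap_continuous[OF \<delta>]) auto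
  qed (simp add: gap_X_coset[OF \<delta>])
  then have "(%k. \<integral>p. f p \<partial>\<nu> k) \<longlonglongrightarrow> (\<integral>p. f p \<partial>\<mu>)" by (rule lim)
  moreover have "\<forall>\<^sub>F k in sequentially. c1 <= (\<integral>p. f p \<partial>\<nu> k)" unfolding f_def by (rule mass[OF e])
  ultimately have "c1 <= (\<integral>p. f p \<partial>\<mu>)" by (rule tendsto_lowerbound) simp
  also have "... <= (\<integral>p. indicator (E n) p \<partial>\<mu>)"
  proof (rule integral_mono)
   have mf: "f \<in> borel_measurable \<mu>" unfolding f_def using m by measurable
   have "0 <= f p \<and> f p <= 1" for p using nn[of p] e by (simp add: f_def)
   then show "integrable \<mu> f" by (intro integrable_const_bound[where B = 1] mf AE_I2) auto
   show "integrable \<mu> (%p. indicator (E n) p :: real)" using E by (simp add: less_top[symmetric])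
   show "f p <= indicator (E n) p" if "p \<in> space \<mu>" for p
   proof (cases "p \<in> E n")
    case True
    then show ?thesis using nn[of p] e by (simp add: f_def)
   next
    case False
    then have "e <= gap_X g \<delta> p" using that by (simp add: E_def e_def not_less)
    then show ?thesis using e False by (simp add: f_def)
   qed
  qed
  also have "... = measure \<mu> (E n)" using E by simp
  finally show ?thesis .
 qed
 have eq: "{p \<in> topspace (topX). gap_X g \<delta> p = 0} = (\<Inter>n. E n)"
 proof (intro equalityI subsetI)
  fix p assume p: "p \<in> (\<Inter>n. E n)"
  then have pn: "p \<in> space \<mu>" "gap_X g \<delta> p < 1 / real (Suc n)" for n by (auto simp: E_def)
  have "gap_X g \<delta> p <= 0"
  proof (rule ccontr)
   assume "\<not> ?thesis"
   then obtain n where "inverse (real (Suc n)) < gap_X g \<delta> p" using reals_Archimedean[of "gap_X g \<delta> p"] by auto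
   then show False using pn(2)[of n] by (simp add: inverse_eq_divide)
  qed
  then show "p \<in> {p \<in> topspace (topX). gap_X g \<delta> p = 0}" using nn[of p] pn(1) sp by simp
 qed (auto simp: E_def sp)
 have dec: "decseq E"
 proof (rule decseq_SucI)
  fix n
  have "1 / real (Suc (Suc n)) <= 1 / real (Suc n)" by (intro divide_left_mono) auto
  then show "E (Suc n) \<subseteq> E n" unfolding E_def by fastforce
 qed
 have "(%n. measure \<mu> (E n)) \<longlonglongrightarrow> measure \<mu> (\<Inter>n. E n)"
  using E dec by (intro finite_Lim_measure_decseq) auto
 then have "c1 <= measure \<mu> (\<Inter>n. E n)" using ge by (intro LIMSEQ_le_const) auto
 then have "0 < measure \<mu> (\<Inter>n. E n)" using c1 by linarith
 then show "emeasure \<mu> {p \<in> topspace (topX). gap_X g \<delta> p = 0} > 0" unfolding eq by (simp add: emeasure_eq_measure)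
 show "{p \<in> topspace (topX). gap_X g \<delta> p = 0} \<in> sets \<mu>" unfolding eq using E by (intro sets.countable_INT) auto
qed

lemma gap_zero_codimension_one:
 assumes R: "0 < R" and g: "g \<in> SL2" "norm g <= R" and \<rho>: "0 < \<rho>" "\<rho> <= 1/4" "12 * \<rho> <= inj_radius R"
 shows "codimension_one \<Gamma> {p \<in> topspace (topX). gap_X g \<rho> p = 0}"
 unfolding codimension_one_def
proof (intro exI conjI subsetI)
 show "compact_embedded_surface \<Gamma> (disc g \<rho>)" by (rule disc_surface[OF R g \<rho>])
 fix p assume "p \<in> {p \<in> topspace (topX). gap_X g \<rho> p = 0}"
 then obtain x where x: "x \<in> SL2" "p = pX x" "gap g \<rho> x = 0"
  using gap_X_coset[of \<rho>] \<rho> by (auto simp: topspace_X)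
 obtain a where a: "\<bar>a - 1\<bar> <= \<rho>" "pX x = pX (g ** mat2 a 0 0 (1 / a))"
  using gap_zero[OF _ _ g(1) x(1) x(3)] \<rho> by auto
 have "mat2 a 0 0 (1 / a) = slab (a - 1) 0 0" by (simp add: slab_def)
 moreover have "(a - 1)\<^sup>2 + 0\<^sup>2 <= \<rho>\<^sup>2" using a(1) \<rho> by (simp add: abs_le_square_iff[symmetric])
 ultimately show "p \<in> disc g \<rho>" unfolding disc_def x(2) a(2)
  by (intro CollectI exI[of _ "a - 1"] exI[of _ 0]) simp
qed

end

section \<open>Conclusion\<close>

context surface_group begin

definition tube_mass :: "real => real => (complex set => complex) => real^2^2 => ennreal" where
 "tube_mass \<delta> r \<psi> y = (\<integral>\<^sup>+h. indicator (tube \<delta> (\<delta> / real (nat \<lfloor>sqrt r\<rfloor>))) h *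
   ennreal ((cmod (liftX r \<psi> (pX (y ** h))))\<^sup>2) \<partial>haar_SL2)"

lemma limit_has_codimension_one_mass:
 assumes R: "0 < R" and \<delta>: "0 < \<delta>" "\<delta> <= 1/4" "12 * \<delta> <= inj_radius R" and c1: "0 < c1" and C: "0 < C"
  and r: "filterlim r at_top sequentially" and \<psi>Q: "\<And>j. \<psi> j \<in> quasi C (r j)"
  and conc: "\<And>j. C < r j ==> 4 <= r j ==> \<exists>y\<in>SL2. norm y <= R \<and>
    ennreal c1 <= tube_mass \<delta> (r j) (\<psi> j) y"
  and \<mu>: "weak_star_limit_point (topX) (%j. mlift (r j) (\<psi> j)) \<mu>"
 shows "\<exists>A\<in>sets \<mu>. codimension_one \<Gamma> A \<and> emeasure \<mu> A > 0"
proof -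
 define L where "L j = nat \<lfloor>sqrt (r j)\<rfloor>" for j
 obtain \<sigma> where \<mu>1: "finite_measure \<mu>" "sets \<mu> = sets (borel_of (topX))" and \<sigma>: "strict_mono \<sigma>"
  and lim: "\<And>f. continuous_map (topX) euclideanreal f ==>
     (%k. \<integral>p. f p \<partial>mlift (r (\<sigma> k)) (\<psi> (\<sigma> k))) \<longlonglongrightarrow> (\<integral>p. f p \<partial>\<mu>)"
  using \<mu> by (auto simp: weak_star_limit_point_def)
 have "\<forall>\<^sub>F j in sequentially. max C 4 < r j" using r unfolding filterlim_at_top_dense by blast
 then obtain N where N: "\<And>j. N <= j ==> C < r j \<and> 4 <= r j" unfolding eventually_sequentially by force
 have good: "C < r (\<sigma> (k + N))" "4 <= r (\<sigma> (k + N))" for k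
  using N[of "\<sigma> (k + N)"] seq_suble[OF \<sigma>, of "k + N"] by auto
 have "\<exists>y. y \<in> SL2 \<and> norm y <= R \<and> ennreal c1 <= tube_mass \<delta> (r (\<sigma> (k + N))) (\<psi> (\<sigma> (k + N))) y" for k
  using conc[OF good[of k]] by blast
 then obtain Y where Y: "\<And>k. Y k \<in> SL2" "\<And>k. norm (Y k) <= R" "\<And>k. ennreal c1 <= tube_mass \<delta> (r (\<sigma> (k + N))) (\<psi> (\<sigma> (k + N))) (Y k)"
  by metis
 have "compact (SL2 \<inter> cball 0 R)" using closed_SL2 by (intro closed_Int_compact) auto
 moreover have "Y k \<in> SL2 \<inter> cball 0 R" for k using Y(1,2) by simp
 ultimately obtain g \<tau> where g: "g \<in> SL2 \<inter> cball 0 R" and \<tau>: "strict_mono \<tau>" "(Y \<circ> \<tau>) \<longlonglongrightarrow> g"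
  unfolding compact_def by meson
 have g1: "g \<in> SL2" "norm g <= R" using g by auto
 define m where "m k = \<sigma> (\<tau> k + N)" for k
 define y where "y k = Y (\<tau> k)" for k
 have sm: "strict_mono (%k. \<tau> k + N)" using \<tau>(1) by (simp add: strict_mono_def)
 have m_sm: "strict_mono m" unfolding m_def using strict_mono_o[OF \<sigma> sm] by (simp add: o_def)
 have rm: "C < r (m k)" "4 <= r (m k)" for k unfolding m_def by (rule good)+
 have L: "int (L (m k)) = \<lfloor>sqrt (r (m k))\<rfloor>" for k using rm(2)[of k] by (simp add: L_def)
 have y: "y k \<in> SL2" "norm (y k) <= R" "ennreal c1 <= tube_mass \<delta> (r (m k)) (\<psi> (m k)) (y k)" for k
  using Y by (simp_all add: y_def m_def)
 have ylim: "y \<longlonglongrightarrow> g" using \<tau>(2) by (simp add: o_def y_def[abs_def])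
 define \<nu> where "\<nu> k = mlift (r (m k)) (\<psi> (m k))" for k
 have lim\<nu>: "(%k. \<integral>p. f p \<partial>\<nu> k) \<longlonglongrightarrow> (\<integral>p. f p \<partial>\<mu>)" if "continuous_map (topX) euclideanreal f" for f
  using LIMSEQ_subseq_LIMSEQ[OF lim[OF that] sm] by (simp add: o_def \<nu>_def m_def)
 define V where "V = enn2real vX"
 have V: "vX = ennreal V" "0 < V" using vX_finite vX_pos by (simp_all add: V_def enn2real_positive_iff)
 have width: "(%k. \<delta> / real (L (m k))) \<longlonglongrightarrow> 0"
 proof -
  have "filterlim (%k. r (m k)) at_top sequentially" by (rule filterlim_compose[OF r filterlim_subseq[OF m_sm]])
  then have s1: "filterlim (%k. sqrt (r (m k))) at_top sequentially" by (rule filterlim_compose[OF sqrt_at_top])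
  have s2: "sqrt (r (m k)) <= 1 + real (L (m k))" for k
  proof -
   have "sqrt (r (m k)) < of_int \<lfloor>sqrt (r (m k))\<rfloor> + 1" by linarith
   then show ?thesis unfolding L[symmetric] by simp
  qed
  have "filterlim (%k. 1 + real (L (m k))) at_top sequentially"
   by (rule filterlim_at_top_mono[OF s1 always_eventually]) (rule allI, rule s2)
  then have "filterlim (%k. - 1 + (1 + real (L (m k)))) at_top sequentially" by (rule filterlim_tendsto_add_at_top[OF tendsto_const])
  then have "filterlim (%k. real (L (m k))) at_top sequentially" by simp
  then show ?thesis by (rule tendsto_divide_0[OF tendsto_const filterlim_at_top_imp_at_infinity])
 qed
 have Kn: "(%k. norm (adj2 (y k) ** g - mat 1)) \<longlonglongrightarrow> 0"
 proof -
  have "continuous_on UNIV (%x. norm (adj2 x ** g - mat 1))" by (intro continuous_intros)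
  then have "isCont (%x. norm (adj2 x ** g - mat 1)) g" by (simp add: continuous_on_eq_continuous_at)
  from isCont_tendsto_compose[OF this ylim] show ?thesis by (simp add: adj2_mult g1)
 qed
 have mass: "\<forall>\<^sub>F k in sequentially. c1 / (2 * V) <= (\<integral>p. max 0 (1 - gap_X g \<delta> p / e) \<partial>\<nu> k)" if e: "0 < e" for e
 proof -
  have "(%k. 25 * norm (adj2 (y k) ** g - mat 1) + 20 * (\<delta> / real (L (m k)))) \<longlonglongrightarrow> 25 * 0 + 20 * 0"
   by (intro tendsto_intros Kn width)
  then have "\<forall>\<^sub>F k in sequentially. 25 * norm (adj2 (y k) ** g - mat 1) + 20 * (\<delta> / real (L (m k))) < e / 2"
   using e by (intro order_tendstoD(2)) auto
  then show ?thesis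
  proof eventually_elim
   case (elim k)
   define f where "f p = max 0 (1 - gap_X g \<delta> p / e)" for p
   obtain I \<phi> where d: "decomp (r (m k) - C) (r (m k) + C) (\<psi> (m k)) I \<phi>"
    using quasimode_decomp[OF \<psi>Q rm(1)] by blast
   have L2: "2 <= L (m k)"
   proof -
    have "sqrt (2\<^sup>2) <= sqrt (r (m k))" using rm(2)[of k] by (intro real_sqrt_le_mono) simp
    then have "2 <= \<lfloor>sqrt (r (m k))\<rfloor>" by (simp add: le_floor_iff)
    then show ?thesis unfolding L[symmetric] by simp
   qed
   have w: "\<delta> / real (L (m k)) <= \<delta>" using \<delta> L2 by (simp add: field_simps)
   have \<delta>': "0 <= \<delta>" "\<delta> <= 1/2" "6 * \<delta> <= inj_radius R" "\<delta> / real (L (m k)) <= 1/2" using \<delta> w by auto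
   have "ennreal c1 <= 2 * (vX * ennreal (\<integral>p. f p \<partial>mlift (r (m k)) (\<psi> (m k))))"
   proof (rule lift_mass_lower[OF d L R y(1,2) w \<delta>'(2,3)])
    show "ennreal c1 <= (\<integral>\<^sup>+h. indicator (tube \<delta> (\<delta> / real (L (m k)))) h *
      ennreal ((cmod (liftX (r (m k)) (\<psi> (m k)) (pX (y k ** h))))\<^sup>2) \<partial>haar_SL2)"
     using y(3)[of k] unfolding tube_mass_def L_def .
    show "continuous_map (topX) euclideanreal f" unfolding f_def
    proof (rule continuous_map_X_top)
     show "continuous_on SL2 (%x. max 0 (1 - gap g \<delta> x / e))" using e by (intro continuous_intros gap_continuous[OF \<delta>'(1)]) auto
    qed (simp add: gap_X_coset[OF \<delta>'(1)])
    show "0 <= f p" "f p <= 1" for p using e gap_nonneg[OF \<delta>'(1)] by (auto simp: f_def gap_X_def)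
    show "1/2 <= f (pX (y k ** h))" if h: "h \<in> tube \<delta> (\<delta> / real (L (m k)))" for h
    proof -
     have "y k ** h \<in> SL2" using h y(1) by (intro SL2_mult) (auto simp: tube_def)
     moreover have "gap g \<delta> (y k ** h) <= e / 2" using gap_tube_le[OF h \<delta>'(1,2,4), of g "y k"] elim by linarith
     ultimately show ?thesis using e by (simp add: f_def gap_X_coset[OF \<delta>'(1)] field_simps)
    qed
   qed
   also have "... = ennreal (2 * (V * (\<integral>p. f p \<partial>\<nu> k)))"
   proof -
    have "0 <= (\<integral>p. f p \<partial>\<nu> k)" by (intro Bochner_Integration.integral_nonneg) (simp add: f_def)
    then show ?thesis using V by (simp add: ennreal_mult \<nu>_def)
   qed
   finally have "c1 <= 2 * (V * (\<integral>p. f p \<partial>\<nu> k))"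
   proof -
    assume le: "ennreal c1 <= ennreal (2 * (V * (\<integral>p. f p \<partial>\<nu> k)))"
    have "0 <= (\<integral>p. f p \<partial>\<nu> k)" by (intro Bochner_Integration.integral_nonneg) (simp add: f_def)
    then show ?thesis using le V by simp
   qed
   then show ?case using V(2) by (simp add: f_def field_simps)
  qed
 qed
 have cV: "0 < c1 / (2 * V)" using c1 V by simp
 let ?A = "{p \<in> topspace (topX). gap_X g \<delta> p = 0}"
 have "?A \<in> sets \<mu>" "emeasure \<mu> ?A > 0"
  by (rule weak_limit_concentrates[OF \<mu>1 lim\<nu> less_imp_le[OF \<delta>(1)] cV mass]; assumption)+
 then show ?thesis using gap_zero_codimension_one[OF R g1 \<delta>] by (intro bexI[of _ ?A] conjI)
qed

text \<open>
  Only large parameters matter for limits; for the others every unit vector is allowed, and there is one because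
  the dimension is positive.
\<close>

lemma quasimodes_exist:
 assumes C: "0 < C" and c: "0 < c" and r: "0 < r"
  and S: "cfun.subspace S" "S \<subseteq> quasi C r" "real (cfun.dim S) >= c * r"
  and R: "\<And>g. g \<in> SL2 ==> \<exists>\<gamma>\<in>\<Gamma>. norm (\<gamma> ** g) <= R"
  and \<delta>: "0 < \<delta>" "\<delta> <= 1/2" "\<delta> * drift C <= 1/48"
 shows "\<exists>\<psi>. \<psi> \<in> S \<and> L2M \<psi> = 1 \<and> (C < r \<longrightarrow> 4 <= r \<longrightarrow> (\<exists>y\<in>SL2. norm y <= R \<and>
    ennreal (c * \<delta>^4 / 2^18) <= tube_mass \<delta> r \<psi> y))"
proof (cases "C < r \<and> 4 <= r")
 case True
 define L where "L = nat \<lfloor>sqrt r\<rfloor>"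
 have L: "int L = \<lfloor>sqrt r\<rfloor>" using r by (simp add: L_def)
 have "sqrt (2\<^sup>2) <= sqrt r" using True by (intro real_sqrt_le_mono) simp
 then have "2 <= \<lfloor>sqrt r\<rfloor>" by (simp add: le_floor_iff)
 then have L2: "2 <= L" unfolding L[symmetric] by simp
 have Cr: "C < r" using True by blast
 obtain \<psi> g where \<psi>: "\<psi> \<in> S" "L2M \<psi> = 1" "g \<in> SL2"
  and le: "ennreal (c * \<delta>^4 / 2^18) <= (\<integral>\<^sup>+h. indicator (tube \<delta> (\<delta> / real L)) h * ennreal ((cmod (liftX r \<psi> (pX (g ** h))))\<^sup>2) \<partial>haar_SL2)"
  by (rule concentrated_quasimode[OF C Cr L L2 c \<delta> S])
 obtain \<gamma> where \<gamma>: "\<gamma> \<in> \<Gamma>" "norm (\<gamma> ** g) <= R" using R[OF \<psi>(3)] by blast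
 have "pX ((\<gamma> ** g) ** h) = pX (g ** h)" for h
  unfolding matrix_mul_assoc[symmetric] by (rule coset_mult[OF \<gamma>(1)])
 moreover have "\<gamma> ** g \<in> SL2" using \<gamma>(1) \<psi>(3) G_SL2 SL2_mult by blast
 ultimately show ?thesis using \<psi>(1,2) \<gamma>(2) le unfolding L_def tube_mass_def
  by (intro exI[of _ \<psi>] conjI impI bexI[of _ "\<gamma> ** g"]) simp_all
next
 case False
 have "0 < c * r" using c r by simp
 then have d: "cfun.dim S \<noteq> 0" using S(3) by (intro notI) simp
 have "\<exists>\<psi>\<in>S. \<psi> \<noteq> 0"
 proof (rule ccontr)
  assume "\<not> ?thesis"
  then have "S \<subseteq> {0}" by blast
  obtain B where B: "B \<subseteq> S" "cfun.independent B" "S \<subseteq> cfun.span B" "card B = cfun.dim S"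
   using cfun.basis_exists[of S] by blast
  then have "B \<noteq> {}" using d by auto
  then have "0 \<in> B" using B(1) \<open>S \<subseteq> {0}\<close> by blast
  then show False using B(2) cfun.dependent_zero by blast
 qed
 then obtain \<psi> where \<psi>: "\<psi> \<in> S" "\<psi> \<noteq> 0" by blast
 have pos: "0 < L2M \<psi>" using \<psi> S(2) by (intro L2_norm_M_pos quasimode_smooth[of \<psi> C r]) auto
 define \<psi>' where "\<psi>' = cscale (of_real (1 / L2M \<psi>)) \<psi>"
 have "\<psi>' \<in> S" unfolding \<psi>'_def by (rule cfun.subspace_scale[OF S(1) \<psi>(1)])
 moreover have "L2M \<psi>' = 1" unfolding \<psi>'_def L2_norm_M_scale norm_of_real using pos by simp
 ultimately show ?thesis using False by blast
qed

end

theorem theorem1: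
  fixes \<Gamma> :: "(real^2^2) set" and C c :: real and r :: "nat \<Rightarrow> real"
    and S :: "nat \<Rightarrow> (complex set \<Rightarrow> complex) set"
  assumes "compact_hyperbolic_surface_group \<Gamma>"
    and "C > 0" and "c > 0"
    and "\<And>j. r j > 0" and "filterlim r at_top sequentially"
    and "\<And>j. cfun.subspace (S j)" and "\<And>j. S j \<subseteq> quasimode_space \<Gamma> C (r j)"
    and "\<And>j. real (cfun.dim (S j)) \<ge> c * r j"
  shows "\<exists>\<psi>. (\<forall>j. \<psi> j \<in> S j \<and> L2_norm_M \<Gamma> (\<psi> j) = 1) \<and>
     (\<forall>\<mu>. weak_star_limit_point (X_top \<Gamma>) (\<lambda>j. microlocal_lift \<Gamma> (r j) (\<psi> j)) \<mu> \<longrightarrow>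
          (\<exists>A\<in>sets \<mu>. codimension_one \<Gamma> A \<and> emeasure \<mu> A > 0))"
proof -
  interpret surface_group \<Gamma> by standard (rule assms(1))
  obtain R where R: "0 < R" "\<And>g. g \<in> SL2 ==> \<exists>\<gamma>\<in>\<Gamma>. norm (\<gamma> ** g) <= R" using bounded_representatives by blast
  define K where "K = drift C"
  have K: "0 < K" unfolding K_def drift_def using assms(2) by (intro add_pos_pos mult_pos_pos) auto
  \<comment> \<open>Small enough for the charts of the disc, for injectivity on the tubes, and for the phase error.\<close>
  define \<delta> where "\<delta> = min (1/4) (min (inj_radius R / 12) (1 / (48 * K)))"
  have \<delta>: "0 < \<delta>" "\<delta> <= 1/4" "12 * \<delta> <= inj_radius R" "\<delta> <= 1 / (48 * K)"
    using inj_radius_pos[OF R(1)] K by (auto simp: \<delta>_def)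
  have "\<delta> * K <= 1 / (48 * K) * K" using \<delta>(4) K by (intro mult_right_mono) auto
  then have \<delta>K: "\<delta> * K <= 1/48" using K by simp
  define P where "P j \<psi> \<longleftrightarrow> \<psi> \<in> S j \<and> L2_norm_M \<Gamma> \<psi> = 1 \<and> (C < r j \<longrightarrow> 4 <= r j \<longrightarrow> (\<exists>y\<in>SL2. norm y <= R \<and>
       ennreal (c * \<delta>^4 / 2^18) <= tube_mass \<delta> (r j) \<psi> y))" for j \<psi>
  have "\<exists>\<psi>. P j \<psi>" for j
    unfolding P_def using \<delta> \<delta>K by (intro quasimodes_exist[OF assms(2,3,4,6,7,8) R(2)]) (auto simp: K_def)
  then obtain \<psi> where "\<And>j. P j (\<psi> j)" by metis
  then have \<psi>: "\<And>j. \<psi> j \<in> S j" "\<And>j. L2_norm_M \<Gamma> (\<psi> j) = 1"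
    and conc: "\<And>j. C < r j ==> 4 <= r j ==> \<exists>y\<in>SL2. norm y <= R \<and>
       ennreal (c * \<delta>^4 / 2^18) <= tube_mass \<delta> (r j) (\<psi> j) y"
    unfolding P_def by blast+
  have c1: "0 < c * \<delta>^4 / 2^18" using assms(3) \<delta>(1) by simp
  have \<psi>Q: "\<psi> j \<in> quasimode_space \<Gamma> C (r j)" for j using \<psi>(1) assms(7) by blast
  show ?thesis
  proof (intro exI[of _ \<psi>] conjI allI impI \<psi>)
    fix \<mu> assume w: "weak_star_limit_point (X_top \<Gamma>) (%j. microlocal_lift \<Gamma> (r j) (\<psi> j)) \<mu>"
    show "\<exists>A\<in>sets \<mu>. codimension_one \<Gamma> A \<and> emeasure \<mu> A > 0"
      by (rule limit_has_codimension_one_mass[OF R(1) \<delta>(1,2,3) c1 assms(2) assms(5) \<psi>Q _ w]) (rule conc; assumption)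
  qed
qed

end
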